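(* Let $X_0$ be an $H$-valued random variable with $\mathbb E[\lVert X_0\rVert^2]<\infty$, independent of the $Q$-Wiener process $W^Q$, where $Q$ is an injective trace class operator on $H$. For every $n\in\mathbb N$ let $(X^n_t)_{t\in[0,T]}$ be the solution of $$\mathrm dX_t^n=-\tfrac12\alpha_tX_t^n\,\mathrm dt+\sqrt{\alpha_t}\,\mathrm dW_t^{Q_n},\qquad X_0^n=\sum_{k=1}^n\langle X_0,e_k\rangle e_k,$$ and assume that $\hat X^n_0=\iota_n(X^n_0)$ admits a Lebesgue density on $\mathbb R^n$. Let $t_0<T$ and assume that $F_t^n:=f^n(t,X_{T-t}^n)$ converges, as $n\to\infty$, to some process $F_t$ in $L^2(\Omega,\mathcal F,\mathbb P;L^2([0,t_0];H))$. For fixed $n\in\mathbb N$, let $\tilde f^n:[0,t_0]\times H\to H_n$ be the approximate score at level $n$, let $\tilde\varepsilon_n$ denote the maximal score path approximation error above level $n$, and let $\varepsilon_n$ be the training loss at level $n$, i.e. $$\tilde\varepsilon_n:=\sup_{m\ge n}\lVert F^m-F\rVert^2_{L^2(\Omega\times[0,t_0];H)},\qquad \varepsilon_n:=\lVert F^n-\tilde f^n(\cdot,X^n_{T-\cdot})\rVert^2_{L^2(\Omega\times[0,t_0];H)} .$$ If, for all $s\le t_0$, the approximate score $\tilde f^n$ is continuous on $[0,s]\times H_n$ and Lipschitz continuous there in the second variable with Lipschitz constant $L_s^n$, and satisfies $\tilde f^n(s,x)=\tilde f^n(s,P^nx)$ for all $x\in H$ and $s\le t_0$, then, for all $m\ge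 n$, $$W_2^2\big(\mathbb P_{(X_{T-t}^m)_{t_0}},\mathbb P_{(\widetilde Y_t^m)_{t_0}}\big)\le 12\,(4\tilde\varepsilon_n+2\varepsilon_n)\,t_0\,e^{4\xi_n(t_0)t_0^2}+12\,e^{3\xi_n(t_0)t_0^2}\,W_2^2\big(\mathbb P_{X_T^m},\mathcal N(0,Q_m)\big),$$ where $\xi_n(t_0):=\sup_{s\in[0,t_0]}\big(\tfrac{\alpha_{T-s}^2}{4}+(L_s^n)^2\big)$ and $\widetilde Y^m$ denotes the approximate reverse process at level $m$ for the choice $\tilde f^m:=\tilde f^n$, i.e. the solution on $[0,t_0]$ of $$\mathrm d\widetilde Y_t^m=\Big(\tfrac12\alpha_{T-t}\widetilde Y_t^m+\tilde f^n(t,\widetilde Y_t^m)\Big)\,\mathrm dt+\sqrt{\alpha_{T-t}}\,\mathrm d\hat W_t^{Q_m},\qquad \widetilde Y_0^m\sim\mathcal N(0,Q_m),$$ with $\hat W^{Q_m}$ a $Q_m$-Wiener process in $H_m$ independent of $\widetilde Y_0^m$. In particular, the right-hand side of this inequality converges to zero (as $n\to\infty$) uniformly in $m\ge n$ whenever the Lipschitz constant $L^n_{t_0}$ is bounded uniformly in $n$ and the training loss $\varepsilon_n$ converges to zero.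
   Context: $(H,\lVert\cdot\rVert)$ is a real separable Hilbert space, $T>0$, $\alpha\in\mathcal C^1([0,T];\mathbb R_{>0})$. A trace class operator $Q$ is a bounded self-adjoint positive semidefinite operator on $H$ with finite trace; $(e_k)_{k\in\mathbb N}$ is an orthonormal basis of $H$ of eigenvectors of $Q$ with eigenvalues $(\lambda_k)_{k\in\mathbb N}$ (all positive when $Q$ is injective). A $Q$-Wiener process is a continuous $H$-valued process $W^Q$ with $W^Q_0=0$, independent increments and $W^Q_t-W^Q_s\sim\mathcal N(0,(t-s)Q)$ for $s\le t$; it has the Karhunen–Loève decomposition $W_t^Q=\sum_k\sqrt{\lambda_k}\beta_k(t)e_k$ with independent standard real Brownian motions $\beta_k$. The objects $X_0,W^Q$ live on a probability space $(\Omega,\mathcal F,\mathbb P)$. Put $H_n:=\mathrm{span}\{e_1,\dots,e_n\}$, $P^n:H\to H_n$ the orthogonal projection, $Q_n:=\sum_{k=1}^n\lambda_k\langle e_k,\cdot\rangle e_k$, $W_t^{Q_n}:=\sum_{k=1}^n\sqrt{\lambda_k}\beta_k(t)e_k$, and $\iota_n:H_n\to\mathbb R^n$, $\iota_n(x):=(\langle x,e_k\rangle)_{k=1}^n$. Discretized score: when $\hat X_0^n$ has a Lebesgue density, $\hat X_t^n:=\iota_n(X_t^n)$ has a positive, twice continuously differentiable Lebesgue density $p_t^n$ for every $t\in(0,T]$, and $$f^n(t,\cdot):=\alpha_{T-t}\,Q_n\big(\iota_n^{-1}\circ\nabla\log p_{T-t}^n\circ\iota_n\big):H_n\to H_n,\qquad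 t\in[0,T).$$ The approximate score $\tilde f^n$ is a map (for instance a learned neural network) meant to approximate $f^n$. For a continuous process $(Z_t)_{t\in[0,t_0]}$, $\mathbb P_{(Z_t)_{t_0}}$ denotes its law on $\mathcal C([0,t_0],H)$ equipped with the uniform norm; $\mathbb P_Z$ is the law of a random variable $Z$. For probability measures $\mu,\nu$ on a separable metric space $(K,d)$, $W_2(\mu,\nu)=\big(\min_{X\sim\mu,Y\sim\nu}\mathbb E[d(X,Y)^2]\big)^{1/2}$.
   Formalization: The final convergence claim fails for fixed T (e.g. X_0 ~ N(0,2Q)); proved instead: the score-error summand tends to zero, and the whole right-hand side does so uniformly in m≥n if also W_2^2(P_{X_T^m},N(0,Q_m)) tends to zero as m→∞. *)

theory Defs
  imports "HOL-Probability.Probability"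
begin

definition borel_of_metric :: "'a metric \<Rightarrow> 'a measure" where
  "borel_of_metric m = sigma (mspace m) {U. openin (mtopology_of m) U}"

definition couplings :: "'a metric \<Rightarrow> 'a measure \<Rightarrow> 'a measure \<Rightarrow> ('a \<times> 'a) measure set" where
  "couplings m \<mu> \<nu> = {\<gamma>.
     sets \<gamma> = sets (borel_of_metric m \<Otimes>\<^sub>M borel_of_metric m) \<and>
     distr \<gamma> (borel_of_metric m) fst = \<mu> \<and>
     distr \<gamma> (borel_of_metric m) snd = \<nu>}"

definition ennreal_sqrt :: "ennreal \<Rightarrow> ennreal" where
  "ennreal_sqrt x = (if x = \<top> then \<top> else ennreal (sqrt (enn2real x)))"

text \<open>The random variables \<open>X \<sim> \<mu>\<close>, \<open>Y \<sim> \<nu>\<close> in the definition of the Wasserstein distance are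
  represented by their joint law.\<close>

definition W2 :: "'a metric \<Rightarrow> 'a measure \<Rightarrow> 'a measure \<Rightarrow> ennreal" where
  "W2 m \<mu> \<nu> =
     ennreal_sqrt (INF \<gamma>\<in>couplings m \<mu> \<nu>. \<integral>\<^sup>+(x, y). ennreal ((mdist m x y)\<^sup>2) \<partial>\<gamma>)"

text \<open>\<open>C([0,t\<^sub>0],H)\<close> with the uniform norm; its elements are extensional outside \<open>[0,t\<^sub>0]\<close>.\<close>

definition path_space :: "real \<Rightarrow> (real \<Rightarrow> 'h::real_normed_vector) metric" where
  "path_space t0 = cfunspace (top_of_set {0..t0}) euclidean_metric"

definition path_law ::
  "'w measure \<Rightarrow> real \<Rightarrow> (real \<Rightarrow> 'w \<Rightarrow> 'h::real_normed_vector) \<Rightarrow> (real \<Rightarrow> 'h) measure" where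
  "path_law M t0 Z = distr M (borel_of_metric (path_space t0)) (\<lambda>\<omega>. \<lambda>t\<in>{0..t0}. Z t \<omega>)"

definition orthonormal_basis :: "(nat \<Rightarrow> 'h::real_inner) \<Rightarrow> bool" where
  "orthonormal_basis e \<longleftrightarrow>
     (\<forall>i j. e i \<bullet> e j = (if i = j then 1 else 0)) \<and> closure (span (range e)) = UNIV"

definition trace_class_operator :: "('h::real_inner \<Rightarrow> 'h) \<Rightarrow> bool" where
  "trace_class_operator Q \<longleftrightarrow>
     bounded_linear Q \<and> (\<forall>x y. Q x \<bullet> y = x \<bullet> Q y) \<and> (\<forall>x. 0 \<le> x \<bullet> Q x) \<and>
     (\<forall>b. orthonormal_basis b \<longrightarrow> summable (\<lambda>k. b k \<bullet> Q (b k)))"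

definition real_gaussian :: "real \<Rightarrow> real measure" where
  "real_gaussian v =
     (if v = 0 then return borel 0 else density lborel (\<lambda>x. ennreal (normal_density 0 (sqrt v) x)))"

definition is_gaussian :: "('h::real_inner \<Rightarrow> 'h) \<Rightarrow> 'h measure \<Rightarrow> bool" where
  "is_gaussian C \<mu> \<longleftrightarrow>
     prob_space \<mu> \<and> sets \<mu> = sets borel \<and>
     (\<forall>h. distr \<mu> borel (\<lambda>x. x \<bullet> h) = real_gaussian (h \<bullet> C h))"

definition gaussian :: "('h::real_inner \<Rightarrow> 'h) \<Rightarrow> 'h measure" where
  "gaussian C = (THE \<mu>. is_gaussian C \<mu>)"

definition wiener_process ::
  "'w measure \<Rightarrow> ('h::{real_inner,second_countable_topology} \<Rightarrow> 'h) \<Rightarrow> real \<Rightarrow> (real \<Rightarrow> 'w \<Rightarrow> 'h) \<Rightarrow> bool" where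
  "wiener_process M Q T W \<longleftrightarrow>
     (\<forall>t\<in>{0..T}. W t \<in> borel_measurable M) \<and>
     (\<forall>\<omega>\<in>space M. continuous_on {0..T} (\<lambda>t. W t \<omega>)) \<and>
     (\<forall>\<omega>\<in>space M. W 0 \<omega> = 0) \<and>
     (\<forall>k. \<forall>\<tau>::nat \<Rightarrow> real. mono \<tau> \<longrightarrow> range \<tau> \<subseteq> {0..T} \<longrightarrow>
        prob_space.indep_vars M (\<lambda>_. borel) (\<lambda>i \<omega>. W (\<tau> (Suc i)) \<omega> - W (\<tau> i) \<omega>) {..<k}) \<and>
     (\<forall>s\<in>{0..T}. \<forall>t\<in>{s..T}.
        is_gaussian (\<lambda>h. (t - s) *\<^sub>R Q h) (distr M borel (\<lambda>\<omega>. W t \<omega> - W s \<omega>)))"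

definition independent_of_process ::
  "'w measure \<Rightarrow> real \<Rightarrow> ('w \<Rightarrow> 'h::topological_space) \<Rightarrow> (real \<Rightarrow> 'w \<Rightarrow> 'h) \<Rightarrow> bool" where
  "independent_of_process M T \<xi> W \<longleftrightarrow>
     \<xi> \<in> borel_measurable M \<and>
     (\<lambda>\<omega>. \<lambda>t\<in>{0..T}. W t \<omega>) \<in> measurable M (\<Pi>\<^sub>M t\<in>{0..T}. borel) \<and>
     prob_space.indep_set M
       (sets (vimage_algebra (space M) \<xi> borel))
       (sets (vimage_algebra (space M) (\<lambda>\<omega>. \<lambda>t\<in>{0..T}. W t \<omega>) (\<Pi>\<^sub>M t\<in>{0..T}. borel)))"

text \<open>\<open>J\<close> is (a version of) the stochastic integral \<open>\<integral>\<^sub>0\<^sup>t \<phi> dW\<close>.  For a continuous deterministic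
  integrand the integrals of the step functions obtained from the partitions of \<open>[0,t]\<close> into \<open>N\<close>
  intervals of equal length converge to it in mean square.\<close>

definition is_stochastic_integral ::
  "'w measure \<Rightarrow> (real \<Rightarrow> real) \<Rightarrow> (real \<Rightarrow> 'w \<Rightarrow> 'h::real_normed_vector) \<Rightarrow> real \<Rightarrow> ('w \<Rightarrow> 'h) \<Rightarrow> bool" where
  "is_stochastic_integral M \<phi> W t J \<longleftrightarrow>
     J \<in> borel_measurable M \<and>
     (\<lambda>N. \<integral>\<^sup>+\<omega>. ennreal ((norm (J \<omega> -
        (\<Sum>i<N. \<phi> (real i * t / real N) *\<^sub>R
           (W (real (Suc i) * t / real N) \<omega> - W (real i * t / real N) \<omega>))))\<^sup>2) \<partial>M)
       \<longlonglongrightarrow> 0"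

text \<open>\<open>Z\<close> is a continuous solution on \<open>[0,T]\<close> of \<open>dZ\<^sub>t = b(t,Z\<^sub>t) dt + \<phi>(t) dW\<^sub>t\<close>; the initial value
  is imposed separately.\<close>

definition sde_solution ::
  "'w measure \<Rightarrow> real \<Rightarrow> (real \<Rightarrow> 'h \<Rightarrow> 'h) \<Rightarrow> (real \<Rightarrow> real) \<Rightarrow> (real \<Rightarrow> 'w \<Rightarrow> 'h::banach) \<Rightarrow>
   (real \<Rightarrow> 'w \<Rightarrow> 'h) \<Rightarrow> bool" where
  "sde_solution M T b \<phi> W Z \<longleftrightarrow>
     (\<forall>t\<in>{0..T}. Z t \<in> borel_measurable M) \<and>
     (\<forall>\<omega>\<in>space M. continuous_on {0..T} (\<lambda>t. Z t \<omega>)) \<and>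
     (\<exists>J. \<forall>t\<in>{0..T}. is_stochastic_integral M \<phi> W t (J t) \<and>
        (AE \<omega> in M. (\<lambda>s. b s (Z s \<omega>)) integrable_on {0..t} \<and>
           Z t \<omega> = Z 0 \<omega> + integral {0..t} (\<lambda>s. b s (Z s \<omega>)) + J t \<omega>))"

text \<open>Basis vectors are indexed from 0, so level \<open>n\<close> uses \<open>e 0, \<dots>, e (n - 1)\<close>.\<close>

definition Hn :: "(nat \<Rightarrow> 'h::real_inner) \<Rightarrow> nat \<Rightarrow> 'h set" where
  "Hn e n = span (e ` {..<n})"

definition Pn :: "(nat \<Rightarrow> 'h::real_inner) \<Rightarrow> nat \<Rightarrow> 'h \<Rightarrow> 'h" where
  "Pn e n x = (\<Sum>k<n. (x \<bullet> e k) *\<^sub>R e k)"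

definition Qn :: "(nat \<Rightarrow> 'h::real_inner) \<Rightarrow> (nat \<Rightarrow> real) \<Rightarrow> nat \<Rightarrow> 'h \<Rightarrow> 'h" where
  "Qn e lam n x = (\<Sum>k<n. (lam k * (e k \<bullet> x)) *\<^sub>R e k)"

text \<open>The coefficient processes of the Karhunen--Loeve decomposition
  \<open>W\<^sub>t = \<Sum>\<^sub>k \<surd>\<lambda>\<^sub>k \<beta>\<^sub>k(t) e\<^sub>k\<close>; for positive eigenvalues they are determined by \<open>W\<close>.\<close>

definition KL_beta ::
  "(nat \<Rightarrow> 'h::real_inner) \<Rightarrow> (nat \<Rightarrow> real) \<Rightarrow> (real \<Rightarrow> 'w \<Rightarrow> 'h) \<Rightarrow> nat \<Rightarrow> real \<Rightarrow> 'w \<Rightarrow> real" where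
  "KL_beta e lam W k t \<omega> = (W t \<omega> \<bullet> e k) / sqrt (lam k)"

definition WQn ::
  "(nat \<Rightarrow> 'h::real_inner) \<Rightarrow> (nat \<Rightarrow> real) \<Rightarrow> (real \<Rightarrow> 'w \<Rightarrow> 'h) \<Rightarrow> nat \<Rightarrow> real \<Rightarrow> 'w \<Rightarrow> 'h" where
  "WQn e lam W n t \<omega> = (\<Sum>k<n. (sqrt (lam k) * KL_beta e lam W k t \<omega>) *\<^sub>R e k)"

text \<open>\<open>\<real>\<^sup>n\<close> is the space of functions on \<open>{..<n}\<close> (extensional outside), with Lebesgue measure
  given by the finite product measure and with the product topology.\<close>

abbreviation Rn :: "nat \<Rightarrow> (nat \<Rightarrow> real) set" where
  "Rn n \<equiv> Pi\<^sub>E {..<n} (\<lambda>_. UNIV)"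

definition lebesgue_Rn :: "nat \<Rightarrow> (nat \<Rightarrow> real) measure" where
  "lebesgue_Rn n = Pi\<^sub>M {..<n} (\<lambda>_. lborel)"

definition iota :: "(nat \<Rightarrow> 'h::real_inner) \<Rightarrow> nat \<Rightarrow> 'h \<Rightarrow> nat \<Rightarrow> real" where
  "iota e n x = (\<lambda>k\<in>{..<n}. x \<bullet> e k)"

definition iota_inv :: "(nat \<Rightarrow> 'h::real_inner) \<Rightarrow> nat \<Rightarrow> (nat \<Rightarrow> real) \<Rightarrow> 'h" where
  "iota_inv e n y = (\<Sum>k<n. y k *\<^sub>R e k)"

definition grad_log :: "nat \<Rightarrow> ((nat \<Rightarrow> real) \<Rightarrow> real) \<Rightarrow> (nat \<Rightarrow> real) \<Rightarrow> nat \<Rightarrow> real" where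
  "grad_log n p y = (\<lambda>k\<in>{..<n}. deriv (\<lambda>s. ln (p (y(k := s)))) (y k))"

definition twice_cont_diff :: "nat \<Rightarrow> ((nat \<Rightarrow> real) \<Rightarrow> real) \<Rightarrow> bool" where
  "twice_cont_diff n p \<longleftrightarrow>
     continuous_on (Rn n) p \<and>
     (\<exists>g h. \<forall>i<n.
        continuous_on (Rn n) (g i) \<and>
        (\<forall>y\<in>Rn n. ((\<lambda>s. p (y(i := s))) has_real_derivative g i y) (at (y i))) \<and>
        (\<forall>j<n. continuous_on (Rn n) (h i j) \<and>
           (\<forall>y\<in>Rn n. ((\<lambda>s. g i (y(j := s))) has_real_derivative h i j y) (at (y j)))))"

definition is_smooth_density ::
  "'w measure \<Rightarrow> nat \<Rightarrow> ('w \<Rightarrow> nat \<Rightarrow> real) \<Rightarrow> ((nat \<Rightarrow> real) \<Rightarrow> real) \<Rightarrow> bool" where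
  "is_smooth_density M n Z p \<longleftrightarrow>
     distributed M (lebesgue_Rn n) Z (\<lambda>y. ennreal (p y)) \<and>
     (\<forall>y\<in>Rn n. 0 < p y) \<and> twice_cont_diff n p"

text \<open>A continuous density is unique on \<open>\<real>\<^sup>n\<close>, so the choice only concerns junk values outside
  \<^term>\<open>Rn n\<close>.\<close>

definition smooth_density ::
  "'w measure \<Rightarrow> nat \<Rightarrow> ('w \<Rightarrow> nat \<Rightarrow> real) \<Rightarrow> (nat \<Rightarrow> real) \<Rightarrow> real" where
  "smooth_density M n Z = (SOME p. is_smooth_density M n Z p)"

definition score ::
  "'w measure \<Rightarrow> (nat \<Rightarrow> 'h::real_inner) \<Rightarrow> (nat \<Rightarrow> real) \<Rightarrow> (real \<Rightarrow> real) \<Rightarrow> real \<Rightarrow>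
   nat \<Rightarrow> (real \<Rightarrow> 'w \<Rightarrow> 'h) \<Rightarrow> real \<Rightarrow> 'h \<Rightarrow> 'h" where
  "score M e lam \<alpha> T n Xn t x =
     \<alpha> (T - t) *\<^sub>R Qn e lam n (iota_inv e n
       (grad_log n (smooth_density M n (\<lambda>\<omega>. iota e n (Xn (T - t) \<omega>))) (iota e n x)))"

definition time_prod :: "'w measure \<Rightarrow> real \<Rightarrow> ('w \<times> real) measure" where
  "time_prod M t0 = M \<Otimes>\<^sub>M restrict_space lborel {0..t0}"

definition L2sq :: "'w measure \<Rightarrow> real \<Rightarrow> (real \<Rightarrow> 'w \<Rightarrow> 'h::real_normed_vector) \<Rightarrow> ennreal" where
  "L2sq M t0 G = (\<integral>\<^sup>+(\<omega>, t). ennreal ((norm (G t \<omega>))\<^sup>2) \<partial>time_prod M t0)"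

definition L2_process :: "'w measure \<Rightarrow> real \<Rightarrow> (real \<Rightarrow> 'w \<Rightarrow> 'h::real_normed_vector) \<Rightarrow> bool" where
  "L2_process M t0 G \<longleftrightarrow>
     (\<lambda>(\<omega>, t). G t \<omega>) \<in> borel_measurable (time_prod M t0) \<and> L2sq M t0 G < \<top>"

definition admissible_score ::
  "(nat \<Rightarrow> 'h::real_inner) \<Rightarrow> real \<Rightarrow> nat \<Rightarrow> (real \<Rightarrow> 'h \<Rightarrow> 'h) \<Rightarrow> bool" where
  "admissible_score e t0 n g \<longleftrightarrow>
     (\<forall>t\<in>{0..t0}. \<forall>x. g t x \<in> Hn e n) \<and>
     (\<forall>s\<in>{0..t0}.
        continuous_on ({0..s} \<times> Hn e n) (\<lambda>(t, x). g t x) \<and>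
        (\<exists>C. \<forall>t\<in>{0..s}. C-lipschitz_on (Hn e n) (g t)) \<and>
        (\<forall>x. g s x = g s (Pn e n x)))"

text \<open>The smallest Lipschitz constant in the second variable on \<open>[0,s] \<times> H\<^sub>n\<close>.  It is
  nondecreasing in \<open>s\<close>, hence bounded on \<open>[0,t\<^sub>0]\<close>, and error bounds stated with it imply those for
  any other choice of Lipschitz constants.\<close>

definition lipschitz_constant ::
  "(nat \<Rightarrow> 'h::real_inner) \<Rightarrow> nat \<Rightarrow> (real \<Rightarrow> 'h \<Rightarrow> 'h) \<Rightarrow> real \<Rightarrow> real" where
  "lipschitz_constant e n g s = Inf {C. \<forall>t\<in>{0..s}. C-lipschitz_on (Hn e n) (g t)}"

definition C1_positive_on :: "real \<Rightarrow> (real \<Rightarrow> real) \<Rightarrow> bool" where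
  "C1_positive_on T \<alpha> \<longleftrightarrow>
     (\<forall>t\<in>{0..T}. 0 < \<alpha> t) \<and>
     (\<exists>\<alpha>'. continuous_on {0..T} \<alpha>' \<and>
        (\<forall>t\<in>{0..T}. (\<alpha> has_real_derivative \<alpha>' t) (at t within {0..T})))"

end

theory Submission
  imports Defs
begin

text \<open>The forward process is explicit: \<open>X\<^sub>t\<close> is a multiple of \<open>X\<^sub>0\<close> plus an independent Gaussian vector, hence its score
  is an affine function of \<open>X\<^sub>t\<close> and of the posterior mean \<open>E[X\<^sub>0 | X\<^sub>t]\<close> (Tweedie).  Given \<open>X\<^sub>0\<close>, the noise runs
  backwards as a Brownian bridge, so \<open>X\<^sub>T\<^sub>-\<^sub>t\<close> solves an equation with a drift depending on \<open>X\<^sub>0\<close>; replacing \<open>X\<^sub>0\<close> by its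
  posterior mean turns this drift into the reverse drift and the noise into an innovation process, which by a
  characteristic-function computation is a \<open>Q\<^sub>m\<close>-noise independent of \<open>X\<^sub>T\<close>.  All stochastic integrals have \<open>C\<^sup>1\<close>
  integrands and become pathwise integrals after partial integration, so no stochastic calculus is needed.

  Given any coupling of the laws of \<open>X\<^sub>T\<close> and of \<open>Y\<^sub>0\<close>, solve the approximate reverse equation with the noise of the true
  reverse process, starting at the second component of the coupling.  Its law is that of \<open>Y\<close>, the difference of the two
  paths obeys a linear integral inequality, and Gronwall's lemma bounds it by the initial distance and the score error.\<close>

section \<open>Characteristic functions\<close>

text \<open>Conditional laws never appear as such: independence, conditional expectations and the
  law of the reverse noise are expressed by integrals against exponentials, and uniqueness of
  characteristic functions turns these into statements about measures. What shapes the coupling is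
  that the reversed noise lives on the original probability space while \<open>Y\<close> lives on
  another one. A starting point coupled to \<open>X T\<close> may depend on the original space only
  through \<open>X T\<close> and fresh randomness, or else the noise would no longer be independent
  of it. An exact gluing would need a disintegration of the coupling; an approximate one doubles the
  initial cost. This doubling, the factor 2 from squaring Gronwall's bound and the bound 3 exp(3
  \<xi> t0^2) for its exponential make up the constant 12 in front of the initial error. In the
  score error the second factor 2 comes from splitting the difference of the level-m score and its
  approximation at the level-n score.\<close>

lemma integrable_iexp_weight:
  fixes w :: "'a \<Rightarrow> complex"
  assumes "integrable M w" "f \<in> borel_measurable M"
  shows "integrable M (\<lambda>x. w x * iexp (f x))"
  by (rule Bochner_Integration.integrable_bound[OF assms(1)]) (use assms in \<open>auto simp: norm_mult\<close>)

lemma norm_add_sq_le2: "(norm (a + b))\<^sup>2 \<le> 2 * (norm a)\<^sup>2 + 2 * (norm (b :: 'a::real_normed_vector))\<^sup>2"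
proof -
  have "(norm (a + b))\<^sup>2 \<le> (norm a + norm b)\<^sup>2" by (intro power_mono norm_triangle_ineq) auto
  also have "\<dots> \<le> 2 * (norm a)\<^sup>2 + 2 * (norm b)\<^sup>2"
    using sum_squares_bound[of "norm a" "norm b"] by (simp add: power2_sum)
  finally show ?thesis .
qed

lemma PiM_lessThan_component: "i < n \<Longrightarrow> (\<lambda>z. z i) \<in> borel_measurable (Pi\<^sub>M {..<n} (\<lambda>_. borel))"
  using measurable_component_singleton[of i "{..<n}" "\<lambda>_. borel"] by simp

text \<open>At \<open>t = 0\<close> the characteristic function is the total mass, so both measures
  have the same mass \<open>c\<close>. If \<open>c = 0\<close> both vanish; otherwise Levy's theorem
  for probability measures applies after division by \<open>c\<close>.\<close>

lemma finite_measure_char_unique: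
  fixes M1 M2 :: "real measure"
  assumes "finite_measure M1" "finite_measure M2" and sets: "sets M1 = sets borel" "sets M2 = sets borel"
    and eq: "\<And>t. (CLINT x|M1. iexp (t * x)) = (CLINT x|M2. iexp (t * x))"
  shows "M1 = M2"
proof -
  interpret M1: finite_measure M1 by fact
  interpret M2: finite_measure M2 by fact
  have sp: "space M1 = UNIV" "space M2 = UNIV" using sets[THEN sets_eq_imp_space_eq] by simp_all
  define c where "c = measure M1 UNIV"
  have c2: "c = measure M2 UNIV"
    using eq[of 0] sp by (simp add: c_def)
  have c_nonneg: "c \<ge> 0" by (simp add: c_def)
  show ?thesis
  proof (cases "c = 0")
    case True
    have "emeasure M1 A = 0" "emeasure M2 A = 0" for A
      using M1.bounded_measure[of A] M2.bounded_measure[of A] True c_def c2 sp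
      by (simp_all add: M1.emeasure_eq_measure M2.emeasure_eq_measure measure_le_0_iff)
    then show ?thesis by (intro measure_eqI) (use sets in auto)
  next
    case False
    then have c: "c > 0" using c_nonneg by simp
    define N1 where "N1 = density M1 (\<lambda>_. ennreal (1 / c))"
    define N2 where "N2 = density M2 (\<lambda>_. ennreal (1 / c))"
    have em1: "emeasure N1 A = ennreal (1/c) * emeasure M1 A" if "A \<in> sets borel" for A
      using that by (simp add: N1_def emeasure_density sets nn_integral_cmult_indicator)
    have em2: "emeasure N2 A = ennreal (1/c) * emeasure M2 A" if "A \<in> sets borel" for A
      using that by (simp add: N2_def emeasure_density sets nn_integral_cmult_indicator)
    have sN: "space N1 = UNIV" "space N2 = UNIV" by (simp_all add: N1_def N2_def sp)
    have "prob_space N1" "prob_space N2"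
      using em1[of UNIV] em2[of UNIV] c c2 c_def sN
      by (auto intro!: prob_spaceI simp: M1.emeasure_eq_measure M2.emeasure_eq_measure ennreal_mult[symmetric])
    then have rd: "real_distribution N1" "real_distribution N2"
      by (auto simp: real_distribution_def real_distribution_axioms_def N1_def N2_def sets)
    have [measurable_cong]: "sets M1 = sets borel" "sets M2 = sets borel" by fact+
    have "char N1 = char N2"
    proof
      fix t
      have "char N1 t = (CLINT x|M1. (1/c) *\<^sub>R iexp (t * x))"
        unfolding char_def N1_def by (subst integral_density) (use c in auto)
      also have "\<dots> = (1/c) *\<^sub>R (CLINT x|M2. iexp (t * x))"
        unfolding integral_scaleR_right eq ..
      also have "\<dots> = char N2 t"
        unfolding char_def N2_def by (subst integral_density) (use c in auto)
      finally show "char N1 t = char N2 t" .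
    qed
    then have N: "N1 = N2" using Levy_uniqueness rd by blast
    show ?thesis
    proof (rule measure_eqI)
      fix A assume "A \<in> sets M1"
      then have "ennreal (1/c) * emeasure M1 A = ennreal (1/c) * emeasure M2 A"
        using em1 em2 N sets by metis
      then show "emeasure M1 A = emeasure M2 A"
        using c by (simp add: ennreal_mult_cancel_left)
    qed (simp add: sets)
  qed
qed

text \<open>The weights \<open>1 + cos v\<close> and \<open>1 + sin v\<close> are nonnegative, hence
  admissible densities, while integrating an exponential against them only needs characteristic
  functions at \<open>u\<close>, \<open>u + v\<close> and \<open>u - v\<close>.\<close>

lemma cos_sin_weight_integral:
  fixes u v :: real
  shows "iexp u * complex_of_real (1 + cos v) = iexp u + (1/2) * (iexp (u + v) + iexp (u - v))"
    and "iexp u * complex_of_real (1 + sin v) = iexp u - (\<i>/2) * (iexp (u + v) - iexp (u - v))"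
  by (simp_all only: cis_conv_exp[symmetric])
    (simp_all add: complex_eq_iff cos_add sin_add cos_diff sin_diff field_simps)

lemma finite_measure_density:
  assumes "integrable M (g :: _ \<Rightarrow> real)" "\<And>x. x \<in> space M \<Longrightarrow> 0 \<le> g x"
  shows "finite_measure (density M (\<lambda>x. ennreal (g x)))"
proof (rule finite_measureI)
  have "emeasure (density M (\<lambda>x. ennreal (g x))) (space M) = (\<integral>\<^sup>+x. ennreal (g x) \<partial>M)"
    using assms by (subst emeasure_density) (auto intro!: nn_integral_cong simp: indicator_def)
  also have "\<dots> = ennreal (LINT x|M. g x)"
    using assms by (intro nn_integral_eq_integral AE_I2) auto
  finally show "emeasure (density M (\<lambda>x. ennreal (g x))) (space (density M (\<lambda>x. ennreal (g x)))) \<noteq> \<infinity>"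
    by simp
qed

text \<open>One coordinate at a time, the exponential is replaced by an indicator: the one-dimensional
  uniqueness theorem is applied to the image of the measure with weight \<open>1 + cos \<theta>\<close> or
  \<open>1 + sin \<theta>\<close>, where \<open>\<theta>\<close> is a linear combination of the remaining coordinates.\<close>

lemma char_eq_imp_rectangles_eq:
  fixes f :: "'i \<Rightarrow> 'a \<Rightarrow> real"
  assumes "finite J" "finite_measure M1" "finite_measure M2" "sets M1 = sets M2"
    and "\<And>i. i \<in> J \<Longrightarrow> f i \<in> borel_measurable M1"
    and "\<And>t. (CLINT x|M1. iexp (\<Sum>i\<in>J. t i * f i x)) = (CLINT x|M2. iexp (\<Sum>i\<in>J. t i * f i x))"
    and "\<And>i. i \<in> J \<Longrightarrow> A i \<in> sets borel"
  shows "emeasure M1 {x\<in>space M1. \<forall>i\<in>J. f i x \<in> A i} = emeasure M2 {x\<in>space M2. \<forall>i\<in>J. f i x \<in> A i}"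
  using assms
proof (induction J arbitrary: M1 M2 rule: finite_induct)
  case empty
  interpret M1: finite_measure M1 by fact
  interpret M2: finite_measure M2 by fact
  show ?case using empty.prems(5)[of "\<lambda>_. 0"]
    by (simp add: M1.emeasure_eq_measure M2.emeasure_eq_measure)
next
  case (insert i J)
  interpret M1: finite_measure M1 by fact
  interpret M2: finite_measure M2 by fact
  have [measurable_cong]: "sets M2 = sets M1" using insert.prems(3) by simp
  have [measurable]: "f i \<in> borel_measurable M1" "\<And>j. j \<in> J \<Longrightarrow> f j \<in> borel_measurable M1" "A i \<in> sets borel"
    using insert.prems(4,6) by auto
  define \<theta> where "\<theta> t x = (\<Sum>j\<in>J. t j * f j x)" for t x
  have [measurable]: "\<theta> t \<in> borel_measurable M1" for t unfolding \<theta>_def by measurable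
  have [measurable]: "\<theta> t \<in> borel_measurable M2" for t by measurable
  have int: "integrable M (\<lambda>x. iexp (a * f i x + b * \<theta> t x))" if "M \<in> {M1, M2}" for M a b t
    using that by (auto intro!: M1.integrable_const_bound[where B=1] M2.integrable_const_bound[where B=1])
  have full: "(CLINT x|M1. iexp (a * f i x + b * \<theta> t x)) = (CLINT x|M2. iexp (a * f i x + b * \<theta> t x))" for a b t
  proof -
    have "(\<Sum>j\<in>insert i J. (if j = i then a else b * t j) * f j x) = a * f i x + b * \<theta> t x" for x
    proof -
      have "(\<Sum>j\<in>J. (if j = i then a else b * t j) * f j x) = (\<Sum>j\<in>J. b * (t j * f j x))"
        by (rule sum.cong) (use insert.hyps in auto)
      then show ?thesis using insert.hyps by (simp add: \<theta>_def sum_distrib_left)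
    qed
    then show ?thesis using insert.prems(5)[of "\<lambda>j. if j = i then a else b * t j"] by simp
  qed
  have weight: "(LINT x|M1. g (\<theta> t x) * indicator (A i) (f i x)) = (LINT x|M2. g (\<theta> t x) * indicator (A i) (f i x))"
    if g: "g \<in> {\<lambda>v. 1 + cos v, \<lambda>v. 1 + sin v}" for g :: "real \<Rightarrow> real" and t
  proof -
    have [measurable]: "g \<in> borel_measurable borel" using g by auto
    have g0: "0 \<le> g v" "g v \<le> 2" for v
      using g cos_ge_minus_one[of v] sin_ge_minus_one[of v] cos_le_one[of v] sin_le_one[of v]
      by (auto simp del: cos_ge_minus_one sin_ge_minus_one cos_le_one sin_le_one)
    have ig: "integrable M1 (\<lambda>x. g (\<theta> t x))" "integrable M2 (\<lambda>x. g (\<theta> t x))"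
      by (rule M1.integrable_const_bound[where B=2] M2.integrable_const_bound[where B=2]; use g0 in auto)+
    define D where "D M = distr (density M (\<lambda>x. ennreal (g (\<theta> t x)))) borel (f i)" for M
    have char: "(CLINT x|M1. iexp (s * f i x) * complex_of_real (g (\<theta> t x))) =
          (CLINT x|M2. iexp (s * f i x) * complex_of_real (g (\<theta> t x)))" for s
    proof -
      have i: "integrable M (\<lambda>x. iexp (s * f i x))" "integrable M (\<lambda>x. iexp (s * f i x + \<theta> t x))"
           "integrable M (\<lambda>x. iexp (s * f i x - \<theta> t x))" if "M \<in> {M1, M2}" for M
        using int[OF that, of s 0 t] int[OF that, of s 1 t] int[OF that, of s "-1" t] by simp_all
      have e: "(CLINT x|M1. iexp (s * f i x)) = (CLINT x|M2. iexp (s * f i x))"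
           "(CLINT x|M1. iexp (s * f i x + \<theta> t x)) = (CLINT x|M2. iexp (s * f i x + \<theta> t x))"
           "(CLINT x|M1. iexp (s * f i x - \<theta> t x)) = (CLINT x|M2. iexp (s * f i x - \<theta> t x))"
        using full[of s 0 t] full[of s 1 t] full[of s "-1" t] by simp_all
      consider "g = (\<lambda>v. 1 + cos v)" | "g = (\<lambda>v. 1 + sin v)" using g by auto
      then show ?thesis
      proof cases
        case 1
        show ?thesis unfolding 1 cos_sin_weight_integral using i[of M1] i[of M2] e by simp
      next
        case 2
        show ?thesis unfolding 2 cos_sin_weight_integral using i[of M1] i[of M2] e by simp
      qed
    qed
    have fin1: "finite_measure (D M1)" "finite_measure (D M2)"
      unfolding D_def
      by (auto intro!: finite_measure.finite_measure_distr finite_measure_density ig simp: g0)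
    have "D M1 = D M2"
    proof (rule finite_measure_char_unique)
      show "finite_measure (D M1)" "finite_measure (D M2)" by (rule fin1)+
      show "sets (D M1) = sets borel" "sets (D M2) = sets borel" by (simp_all add: D_def)
      fix s
      have "(CLINT x|D M. iexp (s * x)) = (CLINT x|M. iexp (s * f i x) * complex_of_real (g (\<theta> t x)))"
        if [measurable]: "f i \<in> borel_measurable M" "\<theta> t \<in> borel_measurable M" for M
        unfolding D_def
        by (simp add: integral_distr integral_density g0 scaleR_conv_of_real mult.commute)
      then show "(CLINT x|D M1. iexp (s * x)) = (CLINT x|D M2. iexp (s * x))"
        using char by simp
    qed
    moreover have "(LINT x|D M. indicator (A i) x) = (LINT x|M. g (\<theta> t x) * indicator (A i) (f i x))"
      if [measurable]: "f i \<in> borel_measurable M" "\<theta> t \<in> borel_measurable M" for M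
    proof -
      have "(LINT x|D M. indicator (A i) x) = (LINT x|density M (\<lambda>x. ennreal (g (\<theta> t x))). (indicator (A i) (f i x) :: real))"
        unfolding D_def by (rule integral_distr) auto
      also have "\<dots> = (LINT x|M. g (\<theta> t x) * indicator (A i) (f i x))"
        by (subst integral_density) (auto simp: g0)
      finally show ?thesis .
    qed
    ultimately show ?thesis by (metis (no_types, lifting) \<open>f i \<in> borel_measurable M1\<close> \<open>\<And>t. \<theta> t \<in> borel_measurable M1\<close>
        \<open>\<And>t. \<theta> t \<in> borel_measurable M2\<close> insert.prems(3) measurable_cong_sets)
  qed
  have ind: "(LINT x|M1. g (\<theta> t x) * indicator (A i) (f i x)) = (LINT x|M2. g (\<theta> t x) * indicator (A i) (f i x))"
    if g: "g \<in> {cos, sin}" for g :: "real \<Rightarrow> real" and t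
  proof -
    \<comment> \<open>With all coefficients 0 the weight \<open>1 + cos\<close> is the constant 2,
      which isolates the unweighted term to be subtracted.\<close>
    have one: "(LINT x|M1. indicator (A i) (f i x)) = (LINT x|M2. (indicator (A i) (f i x) :: real))"
      using weight[of "\<lambda>v. 1 + cos v" "\<lambda>_. 0"] by (simp add: \<theta>_def)
    have [measurable]: "g \<in> borel_measurable borel" using g by auto
    have gb: "\<bar>g v\<bar> \<le> 1" for v using g by auto
    have s: "(LINT x|M1. (1 + g (\<theta> t x)) * indicator (A i) (f i x)) = (LINT x|M2. (1 + g (\<theta> t x)) * indicator (A i) (f i x))"
      using g weight by auto
    have "integrable M1 (\<lambda>x. indicator (A i) (f i x) :: real)" "integrable M2 (\<lambda>x. indicator (A i) (f i x) :: real)"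
       by (auto intro!: M1.integrable_const_bound[where B=1] M2.integrable_const_bound[where B=1] simp: indicator_def)
    moreover have "integrable M1 (\<lambda>x. g (\<theta> t x) * indicator (A i) (f i x) :: real)" 
        "integrable M2 (\<lambda>x. g (\<theta> t x) * indicator (A i) (f i x) :: real)"
       by (auto intro!: M1.integrable_const_bound[where B=1] M2.integrable_const_bound[where B=1] simp: indicator_def gb)
    ultimately show ?thesis using s one by (simp add: distrib_right)
  qed
  \<comment> \<open>The induction hypothesis is used for the restrictions to the event that
    coordinate \<open>i\<close> lies in \<open>A i\<close>; their characteristic functions in the
    other coordinates are made of the cosine and sine integrals in \<open>ind\<close>.\<close>
  define R where "R M = density M (\<lambda>x. ennreal (indicator (A i) (f i x)))" for M
  have charR: "(CLINT x|R M. iexp (\<theta> t x)) =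
      complex_of_real (LINT x|M. cos (\<theta> t x) * indicator (A i) (f i x)) + \<i> * complex_of_real (LINT x|M. sin (\<theta> t x) * indicator (A i) (f i x))"
    if [measurable]: "f i \<in> borel_measurable M" "\<theta> t \<in> borel_measurable M" and "finite_measure M" for M t
  proof -
    interpret finite_measure M by fact
    have "(CLINT x|R M. iexp (\<theta> t x)) = (CLINT x|M. complex_of_real (cos (\<theta> t x) * indicator (A i) (f i x)) +
        \<i> * complex_of_real (sin (\<theta> t x) * indicator (A i) (f i x)))"
      unfolding R_def by (subst integral_density) (auto intro!: Bochner_Integration.integral_cong simp: exp_Euler cos_of_real sin_of_real scaleR_conv_of_real algebra_simps)
    also have "\<dots> = complex_of_real (LINT x|M. cos (\<theta> t x) * indicator (A i) (f i x)) + \<i> * complex_of_real (LINT x|M. sin (\<theta> t x) * indicator (A i) (f i x))"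
    proof -
      have "integrable M (\<lambda>x. cos (\<theta> t x) * indicator (A i) (f i x))" "integrable M (\<lambda>x. sin (\<theta> t x) * indicator (A i) (f i x))"
        by (auto intro!: integrable_const_bound[where B=1] simp: indicator_def)
      then have "integrable M (\<lambda>x. complex_of_real (cos (\<theta> t x) * indicator (A i) (f i x)))"
          "integrable M (\<lambda>x. \<i> * complex_of_real (sin (\<theta> t x) * indicator (A i) (f i x)))"
        by (auto simp del: of_real_mult intro!: integrable_mult_right integrable_of_real)
      then show ?thesis by (simp del: of_real_mult)
    qed
    finally show ?thesis .
  qed
  have "emeasure (R M1) {x\<in>space (R M1). \<forall>i\<in>J. f i x \<in> A i} = emeasure (R M2) {x\<in>space (R M2). \<forall>i\<in>J. f i x \<in> A i}"
  proof (rule insert.IH)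
    show "finite_measure (R M1)" "finite_measure (R M2)"
      unfolding R_def
      by (auto intro!: finite_measure_density M1.integrable_const_bound[where B=1] M2.integrable_const_bound[where B=1]
           simp: indicator_def)
    show "sets (R M1) = sets (R M2)" using insert.prems(3) by (simp add: R_def)
    show "f j \<in> borel_measurable (R M1)" if "j \<in> J" for j using that by (simp add: R_def)
    show "A j \<in> sets borel" if "j \<in> J" for j using that insert.prems(6) by simp
    fix t
    have "(CLINT x|R M1. iexp (\<theta> t x)) = (CLINT x|R M2. iexp (\<theta> t x))"
      using ind[of cos t] ind[of sin t] charR[of M1 t] charR[of M2 t] \<open>finite_measure M1\<close> \<open>finite_measure M2\<close>
      by simp
    then show "(CLINT x|R M1. iexp (\<Sum>i\<in>J. t i * f i x)) = (CLINT x|R M2. iexp (\<Sum>i\<in>J. t i * f i x))"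
      by (simp add: \<theta>_def)
  qed
  moreover have "emeasure (R M) {x\<in>space (R M). \<forall>i\<in>J. f i x \<in> A i} = emeasure M {x\<in>space M. \<forall>i\<in>insert i J. f i x \<in> A i}"
    if [measurable_cong]: "sets M = sets M1" for M
  proof -
    have [measurable]: "{x\<in>space M. \<forall>i\<in>J. f i x \<in> A i} \<in> sets M" "{x\<in>space M. f i x \<in> A i} \<in> sets M"
      using insert.hyps(1) insert.prems(4,6) by measurable
    have "{x\<in>space M. \<forall>i\<in>insert i J. f i x \<in> A i} = {x\<in>space M. \<forall>i\<in>J. f i x \<in> A i} \<inter> {x\<in>space M. f i x \<in> A i}"
      by auto
    then have [measurable]: "{x\<in>space M. \<forall>i\<in>insert i J. f i x \<in> A i} \<in> sets M" by simp
    have "emeasure (R M) {x\<in>space (R M). \<forall>i\<in>J. f i x \<in> A i} =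
        (\<integral>\<^sup>+x. ennreal (indicator (A i) (f i x)) * indicator {x\<in>space M. \<forall>i\<in>J. f i x \<in> A i} x \<partial>M)"
      unfolding R_def by (simp add: emeasure_density)
    also have "\<dots> = (\<integral>\<^sup>+x. indicator {x\<in>space M. \<forall>i\<in>insert i J. f i x \<in> A i} x \<partial>M)"
      by (rule nn_integral_cong) (auto simp: indicator_def)
    finally have "emeasure (R M) {x\<in>space (R M). \<forall>i\<in>J. f i x \<in> A i} =
      (\<integral>\<^sup>+x. indicator {x\<in>space M. \<forall>i\<in>insert i J. f i x \<in> A i} x \<partial>M)" .
    then show ?thesis by simp
  qed
  ultimately show ?case using insert.prems(3) by simp
qed

text \<open>Finite-dimensional rectangles form an intersection-stable generator, and equality on
  them is the preceding lemma. The index set may be uncountable because each rectangle involves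
  finitely many coordinates.\<close>

lemma finite_measure_eqI_char:
  fixes f :: "'i \<Rightarrow> 'a \<Rightarrow> real"
  assumes "finite_measure M1" "finite_measure M2"
    and sets1: "sets M1 = sigma_sets \<Omega> {{x\<in>\<Omega>. f i x \<in> A} | i A. i \<in> I \<and> A \<in> sets borel}"
    and sets2: "sets M2 = sigma_sets \<Omega> {{x\<in>\<Omega>. f i x \<in> A} | i A. i \<in> I \<and> A \<in> sets borel}"
    and char: "\<And>J t. finite J \<Longrightarrow> J \<subseteq> I \<Longrightarrow>
      (CLINT x|M1. iexp (\<Sum>i\<in>J. t i * f i x)) = (CLINT x|M2. iexp (\<Sum>i\<in>J. t i * f i x))"
  shows "M1 = M2"
proof -
  interpret M1: finite_measure M1 by fact
  interpret M2: finite_measure M2 by fact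
  let ?E0 = "{{x\<in>\<Omega>. f i x \<in> A} | i A. i \<in> I \<and> A \<in> sets borel}"
  define E where "E = {{x\<in>\<Omega>. \<forall>i\<in>J. f i x \<in> A i} | J A. finite J \<and> J \<subseteq> I \<and> (\<forall>i. A i \<in> sets borel)}"
  have E0_sub: "?E0 \<subseteq> Pow \<Omega>" by auto
  have spM: "space M = \<Omega>" if "sets M = sigma_sets \<Omega> ?E0" for M :: "'a measure"
  proof -
    have "sets M = sets (sigma \<Omega> ?E0)" using that E0_sub by (simp only: sets_measure_of)
    then have "space M = space (sigma \<Omega> ?E0)" by (rule sets_eq_imp_space_eq)
    then show ?thesis using E0_sub by (simp only: space_measure_of)
  qed
  have sp: "space M1 = \<Omega>" "space M2 = \<Omega>" by (rule spM[OF sets1], rule spM[OF sets2])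
  have [measurable]: "f i \<in> borel_measurable M1" if "i \<in> I" for i
  proof (rule measurableI)
    fix A :: "real set" assume "A \<in> sets borel"
    then have "{x\<in>\<Omega>. f i x \<in> A} \<in> ?E0" using that by auto
    then show "f i -` A \<inter> space M1 \<in> sets M1"
      unfolding sets1 sp by (intro sigma_sets.Basic) (simp add: vimage_def Int_def conj_commute)
  qed simp
  have E_sets: "E \<subseteq> sets M1"
  proof
    fix X assume "X \<in> E"
    then obtain J A where X: "X = {x\<in>\<Omega>. \<forall>i\<in>J. f i x \<in> A i}" "finite J" "J \<subseteq> I" and [measurable]: "\<And>i. A i \<in> sets borel"
      unfolding E_def by auto
    have [measurable]: "f i \<in> borel_measurable M1" if "i \<in> J" for i using X that by auto
    have "{x\<in>space M1. \<forall>i\<in>J. f i x \<in> A i} \<in> sets M1" using X(2) by measurable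
    then show "X \<in> sets M1" using X sp by simp
  qed
  have E0_E: "?E0 \<subseteq> E"
  proof
    fix X assume "X \<in> ?E0"
    then obtain i A where "X = {x\<in>\<Omega>. f i x \<in> A}" "i \<in> I" "A \<in> sets borel" by auto
    then show "X \<in> E" unfolding E_def
      by (intro CollectI exI[of _ "{i}"] exI[of _ "\<lambda>_. A"]) auto
  qed
  have sig: "sigma_sets \<Omega> E = sigma_sets \<Omega> ?E0"
    using E_sets sigma_sets_mono[OF E_sets[unfolded sets1]] sigma_sets_mono'[OF E0_E] by auto
  show ?thesis
  proof (rule measure_eqI_generator_eq[where E=E and \<Omega>=\<Omega> and A="\<lambda>_. \<Omega>"])
    show "Int_stable E"
    proof (rule Int_stableI)
      fix X Y assume "X \<in> E" "Y \<in> E"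
      then obtain J A K B where X: "X = {x\<in>\<Omega>. \<forall>i\<in>J. f i x \<in> A i}" "finite J" "J \<subseteq> I" "\<And>i. A i \<in> sets borel"
        and Y: "Y = {x\<in>\<Omega>. \<forall>i\<in>K. f i x \<in> B i}" "finite K" "K \<subseteq> I" "\<And>i. B i \<in> sets borel"
        unfolding E_def by blast
      have "X \<inter> Y = {x\<in>\<Omega>. \<forall>i\<in>J\<union>K. f i x \<in> (if i \<in> J then A i else UNIV) \<inter> (if i \<in> K then B i else UNIV)}"
        using X(1) Y(1) by auto
      then show "X \<inter> Y \<in> E" unfolding E_def using X Y
        by (intro CollectI exI[of _ "J \<union> K"] exI[of _ "\<lambda>i. (if i \<in> J then A i else UNIV) \<inter> (if i \<in> K then B i else UNIV)"]) auto
    qed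
    show "E \<subseteq> Pow \<Omega>" by (auto simp: E_def)
    show "sets M1 = sigma_sets \<Omega> E" "sets M2 = sigma_sets \<Omega> E" using sets1 sets2 sig by auto
    have "{x\<in>\<Omega>. \<forall>i\<in>{}. f i x \<in> UNIV} \<in> E" unfolding E_def by (intro CollectI exI[of _ "{}"] exI[of _ "\<lambda>_. UNIV"]) auto
    then show "range (\<lambda>_::nat. \<Omega>) \<subseteq> E" by auto
    show "emeasure M1 \<Omega> \<noteq> \<infinity>" using M1.finite_emeasure_space sp by simp
    fix X assume "X \<in> E"
    then obtain J A where X: "X = {x\<in>\<Omega>. \<forall>i\<in>J. f i x \<in> A i}" "finite J" "J \<subseteq> I" "\<And>i. A i \<in> sets borel"
      unfolding E_def by auto
    have "emeasure M1 {x\<in>space M1. \<forall>i\<in>J. f i x \<in> A i} = emeasure M2 {x\<in>space M2. \<forall>i\<in>J. f i x \<in> A i}"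
      by (rule char_eq_imp_rectangles_eq) (use X assms(1,2) sets1 sets2 char in auto)
    then show "emeasure M1 X = emeasure M2 X" using X sp by simp
  qed auto
qed

section \<open>Weak measurability and laws of vectors in a separable inner product space\<close>

lemma borel_measurable_innerI:
  fixes f :: "'a \<Rightarrow> 'h::{real_inner,second_countable_topology}"
  assumes meas: "\<And>h. (\<lambda>x. f x \<bullet> h) \<in> borel_measurable N"
  shows "f \<in> borel_measurable N"
proof -
  obtain D :: "'h set" where D: "countable D" "\<And>X. open X \<Longrightarrow> X \<noteq> {} \<Longrightarrow> \<exists>d\<in>D. d \<in> X"
    using countable_dense_exists by metis
  \<comment> \<open>A closed ball is the intersection of half-spaces with directions
    \<open>h\<close> in a countable dense set, so membership is a countable condition on inner
    products.\<close>
  have cb[measurable]: "Measurable.pred N (\<lambda>x. dist c (f x) \<le> r)" for c r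
  proof -
    \<comment> \<open>The conjunct \<open>0 \<le> r\<close> settles the case \<open>y = c\<close>,
      where the test direction \<open>y - c\<close> is zero and gives nothing.\<close>
    have eq: "dist c y \<le> r \<longleftrightarrow> (\<forall>h\<in>D. (y \<bullet> h) - c \<bullet> h \<le> r * norm h) \<and> 0 \<le> r" for y
    proof safe
      fix h assume "dist c y \<le> r"
      have "(y - c) \<bullet> h \<le> norm (y - c) * norm h" by (rule norm_cauchy_schwarz)
      also have "\<dots> \<le> r * norm h" using \<open>dist c y \<le> r\<close> by (intro mult_right_mono) (auto simp: dist_norm norm_minus_commute)
      finally show "(y \<bullet> h) - c \<bullet> h \<le> r * norm h" by (simp add: inner_diff_left)
    next
      assume "dist c y \<le> r" then show "0 \<le> r" using zero_le_dist order_trans by blast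
    next
      assume *: "\<forall>h\<in>D. (y \<bullet> h) - c \<bullet> h \<le> r * norm h" "0 \<le> r"
      have all: "(y \<bullet> h) - c \<bullet> h \<le> r * norm h" for h
      proof (rule ccontr)
        assume "\<not> ?thesis"
        moreover have "open {h. r * norm h < (y \<bullet> h) - c \<bullet> h}"
          by (intro open_Collect_less continuous_intros)
        moreover from calculation have "{h. r * norm h < (y \<bullet> h) - c \<bullet> h} \<noteq> {}"
          by (metis empty_Collect_eq not_le)
        ultimately have "\<exists>d\<in>D. d \<in> {h. r * norm h < (y \<bullet> h) - c \<bullet> h}"
          by (intro D(2))
        then obtain d where "d \<in> D" "r * norm d < (y \<bullet> d) - c \<bullet> d" by auto
        then show False using * by force
      qed
      have "norm (y - c) * norm (y - c) \<le> r * norm (y - c)"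
        using all[of "y - c"] by (simp add: inner_diff_left[symmetric] power2_norm_eq_inner[symmetric] power2_eq_square)
      then have "norm (y - c) \<le> r"
        using *(2) by (cases "norm (y - c) = 0") (auto)
      then show "dist c y \<le> r" by (simp add: dist_norm norm_minus_commute)
    qed
    show ?thesis unfolding eq using D(1) meas by measurable
  qed
  show ?thesis
  proof (rule borel_measurableI)
    fix U :: "'h set" assume U: "open U"
    \<comment> \<open>The complement of an open set is the closure of a countable set
      \<open>S\<close>, and lying in that closure is again a countable condition on closed
      balls.\<close>
    obtain S where S: "countable S" "S \<subseteq> - U" "- U \<subseteq> closure S" using separable[of "- U"] by metis
    have "closure S = - U" using S(3) closure_minimal[OF S(2)] U by auto
    moreover have "y \<in> closure S \<longleftrightarrow> (\<forall>n. \<exists>c\<in>S. dist c y \<le> 1 / real (Suc n))" for y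
    proof
      assume "y \<in> closure S"
      then show "\<forall>n. \<exists>c\<in>S. dist c y \<le> 1 / real (Suc n)" by (auto simp: closure_approachable_le)
    next
      assume *: "\<forall>n. \<exists>c\<in>S. dist c y \<le> 1 / real (Suc n)"
      show "y \<in> closure S" unfolding closure_approachable_le
      proof (intro allI impI)
        fix e :: real assume "0 < e"
        then obtain n where "1 / real (Suc n) < e" by (rule nat_approx_posE)
        with * show "\<exists>c\<in>S. dist c y \<le> e" by (meson less_imp_le order_trans)
      qed
    qed
    ultimately have "y \<in> U \<longleftrightarrow> \<not> (\<forall>n. \<exists>c\<in>S. dist c y \<le> 1 / real (Suc n))" for y by (metis Compl_iff)
    then have "f -` U \<inter> space N = {x\<in>space N. \<not> (\<forall>n. \<exists>c\<in>S. dist c (f x) \<le> 1 / real (Suc n))}" by blast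
    also have "\<dots> \<in> sets N" using S(1) by measurable
    finally show "f -` U \<inter> space N \<in> sets N" .
  qed
qed

text \<open>\<open>gen\<close> says that \<open>N\<close> carries the smallest sigma-algebra making
  all \<open>Z t\<close> measurable. In this form the lemma serves finite products, a single space
  and the path space alike, with \<open>Z\<close> the coordinates, the identity and the
  evaluations.\<close>

lemma finite_measure_eqI_char_inner:
  fixes Z :: "'t \<Rightarrow> 'a \<Rightarrow> 'h::{real_inner,second_countable_topology}"
  assumes Z: "\<And>t. t \<in> T \<Longrightarrow> Z t \<in> borel_measurable N"
    and gen: "\<And>N'. space N' = space N \<Longrightarrow> (\<And>t. t \<in> T \<Longrightarrow> Z t \<in> borel_measurable N') \<Longrightarrow> (\<lambda>z. z) \<in> measurable N' N"
    and fin: "finite_measure M1" "finite_measure M2" and sets: "sets M1 = sets N" "sets M2 = sets N"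
    and char: "\<And>J k. finite J \<Longrightarrow> J \<subseteq> T \<Longrightarrow>
      (CLINT z|M1. iexp (\<Sum>j\<in>J. Z j z \<bullet> k j)) = (CLINT z|M2. iexp (\<Sum>j\<in>J. Z j z \<bullet> k j))"
  shows "M1 = M2"
proof -
  let ?E = "{{z\<in>space N. Z (fst p) z \<bullet> snd p \<in> A} | p A. p \<in> T \<times> UNIV \<and> A \<in> sets borel}"
  have Es: "?E \<subseteq> sets N"
  proof safe
    fix j h and A :: "real set" assume "j \<in> T" and [measurable]: "A \<in> sets borel"
    then have [measurable]: "Z j \<in> borel_measurable N" by (intro Z)
    show "{z\<in>space N. Z (fst (j, h)) z \<bullet> snd (j, h) \<in> A} \<in> sets N" by simp
  qed
  have sub: "?E \<subseteq> Pow (space N)" by auto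
  \<comment> \<open>Minimality of \<open>N\<close> is applied to the sigma-algebra generated by the
    scalar tests; this gives the nontrivial inclusion of \<open>sets N\<close> in it.\<close>
  have "(\<lambda>z. z) \<in> measurable (sigma (space N) ?E) N"
  proof (rule gen)
    fix j assume "j \<in> T"
    have "(\<lambda>z. Z j z \<bullet> h) \<in> borel_measurable (sigma (space N) ?E)" for h
    proof (rule measurableI)
      fix A :: "real set" assume "A \<in> sets borel"
      then have "{z\<in>space N. Z (fst (j, h)) z \<bullet> snd (j, h) \<in> A} \<in> ?E" using \<open>j \<in> T\<close> by blast
      then show "(\<lambda>z. Z j z \<bullet> h) -` A \<inter> space (sigma (space N) ?E) \<in> sets (sigma (space N) ?E)"
        using sub by (simp add: space_measure_of sets_measure_of vimage_def Int_def conj_commute)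
    qed simp
    then show "Z j \<in> borel_measurable (sigma (space N) ?E)" by (rule borel_measurable_innerI)
  qed (use sub in \<open>simp add: space_measure_of\<close>)
  then have "sets N \<subseteq> sigma_sets (space N) ?E"
    using sub sets.sets_into_space[of _ N]
    by (fastforce simp: measurable_def space_measure_of sets_measure_of Int_absorb2)
  moreover have "sigma_sets (space N) ?E \<subseteq> sets N" using Es by (rule sets.sigma_sets_subset)
  ultimately have eq: "sets N = sigma_sets (space N) ?E" by (rule equalityI)
  show ?thesis
  proof (rule finite_measure_eqI_char[where f="\<lambda>p z. Z (fst p) z \<bullet> snd p" and I="T \<times> UNIV" and \<Omega>="space N"])
    show "sets M1 = sigma_sets (space N) ?E" "sets M2 = sigma_sets (space N) ?E" using eq sets by simp_all
    fix K :: "('t \<times> 'h) set" and t assume K: "finite K" "K \<subseteq> T \<times> UNIV"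
    \<comment> \<open>Scalar tests with the same index are merged into one vector, since
      \<open>char\<close> allows one test vector per index.\<close>
    have "(\<Sum>p\<in>K. t p * (Z (fst p) z \<bullet> snd p)) = (\<Sum>j\<in>fst ` K. Z j z \<bullet> (\<Sum>p\<in>{p\<in>K. fst p = j}. t p *\<^sub>R snd p))" for z
    proof -
      have "(\<Sum>p\<in>K. t p * (Z (fst p) z \<bullet> snd p)) = (\<Sum>j\<in>fst ` K. \<Sum>p\<in>{p\<in>K. fst p = j}. t p * (Z (fst p) z \<bullet> snd p))"
        by (rule sum.group[symmetric]) (use K in auto)
      also have "\<dots> = (\<Sum>j\<in>fst ` K. Z j z \<bullet> (\<Sum>p\<in>{p\<in>K. fst p = j}. t p *\<^sub>R snd p))"
        by (intro sum.cong refl) (auto simp: inner_sum_right intro!: sum.cong)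
      finally show ?thesis .
    qed
    then show "(CLINT x|M1. iexp (\<Sum>i\<in>K. t i * (Z (fst i) x \<bullet> snd i))) = (CLINT x|M2. iexp (\<Sum>i\<in>K. t i * (Z (fst i) x \<bullet> snd i)))"
      using char[of "fst ` K"] K by force
  qed fact+
qed

lemma finite_measure_PiM_eqI_char:
  fixes M1 M2 :: "('j \<Rightarrow> 'h::{real_inner,second_countable_topology}) measure"
  assumes "finite_measure M1" "finite_measure M2" and J: "finite J"
    and "sets M1 = sets (PiM J (\<lambda>_. borel))" "sets M2 = sets (PiM J (\<lambda>_. borel))"
    and char: "\<And>k. (CLINT z|M1. iexp (\<Sum>j\<in>J. z j \<bullet> k j)) = (CLINT z|M2. iexp (\<Sum>j\<in>J. z j \<bullet> k j))"
  shows "M1 = M2"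
proof (rule finite_measure_eqI_char_inner[where Z="\<lambda>j z. z j" and T=J and N="PiM J (\<lambda>_. borel :: 'h measure)"])
  fix N' :: "('j \<Rightarrow> 'h) measure"
  assume "space N' = space (PiM J (\<lambda>_. borel :: 'h measure))" "\<And>j. j \<in> J \<Longrightarrow> (\<lambda>z. z j) \<in> borel_measurable N'"
  then show "(\<lambda>z. z) \<in> measurable N' (PiM J (\<lambda>_. borel))"
    by (intro measurable_PiM_single') (auto simp: space_PiM)
next
  fix K :: "'j set" and k :: "'j \<Rightarrow> 'h" assume K: "finite K" "K \<subseteq> J"
  have "(\<Sum>j\<in>J. z j \<bullet> (if j \<in> K then k j else 0)) = (\<Sum>j\<in>K. z j \<bullet> k j)" for z :: "'j \<Rightarrow> 'h"
    using K J by (intro sum.mono_neutral_cong_right) auto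
  then show "(CLINT z|M1. iexp (\<Sum>j\<in>K. z j \<bullet> k j)) = (CLINT z|M2. iexp (\<Sum>j\<in>K. z j \<bullet> k j))"
    using char[of "\<lambda>j. if j \<in> K then k j else 0"] by simp
qed (use assms in auto)

section \<open>Conditional expectations in terms of characteristic functions\<close>

lemma weighted_char_zero_real:
  fixes Z :: "'j \<Rightarrow> 'a \<Rightarrow> 'h::{real_inner,second_countable_topology}" and w :: "'a \<Rightarrow> real"
  assumes J: "finite J" and Z[measurable]: "\<And>j. j \<in> J \<Longrightarrow> Z j \<in> borel_measurable M" and w: "integrable M w"
    and char: "\<And>k. (CLINT x|M. complex_of_real (w x) * iexp (\<Sum>j\<in>J. Z j x \<bullet> k j)) = 0"
    and \<Psi>[measurable]: "\<Psi> \<in> borel_measurable (PiM J (\<lambda>_. borel))"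
    and int: "integrable M (\<lambda>x. complex_of_real (w x) * \<Psi> (\<lambda>j\<in>J. Z j x))"
  shows "(CLINT x|M. complex_of_real (w x) * \<Psi> (\<lambda>j\<in>J. Z j x)) = 0"
proof -
  have [measurable]: "w \<in> borel_measurable M" using w by auto
  have ZJ[measurable]: "(\<lambda>x. \<lambda>j\<in>J. Z j x) \<in> measurable M (PiM J (\<lambda>_. borel))" by measurable
  \<comment> \<open>\<open>D 1\<close> and \<open>D (- 1)\<close> are the images under
    \<open>Z\<close> of the measures whose densities are the positive and the negative part of
    \<open>w\<close>. The hypothesis \<open>char\<close> says that their characteristic functions
    agree.\<close>
  define D where "D s = distr (density M (\<lambda>x. ennreal (max 0 (s * w x)))) (PiM J (\<lambda>_. borel)) (\<lambda>x. \<lambda>j\<in>J. Z j x)" for s :: real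
  have w': "integrable M (\<lambda>x. max 0 (s * w x))" for s
    using w by (intro integrable_max) auto
  have D_int: "(CLINT z|D s. f z) = (CLINT x|M. complex_of_real (max 0 (s * w x)) * f (\<lambda>j\<in>J. Z j x))"
    if [measurable]: "f \<in> borel_measurable (PiM J (\<lambda>_. borel))" for f s
  proof -
    have "(CLINT z|D s. f z) = (CLINT x|density M (\<lambda>x. ennreal (max 0 (s * w x))). f (\<lambda>j\<in>J. Z j x))"
      unfolding D_def by (rule integral_distr) auto
    also have "\<dots> = (CLINT x|M. max 0 (s * w x) *\<^sub>R f (\<lambda>j\<in>J. Z j x))"
      by (rule integral_density) auto
    finally show ?thesis by (simp add: scaleR_conv_of_real)
  qed
  have split: "(CLINT x|M. complex_of_real (w x) * f (\<lambda>j\<in>J. Z j x)) = (CLINT z|D 1. f z) - (CLINT z|D (-1). f z)"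
    if [measurable]: "f \<in> borel_measurable (PiM J (\<lambda>_. borel))"
      and i: "integrable M (\<lambda>x. complex_of_real (w x) * f (\<lambda>j\<in>J. Z j x))" for f
  proof -
    have "integrable M (\<lambda>x. complex_of_real (max 0 (s * w x)) * f (\<lambda>j\<in>J. Z j x))" if "\<bar>s\<bar> = 1" for s
    proof (rule Bochner_Integration.integrable_bound[OF i])
      have "\<bar>max 0 (s * w x)\<bar> \<le> \<bar>s * w x\<bar>" for x by auto
      then have "\<bar>max 0 (s * w x)\<bar> \<le> \<bar>w x\<bar>" for x using that by (simp add: abs_mult)
      then show "AE x in M. norm (complex_of_real (max 0 (s * w x)) * f (\<lambda>j\<in>J. Z j x)) \<le> norm (complex_of_real (w x) * f (\<lambda>j\<in>J. Z j x))"
        by (intro AE_I2) (simp add: norm_mult mult_right_mono)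
    qed measurable
    from this[of 1] this[of "-1"] show ?thesis
      unfolding D_int[OF that(1)] by (subst Bochner_Integration.integral_diff[symmetric])
        (auto intro!: Bochner_Integration.integral_cong simp: max_def left_diff_distrib[symmetric])
  qed
  have "D 1 = D (-1)"
  proof (rule finite_measure_PiM_eqI_char[OF _ _ J])
    have "finite_measure (D s)" for s
      unfolding D_def using w'[of s] by (intro finite_measure.finite_measure_distr finite_measure_density) auto
    then show "finite_measure (D 1)" "finite_measure (D (-1))" by auto
    fix k :: "'j \<Rightarrow> 'h"
    have [measurable]: "(\<lambda>z. iexp (\<Sum>j\<in>J. z j \<bullet> k j)) \<in> borel_measurable (PiM J (\<lambda>_. borel))"
      by measurable
    have "integrable M (\<lambda>x. complex_of_real (w x) * iexp (\<Sum>j\<in>J. Z j x \<bullet> k j))"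
      using w by (intro integrable_iexp_weight integrable_of_real) auto
    then show "(CLINT z|D 1. iexp (\<Sum>j\<in>J. z j \<bullet> k j)) = (CLINT z|D (-1). iexp (\<Sum>j\<in>J. z j \<bullet> k j))"
      using split[of "\<lambda>z. iexp (\<Sum>j\<in>J. z j \<bullet> k j)"] char[of k] by simp
  qed (auto simp: D_def)
  then show ?thesis unfolding split[OF \<Psi> int] by simp
qed

text \<open>The hypothesis \<open>char\<close> says that the conditional expectation of
  \<open>w\<close> given \<open>Z\<close> vanishes. Real and imaginary part are treated separately,
  as \<open>Re (1 * w)\<close> and \<open>Re (- \<i> * w)\<close>; conjugating the weight only
  replaces \<open>k\<close> by \<open>- k\<close>, so the hypothesis passes to both.\<close>

lemma weighted_char_zero:
  fixes Z :: "'j \<Rightarrow> 'a \<Rightarrow> 'h::{real_inner,second_countable_topology}" and w :: "'a \<Rightarrow> complex"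
  assumes J: "finite J" and Z[measurable]: "\<And>j. j \<in> J \<Longrightarrow> Z j \<in> borel_measurable M" and w: "integrable M w"
    and char: "\<And>k. (CLINT x|M. w x * iexp (\<Sum>j\<in>J. Z j x \<bullet> k j)) = 0"
    and \<Psi>[measurable]: "\<Psi> \<in> borel_measurable (PiM J (\<lambda>_. borel))"
    and int: "integrable M (\<lambda>x. w x * \<Psi> (\<lambda>j\<in>J. Z j x))"
  shows "(CLINT x|M. w x * \<Psi> (\<lambda>j\<in>J. Z j x)) = 0"
proof -
  have [measurable]: "w \<in> borel_measurable M" using w by auto
  have ZJ[measurable]: "(\<lambda>x. \<lambda>j\<in>J. Z j x) \<in> measurable M (PiM J (\<lambda>_. borel))" by measurable
  have cw: "integrable M (\<lambda>x. cnj (w x))" using w by simp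
  have conj: "(CLINT x|M. cnj (w x) * iexp (\<Sum>j\<in>J. Z j x \<bullet> k j)) = 0" for k
  proof -
    have "cnj (w x) * iexp (\<Sum>j\<in>J. Z j x \<bullet> k j) = cnj (w x * iexp (\<Sum>j\<in>J. Z j x \<bullet> - k j))" for x
      by (simp add: exp_cnj sum_negf del: inner_minus_right) (simp add: sum_negf)
    then have "(CLINT x|M. cnj (w x) * iexp (\<Sum>j\<in>J. Z j x \<bullet> k j)) = (CLINT x|M. cnj (w x * iexp (\<Sum>j\<in>J. Z j x \<bullet> - k j)))"
      by (rule Bochner_Integration.integral_cong[OF refl])
    also have "\<dots> = cnj (CLINT x|M. w x * iexp (\<Sum>j\<in>J. Z j x \<bullet> - k j))"
      by (rule Bochner_Integration.integral_cnj)
    finally have "(CLINT x|M. cnj (w x) * iexp (\<Sum>j\<in>J. Z j x \<bullet> k j)) = cnj (CLINT x|M. w x * iexp (\<Sum>j\<in>J. Z j x \<bullet> - k j))" .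
    then show ?thesis unfolding char by simp
  qed
  have wi: "integrable M (\<lambda>x. w x * iexp (\<Sum>j\<in>J. Z j x \<bullet> k j))"
       "integrable M (\<lambda>x. cnj (w x) * iexp (\<Sum>j\<in>J. Z j x \<bullet> k j))" for k
    by (rule integrable_iexp_weight[OF w], measurable) (rule integrable_iexp_weight[OF cw], measurable)
  have int': "integrable M (\<lambda>x. complex_of_real (Re (a * w x)) * \<Psi> (\<lambda>j\<in>J. Z j x))" if "cmod a = 1" for a
  proof (rule Bochner_Integration.integrable_bound[OF int])
    have "\<bar>Re (a * w x)\<bar> \<le> cmod (w x)" for x using abs_Re_le_cmod[of "a * w x"] that by (simp add: norm_mult)
    then show "AE x in M. norm (complex_of_real (Re (a * w x)) * \<Psi> (\<lambda>j\<in>J. Z j x)) \<le> norm (w x * \<Psi> (\<lambda>j\<in>J. Z j x))"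
      unfolding norm_mult norm_of_real by (intro AE_I2 mult_right_mono) auto
  qed measurable
  have part: "(CLINT x|M. complex_of_real (Re (a * w x)) * \<Psi> (\<lambda>j\<in>J. Z j x)) = 0" if a: "cmod a = 1" for a
  proof (rule weighted_char_zero_real[OF J Z _ _ \<Psi> int'[OF a]])
    show "integrable M (\<lambda>x. Re (a * w x))" using w by (intro integrable_Re integrable_mult_right)
    fix k
    have "complex_of_real (Re (a * w x)) * E = a / 2 * (w x * E) + cnj a / 2 * (cnj (w x) * E)" for x E
    proof -
      have "complex_of_real (Re (a * w x)) = (a * w x + cnj a * cnj (w x)) / 2"
        using complex_add_cnj[of "a * w x"] by (simp only: complex_cnj_mult) simp
      then show ?thesis by (simp only:) (simp add: field_simps)
    qed
    then show "(CLINT x|M. complex_of_real (Re (a * w x)) * iexp (\<Sum>j\<in>J. Z j x \<bullet> k j)) = 0"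
      using wi[of k] char[of k] conj[of k] by simp
  qed
  have "w x * \<Psi> z = complex_of_real (Re (1 * w x)) * \<Psi> z + \<i> * (complex_of_real (Re (- \<i> * w x)) * \<Psi> z)" for x z
    by (subst complex_eq[of "w x"]) (simp add: algebra_simps)
  then show ?thesis using part[of 1] part[of "- \<i>"] int'[of 1] int'[of "- \<i>"] by simp
qed

text \<open>Applied to the weight \<open>D - c\<close>, the preceding lemma turns a factorisation
  tested on exponentials into one for every integrable function of \<open>Z\<close>. This is how an
  independent factor \<open>D\<close> with mean \<open>c\<close> is pulled out of an
  expectation.\<close>

lemma (in prob_space) char_factor:
  fixes Z :: "'j \<Rightarrow> 'a \<Rightarrow> 'h::{real_inner,second_countable_topology}" and D :: "'a \<Rightarrow> complex"
  assumes J: "finite J" and Z[measurable]: "\<And>j. j \<in> J \<Longrightarrow> Z j \<in> borel_measurable M"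
    and D[measurable]: "D \<in> borel_measurable M" "\<And>x. cmod (D x) \<le> 1"
    and char: "\<And>k. (CLINT x|M. D x * iexp (\<Sum>j\<in>J. Z j x \<bullet> k j)) = c * (CLINT x|M. iexp (\<Sum>j\<in>J. Z j x \<bullet> k j))"
    and \<Psi>[measurable]: "\<Psi> \<in> borel_measurable (PiM J (\<lambda>_. borel))"
    and int: "integrable M (\<lambda>x. \<Psi> (\<lambda>j\<in>J. Z j x))"
  shows "(CLINT x|M. D x * \<Psi> (\<lambda>j\<in>J. Z j x)) = c * (CLINT x|M. \<Psi> (\<lambda>j\<in>J. Z j x))"
proof -
  have Di: "integrable M D" by (rule integrable_const_bound[where B=1]) (use D in auto)
  have int': "integrable M (\<lambda>x. D x * \<Psi> (\<lambda>j\<in>J. Z j x))"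
    by (rule Bochner_Integration.integrable_bound[OF int]) (measurable, use D(2) in \<open>auto simp: norm_mult intro!: mult_left_le_one_le\<close>)
  have "(CLINT x|M. (D x - c) * \<Psi> (\<lambda>j\<in>J. Z j x)) = 0"
  proof (rule weighted_char_zero[OF J Z _ _ \<Psi>])
    show "integrable M (\<lambda>x. D x - c)" using Di by simp
    show "integrable M (\<lambda>x. (D x - c) * \<Psi> (\<lambda>j\<in>J. Z j x))" using int int' by (simp add: left_diff_distrib)
    fix k :: "'j \<Rightarrow> 'h"
    have "integrable M (\<lambda>x. iexp (\<Sum>j\<in>J. Z j x \<bullet> k j))" by (rule integrable_const_bound[where B=1], simp, measurable)
    moreover have "integrable M (\<lambda>x. D x * iexp (\<Sum>j\<in>J. Z j x \<bullet> k j))" by (rule integrable_iexp_weight[OF Di]) measurable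
    ultimately show "(CLINT x|M. (D x - c) * iexp (\<Sum>j\<in>J. Z j x \<bullet> k j)) = 0"
      using char[of k] by (simp add: left_diff_distrib)
  qed
  then show ?thesis using int int' by (simp add: left_diff_distrib)
qed

lemma is_gaussian_unique:
  fixes \<mu> \<nu> :: "'h::{real_inner,second_countable_topology} measure"
  assumes "is_gaussian C \<mu>" "is_gaussian C \<nu>"
  shows "\<mu> = \<nu>"
proof -
  interpret m: prob_space \<mu> using assms by (simp add: is_gaussian_def)
  interpret n: prob_space \<nu> using assms by (simp add: is_gaussian_def)
  have s[measurable_cong]: "sets \<mu> = sets borel" "sets \<nu> = sets borel"
    using assms by (simp_all add: is_gaussian_def)
  show ?thesis
  \<comment> \<open>A one-point index set reduces the family of maps to the identity.\<close>
  proof (rule finite_measure_eqI_char_inner[where Z="\<lambda>_ z. z" and T="UNIV :: unit set" and N="borel"])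
    fix J :: "unit set" and k :: "unit \<Rightarrow> 'h"
    have lin: "(\<Sum>j\<in>J. z \<bullet> k j) = z \<bullet> (\<Sum>j\<in>J. k j)" for z by (simp add: inner_sum_right)
    have "(CLINT z|M'. iexp (\<Sum>j\<in>J. z \<bullet> k j)) = (CLINT r|distr M' borel (\<lambda>x. x \<bullet> (\<Sum>j\<in>J. k j)). iexp r)"
      if [measurable_cong]: "sets M' = sets borel" for M'
      unfolding lin by (rule integral_distr[symmetric]) auto
    then show "(CLINT z|\<mu>. iexp (\<Sum>j\<in>J. z \<bullet> k j)) = (CLINT z|\<nu>. iexp (\<Sum>j\<in>J. z \<bullet> k j))"
      using s assms by (simp add: is_gaussian_def)
  qed (auto simp: s m.finite_measure_axioms n.finite_measure_axioms)
qed

lemma gaussian_eqI: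
  fixes \<mu> :: "'h::{real_inner,second_countable_topology} measure"
  shows "is_gaussian C \<mu> \<Longrightarrow> gaussian C = \<mu>"
  unfolding gaussian_def using is_gaussian_unique by blast

section \<open>Laws on path space\<close>

lemma mspace_path_space:
  "mspace (path_space t0 :: (real \<Rightarrow> 'h::real_normed_vector) metric) = {f. f \<in> extensional {0..t0} \<and> continuous_on {0..t0} f}"
  unfolding path_space_def by (subst compactin_mspace_cfunspace) auto

lemma mdist_path_space_le:
  assumes "0 \<le> B" "\<And>t. t \<in> {0..t0} \<Longrightarrow> dist (f t) (g t) \<le> B"
  shows "mdist (path_space t0) f g \<le> B"
  unfolding path_space_def using assms by (intro mdist_cfunspace_le) auto

lemma space_borel_of_metric [simp]: "space (borel_of_metric m) = mspace m"
  unfolding borel_of_metric_def by (simp add: space_measure_of_conv)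

lemma borel_of_metric_euclidean: "borel_of_metric euclidean_metric = (borel :: 'a::metric_space measure)"
  unfolding borel_of_metric_def borel_def by simp

lemma floor_grid:
  fixes t h :: real
  assumes "0 \<le> t" "0 < h"
  shows "real (nat \<lfloor>t / h\<rfloor>) * h \<le> t" "t < (real (nat \<lfloor>t / h\<rfloor>) + 1) * h"
proof -
  have "0 \<le> t / h" using assms by simp
  then have "real (nat \<lfloor>t / h\<rfloor>) \<le> t / h" "t / h < real (nat \<lfloor>t / h\<rfloor>) + 1"
    using of_nat_floor[of "t / h"] by linarith+
  then show "real (nat \<lfloor>t / h\<rfloor>) * h \<le> t" "t < (real (nat \<lfloor>t / h\<rfloor>) + 1) * h"
    using assms by (simp_all only: pos_le_divide_eq pos_divide_less_eq)
qed

text \<open>The uniform Borel sets are generated by the evaluations: up to any precision, a path is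
  described by its values, rounded to a countable dense set, on a fine grid.\<close>

lemma path_space_measurableI:
  fixes G :: "'a \<Rightarrow> real \<Rightarrow> 'h::{real_normed_vector,second_countable_topology}"
  assumes "0 \<le> t0"
    and G: "\<And>\<omega>. \<omega> \<in> space N \<Longrightarrow> G \<omega> \<in> mspace (path_space t0)"
    and ev[measurable]: "\<And>t. t \<in> {0..t0} \<Longrightarrow> (\<lambda>\<omega>. G \<omega> t) \<in> borel_measurable N"
  shows "G \<in> measurable N (borel_of_metric (path_space t0))"
proof -
  let ?m = "path_space t0 :: (real \<Rightarrow> 'h) metric"
  obtain D :: "'h set" where D: "countable D" "\<And>X. open X \<Longrightarrow> X \<noteq> {} \<Longrightarrow> \<exists>d\<in>D. d \<in> X"
    using countable_dense_exists by metis
  obtain S where S: "countable S" "S \<subseteq> {0..t0}" "{0..t0} \<subseteq> closure S"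
    using separable[of "{0..t0}"] by metis
  \<comment> \<open>\<open>P (n, r, cs)\<close> collects the paths which on the \<open>i\<close>-th
    window of the grid of mesh \<open>t0 / (n + 1)\<close> stay within \<open>1 / (r + 1)\<close> of
    the point \<open>cs ! i\<close>. The condition is imposed at the times of the countable set
    \<open>S\<close> only, so it is a countable condition on evaluations.\<close>
  define P where "P = (\<lambda>(n, r, cs). {f\<in>mspace ?m. \<forall>i\<in>{..<length cs}. \<forall>t\<in>S.
      \<bar>t - real i * (t0 / real (Suc n))\<bar> \<le> t0 / real (Suc n) \<longrightarrow> dist (f t) (cs ! i) \<le> 1 / real (Suc r)})"
  let ?I = "{(n, r :: nat, cs). cs \<in> lists D \<and> length cs = n + 2}"
  have cI: "countable ?I"
    by (rule countable_subset[of _ "UNIV \<times> UNIV \<times> lists D"]) (use D(1) in \<open>auto intro!: countable_SIGMA countable_lists countableI_type\<close>)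
  have P_meas: "G -` P p \<inter> space N \<in> sets N" if "p \<in> ?I" for p
  proof -
    obtain n r cs where p: "p = (n, r, cs)" by (cases p)
    have "G -` P p \<inter> space N = {\<omega>\<in>space N. \<forall>i\<in>{..<length cs}. \<forall>t\<in>S.
      \<bar>t - real i * (t0 / real (Suc n))\<bar> \<le> t0 / real (Suc n) \<longrightarrow> dist (G \<omega> t) (cs ! i) \<le> 1 / real (Suc r)}"
      unfolding p P_def using G by auto
    also have "\<dots> \<in> sets N"
    proof -
      have [measurable]: "(\<lambda>\<omega>. G \<omega> t) \<in> borel_measurable N" if "t \<in> S" for t using S that by auto
      show ?thesis using S(1) by measurable
    qed
    finally show ?thesis .
  qed
  \<comment> \<open>The floor of \<open>t\<close> divided by the mesh is at most
    \<open>n + 1\<close>, a value attained at \<open>t = t0\<close>; hence the \<open>n + 2\<close>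
    centres.\<close>
  have cell: "\<exists>i<n+2. \<bar>t - real i * (t0 / real (Suc n))\<bar> \<le> t0 / real (Suc n)" if t: "t \<in> {0..t0}" for t n
  proof (cases "t0 = 0")
    case True then show ?thesis using t by (intro exI[of _ 0]) auto
  next
    case False
    then have h: "0 < t0 / real (Suc n)" using assms(1) by simp
    let ?i = "nat \<lfloor>t / (t0 / real (Suc n))\<rfloor>"
    have fg: "real ?i * (t0 / real (Suc n)) \<le> t" "t < (real ?i + 1) * (t0 / real (Suc n))"
      using floor_grid[OF _ h, of t] t by auto
    have "real ?i * (t0 / real (Suc n)) \<le> real (Suc n) * (t0 / real (Suc n))" using fg(1) t by simp
    then have "real ?i \<le> real (Suc n)" using h by (rule mult_right_le_imp_le)
    moreover have "(real ?i + 1) * (t0 / real (Suc n)) = real ?i * (t0 / real (Suc n)) + t0 / real (Suc n)"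
      by (simp only: distrib_right mult_1)
    ultimately show ?thesis using fg by (intro exI[of _ ?i]) auto
  qed
  have P_small: "mdist ?m f g \<le> 2 / real (Suc r)" if "f \<in> P (n, r, cs)" "g \<in> P (n, r, cs)" "length cs = n + 2" for f g n r cs
  proof (rule mdist_path_space_le)
    fix t assume "t \<in> {0..t0}"
    have S_le: "dist (f s) (g s) \<le> 2 / real (Suc r)" if s: "s \<in> S" for s
    proof -
      obtain i where i: "i < n + 2" "\<bar>s - real i * (t0 / real (Suc n))\<bar> \<le> t0 / real (Suc n)"
        using cell[OF subsetD[OF S(2) s], of n] by blast
      then have "dist (f s) (cs ! i) \<le> 1 / real (Suc r)" "dist (g s) (cs ! i) \<le> 1 / real (Suc r)"
        using \<open>f \<in> _\<close> \<open>g \<in> _\<close> \<open>length cs = n + 2\<close> s unfolding P_def by auto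
      moreover have "2 / real (Suc r) = 1 / real (Suc r) + 1 / real (Suc r)" by simp
      ultimately show ?thesis using dist_triangle2[of "f s" "g s" "cs ! i"] by linarith
    qed
    have "closure S = {0..t0}" using S closure_minimal[of S "{0..t0}"] by auto
    moreover have "continuous_on {0..t0} (\<lambda>t. dist (f t) (g t))"
      using \<open>f \<in> _\<close> \<open>g \<in> _\<close> unfolding P_def mspace_path_space by (auto intro!: continuous_intros)
    ultimately show "dist (f t) (g t) \<le> 2 / real (Suc r)"
      using S_le \<open>t \<in> {0..t0}\<close> continuous_le_on_closure[of S "\<lambda>t. dist (f t) (g t)" t "2 / real (Suc r)"] by auto
  qed simp
  \<comment> \<open>Uniform continuity of the path provides the mesh and density of \<open>D\<close>
    the centres; each contributes half of \<open>1 / (r + 1)\<close>.\<close>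
  have P_ex: "\<exists>n cs. (n, r, cs) \<in> ?I \<and> f \<in> P (n, r, cs)" if f: "f \<in> mspace ?m" for f r
  proof -
    have "uniformly_continuous_on {0..t0} f"
      using f by (intro compact_uniformly_continuous) (auto simp: mspace_path_space)
    moreover have "0 < 1 / (2 * real (Suc r))" by simp
    ultimately obtain d where d: "d > 0" "\<And>s t. s \<in> {0..t0} \<Longrightarrow> t \<in> {0..t0} \<Longrightarrow> dist t s < d \<Longrightarrow> dist (f t) (f s) < 1 / (2 * real (Suc r))"
      unfolding uniformly_continuous_on_def by metis
    obtain n :: nat where "t0 / d < real n" using reals_Archimedean2 by blast
    then have n: "t0 / real (Suc n) < d" using d(1) by (simp add: field_simps)
    define a where "a i = min t0 (real i * (t0 / real (Suc n)))" for i :: nat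
    have a_in: "a i \<in> {0..t0}" for i using assms(1) by (auto simp: a_def)
    have "\<exists>c\<in>D. c \<in> ball (f (a i)) (1 / (2 * real (Suc r)))" for i
      by (rule D(2)) auto
    then obtain c where c: "\<And>i. c i \<in> D" "\<And>i. dist (f (a i)) (c i) < 1 / (2 * real (Suc r))"
      by (metis mem_ball)
    let ?cs = "map c [0..<n+2]"
    have "f \<in> P (n, r, ?cs)"
    proof -
      have "dist (f t) (?cs ! i) \<le> 1 / real (Suc r)"
        if "i < n + 2" "t \<in> S" "\<bar>t - real i * (t0 / real (Suc n))\<bar> \<le> t0 / real (Suc n)" for i t
      proof -
        have t: "t \<in> {0..t0}" using S that by auto
        have "\<bar>t - a i\<bar> \<le> t0 / real (Suc n)" using that(3) t unfolding a_def by auto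
        then have "dist t (a i) < d" using n by (simp add: dist_real_def)
        then have close: "dist (f t) (f (a i)) < 1 / (2 * real (Suc r))" by (intro d(2) a_in t)
        have "dist (f t) (c i) \<le> dist (f t) (f (a i)) + dist (f (a i)) (c i)" by (rule dist_triangle)
        also have "\<dots> \<le> 1 / (2 * real (Suc r)) + 1 / (2 * real (Suc r))"
          by (intro add_mono less_imp_le c(2) close)
        also have "\<dots> = 1 / real (Suc r)" by (simp add: field_simps)
        finally have "dist (f t) (c i) \<le> 1 / real (Suc r)" .
        moreover have "?cs ! i = c i" using that(1) by (subst nth_map) (auto simp del: upt_Suc)
        ultimately show ?thesis by simp
      qed
      then show ?thesis using f unfolding P_def by (auto simp del: upt_Suc)
    qed
    moreover have "(n, r, ?cs) \<in> ?I" using c(1) by auto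
    ultimately show ?thesis by blast
  qed
  show ?thesis
    unfolding borel_of_metric_def
  proof (rule measurable_measure_of)
    show "{U. openin (mtopology_of ?m) U} \<subseteq> Pow (mspace ?m)"
      using openin_subset by fastforce
    show "G \<in> space N \<rightarrow> mspace ?m" using G by auto
  next
    fix U assume "U \<in> {U. openin (mtopology_of ?m) U}"
    then have U: "openin (mtopology_of ?m) U" by simp
    interpret Metric_space "mspace ?m" "mdist ?m" by (rule Metric_space_mspace_mdist)
    \<comment> \<open>There are only countably many cells, and each path in \<open>U\<close> lies in
      a cell small enough to stay inside \<open>U\<close>.\<close>
    have eqU: "U = (\<Union>p\<in>{p\<in>?I. P p \<subseteq> U}. P p)"
    proof (intro equalityI subsetI)
      fix f assume f: "f \<in> U"
      then have fm: "f \<in> mspace ?m" using openin_subset[OF U] by auto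
      obtain e where e: "e > 0" "mball f e \<subseteq> U"
        using U f unfolding mtopology_of_def openin_mtopology by blast
      obtain r where r: "1 / real (Suc r) < e / 2" using e by (meson half_gt_zero nat_approx_posE)
      obtain n cs where ncs: "(n, r, cs) \<in> ?I" "f \<in> P (n, r, cs)" using P_ex[OF fm] by blast
      have "P (n, r, cs) \<subseteq> U"
      proof
        fix g assume g: "g \<in> P (n, r, cs)"
        then have "mdist ?m f g \<le> 2 / real (Suc r)" using P_small ncs by auto
        moreover have "2 / real (Suc r) < e" using r by simp
        moreover have "g \<in> mspace ?m" using g by (auto simp: P_def)
        ultimately have "g \<in> mball f e" using fm by (simp add: in_mball)
        then show "g \<in> U" using e by auto
      qed
      then show "f \<in> (\<Union>p\<in>{p\<in>?I. P p \<subseteq> U}. P p)" using ncs by blast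
    qed auto
    have mem: "f \<in> U \<longleftrightarrow> (\<exists>p\<in>{p\<in>?I. P p \<subseteq> U}. f \<in> P p)" for f
      by (subst eqU) (simp only: UN_iff)
    have "G -` U \<inter> space N = (\<Union>p\<in>{p\<in>?I. P p \<subseteq> U}. G -` P p \<inter> space N)"
      unfolding vimage_def mem by blast
    also have "\<dots> \<in> sets N"
    proof (rule sets.countable_UN'')
      show "countable {p\<in>?I. P p \<subseteq> U}" by (rule countable_subset[OF _ cI]) blast
    qed (use P_meas in blast)
    finally show "G -` U \<inter> space N \<in> sets N" .
  qed
qed

text \<open>Evaluation is 1-Lipschitz for the uniform distance, so preimages of open sets are
  open.\<close>

lemma path_space_eval_measurable:
  assumes "t \<in> {0..t0}"
  shows "(\<lambda>f. f t) \<in> borel_measurable (borel_of_metric (path_space t0 :: (real \<Rightarrow> 'h::real_normed_vector) metric))"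
proof (rule borel_measurableI)
  let ?m = "path_space t0 :: (real \<Rightarrow> 'h) metric"
  interpret Metric_space "mspace ?m" "mdist ?m" by (rule Metric_space_mspace_mdist)
  fix U :: "'h set" assume U: "open U"
  have "openin (mtopology_of ?m) {f\<in>mspace ?m. f t \<in> U}"
    unfolding mtopology_of_def openin_mtopology
  proof (intro conjI allI impI)
    fix f assume f: "f \<in> {f\<in>mspace ?m. f t \<in> U}"
    then obtain e where e: "e > 0" "ball (f t) e \<subseteq> U" using U open_contains_ball by blast
    have "mball f e \<subseteq> {f\<in>mspace ?m. f t \<in> U}"
    proof
      fix g assume g: "g \<in> mball f e"
      have "dist (f t) (g t) < e"
      proof -
        have "f \<in> mspace ?m" "g \<in> mspace ?m" "mdist ?m f g < e" using g by (auto simp: in_mball)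
        moreover have "compactin (top_of_set {0..t0}) (topspace (top_of_set {0..t0}))"
          by (simp add: compactin_subtopology)
        ultimately show ?thesis
          using cfunspace_mdist_lt[of "top_of_set {0..t0}" f euclidean_metric g e t] assms
          unfolding path_space_def by (simp del: mspace_cfunspace)
      qed
      then show "g \<in> {f\<in>mspace ?m. f t \<in> U}" using g e by (auto simp: in_mball)
    qed
    then show "\<exists>r>0. mball f r \<subseteq> {f\<in>mspace ?m. f t \<in> U}" using e by blast
  qed auto
  then have "{f\<in>mspace ?m. f t \<in> U} \<in> sets (borel_of_metric ?m)"
    unfolding borel_of_metric_def by (subst sets_measure_of) (auto dest!: openin_subset)
  then show "(\<lambda>f. f t) -` U \<inter> space (borel_of_metric ?m) \<in> sets (borel_of_metric ?m)"
    by (simp add: vimage_def Int_def conj_commute)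
qed

lemma path_map_measurable:
  fixes Z :: "real \<Rightarrow> 'w \<Rightarrow> 'h::{real_normed_vector,second_countable_topology}"
  assumes "0 \<le> t0" "\<And>t. t \<in> {0..t0} \<Longrightarrow> Z t \<in> borel_measurable M"
    and "\<And>w. w \<in> space M \<Longrightarrow> continuous_on {0..t0} (\<lambda>t. Z t w)"
  shows "(\<lambda>w. \<lambda>t\<in>{0..t0}. Z t w) \<in> measurable M (borel_of_metric (path_space t0))"
proof -
  have "continuous_on {0..t0} (\<lambda>t\<in>{0..t0}. Z t w)" if "w \<in> space M" for w
    using continuous_on_cong[of "{0..t0}" "{0..t0}" "\<lambda>t\<in>{0..t0}. Z t w" "\<lambda>t. Z t w"] assms(3)[OF that] by simp
  then show ?thesis
    using assms by (intro path_space_measurableI) (auto simp: mspace_path_space)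
qed

text \<open>Finite-dimensional characteristic functions suffice because the evaluations generate the
  Borel sets of the path space. The two processes may live on different probability spaces, as the
  two copies of the approximate reverse process do.\<close>

lemma path_law_eqI_char:
  fixes Z :: "real \<Rightarrow> 'w \<Rightarrow> 'h::{real_inner,second_countable_topology}" and Z' :: "real \<Rightarrow> 'v \<Rightarrow> 'h"
  assumes "0 \<le> t0" "prob_space M" "prob_space M'"
    and Z: "\<And>t. t \<in> {0..t0} \<Longrightarrow> Z t \<in> borel_measurable M" "\<And>w. w \<in> space M \<Longrightarrow> continuous_on {0..t0} (\<lambda>t. Z t w)"
    and Z': "\<And>t. t \<in> {0..t0} \<Longrightarrow> Z' t \<in> borel_measurable M'" "\<And>w. w \<in> space M' \<Longrightarrow> continuous_on {0..t0} (\<lambda>t. Z' t w)"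
    and char: "\<And>J k. finite J \<Longrightarrow> J \<subseteq> {0..t0} \<Longrightarrow>
      (CLINT w|M. iexp (\<Sum>j\<in>J. Z j w \<bullet> k j)) = (CLINT w|M'. iexp (\<Sum>j\<in>J. Z' j w \<bullet> k j))"
  shows "path_law M t0 Z = path_law M' t0 Z'"
proof (rule finite_measure_eqI_char_inner[where Z="\<lambda>t f. f t" and T="{0..t0}" and
      N="borel_of_metric (path_space t0 :: (real \<Rightarrow> 'h) metric)"])
  interpret M: prob_space M by fact
  interpret M': prob_space M' by fact
  note pm = path_map_measurable[OF assms(1) Z] path_map_measurable[OF assms(1) Z']
  show "finite_measure (path_law M t0 Z)" "finite_measure (path_law M' t0 Z')"
    unfolding path_law_def using pm
    by (auto intro!: prob_space.finite_measure M.prob_space_distr M'.prob_space_distr)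
  fix J :: "real set" and k :: "real \<Rightarrow> 'h" assume J: "finite J" "J \<subseteq> {0..t0}"
  have [measurable]: "(\<lambda>f. f t) \<in> borel_measurable (borel_of_metric (path_space t0 :: (real \<Rightarrow> 'h) metric))" if "t \<in> J" for t
    using path_space_eval_measurable J that by blast
  have m: "(\<lambda>f. iexp (\<Sum>j\<in>J. f j \<bullet> k j)) \<in> borel_measurable (borel_of_metric (path_space t0))"
    by measurable
  have r: "(\<Sum>j\<in>J. (\<lambda>t\<in>{0..t0}. z t) j \<bullet> k j) = (\<Sum>j\<in>J. z j \<bullet> k j)" for z :: "real \<Rightarrow> 'h"
    using J by (intro sum.cong) auto
  show "(CLINT z|path_law M t0 Z. iexp (\<Sum>j\<in>J. z j \<bullet> k j)) = (CLINT z|path_law M' t0 Z'. iexp (\<Sum>j\<in>J. z j \<bullet> k j))"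
    using integral_distr[OF pm(1) m] integral_distr[OF pm(2) m] char[OF J] unfolding path_law_def r by simp
next
  fix N' :: "(real \<Rightarrow> 'h) measure"
  assume "space N' = space (borel_of_metric (path_space t0 :: (real \<Rightarrow> 'h) metric))"
    "\<And>t. t \<in> {0..t0} \<Longrightarrow> (\<lambda>f. f t) \<in> borel_measurable N'"
  then show "(\<lambda>z. z) \<in> measurable N' (borel_of_metric (path_space t0))"
    using assms(1) by (intro path_space_measurableI) auto
qed (auto simp: path_law_def path_space_eval_measurable)

section \<open>Riemann and Stieltjes sums along refining grids\<close>

lemma uniform_derivative:
  fixes G :: "real \<Rightarrow> 'h::banach"
  assumes der: "\<And>t. t \<in> {c..d} \<Longrightarrow> (G has_vector_derivative G' t) (at t within {c..d})"
    and cont: "continuous_on {c..d} G'" and "0 < \<epsilon>"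
  shows "\<exists>\<delta>>0. \<forall>a x b. c \<le> a \<longrightarrow> a \<le> x \<longrightarrow> x \<le> b \<longrightarrow> b \<le> d \<longrightarrow> b - a < \<delta> \<longrightarrow>
    norm (G b - G a - (b - a) *\<^sub>R G' x) \<le> \<epsilon> * (b - a)"
proof -
  have "uniformly_continuous_on {c..d} G'" using cont by (intro compact_uniformly_continuous) auto
  then obtain \<delta> where \<delta>: "\<delta> > 0" "\<And>s t. s \<in> {c..d} \<Longrightarrow> t \<in> {c..d} \<Longrightarrow> dist t s < \<delta> \<Longrightarrow> dist (G' t) (G' s) < \<epsilon>"
    using \<open>0 < \<epsilon>\<close> unfolding uniformly_continuous_on_def by metis
  have "norm (G b - G a - (b - a) *\<^sub>R G' x) \<le> \<epsilon> * (b - a)"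
    if h: "c \<le> a" "a \<le> x" "x \<le> b" "b \<le> d" "b - a < \<delta>" for a x b
  proof -
    \<comment> \<open>The increment is the integral of \<open>G'\<close>, and by uniform continuity
      \<open>G'\<close> stays within \<epsilon> of its value at any tag \<open>x\<close> of a short
      interval.\<close>
    have "(G' has_integral G b - G a) {a..b}"
      using h by (intro fundamental_theorem_of_calculus has_vector_derivative_within_subset[OF der]) auto
    then have "((\<lambda>s. G' s - G' x) has_integral (G b - G a - (b - a) *\<^sub>R G' x)) {a..b}"
      using h has_integral_const_real[of "G' x" a b] by (intro has_integral_diff) auto
    then have "((\<lambda>s. G' s - G' x) has_integral (G b - G a - (b - a) *\<^sub>R G' x)) (cbox a b)" by simp
    then have "norm (G b - G a - (b - a) *\<^sub>R G' x) \<le> \<epsilon> * measure lborel (cbox a b)"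
    proof (rule has_integral_bound[rotated])
      fix s assume "s \<in> cbox a b"
      then have "dist (G' s) (G' x) < \<epsilon>" using h by (intro \<delta>(2)) (auto simp: dist_real_def)
      then show "norm (G' s - G' x) \<le> \<epsilon>" by (simp add: dist_norm)
    qed (use \<open>0 < \<epsilon>\<close> in simp)
    then show ?thesis using h by simp
  qed
  then show ?thesis using \<delta>(1) by blast
qed

text \<open>\<open>S a b\<close> is a local approximation of the increment of \<open>G\<close> with
  error \<open>o(b - a)\<close> uniformly in the position; over \<open>n N\<close> cells of width
  \<open>h N\<close> the errors add up to at most \<epsilon> times \<open>T\<close>. The grid only
  has to end at a point converging to \<open>t\<close>, which covers both the equal division of
  \<open>[0, t]\<close> and a fixed grid cut off below \<open>t\<close>.\<close>

lemma grid_sum_tendsto: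
  fixes G :: "real \<Rightarrow> 'h::real_normed_vector"
  assumes cont: "continuous_on {0..T} G"
    and loc: "\<And>\<epsilon>. 0 < \<epsilon> \<Longrightarrow> \<exists>\<delta>>0. \<forall>a b. 0 \<le> a \<longrightarrow> a \<le> b \<longrightarrow> b \<le> T \<longrightarrow> b - a < \<delta> \<longrightarrow> norm (G b - G a - S a b) \<le> \<epsilon> * (b - a)"
    and t: "t \<in> {0..T}" and h: "\<And>N. 0 \<le> h N" "h \<longlonglongrightarrow> 0"
    and n: "\<And>N. real (n N) * h N \<le> T" "(\<lambda>N. real (n N) * h N) \<longlonglongrightarrow> t"
  shows "(\<lambda>N. \<Sum>i<n N. S (real i * h N) (real (Suc i) * h N)) \<longlonglongrightarrow> G t - G 0"
proof -
  have T: "0 \<le> T" using t by auto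
  have "(\<lambda>N. G (real (n N) * h N)) \<longlonglongrightarrow> G t"
    by (rule continuous_on_tendsto_compose[OF cont n(2) t]) (use h n in auto)
  then have 1: "(\<lambda>N. G (real (n N) * h N) - G 0) \<longlonglongrightarrow> G t - G 0" by (intro tendsto_diff) auto
  have 2: "(\<lambda>N. (G (real (n N) * h N) - G 0) - (\<Sum>i<n N. S (real i * h N) (real (Suc i) * h N))) \<longlonglongrightarrow> 0"
  proof (rule LIMSEQ_I)
    fix r :: real assume "0 < r"
    define \<epsilon> where "\<epsilon> = r / (2 * (T + 1))"
    have \<epsilon>: "\<epsilon> > 0" using \<open>0 < r\<close> T by (simp add: \<epsilon>_def)
    from loc[OF this] obtain \<delta> where \<delta>: "\<delta> > 0"
      "\<And>a b. 0 \<le> a \<Longrightarrow> a \<le> b \<Longrightarrow> b \<le> T \<Longrightarrow> b - a < \<delta> \<Longrightarrow> norm (G b - G a - S a b) \<le> \<epsilon> * (b - a)" by metis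
    obtain N0 where N0: "\<And>N. N \<ge> N0 \<Longrightarrow> h N < \<delta>"
      using LIMSEQ_D[OF h(2) \<delta>(1)] by force
    show "\<exists>no. \<forall>N\<ge>no. norm ((G (real (n N) * h N) - G 0) - (\<Sum>i<n N. S (real i * h N) (real (Suc i) * h N)) - 0) < r"
    proof (intro exI[of _ N0] allI impI)
      fix N assume "N0 \<le> N"
      let ?x = "\<lambda>i. real i * h N"
      have tele: "G (?x (n N)) - G 0 = (\<Sum>i<n N. G (?x (Suc i)) - G (?x i))"
        by (subst sum_lessThan_telescope) simp
      have "norm ((G (?x (n N)) - G 0) - (\<Sum>i<n N. S (?x i) (?x (Suc i)))) =
          norm (\<Sum>i<n N. G (?x (Suc i)) - G (?x i) - S (?x i) (?x (Suc i)))"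
        unfolding tele by (simp only: sum_subtractf)
      also have "\<dots> \<le> (\<Sum>i<n N. \<epsilon> * h N)"
      proof (rule order_trans[OF norm_sum], rule sum_mono)
        fix i assume "i \<in> {..<n N}"
        then have "?x (Suc i) \<le> ?x (n N)" using h(1)[of N] by (intro mult_right_mono) auto
        then have "?x (Suc i) \<le> T" using n(1)[of N] by linarith
        moreover have "?x (Suc i) - ?x i = h N" by (simp add: algebra_simps)
        ultimately show "norm (G (?x (Suc i)) - G (?x i) - S (?x i) (?x (Suc i))) \<le> \<epsilon> * h N"
          using \<delta>(2)[of "?x i" "?x (Suc i)"] h(1)[of N] N0[OF \<open>N0 \<le> N\<close>]
          by (auto simp: algebra_simps)
      qed
      also have "\<dots> = \<epsilon> * ?x (n N)" by simp
      also have "\<dots> \<le> \<epsilon> * T" using n(1)[of N] \<epsilon> by (intro mult_left_mono) auto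
      also have "\<dots> < r"
      proof -
        have "\<epsilon> * T \<le> \<epsilon> * (T + 1)" using \<epsilon> by simp
        also have "\<dots> = r / 2" using T by (simp add: \<epsilon>_def field_simps)
        finally show ?thesis using \<open>0 < r\<close> by simp
      qed
      finally show "norm ((G (?x (n N)) - G 0) - (\<Sum>i<n N. S (?x i) (?x (Suc i))) - 0) < r" by simp
    qed
  qed
  show ?thesis using tendsto_diff[OF 1 2] by simp
qed

lemma integral_has_vector_derivative_Icc:
  fixes f :: "real \<Rightarrow> 'h::banach"
  assumes "continuous_on {0..T} f" "t \<in> {0..T}"
  shows "((\<lambda>u. integral {0..u} f) has_vector_derivative f t) (at t within {0..T})"
  using integral_has_vector_derivative[OF assms] .

lemma continuous_on_integral:
  fixes f :: "real \<Rightarrow> 'h::banach"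
  assumes "continuous_on {0..T} f"
  shows "continuous_on {0..T} (\<lambda>u. integral {0..u} f)"
  using integral_has_vector_derivative_Icc[OF assms]
  by (meson continuous_on_vector_derivative)

text \<open>On each cell both the Stieltjes term and the increment of the integral are compared with
  the cell length times \<open>\<phi>' x\<close> times \<open>g x\<close> at the same tag
  \<open>x\<close>, so every choice of tags gives the same limit.\<close>

lemma stieltjes_sum_tendsto:
  fixes g :: "real \<Rightarrow> 'h::banach"
  assumes g: "continuous_on {0..T} g" and \<phi>': "continuous_on {0..T} \<phi>'"
    and \<phi>: "\<And>t. t \<in> {0..T} \<Longrightarrow> (\<phi> has_real_derivative \<phi>' t) (at t within {0..T})"
    and x: "\<And>a b. a \<le> b \<Longrightarrow> a \<le> x a b \<and> x a b \<le> b"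
    and t: "t \<in> {0..T}" and h: "\<And>N. 0 \<le> h N" "h \<longlonglongrightarrow> 0"
    and n: "\<And>N. real (n N) * h N \<le> T" "(\<lambda>N. real (n N) * h N) \<longlonglongrightarrow> t"
  shows "(\<lambda>N. \<Sum>i<n N. (\<phi> (real (Suc i) * h N) - \<phi> (real i * h N)) *\<^sub>R g (x (real i * h N) (real (Suc i) * h N)))
    \<longlonglongrightarrow> integral {0..t} (\<lambda>s. \<phi>' s *\<^sub>R g s)"
proof -
  define G where "G u = integral {0..u} (\<lambda>s. \<phi>' s *\<^sub>R g s)" for u
  have fc: "continuous_on {0..T} (\<lambda>s. \<phi>' s *\<^sub>R g s)" using g \<phi>' by (intro continuous_intros)
  have G: "(G has_vector_derivative \<phi>' t *\<^sub>R g t) (at t within {0..T})" if "t \<in> {0..T}" for t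
    unfolding G_def by (rule integral_has_vector_derivative_Icc[OF fc that])
  have "bounded (g ` {0..T})" using g by (intro compact_imp_bounded compact_continuous_image) auto
  then obtain B where B: "B > 0" "\<And>t. t \<in> {0..T} \<Longrightarrow> norm (g t) \<le> B"
    unfolding bounded_pos by auto
  have "(\<lambda>N. \<Sum>i<n N. (\<lambda>a b. (\<phi> b - \<phi> a) *\<^sub>R g (x a b)) (real i * h N) (real (Suc i) * h N)) \<longlonglongrightarrow> G t - G 0"
  proof (rule grid_sum_tendsto[OF _ _ t h n])
    show "continuous_on {0..T} G" unfolding G_def by (rule continuous_on_integral[OF fc])
    fix \<epsilon> :: real assume \<epsilon>: "0 < \<epsilon>"
    obtain \<delta>1 where \<delta>1: "\<delta>1 > 0" "\<And>a x b. 0 \<le> a \<Longrightarrow> a \<le> x \<Longrightarrow> x \<le> b \<Longrightarrow> b \<le> T \<Longrightarrow> b - a < \<delta>1 \<Longrightarrow>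
        norm (G b - G a - (b - a) *\<^sub>R (\<phi>' x *\<^sub>R g x)) \<le> \<epsilon> / 2 * (b - a)"
      using uniform_derivative[OF G fc, of "\<epsilon> / 2"] \<epsilon> by auto
    obtain \<delta>2 where \<delta>2: "\<delta>2 > 0" "\<And>a x b. 0 \<le> a \<Longrightarrow> a \<le> x \<Longrightarrow> x \<le> b \<Longrightarrow> b \<le> T \<Longrightarrow> b - a < \<delta>2 \<Longrightarrow>
        norm (\<phi> b - \<phi> a - (b - a) *\<^sub>R \<phi>' x) \<le> \<epsilon> / (2 * B) * (b - a)"
      using uniform_derivative[OF \<phi>[unfolded has_real_derivative_iff_has_vector_derivative] \<phi>', of "\<epsilon> / (2 * B)"] \<epsilon> B by auto
    show "\<exists>\<delta>>0. \<forall>a b. 0 \<le> a \<longrightarrow> a \<le> b \<longrightarrow> b \<le> T \<longrightarrow> b - a < \<delta> \<longrightarrow>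
        norm (G b - G a - (\<phi> b - \<phi> a) *\<^sub>R g (x a b)) \<le> \<epsilon> * (b - a)"
    proof (intro exI[of _ "min \<delta>1 \<delta>2"] conjI allI impI)
      fix a b assume ab: "0 \<le> a" "a \<le> b" "b \<le> T" "b - a < min \<delta>1 \<delta>2"
      let ?x = "x a b"
      have x': "a \<le> ?x" "?x \<le> b" using x ab by auto
      have e: "G b - G a - (\<phi> b - \<phi> a) *\<^sub>R g ?x =
          (G b - G a - (b - a) *\<^sub>R (\<phi>' ?x *\<^sub>R g ?x)) - (\<phi> b - \<phi> a - (b - a) *\<^sub>R \<phi>' ?x) *\<^sub>R g ?x"
        by (simp add: scaleR_diff_left)
      have "norm ((\<phi> b - \<phi> a - (b - a) *\<^sub>R \<phi>' ?x) *\<^sub>R g ?x) \<le> (\<epsilon> / (2 * B) * (b - a)) * B"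
        unfolding norm_scaleR using \<delta>2(2)[of a ?x b] B(2)[of ?x] ab x' B(1) \<epsilon>
        by (intro mult_mono) auto
      also have "\<dots> = \<epsilon> / 2 * (b - a)" using B(1) by simp
      finally have "norm (G b - G a - (\<phi> b - \<phi> a) *\<^sub>R g ?x) \<le> \<epsilon> / 2 * (b - a) + \<epsilon> / 2 * (b - a)"
        unfolding e using ab x' by (intro order_trans[OF norm_triangle_ineq4] add_mono \<delta>1(2)) auto
      also have "\<dots> = \<epsilon> * (b - a)" by (simp add: algebra_simps)
      finally show "norm (G b - G a - (\<phi> b - \<phi> a) *\<^sub>R g ?x) \<le> \<epsilon> * (b - a)" .
    qed (use \<delta>1 \<delta>2 in auto)
  qed
  then show ?thesis by (simp add: G_def)
qed

section \<open>Wiener integrals of smooth functions\<close>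

lemma riemann_sum_tendsto:
  fixes g :: "real \<Rightarrow> 'h::banach"
  assumes g: "continuous_on {0..T} g"
    and t: "t \<in> {0..T}" and h: "\<And>N. 0 \<le> h N" "h \<longlonglongrightarrow> 0"
    and n: "\<And>N. real (n N) * h N \<le> T" "(\<lambda>N. real (n N) * h N) \<longlonglongrightarrow> t"
  shows "(\<lambda>N. \<Sum>i<n N. h N *\<^sub>R g (real i * h N)) \<longlonglongrightarrow> integral {0..t} g"
  using stieltjes_sum_tendsto[OF g _ _ _ t h n, of "\<lambda>_. 1" "\<lambda>s. s" "\<lambda>a b. a"]
  by (simp add: algebra_simps)

text \<open>The integral of \<phi> against \<open>dw\<close> after partial integration. The
  right-hand side makes sense for every continuous path \<open>w\<close>, so the integral is defined
  at every sample point and is continuous in time.\<close>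

definition pathwise_integral :: "(real \<Rightarrow> real) \<Rightarrow> (real \<Rightarrow> real) \<Rightarrow> (real \<Rightarrow> 'h::banach) \<Rightarrow> real \<Rightarrow> 'h" where
  "pathwise_integral \<phi> \<phi>' w t = \<phi> t *\<^sub>R w t - \<phi> 0 *\<^sub>R w 0 - integral {0..t} (\<lambda>s. \<phi>' s *\<^sub>R w s)"

lemma pathwise_integral_tendsto:
  fixes w :: "real \<Rightarrow> 'h::banach"
  assumes w: "continuous_on {0..T} w" and \<phi>': "continuous_on {0..T} \<phi>'"
    and \<phi>: "\<And>t. t \<in> {0..T} \<Longrightarrow> (\<phi> has_real_derivative \<phi>' t) (at t within {0..T})"
    and t: "t \<in> {0..T}" and h: "\<And>N. 0 \<le> h N" "h \<longlonglongrightarrow> 0"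
    and n: "\<And>N. real (n N) * h N \<le> T" "(\<lambda>N. real (n N) * h N) \<longlonglongrightarrow> t"
  shows "(\<lambda>N. \<Sum>i<n N. \<phi> (real i * h N) *\<^sub>R (w (real (Suc i) * h N) - w (real i * h N))) \<longlonglongrightarrow> pathwise_integral \<phi> \<phi>' w t"
proof -
  have \<phi>c: "continuous_on {0..T} \<phi>" by (rule DERIV_continuous_on[OF \<phi>])
  \<comment> \<open>Abel summation puts \<open>w\<close> at the right end of each cell; hence the
    tag \<open>b\<close> below.\<close>
  have parts: "(\<Sum>i<k. \<phi> (real i * h N) *\<^sub>R (w (real (Suc i) * h N) - w (real i * h N))) =
     \<phi> (real k * h N) *\<^sub>R w (real k * h N) - \<phi> 0 *\<^sub>R w 0 -
     (\<Sum>i<k. (\<phi> (real (Suc i) * h N) - \<phi> (real i * h N)) *\<^sub>R w (real (Suc i) * h N))" for k N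
    by (induction k) (simp_all add: scaleR_diff_left scaleR_diff_right algebra_simps)
  have lim: "(\<lambda>N. f (real (n N) * h N)) \<longlonglongrightarrow> f t" if "continuous_on {0..T} f" for f :: "real \<Rightarrow> 'b::real_normed_vector"
    by (rule continuous_on_tendsto_compose[OF that n(2) t]) (use h n in auto)
  show ?thesis
    unfolding parts pathwise_integral_def
    by (intro tendsto_diff tendsto_const lim tendsto_scaleR stieltjes_sum_tendsto[OF w \<phi>' \<phi> _ t h n, where x="\<lambda>a b. b"] \<phi>c w) auto
qed

lemma pathwise_integral_continuous:
  fixes w :: "real \<Rightarrow> 'h::banach"
  assumes w: "continuous_on {0..T} w" and \<phi>': "continuous_on {0..T} \<phi>'"
    and \<phi>: "\<And>t. t \<in> {0..T} \<Longrightarrow> (\<phi> has_real_derivative \<phi>' t) (at t within {0..T})"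
  shows "continuous_on {0..T} (pathwise_integral \<phi> \<phi>' w)"
proof -
  have "continuous_on {0..T} \<phi>" by (rule DERIV_continuous_on[OF \<phi>])
  then show ?thesis unfolding pathwise_integral_def
    using w \<phi>' by (intro continuous_intros continuous_on_integral)
qed

definition gstep :: "nat \<Rightarrow> real" where
  "gstep N = 1 / real (Suc N)"

text \<open>The grid of mesh \<open>gstep N\<close> does not depend on \<open>t\<close>;
  \<open>gidx t N\<close> counts the whole steps up to \<open>t\<close>. Sums up to different times
  therefore run over the same increments.\<close>

definition gidx :: "real \<Rightarrow> nat \<Rightarrow> nat" where
  "gidx t N = nat \<lfloor>t / gstep N\<rfloor>"

lemma gstep_pos: "0 < gstep N" and gstep_nonneg: "0 \<le> gstep N" and gstep_tendsto: "gstep \<longlonglongrightarrow> 0"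
proof -
  show "gstep \<longlonglongrightarrow> 0" unfolding gstep_def[abs_def]
    using LIMSEQ_Suc[OF lim_const_over_n[of "1 :: real"]] by simp
qed (simp_all add: gstep_def)

lemma gidx_le: "0 \<le> t \<Longrightarrow> real (gidx t N) * gstep N \<le> t"
  unfolding gidx_def by (rule floor_grid[OF _ gstep_pos])

lemma gidx_grid:
  assumes "0 \<le> t" "i \<le> gidx t N"
  shows "real i * gstep N \<in> {0..t}"
proof -
  have "real i * gstep N \<le> real (gidx t N) * gstep N" using assms gstep_nonneg by (intro mult_right_mono) auto
  then show ?thesis using gidx_le[OF assms(1), of N] gstep_nonneg[of N] by simp
qed

lemma gidx_tendsto:
  assumes "0 \<le> t"
  shows "(\<lambda>N. real (gidx t N) * gstep N) \<longlonglongrightarrow> t"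
proof (rule LIMSEQ_I)
  have fg: "real (gidx t N) * gstep N \<le> t" "t < (real (gidx t N) + 1) * gstep N" for N
    unfolding gidx_def using floor_grid[OF assms gstep_pos] by auto
  fix r :: real assume "0 < r"
  then obtain N0 where "\<And>N. N \<ge> N0 \<Longrightarrow> norm (gstep N - 0) < r" using LIMSEQ_D[OF gstep_tendsto] by blast
  then have "norm (real (gidx t N) * gstep N - t) < r" if "N \<ge> N0" for N
    using fg[of N] that gstep_pos[of N] by (force simp: algebra_simps)
  then show "\<exists>no. \<forall>N\<ge>no. norm (real (gidx t N) * gstep N - t) < r" by blast
qed

lemma gidx_mono: "s \<le> t \<Longrightarrow> gidx s N \<le> gidx t N"
  unfolding gidx_def using gstep_pos[of N] by (intro nat_mono floor_mono divide_right_mono) auto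

lemma gidx_min: "gidx (min s t) N = min (gidx s N) (gidx t N)"
  using gidx_mono[of s t N] gidx_mono[of t s N] by (cases "s \<le> t") (auto simp: min_def)

section \<open>Gronwall's lemma, integral equations and Euler's scheme\<close>

lemma gronwall:
  fixes u :: "real \<Rightarrow> real"
  assumes u: "continuous_on {0..T} u" and K: "0 \<le> K"
    and le: "\<And>t. t \<in> {0..T} \<Longrightarrow> u t \<le> c + K * integral {0..t} u"
    and t: "t \<in> {0..T}"
  shows "u t \<le> c * exp (K * t)"
proof -
  \<comment> \<open>By the integral inequality the derivative of this function is
    nonpositive.\<close>
  define v where "v s = (c + K * integral {0..s} u) * exp (- K * s)" for s
  have "v t \<le> v 0"
  proof (rule DERIV_nonpos_imp_decreasing_open[of 0 t v])
    show "0 \<le> t" using t by simp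
    show "continuous_on {0..t} v" unfolding v_def
      using t by (intro continuous_intros continuous_on_integral continuous_on_subset[OF u]) auto
    fix s assume s: "0 < s" "s < t"
    have "((\<lambda>s. integral {0..s} u) has_vector_derivative u s) (at s within {0..T})"
      using s t by (intro integral_has_vector_derivative_Icc u) auto
    then have "((\<lambda>s. integral {0..s} u) has_real_derivative u s) (at s)"
      using s t by (simp add: has_real_derivative_iff_has_vector_derivative at_within_Icc_at)
    then have "(v has_real_derivative (K * u s * exp (- K * s) + (c + K * integral {0..s} u) * (- K * exp (- K * s)))) (at s)"
      unfolding v_def by (auto intro!: derivative_eq_intros)
    moreover have "K * u s * exp (- K * s) + (c + K * integral {0..s} u) * (- K * exp (- K * s)) =
        (K * exp (- K * s)) * (u s - (c + K * integral {0..s} u))" by (simp add: algebra_simps)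
    moreover have "\<dots> \<le> 0" using le[of s] s t K by (intro mult_nonneg_nonpos) auto
    ultimately show "\<exists>y. (v has_real_derivative y) (at s) \<and> y \<le> 0" by auto
  qed
  then have "(c + K * integral {0..t} u) * exp (- K * t) \<le> c" by (simp add: v_def)
  then have "(c + K * integral {0..t} u) \<le> c * exp (K * t)"
    by (simp add: exp_minus field_simps)
  then show ?thesis using le[OF t] by linarith
qed

text \<open>Picard iteration with an additive continuous perturbation \<open>B\<close>. The unknown
  is rescaled to \<open>exp (- K * t)\<close> times \<open>y t\<close>; in the resulting weighted
  supremum norm the iteration contracts by \<open>L / K\<close> on the whole interval at once, so no
  short intervals have to be patched together.\<close>

lemma ode_exists:
  fixes b :: "real \<Rightarrow> 'h::banach \<Rightarrow> 'h"
  assumes t0: "0 \<le> t0" and b: "continuous_on ({0..t0} \<times> UNIV) (\<lambda>(t, x). b t x)"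
    and L: "\<And>t. t \<in> {0..t0} \<Longrightarrow> L-lipschitz_on UNIV (b t)"
    and B: "continuous_on {0..t0} B"
  shows "\<exists>y. continuous_on {0..t0} y \<and> (\<forall>t\<in>{0..t0}. y t = y0 + integral {0..t} (\<lambda>s. b s (y s)) + B t)"
proof -
  have L0: "0 \<le> L" using L[of 0] t0 lipschitz_on_nonneg by auto
  \<comment> \<open>Any \<open>K \<ge> 2 * L\<close> gives the contraction factor 1/2; the summand 1
    keeps \<open>K\<close> positive when \<open>L = 0\<close>.\<close>
  define K where "K = 2 * L + 1"
  have K: "0 < K" "L / K \<le> 1/2" using L0 by (auto simp: K_def field_simps)
  define R where "R z s = b s (exp (K * s) *\<^sub>R apply_bcontfun z s)" for z :: "real \<Rightarrow>\<^sub>C 'h" and s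
  have Rc: "continuous_on {0..t0} (R z)" for z
  proof -
    have "continuous_on {0..t0} (\<lambda>s. (s, exp (K * s) *\<^sub>R apply_bcontfun z s))"
      by (intro continuous_intros) (simp add: continuous_on_apply_bcontfun)
    then show ?thesis unfolding R_def
      using continuous_on_compose2[OF b, of "{0..t0}" "\<lambda>s. (s, exp (K * s) *\<^sub>R apply_bcontfun z s)"] by auto
  qed
  define H where "H z t = exp (- K * t) *\<^sub>R (y0 + integral {0..t} (R z) + B t)" for z t
  have Hc: "continuous_on {0..t0} (H z)" for z
    unfolding H_def using Rc B by (intro continuous_intros continuous_on_integral) auto
  \<comment> \<open>The Banach space at hand consists of bounded continuous functions on the whole
    line, so paths are extended constantly outside \<open>[0, t0]\<close>.\<close>
  define cl where "cl t = max 0 (min t t0)" for t :: real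
  have cl: "cl t \<in> {0..t0}" "t \<in> {0..t0} \<Longrightarrow> cl t = t" for t using t0 by (auto simp: cl_def)
  have bc: "(\<lambda>t. H z (cl t)) \<in> bcontfun" for z
  proof -
    have "bounded (H z ` {0..t0})" using Hc by (intro compact_imp_bounded compact_continuous_image) auto
    then obtain C where C: "\<forall>t\<in>{0..t0}. norm (H z t) \<le> C"
      unfolding bounded_iff by (auto simp del: atLeastAtMost_iff)
    have "continuous_on UNIV (\<lambda>t. H z (cl t))"
      by (rule continuous_on_compose2[OF Hc, where f=cl]) (use cl in \<open>auto simp: cl_def[abs_def] intro!: continuous_intros\<close>)
    then show ?thesis using C cl(1) by (intro bcontfun_normI[where b=C]) blast+
  qed
  define F where "F z = Bcontfun (\<lambda>t. H z (cl t))" for z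
  have F: "apply_bcontfun (F z) t = H z (cl t)" for z t
    unfolding F_def by (simp add: Bcontfun_inverse[OF bc])
  have "dist (F z) (F z') \<le> 1/2 * dist z z'" for z z'
  proof (rule dist_bound)
    fix t
    let ?t = "cl t"
    let ?d = "dist z z'"
    have Rd: "norm (R z s - R z' s) \<le> L * ?d * exp (K * s)" if s: "s \<in> {0..?t}" for s
    proof -
      have "s \<in> {0..t0}" using s cl(1)[of t] by auto
      then have "norm (R z s - R z' s) \<le> L * dist (exp (K * s) *\<^sub>R apply_bcontfun z s) (exp (K * s) *\<^sub>R apply_bcontfun z' s)"
        unfolding R_def using lipschitz_onD[OF L] by (simp add: dist_norm)
      also have "\<dots> = L * (exp (K * s) * dist (apply_bcontfun z s) (apply_bcontfun z' s))"
        by (simp add: dist_norm flip: scaleR_diff_right)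
      also have "\<dots> \<le> L * (exp (K * s) * ?d)"
        using L0 by (intro mult_left_mono dist_bounded) auto
      finally show ?thesis by (simp add: mult_ac)
    qed
    have ii: "((\<lambda>s. L * ?d * exp (K * s)) has_integral (L * ?d * exp (K * ?t) / K - L * ?d * exp (K * 0) / K)) {0..?t}"
      using K cl(1)[of t]
      by (intro fundamental_theorem_of_calculus)
         (auto intro!: derivative_eq_intros simp flip: has_real_derivative_iff_has_vector_derivative)
    have Ri: "R z integrable_on {0..?t}" for z
      using Rc[of z] cl(1)[of t] by (intro integrable_continuous_interval continuous_on_subset[OF Rc]) auto
    have "norm (integral {0..?t} (R z) - integral {0..?t} (R z')) = norm (integral {0..?t} (\<lambda>s. R z s - R z' s))"
      using Ri by (simp add: Henstock_Kurzweil_Integration.integral_diff)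
    also have "\<dots> \<le> integral {0..?t} (\<lambda>s. L * ?d * exp (K * s))"
      using Ri ii Rd by (intro integral_norm_bound_integral) (auto intro!: integrable_diff)
    also have "\<dots> = L * ?d * exp (K * ?t) / K - L * ?d * exp (K * 0) / K" using ii by (rule integral_unique)
    also have "\<dots> \<le> L * ?d * exp (K * ?t) / K" using L0 K by simp
    finally have le: "norm (integral {0..?t} (R z) - integral {0..?t} (R z')) \<le> L * ?d * exp (K * ?t) / K" .
    have "dist (H z ?t) (H z' ?t) = exp (- K * ?t) * norm (integral {0..?t} (R z) - integral {0..?t} (R z'))"
      by (simp add: H_def dist_norm flip: scaleR_diff_right)
    also have "\<dots> \<le> exp (- K * ?t) * (L * ?d * exp (K * ?t) / K)" using le by (intro mult_left_mono) auto
    also have "\<dots> = L / K * ?d" by (simp add: exp_minus)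
    also have "\<dots> \<le> 1/2 * ?d" using K by (intro mult_right_mono) auto
    finally show "dist (apply_bcontfun (F z) t) (apply_bcontfun (F z') t) \<le> 1/2 * dist z z'" by (simp add: F)
  qed
  then have "\<exists>!z. F z = z" by (intro banach_fix_type[of "1/2"]) auto
  then obtain z where z: "F z = z" by blast
  define y where "y t = exp (K * t) *\<^sub>R apply_bcontfun z t" for t
  have "continuous_on {0..t0} y" unfolding y_def
    by (intro continuous_intros) (simp add: continuous_on_apply_bcontfun)
  moreover have "y t = y0 + integral {0..t} (\<lambda>s. b s (y s)) + B t" if t: "t \<in> {0..t0}" for t
  proof -
    have "apply_bcontfun z t = H z t" using F[of z t] z cl(2)[OF t] by simp
    moreover have "R z = (\<lambda>s. b s (y s))" by (rule ext) (simp add: R_def y_def)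
    ultimately show ?thesis by (simp add: y_def H_def flip: exp_add)
  qed
  ultimately show ?thesis by blast
qed

text \<open>The perturbation enters through its values at the grid points only, so each iterate is a
  fixed function of the initial value and of finitely many values of the noise.\<close>

fun euler :: "(real \<Rightarrow> 'h \<Rightarrow> 'h) \<Rightarrow> (nat \<Rightarrow> 'h) \<Rightarrow> 'h \<Rightarrow> real \<Rightarrow> nat \<Rightarrow> 'h::real_normed_vector" where
  "euler b B y0 h 0 = y0"
| "euler b B y0 h (Suc i) = euler b B y0 h i + h *\<^sub>R b (real i * h) (euler b B y0 h i) + (B (Suc i) - B i)"

text \<open>The noise increments are added exactly and cancel from the error, so only the drift is
  discretised: each step makes an error of at most \<epsilon> times \<open>h\<close>, and earlier
  errors are propagated by the factor \<open>1 + L * h\<close> per step.\<close>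

lemma euler_tendsto:
  fixes b :: "real \<Rightarrow> 'h::banach \<Rightarrow> 'h"
  assumes b: "continuous_on ({0..t0} \<times> UNIV) (\<lambda>(t, x). b t x)"
    and L: "\<And>t. t \<in> {0..t0} \<Longrightarrow> L-lipschitz_on UNIV (b t)" and B0: "B 0 = 0"
    and y: "continuous_on {0..t0} y" "\<And>t. t \<in> {0..t0} \<Longrightarrow> y t = y0 + integral {0..t} (\<lambda>s. b s (y s)) + B t"
    and t: "t \<in> {0..t0}" and h: "\<And>N. 0 \<le> h N" "h \<longlonglongrightarrow> 0"
    and n: "\<And>N. real (n N) * h N \<le> t0" "(\<lambda>N. real (n N) * h N) \<longlonglongrightarrow> t"
  shows "(\<lambda>N. euler b (\<lambda>i. B (real i * h N)) y0 (h N) (n N)) \<longlonglongrightarrow> y t"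
proof -
  have t0: "0 \<le> t0" using t by auto
  have L0: "0 \<le> L" using L[of 0] t0 lipschitz_on_nonneg by auto
  have fc: "continuous_on {0..t0} (\<lambda>s. b s (y s))"
    using continuous_on_compose2[OF b, of "{0..t0}" "\<lambda>s. (s, y s)"] y(1) by (simp add: continuous_on_Pair image_subset_iff)
  define G where "G u = integral {0..u} (\<lambda>s. b s (y s))" for u
  have G: "(G has_vector_derivative b t (y t)) (at t within {0..t0})" if "t \<in> {0..t0}" for t
    unfolding G_def by (rule integral_has_vector_derivative_Icc[OF fc that])
  have 1: "(\<lambda>N. y (real (n N) * h N)) \<longlonglongrightarrow> y t"
    by (rule continuous_on_tendsto_compose[OF y(1) n(2) t]) (use h n in auto)
  have 2: "(\<lambda>N. y (real (n N) * h N) - euler b (\<lambda>i. B (real i * h N)) y0 (h N) (n N)) \<longlonglongrightarrow> 0"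
  proof (rule LIMSEQ_I)
    fix r :: real assume "0 < r"
    \<comment> \<open>Makes the final error \<open>\<epsilon> * t0 * exp (L * t0)\<close> at most
      \<open>r / 2\<close>; the summand 1 avoids division by zero.\<close>
    define \<epsilon> where "\<epsilon> = r / (2 * (t0 * exp (L * t0) + 1))"
    have pos: "0 < t0 * exp (L * t0) + 1" using t0 by (simp add: add_nonneg_pos)
    have \<epsilon>: "\<epsilon> > 0" using \<open>0 < r\<close> pos by (simp add: \<epsilon>_def)
    obtain \<delta> where \<delta>: "\<delta> > 0" "\<And>a x b'. 0 \<le> a \<Longrightarrow> a \<le> x \<Longrightarrow> x \<le> b' \<Longrightarrow> b' \<le> t0 \<Longrightarrow> b' - a < \<delta> \<Longrightarrow>
        norm (G b' - G a - (b' - a) *\<^sub>R b x (y x)) \<le> \<epsilon> * (b' - a)"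
      using uniform_derivative[OF G fc \<epsilon>] by auto
    obtain N0 where N0: "\<And>N. N \<ge> N0 \<Longrightarrow> h N < \<delta>"
      using LIMSEQ_D[OF h(2) \<delta>(1)] by force
    have "norm (y (real (n N) * h N) - euler b (\<lambda>i. B (real i * h N)) y0 (h N) (n N) - 0) < r" if "N \<ge> N0" for N
    proof -
      let ?h = "h N" let ?x = "\<lambda>i. real i * h N" let ?e = "euler b (\<lambda>i. B (real i * h N)) y0 (h N)"
      have err: "norm (y (?x i) - ?e i) \<le> \<epsilon> * ?x i * (1 + L * ?h) ^ i" if "i \<le> n N" for i
        using that
      proof (induction i)
        case 0
        then show ?case using y(2)[of 0] t0 B0 by simp
      next
        case (Suc i)
        have mono: "?x j \<le> t0" if "j \<le> n N" for j
        proof -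
          have "?x j \<le> ?x (n N)" using that h(1)[of N] by (intro mult_right_mono) auto
          then show ?thesis using n(1)[of N] by linarith
        qed
        have x: "?x i \<in> {0..t0}" "?x (Suc i) \<in> {0..t0}" using mono[of i] mono[of "Suc i"] Suc.prems h(1)[of N] by auto
        have d: "?x (Suc i) - ?x i = ?h" by (simp add: algebra_simps)
        have eq: "y (?x (Suc i)) - ?e (Suc i) = (G (?x (Suc i)) - G (?x i) - ?h *\<^sub>R b (?x i) (y (?x i)))
            + (y (?x i) - ?e i) + ?h *\<^sub>R (b (?x i) (y (?x i)) - b (?x i) (?e i))"
        proof -
          have "y (?x (Suc i)) = y0 + G (?x (Suc i)) + B (?x (Suc i))" "B (?x i) = y (?x i) - y0 - G (?x i)"
            unfolding G_def using y(2)[OF x(2)] y(2)[OF x(1)] by (auto simp: algebra_simps)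
          then show ?thesis unfolding euler.simps by (simp only:) (simp add: scaleR_diff_right)
        qed
        have "norm (y (?x (Suc i)) - ?e (Suc i)) \<le> norm (G (?x (Suc i)) - G (?x i) - ?h *\<^sub>R b (?x i) (y (?x i)))
            + norm (y (?x i) - ?e i) + norm (?h *\<^sub>R (b (?x i) (y (?x i)) - b (?x i) (?e i)))"
          unfolding eq by (intro order_trans[OF norm_triangle_ineq] add_mono order_refl)
        also have "\<dots> \<le> \<epsilon> * ?h + norm (y (?x i) - ?e i) + ?h * (L * norm (y (?x i) - ?e i))"
        proof (intro add_mono order_refl)
          show "norm (G (?x (Suc i)) - G (?x i) - ?h *\<^sub>R b (?x i) (y (?x i))) \<le> \<epsilon> * ?h"
            using \<delta>(2)[of "?x i" "?x i" "?x (Suc i)"] x d N0[OF \<open>N \<ge> N0\<close>] h(1)[of N] by auto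
          show "norm (?h *\<^sub>R (b (?x i) (y (?x i)) - b (?x i) (?e i))) \<le> ?h * (L * norm (y (?x i) - ?e i))"
            using lipschitz_onD[OF L[OF x(1)], of "y (?x i)" "?e i"] h(1)[of N] by (auto simp: dist_norm intro!: mult_left_mono)
        qed
        also have "\<dots> = \<epsilon> * ?h + (1 + L * ?h) * norm (y (?x i) - ?e i)" by (simp add: algebra_simps)
        also have "\<dots> \<le> \<epsilon> * ?h * (1 + L * ?h) ^ Suc i + (1 + L * ?h) * (\<epsilon> * ?x i * (1 + L * ?h) ^ i)"
        proof (intro add_mono mult_left_mono)
          have "1 \<le> (1 + L * ?h) ^ Suc i" using L0 h(1)[of N] by (intro one_le_power) simp
          then show "\<epsilon> * ?h \<le> \<epsilon> * ?h * (1 + L * ?h) ^ Suc i"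
            using \<epsilon> h(1)[of N] mult_left_mono[of 1 "(1 + L * ?h) ^ Suc i" "\<epsilon> * ?h"] by simp
          show "norm (y (?x i) - ?e i) \<le> \<epsilon> * ?x i * (1 + L * ?h) ^ i" using Suc by simp
        qed (use L0 h(1)[of N] in auto)
        also have "\<dots> = \<epsilon> * ?x (Suc i) * (1 + L * ?h) ^ Suc i" by (simp add: algebra_simps)
        finally show ?case .
      qed
      have "(1 + L * ?h) ^ n N \<le> exp (L * ?h) ^ n N"
        using L0 h(1)[of N] by (intro power_mono exp_ge_add_one_self) auto
      also have "\<dots> = exp (L * ?x (n N))" by (simp add: mult_ac flip: exp_of_nat_mult)
      also have "\<dots> \<le> exp (L * t0)" using L0 n(1)[of N] by (simp add: mult_left_mono)
      finally have p: "(1 + L * ?h) ^ n N \<le> exp (L * t0)" .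
      have "norm (y (?x (n N)) - ?e (n N)) \<le> \<epsilon> * ?x (n N) * (1 + L * ?h) ^ n N" by (rule err) simp
      also have "\<dots> \<le> \<epsilon> * t0 * exp (L * t0)"
        using p \<epsilon> n(1)[of N] h(1)[of N] t0 L0 by (intro mult_mono) auto
      also have "\<dots> \<le> \<epsilon> * (t0 * exp (L * t0) + 1)" using \<epsilon> by (simp add: algebra_simps)
      also have "\<dots> = r / 2"
      proof -
        have "r / (2 * c) * c = r / 2" if "0 < c" for c :: real using that by simp
        then show ?thesis unfolding \<epsilon>_def using pos by blast
      qed
      finally show ?thesis using \<open>0 < r\<close> by simp
    qed
    then show "\<exists>no. \<forall>N\<ge>no. norm (y (real (n N) * h N) - euler b (\<lambda>i. B (real i * h N)) y0 (h N) (n N) - 0) < r" by blast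
  qed
  show ?thesis using tendsto_diff[OF 1 2] by simp
qed

section \<open>Gaussian characteristic functions and the law of Wiener integrals\<close>

lemma char_real_gaussian:
  assumes "0 \<le> v"
  shows "(CLINT x|real_gaussian v. iexp (t * x)) = complex_of_real (exp (- v * t\<^sup>2 / 2))"
proof (cases "v = 0")
  case True
  then show ?thesis by (simp add: real_gaussian_def integral_return)
next
  case False
  then have v: "0 < v" using assms by simp
  interpret S: real_distribution std_normal_distribution by (rule real_dist_normal_dist)
  have sets[measurable_cong]: "sets std_normal_distribution = sets borel" by simp
  have "distributed std_normal_distribution lborel (\<lambda>x. x) (\<lambda>x. ennreal (std_normal_density x))"
    by (auto simp: distributed_def distr_id2)
  then have "distributed std_normal_distribution lborel (\<lambda>x. 0 + sqrt v * x) (\<lambda>x. ennreal (normal_density (0 + sqrt v * 0) (\<bar>sqrt v\<bar> * 1) x))"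
    using v by (intro S.normal_density_affine) auto
  then have d: "distr std_normal_distribution lborel (\<lambda>x. sqrt v * x) = real_gaussian v"
    using v by (simp add: distributed_def real_gaussian_def)
  have "(CLINT x|real_gaussian v. iexp (t * x)) = (CLINT x|std_normal_distribution. iexp (t * (sqrt v * x)))"
    unfolding d[symmetric] by (subst integral_distr) auto
  also have "\<dots> = char std_normal_distribution (t * sqrt v)" by (simp add: char_def mult.assoc)
  also have "\<dots> = complex_of_real (exp (- v * t\<^sup>2 / 2))"
    using v by (simp add: char_std_normal_distribution power_mult_distrib mult.commute)
  finally show ?thesis .
qed

lemma is_gaussian_char:
  fixes X :: "'a \<Rightarrow> 'h::{real_inner,second_countable_topology}"
  assumes g: "is_gaussian C (distr M borel X)" and [measurable]: "X \<in> borel_measurable M" and C: "0 \<le> h \<bullet> C h"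
  shows "(CLINT w|M. iexp (X w \<bullet> h)) = complex_of_real (exp (- (h \<bullet> C h) / 2))"
proof -
  have "distr (distr M borel X) borel (\<lambda>x. x \<bullet> h) = real_gaussian (h \<bullet> C h)"
    using g by (simp add: is_gaussian_def)
  then have d: "distr M borel (\<lambda>w. X w \<bullet> h) = real_gaussian (h \<bullet> C h)"
    by (subst (asm) distr_distr) (auto simp: comp_def)
  have "(CLINT w|M. iexp (X w \<bullet> h)) = (CLINT x|real_gaussian (h \<bullet> C h). iexp x)"
    unfolding d[symmetric] by (subst integral_distr) auto
  then show ?thesis using char_real_gaussian[OF C, of 1] by simp
qed

lemma pathwise_integral_measurable:
  fixes w :: "real \<Rightarrow> 'w \<Rightarrow> 'h::{banach,second_countable_topology}"
  assumes w: "\<And>\<omega>. \<omega> \<in> space M \<Longrightarrow> continuous_on {0..T} (\<lambda>t. w t \<omega>)"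
    and wm: "\<And>t. t \<in> {0..T} \<Longrightarrow> w t \<in> borel_measurable M"
    and \<phi>': "continuous_on {0..T} \<phi>'"
    and \<phi>: "\<And>t. t \<in> {0..T} \<Longrightarrow> (\<phi> has_real_derivative \<phi>' t) (at t within {0..T})"
    and t: "t \<in> {0..T}"
  shows "(\<lambda>\<omega>. pathwise_integral \<phi> \<phi>' (\<lambda>t. w t \<omega>) t) \<in> borel_measurable M"
proof (rule borel_measurable_LIMSEQ_metric)
  have t0: "0 \<le> t" "t \<le> T" using t by auto
  show "(\<lambda>\<omega>. \<Sum>i<gidx t N. \<phi> (real i * gstep N) *\<^sub>R (w (real (Suc i) * gstep N) \<omega> - w (real i * gstep N) \<omega>)) \<in> borel_measurable M" for N
  proof (intro borel_measurable_sum borel_measurable_scaleR borel_measurable_diff wm borel_measurable_const)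
    fix i assume i: "i \<in> {..<gidx t N}"
    show "real (Suc i) * gstep N \<in> {0..T}" "real i * gstep N \<in> {0..T}"
      using gidx_grid[OF t0(1), of "Suc i" N] gidx_grid[OF t0(1), of i N] i t0 by auto
  qed
  show "(\<lambda>N. \<Sum>i<gidx t N. \<phi> (real i * gstep N) *\<^sub>R (w (real (Suc i) * gstep N) \<omega> - w (real i * gstep N) \<omega>))
     \<longlonglongrightarrow> pathwise_integral \<phi> \<phi>' (\<lambda>t. w t \<omega>) t" if "\<omega> \<in> space M" for \<omega>
    by (rule pathwise_integral_tendsto[OF w[OF that] \<phi>' \<phi> t gstep_nonneg gstep_tendsto])
       (use gidx_le[OF t0(1)] gidx_tendsto[OF t0(1)] t0 order_trans in auto)
qed

text \<open>The defining sums converge to \<open>J\<close> in mean square and, path by path, to the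
  integral obtained by partial integration; Fatou's lemma identifies the two limits almost
  surely.\<close>

lemma (in prob_space) stochastic_integral_eq_pathwise:
  fixes w :: "real \<Rightarrow> 'a \<Rightarrow> 'h::{banach,second_countable_topology}"
  assumes w: "\<And>\<omega>. \<omega> \<in> space M \<Longrightarrow> continuous_on {0..T} (\<lambda>t. w t \<omega>)"
    and wm: "\<And>t. t \<in> {0..T} \<Longrightarrow> w t \<in> borel_measurable M"
    and \<phi>': "continuous_on {0..T} \<phi>'"
    and \<phi>: "\<And>t. t \<in> {0..T} \<Longrightarrow> (\<phi> has_real_derivative \<phi>' t) (at t within {0..T})"
    and t: "t \<in> {0..T}" and J: "is_stochastic_integral M \<phi> w t J"
  shows "AE \<omega> in M. J \<omega> = pathwise_integral \<phi> \<phi>' (\<lambda>t. w t \<omega>) t"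
proof -
  define S where "S N \<omega> = (\<Sum>i<N. \<phi> (real i * t / real N) *\<^sub>R (w (real (Suc i) * t / real N) \<omega> - w (real i * t / real N) \<omega>))" for N \<omega>
  let ?I = "\<lambda>\<omega>. pathwise_integral \<phi> \<phi>' (\<lambda>t. w t \<omega>) t"
  have [measurable]: "J \<in> borel_measurable M" and lim: "(\<lambda>N. \<integral>\<^sup>+\<omega>. ennreal ((norm (J \<omega> - S N \<omega>))\<^sup>2) \<partial>M) \<longlonglongrightarrow> 0"
    using J unfolding is_stochastic_integral_def S_def by auto
  have [measurable]: "?I \<in> borel_measurable M" by (rule pathwise_integral_measurable[OF w wm \<phi>' \<phi> t])
  have grid: "real i * t / real N \<in> {0..T}" if "i \<le> N" for i N
  proof -
    have "real i * t / real N \<le> t" using that t by (cases "N = 0") (auto simp: field_simps intro!: mult_left_mono)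
    then show ?thesis using t by auto
  qed
  have [measurable]: "S N \<in> borel_measurable M" for N
    unfolding S_def[abs_def]
    by (intro borel_measurable_sum borel_measurable_scaleR borel_measurable_diff wm borel_measurable_const grid) auto
  have SI: "(\<lambda>N. S N \<omega>) \<longlonglongrightarrow> ?I \<omega>" if "\<omega> \<in> space M" for \<omega>
  proof -
    have nh: "real N * (t / real N) \<le> T" for N using t by (cases "N = 0") auto
    have "(\<lambda>N. real N * (t / real N)) \<longlonglongrightarrow> t"
      by (rule tendsto_eventually) (auto simp: eventually_sequentially intro!: exI[of _ 1])
    then have "(\<lambda>N. \<Sum>i<N. \<phi> (real i * (t / real N)) *\<^sub>R (w (real (Suc i) * (t / real N)) \<omega> - w (real i * (t / real N)) \<omega>)) \<longlonglongrightarrow> ?I \<omega>"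
      by (intro pathwise_integral_tendsto[OF w[OF that] \<phi>' \<phi> t _ lim_const_over_n nh]) (use t in auto)
    then show ?thesis by (simp add: S_def)
  qed
  have "(\<integral>\<^sup>+\<omega>. ennreal ((norm (J \<omega> - ?I \<omega>))\<^sup>2) \<partial>M) = (\<integral>\<^sup>+\<omega>. liminf (\<lambda>N. ennreal ((norm (J \<omega> - S N \<omega>))\<^sup>2)) \<partial>M)"
  proof (rule nn_integral_cong)
    fix \<omega> assume "\<omega> \<in> space M"
    then have "(\<lambda>N. ennreal ((norm (J \<omega> - S N \<omega>))\<^sup>2)) \<longlonglongrightarrow> ennreal ((norm (J \<omega> - ?I \<omega>))\<^sup>2)"
      by (intro tendsto_intros SI) 
    then show "ennreal ((norm (J \<omega> - ?I \<omega>))\<^sup>2) = liminf (\<lambda>N. ennreal ((norm (J \<omega> - S N \<omega>))\<^sup>2))"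
      by (intro lim_imp_Liminf[symmetric]) simp
  qed
  also have "\<dots> \<le> liminf (\<lambda>N. \<integral>\<^sup>+\<omega>. ennreal ((norm (J \<omega> - S N \<omega>))\<^sup>2) \<partial>M)"
    by (rule nn_integral_liminf) measurable
  also have "\<dots> = 0" using lim by (simp add: lim_imp_Liminf)
  finally have "(\<integral>\<^sup>+\<omega>. ennreal ((norm (J \<omega> - ?I \<omega>))\<^sup>2) \<partial>M) = 0" by simp
  then have "AE \<omega> in M. ennreal ((norm (J \<omega> - ?I \<omega>))\<^sup>2) = 0"
    by (subst (asm) nn_integral_0_iff_AE) measurable
  then show ?thesis by (rule AE_mp) (auto simp: ennreal_eq_0_iff)
qed

lemma (in prob_space) independent_of_process_indep_var:
  assumes ind: "independent_of_process M T \<xi> W"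
    and g: "g \<in> measurable borel N" and h: "h \<in> measurable (\<Pi>\<^sub>M t\<in>{0..T}. borel) N'"
  shows "indep_var N (\<lambda>w. g (\<xi> w)) N' (\<lambda>w. h (\<lambda>t\<in>{0..T}. W t w))"
proof -
  let ?P = "\<Pi>\<^sub>M t\<in>{0..T}. borel" and ?W = "\<lambda>w. \<lambda>t\<in>{0..T}. W t w"
  have m: "\<xi> \<in> borel_measurable M" "?W \<in> measurable M ?P"
    and i: "indep_set (sets (vimage_algebra (space M) \<xi> borel)) (sets (vimage_algebra (space M) ?W ?P))"
    using ind unfolding independent_of_process_def by auto
  have sub: "sigma_sets (space M) {(\<lambda>w. k (f w)) -` A \<inter> space M |A. A \<in> sets K} \<subseteq> sets (vimage_algebra (space M) f S)"
    if f: "f \<in> measurable M S" and k: "k \<in> measurable S K" for f k and S :: "'y measure" and K :: "'z measure"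
  proof -
    have "f \<in> measurable (vimage_algebra (space M) f S) S"
      by (rule measurable_vimage_algebra1) (use measurable_space[OF f] in auto)
    from measurable_compose[OF this k] have "(\<lambda>w. k (f w)) \<in> measurable (vimage_algebra (space M) f S) K" .
    then have "{(\<lambda>w. k (f w)) -` A \<inter> space M |A. A \<in> sets K} \<subseteq> sets (vimage_algebra (space M) f S)"
      by (auto dest: measurable_sets)
    then show ?thesis using sets.sigma_sets_subset[of _ "vimage_algebra (space M) f S"] by simp
  qed
  show ?thesis unfolding indep_var_eq
  proof (intro conjI)
    show "indep_set (sigma_sets (space M) {(\<lambda>w. g (\<xi> w)) -` A \<inter> space M |A. A \<in> sets N})
        (sigma_sets (space M) {(\<lambda>w. h (?W w)) -` A \<inter> space M |A. A \<in> sets N'})"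
      using i sub[OF m(1) g] sub[OF m(2) h] unfolding indep_set_def
      by (elim indep_sets_mono_sets) (auto split: bool.splits)
  qed (rule measurable_compose[OF m(1) g] measurable_compose[OF m(2) h])+
qed

text \<open>On a grid the exponent is a sum of independent Gaussian increments which are also
  independent of \<xi>, so the expectation factorises, and the exponent of the result is a Riemann
  sum for the covariance. Dominated convergence passes to the limit.\<close>

lemma (in prob_space) wiener_integral_char:
  fixes w :: "real \<Rightarrow> 'a \<Rightarrow> 'h::{real_inner,banach,second_countable_topology}" and u :: "'j \<Rightarrow> real"
  assumes W: "wiener_process M Q T w" and T: "0 \<le> T"
    and Q: "linear Q" "\<And>x. 0 \<le> x \<bullet> Q x"
    and \<phi>': "continuous_on {0..T} \<phi>'"
    and \<phi>: "\<And>t. t \<in> {0..T} \<Longrightarrow> (\<phi> has_real_derivative \<phi>' t) (at t within {0..T})"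
    and indep: "independent_of_process M T \<xi> w"
    and g[measurable]: "g \<in> borel_measurable borel" "\<And>x. cmod (g x) \<le> C"
    and J: "finite J" "\<And>j. j \<in> J \<Longrightarrow> u j \<in> {0..T}"
  shows "(CLINT \<omega>|M. g (\<xi> \<omega>) * iexp (\<Sum>j\<in>J. pathwise_integral \<phi> \<phi>' (\<lambda>t. w t \<omega>) (u j) \<bullet> k j)) =
    (CLINT \<omega>|M. g (\<xi> \<omega>)) * exp (- (\<Sum>i\<in>J. \<Sum>j\<in>J. (k i \<bullet> Q (k j)) * integral {0..min (u i) (u j)} (\<lambda>s. (\<phi> s)\<^sup>2)) / 2)"
    (is "?L = ?R")
proof -
  have wc: "\<And>\<omega>. \<omega> \<in> space M \<Longrightarrow> continuous_on {0..T} (\<lambda>t. w t \<omega>)"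
    and wm: "\<And>t. t \<in> {0..T} \<Longrightarrow> w t \<in> borel_measurable M" using W unfolding wiener_process_def by auto
  have \<phi>c: "continuous_on {0..T} \<phi>" by (rule DERIV_continuous_on[OF \<phi>])
  have [measurable]: "\<xi> \<in> borel_measurable M" using indep by (simp add: independent_of_process_def)
  have u0: "0 \<le> u j" "u j \<le> T" if "j \<in> J" for j using J that by auto
  \<comment> \<open>Test vector of the \<open>i\<close>-th increment: all indices \<open>j\<close>
    whose integral still contains that grid cell contribute.\<close>
  define \<kappa> where "\<kappa> N i = \<phi> (real i * gstep N) *\<^sub>R (\<Sum>j\<in>J. of_bool (i < gidx (u j) N) *\<^sub>R k j)" for N i
  \<comment> \<open>The index is frozen at the last grid point below \<open>T\<close>, because
    \<open>wiener_process\<close> speaks of monotone sequences with all values in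
    \<open>[0, T]\<close>.\<close>
  define \<tau> where "\<tau> N i = real (min i (gidx T N)) * gstep N" for N i
  have \<tau>_mono: "mono (\<tau> N)" for N
    unfolding \<tau>_def mono_def using gstep_nonneg by (auto intro!: mult_right_mono)
  have \<tau>_range: "\<tau> N i \<in> {0..T}" for N i unfolding \<tau>_def by (rule gidx_grid[OF T]) simp
  define \<Delta> where "\<Delta> N i \<omega> = w (\<tau> N (Suc i)) \<omega> - w (\<tau> N i) \<omega>" for N i \<omega>
  have [measurable]: "\<Delta> N i \<in> borel_measurable M" for N i
    unfolding \<Delta>_def[abs_def] using wm[OF \<tau>_range] by measurable
  define S' where "S' N j \<omega> = (\<Sum>i<gidx (u j) N. \<phi> (real i * gstep N) *\<^sub>R (w (real (Suc i) * gstep N) \<omega> - w (real i * gstep N) \<omega>))" for N j \<omega>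
  have S'_eq: "(\<Sum>j\<in>J. S' N j \<omega> \<bullet> k j) = (\<Sum>i<gidx T N. \<Delta> N i \<omega> \<bullet> \<kappa> N i)" for N \<omega>
  proof -
    have "S' N j \<omega> \<bullet> k j = (\<Sum>i<gidx T N. \<Delta> N i \<omega> \<bullet> (\<phi> (real i * gstep N) *\<^sub>R (of_bool (i < gidx (u j) N) *\<^sub>R k j)))" if "j \<in> J" for j
    proof -
      have le: "gidx (u j) N \<le> gidx T N" using u0[OF that] by (intro gidx_mono)
      have "(\<Sum>i<gidx T N. \<Delta> N i \<omega> \<bullet> (\<phi> (real i * gstep N) *\<^sub>R (of_bool (i < gidx (u j) N) *\<^sub>R k j))) =
         (\<Sum>i<gidx (u j) N. \<Delta> N i \<omega> \<bullet> (\<phi> (real i * gstep N) *\<^sub>R (of_bool (i < gidx (u j) N) *\<^sub>R k j)))"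
        using le by (intro sum.mono_neutral_right) auto
      also have "\<dots> = S' N j \<omega> \<bullet> k j" unfolding S'_def inner_sum_left
        using le by (intro sum.cong refl) (auto simp: \<Delta>_def \<tau>_def min_def)
      finally show ?thesis by simp
    qed
    then have "(\<Sum>j\<in>J. S' N j \<omega> \<bullet> k j) = (\<Sum>j\<in>J. \<Sum>i<gidx T N. \<Delta> N i \<omega> \<bullet> (\<phi> (real i * gstep N) *\<^sub>R (of_bool (i < gidx (u j) N) *\<^sub>R k j)))"
      by (rule sum.cong[OF refl])
    also have "\<dots> = (\<Sum>i<gidx T N. \<Delta> N i \<omega> \<bullet> \<kappa> N i)"
      by (subst sum.swap) (simp add: \<kappa>_def inner_sum_right sum_distrib_left mult_ac)
    finally show ?thesis .
  qed
  have step: "(CLINT \<omega>|M. g (\<xi> \<omega>) * iexp (\<Sum>j\<in>J. S' N j \<omega> \<bullet> k j)) =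
     (CLINT \<omega>|M. g (\<xi> \<omega>)) * exp (- (\<Sum>i\<in>J. \<Sum>j\<in>J. (k i \<bullet> Q (k j)) * (\<Sum>l<gidx (min (u i) (u j)) N. gstep N * (\<phi> (real l * gstep N))\<^sup>2)) / 2)" for N
  proof -
    let ?n = "gidx T N"
    have prod: "iexp (\<Sum>j\<in>J. S' N j \<omega> \<bullet> k j) = (\<Prod>i<?n. iexp (\<Delta> N i \<omega> \<bullet> \<kappa> N i))" for \<omega>
      unfolding S'_eq by (simp add: exp_sum sum_distrib_left)
    have "indep_vars (\<lambda>_. borel) (\<Delta> N) {..<?n}"
      using W \<tau>_mono[of N] \<tau>_range[of N] unfolding wiener_process_def \<Delta>_def[abs_def] by blast
    then have iv: "indep_vars (\<lambda>_. borel) (\<lambda>i \<omega>. iexp (\<Delta> N i \<omega> \<bullet> \<kappa> N i)) {..<?n}"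
      by (rule indep_vars_compose2[where Y="\<lambda>i x. iexp (x \<bullet> \<kappa> N i)"]) measurable
    have int1: "integrable M (\<lambda>\<omega>. iexp (\<Delta> N i \<omega> \<bullet> \<kappa> N i))" for i
      by (rule integrable_const_bound[where B=1]) auto
    have char1: "(CLINT \<omega>|M. iexp (\<Delta> N i \<omega> \<bullet> \<kappa> N i)) = complex_of_real (exp (- (gstep N * (\<kappa> N i \<bullet> Q (\<kappa> N i))) / 2))" if "i < ?n" for i
    proof -
      have d: "\<tau> N (Suc i) - \<tau> N i = gstep N" using that by (simp add: \<tau>_def min_def algebra_simps)
      have \<Delta>_eq: "\<Delta> N i = (\<lambda>\<omega>. w (\<tau> N (Suc i)) \<omega> - w (\<tau> N i) \<omega>)" by (rule ext) (simp add: \<Delta>_def)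
      have gd: "is_gaussian (\<lambda>h. (\<tau> N (Suc i) - \<tau> N i) *\<^sub>R Q h) (distr M borel (\<Delta> N i))"
        unfolding \<Delta>_eq
        using W \<tau>_range[of N i] \<tau>_range[of N "Suc i"] monoD[OF \<tau>_mono[of N], of i "Suc i"]
        unfolding wiener_process_def by auto
      show ?thesis
        using is_gaussian_char[OF gd, of "\<kappa> N i"] gstep_nonneg[of N] Q(2)[of "\<kappa> N i"] unfolding d by simp
    qed
    have iv2: "indep_var borel (\<lambda>\<omega>. g (\<xi> \<omega>)) borel (\<lambda>\<omega>. \<Prod>i<?n. iexp (((\<lambda>t\<in>{0..T}. w t \<omega>) (\<tau> N (Suc i)) - (\<lambda>t\<in>{0..T}. w t \<omega>) (\<tau> N i)) \<bullet> \<kappa> N i))"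
    proof (rule independent_of_process_indep_var[OF indep g(1), where h="\<lambda>z. \<Prod>i<?n. iexp ((z (\<tau> N (Suc i)) - z (\<tau> N i)) \<bullet> \<kappa> N i)"])
      have [measurable]: "(\<lambda>z. z (\<tau> N i)) \<in> borel_measurable (\<Pi>\<^sub>M t\<in>{0..T}. (borel :: 'h measure))" for i
        by (rule measurable_component_singleton[OF \<tau>_range])
      show "(\<lambda>z. \<Prod>i<?n. iexp ((z (\<tau> N (Suc i)) - z (\<tau> N i)) \<bullet> \<kappa> N i)) \<in> borel_measurable (\<Pi>\<^sub>M t\<in>{0..T}. borel)"
        by measurable
    qed
    have iv3: "indep_var borel (\<lambda>\<omega>. g (\<xi> \<omega>)) borel (\<lambda>\<omega>. \<Prod>i<?n. iexp (\<Delta> N i \<omega> \<bullet> \<kappa> N i))"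
      using iv2 \<tau>_range[of N] by (simp add: \<Delta>_def)
    have "(CLINT \<omega>|M. g (\<xi> \<omega>) * iexp (\<Sum>j\<in>J. S' N j \<omega> \<bullet> k j)) = (CLINT \<omega>|M. g (\<xi> \<omega>)) * (CLINT \<omega>|M. \<Prod>i<?n. iexp (\<Delta> N i \<omega> \<bullet> \<kappa> N i))"
      unfolding prod
      by (rule indep_var_lebesgue_integral[OF iv3])
         (auto intro!: integrable_const_bound[where B=C] g indep_vars_integrable[OF _ iv] int1)
    also have "(CLINT \<omega>|M. \<Prod>i<?n. iexp (\<Delta> N i \<omega> \<bullet> \<kappa> N i)) = (\<Prod>i<?n. (CLINT \<omega>|M. iexp (\<Delta> N i \<omega> \<bullet> \<kappa> N i)))"
      by (rule indep_vars_lebesgue_integral[OF _ iv int1]) auto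
    also have "\<dots> = (\<Prod>i<?n. complex_of_real (exp (- (gstep N * (\<kappa> N i \<bullet> Q (\<kappa> N i))) / 2)))"
      by (rule prod.cong[OF refl]) (rule char1, simp)
    also have "\<dots> = complex_of_real (exp (\<Sum>i<?n. - (gstep N * (\<kappa> N i \<bullet> Q (\<kappa> N i))) / 2))"
      by (simp add: exp_sum)
    also have "(\<Sum>i<?n. - (gstep N * (\<kappa> N i \<bullet> Q (\<kappa> N i))) / 2) = - (\<Sum>l<?n. gstep N * (\<kappa> N l \<bullet> Q (\<kappa> N l))) / 2"
      by (simp add: sum_negf sum_divide_distrib)
    also have "(\<Sum>l<?n. gstep N * (\<kappa> N l \<bullet> Q (\<kappa> N l))) =
      (\<Sum>l<?n. \<Sum>i\<in>J. \<Sum>j\<in>J. (k i \<bullet> Q (k j)) * (of_bool (l < gidx (min (u i) (u j)) N) * (gstep N * (\<phi> (real l * gstep N))\<^sup>2)))"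
    proof (rule sum.cong[OF refl])
      fix l
      have "\<kappa> N l \<bullet> Q (\<kappa> N l) = (\<phi> (real l * gstep N))\<^sup>2 * (\<Sum>i\<in>J. \<Sum>j\<in>J. of_bool (l < gidx (u i) N) * (of_bool (l < gidx (u j) N) * (k i \<bullet> Q (k j))))"
        unfolding \<kappa>_def
        by (simp add: linear_scale[OF Q(1)] linear_sum[OF Q(1)] inner_sum_left inner_sum_right power2_eq_square sum_distrib_left mult_ac)
          (subst sum.swap, simp add: mult_ac)
      \<comment> \<open>A cell counts for the pair \<open>i\<close>, \<open>j\<close> exactly if it
        lies before both times, that is, before \<open>min (u i) (u j)\<close>.\<close>
      then show "gstep N * (\<kappa> N l \<bullet> Q (\<kappa> N l)) = (\<Sum>i\<in>J. \<Sum>j\<in>J. (k i \<bullet> Q (k j)) * (of_bool (l < gidx (min (u i) (u j)) N) * (gstep N * (\<phi> (real l * gstep N))\<^sup>2)))"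
        unfolding gidx_min by (simp add: sum_distrib_left of_bool_conj mult_ac)
    qed
    also have "\<dots> = (\<Sum>i\<in>J. \<Sum>j\<in>J. \<Sum>l<?n. (k i \<bullet> Q (k j)) * (of_bool (l < gidx (min (u i) (u j)) N) * (gstep N * (\<phi> (real l * gstep N))\<^sup>2)))"
      by (subst sum.swap, rule sum.cong[OF refl], rule sum.swap)
    also have "\<dots> = (\<Sum>i\<in>J. \<Sum>j\<in>J. (k i \<bullet> Q (k j)) * (\<Sum>l<gidx (min (u i) (u j)) N. gstep N * (\<phi> (real l * gstep N))\<^sup>2))"
    proof (intro sum.cong refl)
      fix i j assume "i \<in> J" "j \<in> J"
      then have le: "gidx (min (u i) (u j)) N \<le> ?n" using u0 by (intro gidx_mono) (auto simp: min_def)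
      have "(\<Sum>l<?n. of_bool (l < gidx (min (u i) (u j)) N) * (gstep N * (\<phi> (real l * gstep N))\<^sup>2)) =
        (\<Sum>l<gidx (min (u i) (u j)) N. gstep N * (\<phi> (real l * gstep N))\<^sup>2)"
        using le by (intro sum.mono_neutral_cong_right) auto
      then show "(\<Sum>l<?n. (k i \<bullet> Q (k j)) * (of_bool (l < gidx (min (u i) (u j)) N) * (gstep N * (\<phi> (real l * gstep N))\<^sup>2))) =
         (k i \<bullet> Q (k j)) * (\<Sum>l<gidx (min (u i) (u j)) N. gstep N * (\<phi> (real l * gstep N))\<^sup>2)"
        by (simp add: sum_distrib_left[symmetric])
    qed
    finally show ?thesis .
  qed
  have S'_lim: "(\<lambda>N. S' N j \<omega>) \<longlonglongrightarrow> pathwise_integral \<phi> \<phi>' (\<lambda>t. w t \<omega>) (u j)" if "\<omega> \<in> space M" "j \<in> J" for j \<omega>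
    unfolding S'_def
    by (rule pathwise_integral_tendsto[OF wc[OF that(1)] \<phi>' \<phi> J(2)[OF that(2)] gstep_nonneg gstep_tendsto])
       (use gidx_le[OF u0(1)[OF that(2)]] gidx_tendsto[OF u0(1)[OF that(2)]] u0(2)[OF that(2)] order_trans in auto)
  have [measurable]: "(\<lambda>\<omega>. \<Sum>j\<in>J. S' N j \<omega> \<bullet> k j) \<in> borel_measurable M" for N
    unfolding S'_eq by measurable
  have pm[measurable]: "(\<lambda>\<omega>. pathwise_integral \<phi> \<phi>' (\<lambda>t. w t \<omega>) (u j)) \<in> borel_measurable M" if "j \<in> J" for j
    by (rule pathwise_integral_measurable[OF wc wm \<phi>' \<phi> J(2)[OF that]])
  have "(\<lambda>N. CLINT \<omega>|M. g (\<xi> \<omega>) * iexp (\<Sum>j\<in>J. S' N j \<omega> \<bullet> k j)) \<longlonglongrightarrow> ?L"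
  proof (rule integral_dominated_convergence[where w="\<lambda>_. C"])
    show "AE \<omega> in M. (\<lambda>N. g (\<xi> \<omega>) * iexp (\<Sum>j\<in>J. S' N j \<omega> \<bullet> k j)) \<longlonglongrightarrow>
        g (\<xi> \<omega>) * iexp (\<Sum>j\<in>J. pathwise_integral \<phi> \<phi>' (\<lambda>t. w t \<omega>) (u j) \<bullet> k j)"
      by (intro AE_I2 tendsto_intros S'_lim)
    show "(\<lambda>\<omega>. g (\<xi> \<omega>) * iexp (\<Sum>j\<in>J. S' N j \<omega> \<bullet> k j)) \<in> borel_measurable M" for N
      by measurable
    show "(\<lambda>\<omega>. g (\<xi> \<omega>) * iexp (\<Sum>j\<in>J. pathwise_integral \<phi> \<phi>' (\<lambda>t. w t \<omega>) (u j) \<bullet> k j)) \<in> borel_measurable M"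
      by measurable
  qed (use g in \<open>auto simp: norm_mult\<close>)
  moreover have "(\<lambda>N. CLINT \<omega>|M. g (\<xi> \<omega>) * iexp (\<Sum>j\<in>J. S' N j \<omega> \<bullet> k j)) \<longlonglongrightarrow> ?R"
    unfolding step
  proof (intro tendsto_intros)
    fix i j assume ij: "i \<in> J" "j \<in> J"
    have c: "continuous_on {0..T} (\<lambda>s. (\<phi> s)\<^sup>2)" using \<phi>c by (intro continuous_intros)
    have m: "0 \<le> min (u i) (u j)" "min (u i) (u j) \<le> T" using u0 ij by (auto simp: min_def)
    show "(\<lambda>N. \<Sum>l<gidx (min (u i) (u j)) N. gstep N * (\<phi> (real l * gstep N))\<^sup>2) \<longlonglongrightarrow> integral {0..min (u i) (u j)} (\<lambda>s. (\<phi> s)\<^sup>2)"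
      using riemann_sum_tendsto[OF c, of "min (u i) (u j)" gstep "gidx (min (u i) (u j))"] m gstep_nonneg gstep_tendsto
        gidx_le[OF m(1)] gidx_tendsto[OF m(1)] order_trans[OF gidx_le[OF m(1)] m(2)] by simp
  qed simp
  ultimately show ?thesis by (rule LIMSEQ_unique)
qed

section \<open>The coefficients of the Ornstein--Uhlenbeck process\<close>

locale noise_schedule =
  fixes T :: real and \<alpha> \<alpha>' :: "real \<Rightarrow> real"
  assumes T_pos: "0 < T"
    and \<alpha>_pos: "\<And>t. t \<in> {0..T} \<Longrightarrow> 0 < \<alpha> t"
    and \<alpha>'_cont: "continuous_on {0..T} \<alpha>'"
    and \<alpha>_deriv: "\<And>t. t \<in> {0..T} \<Longrightarrow> (\<alpha> has_real_derivative \<alpha>' t) (at t within {0..T})"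
begin

text \<open>\<open>growth t = exp (\<integral>\<^sub>0\<^sup>t \<alpha> / 2)\<close>; the forward process is
  \<open>X\<^sub>t = (X\<^sub>0 + \<integral>\<^sub>0\<^sup>t growth \<surd>\<alpha> dW) / growth t\<close>, and the integral has covariance \<open>noise_var t\<close> times \<open>Q\<close>.\<close>

definition growth :: "real \<Rightarrow> real" where
  "growth t = exp (integral {0..t} \<alpha> / 2)"

definition noise_var :: "real \<Rightarrow> real" where
  "noise_var t = (growth t)\<^sup>2 - 1"

definition \<phi>' :: "real \<Rightarrow> real" where
  "\<phi>' t = \<alpha>' t / (2 * sqrt (\<alpha> t))"

definition \<psi> :: "real \<Rightarrow> real" where
  "\<psi> t = growth t * sqrt (\<alpha> t)"

definition \<psi>' :: "real \<Rightarrow> real" where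
  "\<psi>' t = growth t * (\<phi>' t + \<alpha> t / 2 * sqrt (\<alpha> t))"

lemma \<alpha>_cont: "continuous_on {0..T} \<alpha>"
  by (rule DERIV_continuous_on[OF \<alpha>_deriv])

lemma growth_deriv:
  assumes "t \<in> {0..T}"
  shows "(growth has_real_derivative \<alpha> t / 2 * growth t) (at t within {0..T})"
proof -
  have "((\<lambda>u. integral {0..u} \<alpha>) has_real_derivative \<alpha> t) (at t within {0..T})"
    using integral_has_vector_derivative_Icc[OF \<alpha>_cont assms]
    by (simp add: has_real_derivative_iff_has_vector_derivative)
  then show ?thesis unfolding growth_def[abs_def]
    by (auto intro!: derivative_eq_intros)
qed

lemma growth_cont: "continuous_on {0..T} growth"
  by (rule DERIV_continuous_on[OF growth_deriv])

lemma growth_pos [simp]: "0 < growth t" by (simp add: growth_def)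
lemma growth_nonzero [simp]: "growth t \<noteq> 0" by (simp add: growth_def)
lemma growth_0 [simp]: "growth 0 = 1" by (simp add: growth_def)

lemma growth_strict_mono:
  assumes "0 \<le> s" "s < t" "t \<le> T"
  shows "growth s < growth t"
proof (rule DERIV_pos_imp_increasing_open[OF assms(2)])
  show "continuous_on {s..t} growth" using assms by (intro continuous_on_subset[OF growth_cont]) auto
  fix x assume x: "s < x" "x < t"
  then have "(growth has_real_derivative \<alpha> x / 2 * growth x) (at x)"
    using growth_deriv[of x] assms by (simp add: at_within_Icc_at)
  moreover have "0 < \<alpha> x / 2 * growth x" using \<alpha>_pos[of x] x assms by simp
  ultimately show "\<exists>y. DERIV growth x :> y \<and> 0 < y" by blast
qed

lemma growth_ge_1: "0 \<le> t \<Longrightarrow> t \<le> T \<Longrightarrow> 1 \<le> growth t"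
  using growth_strict_mono[of 0 t] by (cases "t = 0") auto

lemma growth_gt_1: "0 < t \<Longrightarrow> t \<le> T \<Longrightarrow> 1 < growth t"
  using growth_strict_mono[of 0 t] by auto

lemma growth_mono: "0 \<le> s \<Longrightarrow> s \<le> t \<Longrightarrow> t \<le> T \<Longrightarrow> growth s \<le> growth t"
  using growth_strict_mono[of s t] by (cases "s = t") auto

lemma noise_var_pos: "0 < t \<Longrightarrow> t \<le> T \<Longrightarrow> 0 < noise_var t"
  using growth_gt_1[of t] by (simp add: noise_var_def one_less_power)

lemma noise_var_nonneg: "0 \<le> t \<Longrightarrow> t \<le> T \<Longrightarrow> 0 \<le> noise_var t"
  using growth_ge_1[of t] by (simp add: noise_var_def one_le_power)

lemma noise_var_mono: "0 \<le> s \<Longrightarrow> s \<le> t \<Longrightarrow> t \<le> T \<Longrightarrow> noise_var s \<le> noise_var t"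
  using growth_mono[of s t] growth_ge_1[of s] by (auto simp: noise_var_def intro!: power_mono)

lemma noise_var_cont: "continuous_on {0..T} noise_var"
  unfolding noise_var_def[abs_def] by (intro continuous_intros growth_cont)

lemma sqrt_\<alpha>_deriv:
  assumes "t \<in> {0..T}"
  shows "((\<lambda>t. sqrt (\<alpha> t)) has_real_derivative \<phi>' t) (at t within {0..T})"
  using \<alpha>_deriv[OF assms] \<alpha>_pos[OF assms] unfolding \<phi>'_def
  by (auto intro!: derivative_eq_intros simp: field_simps)

lemma \<phi>'_cont: "continuous_on {0..T} \<phi>'"
  unfolding \<phi>'_def[abs_def] using \<alpha>_pos by (intro continuous_intros \<alpha>'_cont \<alpha>_cont) force

lemma \<psi>_deriv:
  assumes "t \<in> {0..T}"
  shows "(\<psi> has_real_derivative \<psi>' t) (at t within {0..T})"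
  unfolding \<psi>_def[abs_def] \<psi>'_def
  by (rule derivative_eq_intros growth_deriv[OF assms] sqrt_\<alpha>_deriv[OF assms])+ (simp add: algebra_simps)

lemma \<psi>'_cont: "continuous_on {0..T} \<psi>'"
  unfolding \<psi>'_def[abs_def] by (intro continuous_intros growth_cont \<phi>'_cont \<alpha>_cont) auto

text \<open>The square of \<psi> is the derivative of the square of \<open>growth\<close>.\<close>

lemma integral_\<psi>_sq:
  assumes "u \<in> {0..T}"
  shows "integral {0..u} (\<lambda>s. (\<psi> s)\<^sup>2) = noise_var u"
proof -
  have "((\<lambda>s. (\<psi> s)\<^sup>2) has_integral (growth u)\<^sup>2 - (growth 0)\<^sup>2) {0..u}"
  proof (rule fundamental_theorem_of_calculus)
    fix x assume x: "x \<in> {0..u}"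
    then have xT: "x \<in> {0..T}" using assms by auto
    have "((\<lambda>s. (growth s)\<^sup>2) has_real_derivative (\<psi> x)\<^sup>2) (at x within {0..T})"
      using growth_deriv[OF xT] \<alpha>_pos[OF xT]
      by (auto intro!: derivative_eq_intros simp: \<psi>_def power2_eq_square mult_ac)
    then show "((\<lambda>s. (growth s)\<^sup>2) has_vector_derivative (\<psi> x)\<^sup>2) (at x within {0..u})"
      unfolding has_real_derivative_iff_has_vector_derivative
      by (rule has_vector_derivative_within_subset) (use assms in auto)
  qed (use assms in auto)
  then show ?thesis by (simp add: noise_var_def integral_unique)
qed

text \<open>Variation of constants, done pathwise. The path \<open>x\<close> itself need not be
  differentiable, but \<open>z = x - sqrt \<alpha> * w\<close> is, because partial integration
  leaves only ordinary integrals. The derivative of \<open>growth * z\<close> is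
  \<open>- \<psi>' * w\<close>, which integrates to the explicit formula.\<close>

lemma ou_explicit:
  fixes x w :: "real \<Rightarrow> 'h::banach"
  assumes x: "continuous_on {0..T} x" and w: "continuous_on {0..T} w" "w 0 = 0"
    and eq: "\<And>t. t \<in> {0..T} \<Longrightarrow> x t = x 0 + integral {0..t} (\<lambda>s. - (\<alpha> s / 2) *\<^sub>R x s) + pathwise_integral (\<lambda>t. sqrt (\<alpha> t)) \<phi>' w t"
    and t: "t \<in> {0..T}"
  shows "x t = (1 / growth t) *\<^sub>R (x 0 + pathwise_integral \<psi> \<psi>' w t)"
proof -
  let ?\<phi> = "\<lambda>t. sqrt (\<alpha> t)"
  define z where "z t = x t - ?\<phi> t *\<^sub>R w t" for t
  have c: "continuous_on {0..T} (\<lambda>s. - (\<alpha> s / 2) *\<^sub>R x s)" "continuous_on {0..T} (\<lambda>s. \<phi>' s *\<^sub>R w s)"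
    by (intro continuous_intros x w \<alpha>_cont \<phi>'_cont; simp)+
  have z_eq: "z t = x 0 + integral {0..t} (\<lambda>s. - (\<alpha> s / 2) *\<^sub>R x s) - integral {0..t} (\<lambda>s. \<phi>' s *\<^sub>R w s)" if "t \<in> {0..T}" for t
    unfolding z_def eq[OF that] by (simp add: pathwise_integral_def w)
  have z_der: "(z has_vector_derivative (- (\<alpha> t / 2) *\<^sub>R x t - \<phi>' t *\<^sub>R w t)) (at t within {0..T})" if "t \<in> {0..T}" for t
  proof (rule has_vector_derivative_transform[OF that])
    show "z t = x 0 + integral {0..t} (\<lambda>s. - (\<alpha> s / 2) *\<^sub>R x s) - integral {0..t} (\<lambda>s. \<phi>' s *\<^sub>R w s)"
      if "t \<in> {0..T}" for t using z_eq[OF that] .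
    show "((\<lambda>t. x 0 + integral {0..t} (\<lambda>s. - (\<alpha> s / 2) *\<^sub>R x s) - integral {0..t} (\<lambda>s. \<phi>' s *\<^sub>R w s))
       has_vector_derivative (- (\<alpha> t / 2) *\<^sub>R x t - \<phi>' t *\<^sub>R w t)) (at t within {0..T})"
      using has_vector_derivative_diff[OF has_vector_derivative_add[OF has_vector_derivative_const
          integral_has_vector_derivative_Icc[OF c(1) that]] integral_has_vector_derivative_Icc[OF c(2) that], of "x 0"]
      by simp
  qed
  have y_der: "((\<lambda>t. growth t *\<^sub>R z t) has_vector_derivative - (\<psi>' s *\<^sub>R w s)) (at s within {0..t})" if "s \<in> {0..t}" for s
  proof -
    have s: "s \<in> {0..T}" using that t by auto
    have "((\<lambda>t. growth t *\<^sub>R z t) has_vector_derivative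
        (growth s *\<^sub>R (- (\<alpha> s / 2) *\<^sub>R x s - \<phi>' s *\<^sub>R w s) + (\<alpha> s / 2 * growth s) *\<^sub>R z s)) (at s within {0..T})"
      by (rule has_vector_derivative_scaleR[OF growth_deriv[OF s] z_der[OF s]])
    moreover have "growth s *\<^sub>R (- (\<alpha> s / 2) *\<^sub>R x s - \<phi>' s *\<^sub>R w s) + (\<alpha> s / 2 * growth s) *\<^sub>R z s = - (\<psi>' s *\<^sub>R w s)"
      by (simp add: z_def \<psi>'_def scaleR_diff_right scaleR_add_left algebra_simps)
    ultimately show ?thesis using t by (auto intro: has_vector_derivative_within_subset)
  qed
  have "((\<lambda>s. - (\<psi>' s *\<^sub>R w s)) has_integral (growth t *\<^sub>R z t - growth 0 *\<^sub>R z 0)) {0..t}"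
    using t y_der by (intro fundamental_theorem_of_calculus) auto
  then have "- integral {0..t} (\<lambda>s. \<psi>' s *\<^sub>R w s) = growth t *\<^sub>R z t - z 0"
    using integral_unique[of "\<lambda>s. - (\<psi>' s *\<^sub>R w s)"] by simp
  then have "growth t *\<^sub>R x t = x 0 + pathwise_integral \<psi> \<psi>' w t"
    by (simp add: z_def pathwise_integral_def w scaleR_diff_right \<psi>_def algebra_simps)
  then have "(1 / growth t) *\<^sub>R (x 0 + pathwise_integral \<psi> \<psi>' w t) = (1 / growth t) *\<^sub>R growth t *\<^sub>R x t" by simp
  then show ?thesis by simp
qed

text \<open>The coefficients of the reverse-time dynamics: the drift of \<open>X\<^sub>T\<^sub>-\<^sub>t\<close> is
  \<open>\<kappa>1 X + \<kappa>2 E[X\<^sub>0 | X]\<close>.\<close>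

definition \<kappa>1 :: "real \<Rightarrow> real" where
  "\<kappa>1 t = - (\<alpha> t / 2 * (growth t + 1 / growth t)) / (growth t - 1 / growth t)"

definition \<kappa>2 :: "real \<Rightarrow> real" where
  "\<kappa>2 t = \<alpha> t / (growth t - 1 / growth t)"

text \<open>For \<open>s \<le> t\<close> the covariance of the noise integrals at \<open>s\<close>
  and \<open>t\<close> is \<open>noise_var s\<close> times the covariance operator, so this ratio is
  the regression coefficient of the earlier integral on the later one.\<close>

definition bridge :: "real \<Rightarrow> real \<Rightarrow> real" where
  "bridge s t = noise_var s / noise_var t"

lemma growth_diff_pos:
  assumes "0 < t" "t \<le> T"
  shows "0 < growth t - 1 / growth t"
proof -
  have "1 / growth t < 1" using growth_gt_1[OF assms] by (simp add: divide_less_eq)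
  then show ?thesis using growth_gt_1[OF assms] by linarith
qed

lemma \<kappa>_cont: "0 < r \<Longrightarrow> continuous_on {r..T} \<kappa>1" "0 < r \<Longrightarrow> continuous_on {r..T} \<kappa>2"
proof -
  assume r: "0 < r"
  have sub: "{r..T} \<subseteq> {0..T}" using r by auto
  have nz: "\<forall>t\<in>{r..T}. growth t - 1 / growth t \<noteq> 0"
  proof
    fix t assume "t \<in> {r..T}"
    then have "0 < growth t - 1 / growth t" using r by (intro growth_diff_pos) auto
    then show "growth t - 1 / growth t \<noteq> 0" by simp
  qed
  note c = continuous_on_subset[OF growth_cont sub] continuous_on_subset[OF \<alpha>_cont sub]
  show "continuous_on {r..T} \<kappa>1" "continuous_on {r..T} \<kappa>2"
    unfolding \<kappa>1_def[abs_def] \<kappa>2_def[abs_def] using nz by (auto intro!: continuous_intros c)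
qed

text \<open>Given \<open>X t\<close> and \<open>X0\<close>, the state at the earlier time
  \<open>s\<close> has mean \<open>growth t / growth s * bridge s t * X t + (1 - bridge s t) /
  growth s * X0\<close>, and its covariance is
  \<open>noise_var s * (1 - bridge s t) / (growth s)^2\<close> times the covariance operator. The
  three estimates are the first-order expansions of these coefficients in \<open>t - s\<close>,
  taken away from time 0, where \<open>noise_var\<close> vanishes.\<close>

lemma one_step_coefficients:
  assumes r: "0 < r" "r \<le> T" and \<epsilon>: "0 < \<epsilon>"
  shows "\<exists>\<delta>>0. \<forall>s t. r \<le> s \<longrightarrow> s \<le> t \<longrightarrow> t \<le> T \<longrightarrow> t - s < \<delta> \<longrightarrow>
    \<bar>growth t / growth s * bridge s t - 1 - (t - s) * \<kappa>1 t\<bar> \<le> \<epsilon> * (t - s) \<and>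
    \<bar>(1 - bridge s t) / growth s - (t - s) * \<kappa>2 t\<bar> \<le> \<epsilon> * (t - s) \<and>
    \<bar>noise_var s * (1 - bridge s t) / (growth s)\<^sup>2 - (t - s) * \<alpha> t\<bar> \<le> \<epsilon> * (t - s)"
proof -
  \<comment> \<open>This is \<open>noise_var / growth\<close>. Its logarithmic derivative is
    \<open>- \<kappa>1\<close>, and \<open>\<kappa>2\<close> is
    \<open>\<alpha> / \<beta>\<close>.\<close>
  define \<beta> where "\<beta> t = growth t - 1 / growth t" for t
  have sub: "{r..T} \<subseteq> {0..T}" using r by auto
  have \<beta>_pos: "0 < \<beta> t" if "t \<in> {r..T}" for t using growth_diff_pos[of t] that r by (auto simp: \<beta>_def)
  have \<beta>_nv: "noise_var t = growth t * \<beta> t" for t by (simp add: \<beta>_def noise_var_def power2_eq_square algebra_simps)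
  have gd: "(growth has_real_derivative \<alpha> t / 2 * growth t) (at t within {r..T})" if "t \<in> {r..T}" for t
    using growth_deriv[of t] that sub by (auto intro: DERIV_subset)
  define \<gamma> where "\<gamma> t = 1 / growth t" for t
  have \<gamma>d: "(\<gamma> has_real_derivative - (\<alpha> t / 2 * \<gamma> t)) (at t within {r..T})" if "t \<in> {r..T}" for t
    unfolding \<gamma>_def[abs_def] by (rule derivative_eq_intros gd[OF that] | simp add: field_simps power2_eq_square)+
  have \<beta>d: "(\<beta> has_real_derivative \<alpha> t / 2 * (growth t + \<gamma> t)) (at t within {r..T})" if "t \<in> {r..T}" for t
    unfolding \<beta>_def[abs_def] using DERIV_diff[OF gd[OF that] \<gamma>d[OF that]] by (simp add: \<gamma>_def[abs_def] algebra_simps)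
  have gc: "continuous_on {r..T} growth" "continuous_on {r..T} \<alpha>"
    using continuous_on_subset[OF growth_cont sub] continuous_on_subset[OF \<alpha>_cont sub] .
  have \<gamma>c: "continuous_on {r..T} \<gamma>" unfolding \<gamma>_def[abs_def] by (intro continuous_intros gc) auto
  have \<beta>c: "continuous_on {r..T} \<beta>" unfolding \<beta>_def[abs_def] by (intro continuous_intros gc) auto
  obtain b where b: "0 < b" "\<And>t. t \<in> {r..T} \<Longrightarrow> b \<le> \<beta> t"
  proof -
    have "\<exists>x\<in>{r..T}. \<forall>y\<in>{r..T}. \<beta> x \<le> \<beta> y" by (rule continuous_attains_inf) (use \<beta>c r in auto)
    then show ?thesis using that \<beta>_pos by metis
  qed
  have "bounded (\<beta> ` {r..T})" "bounded (\<kappa>2 ` {r..T})" using \<beta>c \<kappa>_cont(2)[OF r(1)]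
    by (auto intro!: compact_imp_bounded compact_continuous_image)
  then obtain B1 B2 where B: "\<And>t. t \<in> {r..T} \<Longrightarrow> \<bar>\<beta> t\<bar> \<le> B1" "\<And>t. t \<in> {r..T} \<Longrightarrow> \<bar>\<kappa>2 t\<bar> \<le> B2"
    unfolding bounded_iff by (metis image_eqI real_norm_def)
  have B0: "0 \<le> B1" "0 \<le> B2" using B[of T] r by force+
  define \<epsilon>1 where "\<epsilon>1 = \<epsilon> / (2 * (B1 + 1))"
  have \<epsilon>1: "0 < \<epsilon>1" "B1 * \<epsilon>1 \<le> \<epsilon> / 2" "\<epsilon>1 \<le> \<epsilon>" using \<epsilon> B0 by (auto simp: \<epsilon>1_def field_simps)
  \<comment> \<open>The denominators are bounded below by \<open>b\<close>. The first entry serves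
    the first estimate; the other two give the second estimate with the smaller constant
    \<epsilon>1, which the third one uses multiplied by the bound \<open>B1\<close> of
    \<beta>.\<close>
  define \<eta> where "\<eta> = min (b * \<epsilon>) (min (b * \<epsilon>1 / 2) (\<epsilon>1 / 2))"
  have \<eta>: "0 < \<eta>" "\<eta> \<le> b * \<epsilon>" "\<eta> \<le> b * \<epsilon>1 / 2" "\<eta> \<le> \<epsilon>1 / 2" using b \<epsilon> \<epsilon>1 by (auto simp: \<eta>_def)
  have c1: "continuous_on {r..T} (\<lambda>x. \<alpha> x / 2 * (growth x + \<gamma> x))" by (intro continuous_intros gc \<gamma>c) simp
  have c2: "continuous_on {r..T} (\<lambda>x. - (\<alpha> x / 2 * \<gamma> x))" by (intro continuous_intros gc \<gamma>c) simp
  obtain \<delta>1 where \<delta>1: "\<delta>1 > 0" "\<And>s x t. r \<le> s \<Longrightarrow> s \<le> x \<Longrightarrow> x \<le> t \<Longrightarrow> t \<le> T \<Longrightarrow> t - s < \<delta>1 \<Longrightarrow>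
      norm (\<beta> t - \<beta> s - (t - s) *\<^sub>R (\<alpha> x / 2 * (growth x + \<gamma> x))) \<le> \<eta> * (t - s)"
    using uniform_derivative[OF \<beta>d[unfolded has_real_derivative_iff_has_vector_derivative] c1 \<eta>(1)] by blast
  obtain \<delta>2 where \<delta>2: "\<delta>2 > 0" "\<And>s x t. r \<le> s \<Longrightarrow> s \<le> x \<Longrightarrow> x \<le> t \<Longrightarrow> t \<le> T \<Longrightarrow> t - s < \<delta>2 \<Longrightarrow>
      norm (\<gamma> t - \<gamma> s - (t - s) *\<^sub>R (- (\<alpha> x / 2 * \<gamma> x))) \<le> \<eta> * (t - s)"
    using uniform_derivative[OF \<gamma>d[unfolded has_real_derivative_iff_has_vector_derivative] c2 \<eta>(1)] by blast
  have "uniformly_continuous_on {r..T} \<beta>" using \<beta>c by (intro compact_uniformly_continuous) auto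
  moreover have "0 < \<epsilon> / (2 * (B2 + 1))" using \<epsilon> B0 by simp
  ultimately obtain \<delta>3 where \<delta>3: "\<delta>3 > 0" "\<And>s t. s \<in> {r..T} \<Longrightarrow> t \<in> {r..T} \<Longrightarrow> dist t s < \<delta>3 \<Longrightarrow> dist (\<beta> t) (\<beta> s) < \<epsilon> / (2 * (B2 + 1))"
    unfolding uniformly_continuous_on_def by metis
  show ?thesis
  proof (intro exI[of _ "min \<delta>1 (min \<delta>2 \<delta>3)"] conjI allI impI)
    show "0 < min \<delta>1 (min \<delta>2 \<delta>3)" using \<delta>1 \<delta>2 \<delta>3 by auto
    fix s t assume st: "r \<le> s" "s \<le> t" "t \<le> T" "t - s < min \<delta>1 (min \<delta>2 \<delta>3)"
    define h where "h = t - s"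
    have h: "0 \<le> h" using st by (simp add: h_def)
    have rng: "s \<in> {r..T}" "t \<in> {r..T}" using st by auto
    have bt: "b \<le> \<beta> t" "0 < \<beta> t" "0 < \<beta> s" using b(2) \<beta>_pos rng by auto
    define A where "A = \<beta> t - \<beta> s - h * (\<alpha> t / 2 * (growth t + \<gamma> t))"
    define C where "C = \<gamma> t - \<gamma> s + h * (\<alpha> t / 2 * \<gamma> t)"
    have A: "\<bar>A\<bar> \<le> \<eta> * h" using \<delta>1(2)[of s t t] st by (simp add: A_def h_def)
    have C: "\<bar>C\<bar> \<le> \<eta> * h" using \<delta>2(2)[of s t t] st by (simp add: C_def h_def)
    have g\<gamma>: "growth t * \<gamma> t = 1" "growth s * \<gamma> s = 1" by (simp_all add: \<gamma>_def)
    have \<beta>g: "\<beta> t = growth t - \<gamma> t" "\<beta> s = growth s - \<gamma> s" by (simp_all add: \<beta>_def \<gamma>_def)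
    have br: "bridge s t = growth s * \<beta> s / (growth t * \<beta> t)" by (simp add: bridge_def \<beta>_nv)
    have e1: "growth t / growth s * bridge s t - 1 - h * \<kappa>1 t = - A / \<beta> t"
      unfolding br A_def \<kappa>1_def \<gamma>_def[symmetric] \<beta>g[symmetric] using bt by (simp add: field_simps)
    have "\<bar>- A / \<beta> t\<bar> \<le> (\<eta> * h) / b" unfolding abs_divide using A bt b(1) h \<eta>(1) by (auto intro!: frac_le)
    also have "\<dots> \<le> (b * \<epsilon> * h) / b" using \<eta>(2) h b by (intro divide_right_mono mult_right_mono) auto
    also have "\<dots> = \<epsilon> * h" using b by simp
    finally show "\<bar>growth t / growth s * bridge s t - 1 - (t - s) * \<kappa>1 t\<bar> \<le> \<epsilon> * (t - s)"
      unfolding h_def[symmetric] e1 .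
    have "(1 - bridge s t) / growth s = \<gamma> s - \<beta> s / (growth t * \<beta> t)"
      unfolding br \<gamma>_def by (simp add: field_simps)
    also have "\<beta> s / (growth t * \<beta> t) = \<gamma> t * \<beta> s / \<beta> t" by (simp add: \<gamma>_def)
    finally have c2: "(1 - bridge s t) / growth s = \<gamma> s - \<gamma> t * \<beta> s / \<beta> t" .
    have e2: "(1 - bridge s t) / growth s - h * \<kappa>2 t = - C + \<gamma> t * A / \<beta> t"
    proof -
      have \<kappa>2_eq: "\<kappa>2 t = \<alpha> t / 2 * \<gamma> t + \<gamma> t * (\<alpha> t / 2 * (growth t + \<gamma> t)) / \<beta> t"
      proof -
        have "\<alpha> t = \<alpha> t / 2 * \<gamma> t * \<beta> t + \<gamma> t * (\<alpha> t / 2 * (growth t + \<gamma> t))"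
          unfolding \<beta>g using g\<gamma>(1) by (simp add: field_simps)
        then have "\<alpha> t / \<beta> t = (\<alpha> t / 2 * \<gamma> t * \<beta> t + \<gamma> t * (\<alpha> t / 2 * (growth t + \<gamma> t))) / \<beta> t" by simp
        also have "\<dots> = \<alpha> t / 2 * \<gamma> t + \<gamma> t * (\<alpha> t / 2 * (growth t + \<gamma> t)) / \<beta> t"
          using bt(2) by (simp add: add_divide_distrib)
        finally show ?thesis by (simp add: \<kappa>2_def \<beta>_def)
      qed
      have idn: "g' - g * b' / b - h * (k * g + g * D / b) = - (g - g' + h * (k * g)) + g * (b - b' - h * D) / b"
        if "b \<noteq> 0" for g g' b b' k D :: real
        using that by (simp add: field_simps)
      show ?thesis unfolding c2 A_def C_def \<kappa>2_eq by (rule idn) (use bt(2) in simp)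
    qed
    have \<gamma>1: "0 < \<gamma> t" "\<gamma> t \<le> 1" using growth_gt_1[of t] st r by (auto simp: \<gamma>_def)
    have "\<bar>- C + \<gamma> t * A / \<beta> t\<bar> \<le> \<bar>C\<bar> + \<bar>\<gamma> t * A / \<beta> t\<bar>"
      using abs_triangle_ineq[of "- C" "\<gamma> t * A / \<beta> t"] by (simp only: abs_minus_cancel)
    also have "\<dots> \<le> \<epsilon>1 / 2 * h + (\<eta> * h) / b"
    proof (rule add_mono)
      show "\<bar>C\<bar> \<le> \<epsilon>1 / 2 * h" using C \<eta>(4) h by (meson mult_right_mono order_trans)
      have "\<bar>\<gamma> t * A\<bar> \<le> 1 * (\<eta> * h)" unfolding abs_mult using \<gamma>1 A by (intro mult_mono) auto
      then show "\<bar>\<gamma> t * A / \<beta> t\<bar> \<le> (\<eta> * h) / b" unfolding abs_divide using bt b(1) h \<eta>(1) by (auto intro!: frac_le)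
    qed
    also have "(\<eta> * h) / b \<le> (b * \<epsilon>1 / 2 * h) / b" using \<eta>(3) h b by (intro divide_right_mono mult_right_mono) auto
    also have "\<epsilon>1 / 2 * h + (b * \<epsilon>1 / 2 * h) / b = \<epsilon>1 * h" using b by (simp add: field_simps)
    finally have l2: "\<bar>(1 - bridge s t) / growth s - h * \<kappa>2 t\<bar> \<le> \<epsilon>1 * h" unfolding e2 by simp
    then show "\<bar>(1 - bridge s t) / growth s - (t - s) * \<kappa>2 t\<bar> \<le> \<epsilon> * (t - s)"
      unfolding h_def[symmetric] using \<epsilon>1(3) h by (meson mult_right_mono order_trans)
    \<comment> \<open>The variance coefficient is \<open>\<beta> s\<close> times the second
      coefficient, and \<open>\<kappa>2 * \<beta> = \<alpha>\<close>; so the third estimate follows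
      from the second one and the uniform continuity of \<beta>.\<close>
    have "noise_var s * (1 - bridge s t) / (growth s)\<^sup>2 = \<beta> s * ((1 - bridge s t) / growth s)"
      by (simp add: \<beta>_nv power2_eq_square)
    moreover have "\<kappa>2 t * \<beta> t = \<alpha> t" using bt(2) by (simp add: \<kappa>2_def \<beta>_def)
    ultimately have e3: "noise_var s * (1 - bridge s t) / (growth s)\<^sup>2 - h * \<alpha> t =
        \<beta> s * ((1 - bridge s t) / growth s - h * \<kappa>2 t) + h * \<kappa>2 t * (\<beta> s - \<beta> t)"
      by (simp add: algebra_simps)
    have "\<bar>\<dots>\<bar> \<le> \<bar>\<beta> s\<bar> * \<bar>(1 - bridge s t) / growth s - h * \<kappa>2 t\<bar> + h * \<bar>\<kappa>2 t\<bar> * \<bar>\<beta> s - \<beta> t\<bar>"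
      using h by (intro order_trans[OF abs_triangle_ineq]) (simp add: abs_mult)
    also have "\<dots> \<le> B1 * (\<epsilon>1 * h) + h * B2 * (\<epsilon> / (2 * (B2 + 1)))"
      using B rng l2 h B0 \<delta>3(2)[of t s] st
      by (intro add_mono mult_mono) (auto simp: dist_real_def)
    also have "\<dots> \<le> \<epsilon> / 2 * h + \<epsilon> / 2 * h"
    proof (rule add_mono)
      show "B1 * (\<epsilon>1 * h) \<le> \<epsilon> / 2 * h" using mult_right_mono[OF \<epsilon>1(2) h] by (simp add: mult_ac)
      have "B2 * (\<epsilon> / (2 * (B2 + 1))) \<le> \<epsilon> / 2" using B0 \<epsilon> by (simp add: field_simps)
      from mult_left_mono[OF this h]
      show "h * B2 * (\<epsilon> / (2 * (B2 + 1))) \<le> \<epsilon> / 2 * h" by (simp only: mult.assoc mult.commute[of _ h])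
    qed
    also have "\<dots> = \<epsilon> * h" by simp
    finally show "\<bar>noise_var s * (1 - bridge s t) / (growth s)\<^sup>2 - (t - s) * \<alpha> t\<bar> \<le> \<epsilon> * (t - s)"
      unfolding h_def[symmetric] e3 .
  qed
qed

end

lemma C1_positive_on_schedule:
  assumes "0 < T" "C1_positive_on T \<alpha>"
  obtains \<alpha>' where "noise_schedule T \<alpha> \<alpha>'"
  using assms unfolding C1_positive_on_def noise_schedule_def by blast

text \<open>For each \<open>t\<close> the equation holds outside a null set that depends on
  \<open>t\<close>. Countably many dense times have a common null set, and both sides are continuous
  in \<open>t\<close>.\<close>

lemma (in prob_space) sde_solution_pathwise:
  fixes w :: "real \<Rightarrow> 'a \<Rightarrow> 'h::{banach,second_countable_topology}"
  assumes sol: "sde_solution M T b \<phi> w Z"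
    and w: "\<And>\<omega>. \<omega> \<in> space M \<Longrightarrow> continuous_on {0..T} (\<lambda>t. w t \<omega>)"
    and wm: "\<And>t. t \<in> {0..T} \<Longrightarrow> w t \<in> borel_measurable M"
    and \<phi>': "continuous_on {0..T} \<phi>'"
    and \<phi>: "\<And>t. t \<in> {0..T} \<Longrightarrow> (\<phi> has_real_derivative \<phi>' t) (at t within {0..T})"
    and b: "\<And>\<omega>. \<omega> \<in> space M \<Longrightarrow> continuous_on {0..T} (\<lambda>s. b s (Z s \<omega>))"
  shows "AE \<omega> in M. \<forall>t\<in>{0..T}. Z t \<omega> = Z 0 \<omega> + integral {0..t} (\<lambda>s. b s (Z s \<omega>)) + pathwise_integral \<phi> \<phi>' (\<lambda>t. w t \<omega>) t"
proof -
  obtain J where Zc: "\<And>\<omega>. \<omega> \<in> space M \<Longrightarrow> continuous_on {0..T} (\<lambda>t. Z t \<omega>)"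
    and J: "\<And>t. t \<in> {0..T} \<Longrightarrow> is_stochastic_integral M \<phi> w t (J t)"
      "\<And>t. t \<in> {0..T} \<Longrightarrow> AE \<omega> in M. (\<lambda>s. b s (Z s \<omega>)) integrable_on {0..t} \<and>
           Z t \<omega> = Z 0 \<omega> + integral {0..t} (\<lambda>s. b s (Z s \<omega>)) + J t \<omega>"
    using sol unfolding sde_solution_def by blast
  obtain S where S: "countable S" "S \<subseteq> {0..T}" "{0..T} \<subseteq> closure S"
    using separable[of "{0..T}"] by metis
  have "AE \<omega> in M. Z t \<omega> = Z 0 \<omega> + integral {0..t} (\<lambda>s. b s (Z s \<omega>)) + pathwise_integral \<phi> \<phi>' (\<lambda>t. w t \<omega>) t" if "t \<in> S" for t
  proof -
    have t: "t \<in> {0..T}" using that S by auto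
    have "AE \<omega> in M. J t \<omega> = pathwise_integral \<phi> \<phi>' (\<lambda>t. w t \<omega>) t"
      by (rule stochastic_integral_eq_pathwise[OF w wm \<phi>' \<phi> t J(1)[OF t]])
    with J(2)[OF t] show ?thesis by eventually_elim simp
  qed
  then have "AE \<omega> in M. \<forall>t\<in>S. Z t \<omega> = Z 0 \<omega> + integral {0..t} (\<lambda>s. b s (Z s \<omega>)) + pathwise_integral \<phi> \<phi>' (\<lambda>t. w t \<omega>) t"
    by (intro AE_ball_countable[THEN iffD2] ballI S(1))
  then show ?thesis
  proof (rule AE_mp, intro AE_I2 impI ballI)
    fix \<omega> t assume \<omega>: "\<omega> \<in> space M" and eq: "\<forall>t\<in>S. Z t \<omega> = Z 0 \<omega> + integral {0..t} (\<lambda>s. b s (Z s \<omega>)) + pathwise_integral \<phi> \<phi>' (\<lambda>t. w t \<omega>) t"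
      and t: "t \<in> {0..T}"
    let ?f = "\<lambda>t. Z t \<omega> - (Z 0 \<omega> + integral {0..t} (\<lambda>s. b s (Z s \<omega>)) + pathwise_integral \<phi> \<phi>' (\<lambda>t. w t \<omega>) t)"
    have cl: "closure S = {0..T}" using S closure_minimal[of S "{0..T}"] by auto
    have "?f t = 0"
    proof (rule continuous_constant_on_closure[of S ?f])
      show "continuous_on (closure S) ?f" unfolding cl
        by (intro continuous_intros Zc[OF \<omega>] continuous_on_integral b[OF \<omega>] pathwise_integral_continuous[OF w[OF \<omega>] \<phi>' \<phi>])
    qed (use eq t cl in auto)
    then show "Z t \<omega> = Z 0 \<omega> + integral {0..t} (\<lambda>s. b s (Z s \<omega>)) + pathwise_integral \<phi> \<phi>' (\<lambda>t. w t \<omega>) t" by simp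
  qed
qed

lemma pathwise_integral_bounded_linear:
  fixes f :: "'h::banach \<Rightarrow> 'k::banach"
  assumes f: "bounded_linear f" and w: "continuous_on {0..T} w" and \<phi>': "continuous_on {0..T} \<phi>'" and t: "t \<in> {0..T}"
  shows "pathwise_integral \<phi> \<phi>' (\<lambda>s. f (w s)) t = f (pathwise_integral \<phi> \<phi>' w t)"
proof -
  interpret bounded_linear f by fact
  have "(\<lambda>s. \<phi>' s *\<^sub>R w s) integrable_on {0..t}"
    using t by (intro integrable_continuous_interval continuous_intros continuous_on_subset[OF w] continuous_on_subset[OF \<phi>']) auto
  from integral_linear[OF this f] show ?thesis
    by (simp add: pathwise_integral_def diff scaleR comp_def)
qed

section \<open>The normal density, its derivatives and differentiation under the integral\<close>

lemma char_normal_density: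
  assumes "0 < s"
  shows "(CLINT y|lborel. complex_of_real (normal_density 0 s (y - \<mu>)) * iexp (t * y)) =
    iexp (t * \<mu>) * complex_of_real (exp (- s\<^sup>2 * t\<^sup>2 / 2))"
proof -
  have "(CLINT y|lborel. complex_of_real (normal_density 0 s (y - \<mu>)) * iexp (t * y)) =
      (CLINT y|lborel. complex_of_real (normal_density 0 s y) * iexp (t * (\<mu> + y)))"
    using lborel_integral_real_affine[of 1 "\<lambda>y. complex_of_real (normal_density 0 s (y - \<mu>)) * iexp (t * y)" \<mu>]
    by simp
  also have "\<dots> = (CLINT y|lborel. iexp (t * \<mu>) * (normal_density 0 s y *\<^sub>R iexp (t * y)))"
    by (intro Bochner_Integration.integral_cong refl) (simp add: distrib_left exp_add scaleR_conv_of_real mult_ac)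
  also have "\<dots> = iexp (t * \<mu>) * (CLINT y|density lborel (\<lambda>y. ennreal (normal_density 0 s y)). iexp (t * y))"
  proof -
    have "(CLINT y|density lborel (\<lambda>y. ennreal (normal_density 0 s y)). iexp (t * y)) = (CLINT y|lborel. normal_density 0 s y *\<^sub>R iexp (t * y))"
      by (rule integral_density) auto
    then show ?thesis by (simp only: integral_mult_right_zero)
  qed
  also have "density lborel (\<lambda>y. ennreal (normal_density 0 s y)) = real_gaussian (s\<^sup>2)"
    using assms by (simp add: real_gaussian_def)
  finally show ?thesis using char_real_gaussian[of "s\<^sup>2" t] by simp
qed

text \<open>The index is the order of the derivative in \<open>z\<close>, with every index from 2 on
  standing for the second derivative; higher ones are never taken.\<close>

fun normal_deriv :: "nat \<Rightarrow> real \<Rightarrow> real \<Rightarrow> real" where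
  "normal_deriv 0 s z = normal_density 0 s z"
| "normal_deriv (Suc 0) s z = - (z / s\<^sup>2) * normal_density 0 s z"
| "normal_deriv (Suc (Suc r)) s z = (z\<^sup>2 / s ^ 4 - 1 / s\<^sup>2) * normal_density 0 s z"

lemma normal_deriv_measurable [measurable]: "normal_deriv r s \<in> borel_measurable borel"
  by (cases "(r, s, 0 :: real)" rule: normal_deriv.cases) (simp_all add: fun_eq_iff cong: measurable_cong)

lemma normal_deriv_has_derivative:
  assumes "0 < s" "r \<le> 1"
  shows "(normal_deriv r s has_real_derivative normal_deriv (Suc r) s z) (at z)"
proof -
  have d: "((\<lambda>z. normal_density 0 s z) has_real_derivative - (z / s\<^sup>2) * normal_density 0 s z) (at z)" for z
    unfolding normal_density_def[abs_def] using assms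
    by (auto intro!: derivative_eq_intros simp: field_simps power2_eq_square)
  consider "r = 0" | "r = Suc 0" using assms by linarith
  then show ?thesis
  proof cases
    case 1
    have "normal_deriv 0 s = normal_density 0 s" by (rule ext) simp
    then show ?thesis using d[of z] unfolding 1 by simp
  next
    case 2
    have "((\<lambda>z. - (z / s\<^sup>2) * normal_density 0 s z) has_real_derivative normal_deriv (Suc (Suc 0)) s z) (at z)"
    proof -
      have "((\<lambda>z. - (z / s\<^sup>2)) has_real_derivative - (1 / s\<^sup>2)) (at z)"
        by (rule DERIV_minus[OF DERIV_cdivide[OF DERIV_ident]])
      from DERIV_mult[OF this d[of z]] have "((\<lambda>z. - (z / s\<^sup>2) * normal_density 0 s z) has_real_derivative
          - (1 / s\<^sup>2) * normal_density 0 s z + - (z / s\<^sup>2) * normal_density 0 s z * - (z / s\<^sup>2)) (at z)" .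
      moreover have "- (1 / s\<^sup>2) * normal_density 0 s z + - (z / s\<^sup>2) * normal_density 0 s z * - (z / s\<^sup>2) = normal_deriv (Suc (Suc 0)) s z"
        using assms by (simp add: field_simps power2_eq_square eval_nat_numeral)
      ultimately show ?thesis by simp
    qed
    moreover have "normal_deriv (Suc 0) s = (\<lambda>z. - (z / s\<^sup>2) * normal_density 0 s z)" by (rule ext) simp
    ultimately show ?thesis unfolding 2 by simp
  qed
qed

text \<open>One bound for all orders and all arguments, explicit in \<open>s\<close>, so that it
  still dominates when \<open>s\<close> varies along a convergent sequence. In terms of
  \<open>w = z / s\<close> everything follows from
  \<open>1 + w^2 / 2 \<le> exp (w^2 / 2)\<close>.\<close>

lemma normal_deriv_bounded:
  assumes "0 < s"
  shows "\<bar>normal_deriv r s z\<bar> \<le> 1 / s + 1 / s\<^sup>2 + 3 / s ^ 3"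
proof -
  define w where "w = z / s"
  have z: "z = w * s" using assms by (simp add: w_def)
  have "1 \<le> sqrt (2 * pi)" using pi_gt3 by simp
  then have c: "1 / sqrt (2 * pi * s\<^sup>2) \<le> 1 / s" using assms
    by (simp add: real_sqrt_mult field_simps)
  have nd: "normal_density 0 s z = 1 / sqrt (2 * pi * s\<^sup>2) * exp (- w\<^sup>2 / 2)"
    using assms by (simp add: normal_density_def z power_mult_distrib)
  have e: "1 + w\<^sup>2 / 2 \<le> exp (w\<^sup>2 / 2)" by (rule exp_ge_add_one_self)
  have b: "w\<^sup>2 * exp (- w\<^sup>2 / 2) \<le> 2" "exp (- w\<^sup>2 / 2) \<le> 1" "\<bar>w\<bar> * exp (- w\<^sup>2 / 2) \<le> 1"
  proof -
    have "w\<^sup>2 \<le> 2 * exp (w\<^sup>2 / 2)" using e by (simp add: field_simps)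
    then show "w\<^sup>2 * exp (- w\<^sup>2 / 2) \<le> 2" by (simp add: exp_minus field_simps)
    show "exp (- w\<^sup>2 / 2) \<le> 1" by simp
    have "0 \<le> (\<bar>w\<bar> - 1)\<^sup>2" by simp
    then have "2 * \<bar>w\<bar> \<le> 1 + w\<^sup>2" by (simp add: power2_diff)
    then have "\<bar>w\<bar> \<le> exp (w\<^sup>2 / 2)" using e by linarith
    then show "\<bar>w\<bar> * exp (- w\<^sup>2 / 2) \<le> 1" by (simp add: exp_minus field_simps)
  qed
  have n0: "0 \<le> normal_density 0 s z" by simp
  have n1: "normal_density 0 s z \<le> 1 / s * exp (- w\<^sup>2 / 2)" unfolding nd using c by (intro mult_right_mono) auto
  have pos: "0 \<le> 1 / s" "0 \<le> 1 / s\<^sup>2" "0 \<le> 3 / s ^ 3" using assms by auto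
  consider "r = 0" | "r = Suc 0" | q where "r = Suc (Suc q)" by (metis not0_implies_Suc)
  then show ?thesis
  proof cases
    case 1
    have "normal_density 0 s z \<le> 1 / s * 1" using n1 b(2) pos by (meson mult_left_mono order_trans)
    then show ?thesis using pos n0 unfolding 1 normal_deriv.simps by linarith
  next
    case 2
    have "\<bar>normal_deriv r s z\<bar> = \<bar>w\<bar> / s * normal_density 0 s z"
      using assms n0 by (simp add: 2 z abs_mult power2_eq_square)
    also have "\<dots> \<le> \<bar>w\<bar> / s * (1 / s * exp (- w\<^sup>2 / 2))" using n1 assms by (intro mult_left_mono) auto
    also have "\<dots> = (\<bar>w\<bar> * exp (- w\<^sup>2 / 2)) * (1 / s\<^sup>2)" by (simp add: power2_eq_square)
    also have "\<dots> \<le> 1 * (1 / s\<^sup>2)" using b(3) by (intro mult_right_mono) auto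
    finally show ?thesis using pos by linarith
  next
    case 3
    have "\<bar>normal_deriv r s z\<bar> = \<bar>w\<^sup>2 - 1\<bar> / s\<^sup>2 * normal_density 0 s z"
    proof -
      have "z\<^sup>2 / s ^ 4 - 1 / s\<^sup>2 = (w\<^sup>2 - 1) / s\<^sup>2" using assms by (simp add: z field_simps power2_eq_square eval_nat_numeral)
      then show ?thesis using n0 by (simp add: 3 abs_mult)
    qed
    also have "\<dots> \<le> (w\<^sup>2 + 1) / s\<^sup>2 * (1 / s * exp (- w\<^sup>2 / 2))"
      using n1 n0 by (intro mult_mono divide_right_mono) (auto simp: abs_le_iff)
    also have "\<dots> = (w\<^sup>2 * exp (- w\<^sup>2 / 2) + exp (- w\<^sup>2 / 2)) * (1 / s ^ 3)"
      by (simp add: field_simps power2_eq_square eval_nat_numeral)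
    also have "\<dots> \<le> 3 * (1 / s ^ 3)"
    proof (rule mult_right_mono)
      show "w\<^sup>2 * exp (- w\<^sup>2 / 2) + exp (- w\<^sup>2 / 2) \<le> 3" using b(1,2) by linarith
    qed (use assms in simp)
    finally show ?thesis using pos by linarith
  qed
qed

lemma normal_deriv_continuous: "0 < s \<Longrightarrow> continuous_on UNIV (normal_deriv r s)"
  by (cases "(r, s, 0 :: real)" rule: normal_deriv.cases)
     (simp_all add: normal_density_def[abs_def] fun_eq_iff cong: continuous_on_cong, (auto intro!: continuous_intros)+)

text \<open>The mean value theorem bounds all difference quotients by \<open>C\<close>, and
  constants are integrable on a finite measure space, so dominated convergence applies.\<close>

lemma has_real_derivative_integral:
  fixes f :: "real \<Rightarrow> 'a \<Rightarrow> real"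
  assumes fin: "finite_measure M"
    and f: "\<And>t. integrable M (f t)"
    and d: "\<And>t w. w \<in> space M \<Longrightarrow> ((\<lambda>t. f t w) has_real_derivative f' t w) (at t)"
    and f': "\<And>t w. w \<in> space M \<Longrightarrow> \<bar>f' t w\<bar> \<le> C" and f'm: "f' x \<in> borel_measurable M"
  shows "((\<lambda>t. \<integral>w. f t w \<partial>M) has_real_derivative (\<integral>w. f' x w \<partial>M)) (at x)"
  unfolding has_field_derivative_iff tendsto_at_iff_sequentially comp_def
proof (intro allI impI)
  interpret finite_measure M by fact
  fix X :: "nat \<Rightarrow> real" assume X: "\<forall>i. X i \<in> UNIV - {x}" "X \<longlonglongrightarrow> x"
  have "(\<lambda>i. \<integral>w. (f (X i) w - f x w) / (X i - x) \<partial>M) \<longlonglongrightarrow> (\<integral>w. f' x w \<partial>M)"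
  proof (rule integral_dominated_convergence[where w="\<lambda>_. C"])
    show "AE w in M. (\<lambda>i. (f (X i) w - f x w) / (X i - x)) \<longlonglongrightarrow> f' x w"
    proof (rule AE_I2)
      fix w assume "w \<in> space M"
      from d[OF this, of x] X show "(\<lambda>i. (f (X i) w - f x w) / (X i - x)) \<longlonglongrightarrow> f' x w"
        unfolding has_field_derivative_iff tendsto_at_iff_sequentially comp_def by blast
    qed
    show "AE w in M. norm ((f (X i) w - f x w) / (X i - x)) \<le> C" for i
    proof (rule AE_I2)
      fix w assume w: "w \<in> space M"
      have "norm (f (X i) w - f x w) \<le> C * norm (X i - x)"
        by (rule field_differentiable_bound[of UNIV "\<lambda>t. f t w" "\<lambda>t. f' t w"])
           (use d[OF w] f'[OF w] in auto)
      then show "norm ((f (X i) w - f x w) / (X i - x)) \<le> C"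
        using X(1) by (simp add: divide_le_eq)
    qed
  qed (use f f'm in auto)
  then show "(\<lambda>i. ((\<integral>w. f (X i) w \<partial>M) - (\<integral>w. f x w \<partial>M)) / (X i - x)) \<longlonglongrightarrow> (\<integral>w. f' x w \<partial>M)"
    using f by simp
qed

lemma prod_bounded:
  fixes f :: "nat \<Rightarrow> real"
  assumes "\<And>k. k < m \<Longrightarrow> \<bar>f k\<bar> \<le> C k"
  shows "\<bar>\<Prod>k<m. f k\<bar> \<le> (\<Prod>k<m. C k)"
  unfolding abs_prod using assms by (intro prod_mono) auto

lemma space_lebesgue_Rn: "space (lebesgue_Rn n) = Rn n"
  by (simp add: lebesgue_Rn_def space_PiM)

lemma sets_lebesgue_Rn [measurable_cong]: "sets (lebesgue_Rn n) = sets (Pi\<^sub>M {..<n} (\<lambda>_. borel))"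
  unfolding lebesgue_Rn_def by (rule sets_PiM_cong) auto

lemma sigma_finite_lebesgue_Rn: "sigma_finite_measure (lebesgue_Rn n)"
proof -
  interpret finite_product_sigma_finite "\<lambda>_. lborel :: real measure" "{..<n}" by standard auto
  show ?thesis unfolding lebesgue_Rn_def by (rule sigma_finite_measure_axioms)
qed

lemma lebesgue_Rn_component [measurable]: "k < n \<Longrightarrow> (\<lambda>y. y k) \<in> borel_measurable (lebesgue_Rn n)"
  using measurable_component_singleton[of k "{..<n}" "\<lambda>_. borel :: real measure"] by simp

section \<open>Posterior means in Gaussian noise\<close>

text \<open>\<open>Y\<close> is \<open>c\<close> times \<open>x\<close> plus an independent centred Gaussian vector with independent components
  of standard deviations \<open>s\<close>; the independence is expressed by the joint characteristic function.\<close>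

locale gaussian_channel = prob_space M for M :: "'w measure" +
  fixes m :: nat and x :: "'w \<Rightarrow> nat \<Rightarrow> real" and Y :: "'w \<Rightarrow> nat \<Rightarrow> real" and c :: real and s :: "nat \<Rightarrow> real"
  assumes x_meas [measurable]: "x \<in> measurable M (Pi\<^sub>M {..<m} (\<lambda>_. borel))"
    and Y_meas [measurable]: "Y \<in> measurable M (Pi\<^sub>M {..<m} (\<lambda>_. borel))"
    and s_pos: "\<And>k. k < m \<Longrightarrow> 0 < s k"
    and channel_char: "\<And>a b. (CLINT w|M. iexp ((\<Sum>k<m. x w k * a k) + (\<Sum>k<m. Y w k * b k))) =
      (CLINT w|M. iexp (\<Sum>k<m. x w k * (a k + c * b k))) * complex_of_real (exp (- (\<Sum>k<m. (s k)\<^sup>2 * (b k)\<^sup>2) / 2))"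
begin

text \<open>Partial derivative with multi-index \<open>r\<close> of the density of \<open>Y\<close>:
  the density is a mixture of Gaussian densities over \<open>x\<close>, and differentiation is
  carried out under the integral.\<close>

definition smooth_deriv :: "(nat \<Rightarrow> nat) \<Rightarrow> (nat \<Rightarrow> real) \<Rightarrow> real" where
  "smooth_deriv r y = (\<integral>w. (\<Prod>k<m. normal_deriv (r k) (s k) (y k - c * x w k)) \<partial>M)"

text \<open>The conditional density of \<open>Y\<close> at \<open>y\<close> given the sample point
  \<open>w\<close>, which enters through \<open>x w\<close> only.\<close>

definition kern :: "'w \<Rightarrow> (nat \<Rightarrow> real) \<Rightarrow> real" where
  "kern w y = (\<Prod>k<m. normal_density 0 (s k) (y k - c * x w k))"

definition dens :: "(nat \<Rightarrow> real) \<Rightarrow> real" where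
  "dens y = (\<integral>w. kern w y \<partial>M)"

lemma dens_eq_smooth_deriv: "dens = smooth_deriv (\<lambda>_. 0)"
  by (simp add: fun_eq_iff dens_def smooth_deriv_def kern_def)

lemma x_comp [measurable]: "k < m \<Longrightarrow> (\<lambda>w. x w k) \<in> borel_measurable M"
  using measurable_compose[OF x_meas measurable_component_singleton[of k "{..<m}"]] by simp

lemma Y_comp [measurable]: "k < m \<Longrightarrow> (\<lambda>w. Y w k) \<in> borel_measurable M"
  using measurable_compose[OF Y_meas measurable_component_singleton[of k "{..<m}"]] by simp

lemma smooth_deriv_integrand:
  shows "(\<lambda>w. \<Prod>k<m. normal_deriv (r k) (s k) (y k - c * x w k)) \<in> borel_measurable M"
    and "\<bar>\<Prod>k<m. normal_deriv (r k) (s k) (y k - c * x w k)\<bar> \<le> (\<Prod>k<m. 1 / s k + 1 / (s k)\<^sup>2 + 3 / s k ^ 3)"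
    and "integrable M (\<lambda>w. \<Prod>k<m. normal_deriv (r k) (s k) (y k - c * x w k))"
proof -
  show m: "(\<lambda>w. \<Prod>k<m. normal_deriv (r k) (s k) (y k - c * x w k)) \<in> borel_measurable M"
    by measurable
  show b: "\<bar>\<Prod>k<m. normal_deriv (r k) (s k) (y k - c * x w k)\<bar> \<le> (\<Prod>k<m. 1 / s k + 1 / (s k)\<^sup>2 + 3 / s k ^ 3)" for w
    by (rule prod_bounded) (rule normal_deriv_bounded[OF s_pos])
  show "integrable M (\<lambda>w. \<Prod>k<m. normal_deriv (r k) (s k) (y k - c * x w k))"
    by (rule integrable_const_bound[OF _ m]) (use b in auto)
qed

lemma smooth_deriv_has_derivative:
  assumes i: "i < m" and r: "r i \<le> 1"
  shows "((\<lambda>t. smooth_deriv r (y(i := t))) has_real_derivative smooth_deriv (r(i := Suc (r i))) (y(i := t))) (at t)"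
proof -
  have split: "(\<Prod>k<m. f k) = f i * (\<Prod>k\<in>{..<m} - {i}. f k)" for f :: "nat \<Rightarrow> real"
    using i by (subst prod.remove[of _ i]) auto
  show ?thesis unfolding smooth_deriv_def
  proof (rule has_real_derivative_integral[OF finite_measure_axioms smooth_deriv_integrand(3) _ smooth_deriv_integrand(2) smooth_deriv_integrand(1)])
    fix t w
    let ?P = "\<Prod>k\<in>{..<m} - {i}. normal_deriv (r k) (s k) (y k - c * x w k)"
    have "((\<lambda>t. normal_deriv (r i) (s i) (t - c * x w i) * ?P) has_real_derivative
        normal_deriv (Suc (r i)) (s i) (t - c * x w i) * 1 * ?P) (at t)"
      by (intro DERIV_cmult_right DERIV_chain2[OF normal_deriv_has_derivative[OF s_pos[OF i] r]])
         (auto intro!: derivative_eq_intros)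
    moreover have "(\<Prod>k<m. normal_deriv (r k) (s k) ((y(i := t)) k - c * x w k)) = normal_deriv (r i) (s i) (t - c * x w i) * ?P" for t
      unfolding split by simp
    moreover have "(\<Prod>k<m. normal_deriv ((r(i := Suc (r i))) k) (s k) ((y(i := t)) k - c * x w k)) =
        normal_deriv (Suc (r i)) (s i) (t - c * x w i) * ?P"
      unfolding split by simp
    ultimately show "((\<lambda>t. \<Prod>k<m. normal_deriv (r k) (s k) ((y(i := t)) k - c * x w k)) has_real_derivative
       (\<Prod>k<m. normal_deriv ((r(i := Suc (r i))) k) (s k) ((y(i := t)) k - c * x w k))) (at t)"
      by simp
  qed
qed

lemma smooth_deriv_continuous: "continuous_on S (smooth_deriv r)"
proof (rule continuous_on_sequentiallyI)
  fix u :: "nat \<Rightarrow> nat \<Rightarrow> real" and a assume "u \<longlonglongrightarrow> a"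
  then have u: "(\<lambda>n. u n k) \<longlonglongrightarrow> a k" for k
    by (rule continuous_on_tendsto_compose[OF continuous_on_product_coordinates]) auto
  show "(\<lambda>n. smooth_deriv r (u n)) \<longlonglongrightarrow> smooth_deriv r a"
    unfolding smooth_deriv_def
  proof (rule integral_dominated_convergence[where w="\<lambda>_. \<Prod>k<m. 1 / s k + 1 / (s k)\<^sup>2 + 3 / s k ^ 3"])
    show "AE w in M. (\<lambda>n. \<Prod>k<m. normal_deriv (r k) (s k) (u n k - c * x w k)) \<longlonglongrightarrow>
        (\<Prod>k<m. normal_deriv (r k) (s k) (a k - c * x w k))"
    proof (intro AE_I2 tendsto_prod)
      fix w k assume "k \<in> {..<m}"
      then show "(\<lambda>n. normal_deriv (r k) (s k) (u n k - c * x w k)) \<longlonglongrightarrow> normal_deriv (r k) (s k) (a k - c * x w k)"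
        by (intro continuous_on_tendsto_compose[OF normal_deriv_continuous[OF s_pos]] tendsto_diff tendsto_const u) auto
    qed
  qed (use smooth_deriv_integrand in auto)
qed

lemma twice_cont_diff_dens: "twice_cont_diff m dens"
  unfolding twice_cont_diff_def dens_eq_smooth_deriv
proof (intro conjI smooth_deriv_continuous exI allI impI ballI)
  fix i j y assume i: "i < m" and j: "j < m"
  have "((\<lambda>t. smooth_deriv (\<lambda>_. 0) (y(i := t))) has_real_derivative smooth_deriv ((\<lambda>_. 0)(i := Suc 0)) (y(i := y i))) (at (y i))"
    by (rule smooth_deriv_has_derivative[OF i]) simp
  then show "((\<lambda>t. smooth_deriv (\<lambda>_. 0) (y(i := t))) has_real_derivative smooth_deriv ((\<lambda>_. 0)(i := Suc 0)) y) (at (y i))"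
    by simp
  let ?r = "(\<lambda>_. 0)(i := Suc 0)"
  have "((\<lambda>t. smooth_deriv ?r (y(j := t))) has_real_derivative smooth_deriv (?r(j := Suc (?r j))) (y(j := y j))) (at (y j))"
    by (rule smooth_deriv_has_derivative[OF j]) simp
  then show "((\<lambda>t. smooth_deriv ?r (y(j := t))) has_real_derivative smooth_deriv (?r(j := Suc (?r j))) y) (at (y j))"
    by simp
qed (rule smooth_deriv_continuous)+

lemma kern_pos: "0 < kern w y"
  unfolding kern_def using s_pos by (intro prod_pos) (auto intro!: normal_density_pos)

lemma kern_integrable: "integrable M (\<lambda>w. kern w y)"
  using smooth_deriv_integrand(3)[of "\<lambda>_. 0" y] by (simp add: kern_def)

lemma kern_bounded: "\<bar>kern w y\<bar> \<le> (\<Prod>k<m. 1 / s k + 1 / (s k)\<^sup>2 + 3 / s k ^ 3)"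
  using smooth_deriv_integrand(2)[of "\<lambda>_. 0" y w] by (simp add: kern_def)

lemma dens_pos: "0 < dens y"
proof (rule ccontr)
  assume "\<not> 0 < dens y"
  moreover have "0 \<le> dens y" unfolding dens_def by (intro integral_nonneg_AE AE_I2 less_imp_le kern_pos)
  ultimately have "(\<integral>w. kern w y \<partial>M) = 0" by (simp add: dens_def)
  then have "AE w in M. kern w y = 0"
    by (subst (asm) integral_nonneg_eq_0_iff_AE[OF kern_integrable]) (auto intro!: less_imp_le kern_pos)
  then have "AE w in M. False" by (rule AE_mp) (use kern_pos[of _ y] in \<open>auto intro!: AE_I2 simp: less_le\<close>)
  then show False by simp
qed

lemma kern_meas [measurable]: "(\<lambda>(w, y). kern w y) \<in> borel_measurable (M \<Otimes>\<^sub>M lebesgue_Rn m)"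
  unfolding kern_def by measurable

lemma kern_nn_integral: "(\<integral>\<^sup>+y. ennreal (kern w y) \<partial>lebesgue_Rn m) = 1"
proof -
  interpret product_sigma_finite "\<lambda>_. lborel :: real measure" by standard
  have "(\<integral>\<^sup>+y. ennreal (kern w y) \<partial>lebesgue_Rn m) =
    (\<integral>\<^sup>+y. (\<Prod>k<m. ennreal (normal_density 0 (s k) (y k - c * x w k))) \<partial>Pi\<^sub>M {..<m} (\<lambda>_. lborel))"
    unfolding lebesgue_Rn_def kern_def by (simp add: prod_ennreal)
  also have "\<dots> = (\<Prod>k<m. \<integral>\<^sup>+y. ennreal (normal_density 0 (s k) (y - c * x w k)) \<partial>lborel)"
    by (rule product_nn_integral_prod) auto
  also have "\<dots> = (\<Prod>k<m. 1)"
  proof (rule prod.cong[OF refl])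
    fix k assume k: "k \<in> {..<m}"
    have "normal_density 0 (s k) (y - c * x w k) = normal_density (c * x w k) (s k) y" for y
      by (simp add: normal_density_def)
    moreover have "(\<integral>\<^sup>+y. ennreal (normal_density (c * x w k) (s k) y) \<partial>lborel) = 1"
      using s_pos k by (subst nn_integral_eq_integral) auto
    ultimately show "(\<integral>\<^sup>+y. ennreal (normal_density 0 (s k) (y - c * x w k)) \<partial>lborel) = 1" by simp
  qed
  finally show ?thesis by simp
qed

text \<open>A second model of the channel on an enlarged space, in which \<open>y\<close> is drawn
  from the density \<open>kern w\<close> given \<open>w\<close>. In this model Bayes' formula is an
  application of Fubini's theorem.\<close>

definition joint :: "('w \<times> (nat \<Rightarrow> real)) measure" where
  "joint = density (M \<Otimes>\<^sub>M lebesgue_Rn m) (\<lambda>(w, y). ennreal (kern w y))"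

lemma joint_nn_integral:
  assumes [measurable]: "f \<in> borel_measurable (M \<Otimes>\<^sub>M lebesgue_Rn m)"
  shows "(\<integral>\<^sup>+p. f p \<partial>joint) = (\<integral>\<^sup>+w. \<integral>\<^sup>+y. ennreal (kern w y) * f (w, y) \<partial>lebesgue_Rn m \<partial>M)"
proof -
  interpret L: sigma_finite_measure "lebesgue_Rn m" by (rule sigma_finite_lebesgue_Rn)
  show ?thesis unfolding joint_def
    using L.nn_integral_fst[of "\<lambda>p. ennreal (case_prod kern p) * f p" M, symmetric]
    by (subst nn_integral_density) (auto simp: case_prod_beta')
qed

lemma prob_space_joint: "prob_space joint"
proof (rule prob_spaceI)
  have "emeasure joint (space joint) = (\<integral>\<^sup>+p. 1 \<partial>joint)" by simp
  also have "\<dots> = 1" by (subst joint_nn_integral) (auto simp: kern_nn_integral emeasure_space_1)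
  finally show "emeasure joint (space joint) = 1" .
qed

lemma sets_joint [measurable_cong]: "sets joint = sets (M \<Otimes>\<^sub>M lebesgue_Rn m)"
  by (simp add: joint_def)

lemma joint_integral:
  fixes f :: "'w \<times> (nat \<Rightarrow> real) \<Rightarrow> 'b::{banach,second_countable_topology}"
  assumes f: "integrable joint f"
  shows "(\<integral>p. f p \<partial>joint) = (\<integral>w. \<integral>y. kern w y *\<^sub>R f (w, y) \<partial>lebesgue_Rn m \<partial>M)"
    and "(\<integral>p. f p \<partial>joint) = (\<integral>y. \<integral>w. kern w y *\<^sub>R f (w, y) \<partial>M \<partial>lebesgue_Rn m)"
proof -
  interpret L: sigma_finite_measure "lebesgue_Rn m" by (rule sigma_finite_lebesgue_Rn)
  interpret P: pair_sigma_finite M "lebesgue_Rn m" ..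
  have [measurable]: "f \<in> borel_measurable (M \<Otimes>\<^sub>M lebesgue_Rn m)"
    using borel_measurable_integrable[OF f] by measurable
  have k: "joint = density (M \<Otimes>\<^sub>M lebesgue_Rn m) (\<lambda>p. ennreal (case_prod kern p))"
    by (simp add: joint_def case_prod_beta')
  have nn: "AE p in M \<Otimes>\<^sub>M lebesgue_Rn m. 0 \<le> case_prod kern p"
    using kern_pos by (auto intro!: less_imp_le)
  have "integrable (M \<Otimes>\<^sub>M lebesgue_Rn m) (\<lambda>p. case_prod kern p *\<^sub>R f p)"
    using f unfolding k by (subst (asm) integrable_density[OF _ _ nn]) auto
  then have i: "integrable (M \<Otimes>\<^sub>M lebesgue_Rn m) (\<lambda>(w, y). kern w y *\<^sub>R f (w, y))"
    by (simp add: case_prod_beta')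
  have e: "(\<integral>p. f p \<partial>joint) = (\<integral>(w, y). kern w y *\<^sub>R f (w, y) \<partial>(M \<Otimes>\<^sub>M lebesgue_Rn m))"
    unfolding k by (subst integral_density[OF _ _ nn]) (auto simp: case_prod_beta')
  show "(\<integral>p. f p \<partial>joint) = (\<integral>w. \<integral>y. kern w y *\<^sub>R f (w, y) \<partial>lebesgue_Rn m \<partial>M)"
    unfolding e using P.integral_fst[OF i] by simp
  show "(\<integral>p. f p \<partial>joint) = (\<integral>y. \<integral>w. kern w y *\<^sub>R f (w, y) \<partial>M \<partial>lebesgue_Rn m)"
    unfolding e using P.integral_snd[OF i] by simp
qed

abbreviation RnB :: "(nat \<Rightarrow> real) measure" where "RnB \<equiv> Pi\<^sub>M {..<m} (\<lambda>_. borel)"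

text \<open>The channel is known only through a characteristic function. Input and output have the
  same joint characteristic function in the model \<open>joint\<close>, so every identity that
  involves only this pair may be computed there.\<close>

lemma joint_law: "distr M (RnB \<Otimes>\<^sub>M RnB) (\<lambda>w. (x w, Y w)) = distr joint (RnB \<Otimes>\<^sub>M RnB) (\<lambda>(w, y). (x w, y))"
proof (rule finite_measure_eqI_char_inner[where T="{..<m} <+> {..<m}" and N="RnB \<Otimes>\<^sub>M RnB" and
      Z="\<lambda>j p. case j of Inl k \<Rightarrow> fst p k | Inr k \<Rightarrow> snd p k"])
  interpret J: prob_space joint by (rule prob_space_joint)
  have m2[measurable]: "(\<lambda>(w, y). (x w, y)) \<in> measurable joint (RnB \<Otimes>\<^sub>M RnB)" by measurable
  show "(\<lambda>p. case t of Inl k \<Rightarrow> fst p k | Inr k \<Rightarrow> snd p k) \<in> borel_measurable (RnB \<Otimes>\<^sub>M RnB)" if "t \<in> {..<m} <+> {..<m}" for t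
    using that by (auto intro: measurable_compose[OF measurable_fst] measurable_compose[OF measurable_snd])
  show "finite_measure (distr M (RnB \<Otimes>\<^sub>M RnB) (\<lambda>w. (x w, Y w)))"
    by (rule finite_measure_distr) measurable
  show "finite_measure (distr joint (RnB \<Otimes>\<^sub>M RnB) (\<lambda>(w, y). (x w, y)))"
    by (rule J.finite_measure_distr) measurable
next
  fix N' :: "((nat \<Rightarrow> real) \<times> (nat \<Rightarrow> real)) measure"
  assume sp: "space N' = space (RnB \<Otimes>\<^sub>M RnB)"
    and Z: "\<And>t. t \<in> {..<m} <+> {..<m} \<Longrightarrow> (\<lambda>p. case t of Inl k \<Rightarrow> fst p k | Inr k \<Rightarrow> snd p k) \<in> borel_measurable N'"
  have 1: "(\<lambda>p. fst p k) \<in> borel_measurable N'" if "k < m" for k using Z[of "Inl k"] that by auto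
  have 2: "(\<lambda>p. snd p k) \<in> borel_measurable N'" if "k < m" for k using Z[of "Inr k"] that by auto
  have "(\<lambda>p. (fst p, snd p)) \<in> measurable N' (RnB \<Otimes>\<^sub>M RnB)"
    using 1 2 sp by (intro measurable_Pair measurable_PiM_single') (auto simp: space_pair_measure space_PiM)
  then show "(\<lambda>p. p) \<in> measurable N' (RnB \<Otimes>\<^sub>M RnB)" by simp
next
  fix J :: "(nat + nat) set" and k :: "nat + nat \<Rightarrow> real" assume J: "finite J" "J \<subseteq> {..<m} <+> {..<m}"
  define a where "a i = (if Inl i \<in> J then k (Inl i) else 0)" for i
  define b where "b i = (if Inr i \<in> J then k (Inr i) else 0)" for i
  interpret L: sigma_finite_measure "lebesgue_Rn m" by (rule sigma_finite_lebesgue_Rn)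
  interpret Jt: prob_space joint by (rule prob_space_joint)
  have lin: "(\<Sum>j\<in>J. (case j of Inl k \<Rightarrow> fst p k | Inr k \<Rightarrow> snd p k) \<bullet> k j) = (\<Sum>i<m. fst p i * a i) + (\<Sum>i<m. snd p i * b i)" for p :: "(nat \<Rightarrow> real) \<times> (nat \<Rightarrow> real)"
  proof -
    have "(\<Sum>j\<in>J. (case j of Inl k \<Rightarrow> fst p k | Inr k \<Rightarrow> snd p k) \<bullet> k j) =
       (\<Sum>j\<in>{..<m} <+> {..<m}. (case j of Inl i \<Rightarrow> fst p i * a i | Inr i \<Rightarrow> snd p i * b i))"
      using J by (intro sum.mono_neutral_cong_left) (auto simp: a_def b_def split: sum.split)
    then show ?thesis by (subst (asm) sum.Plus) auto
  qed
  have m1: "(\<lambda>w. (x w, Y w)) \<in> measurable M (RnB \<Otimes>\<^sub>M RnB)" by measurable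
  have m2: "(\<lambda>(w, y). (x w, y)) \<in> measurable joint (RnB \<Otimes>\<^sub>M RnB)" by measurable
  have me: "(\<lambda>p. iexp ((\<Sum>i<m. fst p i * a i) + (\<Sum>i<m. snd p i * b i))) \<in> borel_measurable (RnB \<Otimes>\<^sub>M RnB)"
  proof -
    have [measurable]: "(\<lambda>p. fst p i) \<in> borel_measurable (RnB \<Otimes>\<^sub>M RnB)" "(\<lambda>p. snd p i) \<in> borel_measurable (RnB \<Otimes>\<^sub>M RnB)" if "i < m" for i
      using that by (auto intro: measurable_compose[OF measurable_fst] measurable_compose[OF measurable_snd])
    show ?thesis by measurable
  qed
  \<comment> \<open>Given \<open>w\<close>, the components of \<open>y\<close> are independent
    normal variables with means \<open>c * x w k\<close>, so the integral is a product of
    one-dimensional ones.\<close>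
  have inner: "(\<integral>y. kern w y *\<^sub>R iexp ((\<Sum>i<m. x w i * a i) + (\<Sum>i<m. y i * b i)) \<partial>lebesgue_Rn m) =
     iexp (\<Sum>i<m. x w i * (a i + c * b i)) * complex_of_real (exp (- (\<Sum>k<m. (s k)\<^sup>2 * (b k)\<^sup>2) / 2))" for w
  proof -
    interpret product_sigma_finite "\<lambda>_. lborel :: real measure" by standard
    let ?f = "\<lambda>k y. complex_of_real (normal_density 0 (s k) (y - c * x w k)) * iexp (b k * y)"
    have int: "integrable lborel (?f k)" if "k < m" for k
    proof -
      have "integrable lborel (\<lambda>y. normal_density (c * x w k) (s k) y)" using s_pos[OF that] by simp
      then have "integrable lborel (\<lambda>y. normal_density 0 (s k) (y - c * x w k))" by (simp add: normal_density_def)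
      then show ?thesis by (intro integrable_iexp_weight integrable_of_real) auto
    qed
    have "kern w y *\<^sub>R iexp ((\<Sum>i<m. x w i * a i) + (\<Sum>i<m. y i * b i)) = iexp (\<Sum>i<m. x w i * a i) * (\<Prod>k<m. ?f k (y k))" for y
      by (simp add: kern_def scaleR_conv_of_real prod.distrib exp_sum distrib_left exp_add sum_distrib_left mult_ac)
    then have "(\<integral>y. kern w y *\<^sub>R iexp ((\<Sum>i<m. x w i * a i) + (\<Sum>i<m. y i * b i)) \<partial>lebesgue_Rn m) =
      iexp (\<Sum>i<m. x w i * a i) * (\<integral>y. (\<Prod>k<m. ?f k (y k)) \<partial>Pi\<^sub>M {..<m} (\<lambda>_. lborel))"
      by (simp add: lebesgue_Rn_def)
    also have "(\<integral>y. (\<Prod>k<m. ?f k (y k)) \<partial>Pi\<^sub>M {..<m} (\<lambda>_. lborel)) = (\<Prod>k<m. (CLINT y|lborel. ?f k y))"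
      by (rule product_integral_prod) (use int in auto)
    also have "\<dots> = (\<Prod>k<m. iexp (b k * (c * x w k)) * complex_of_real (exp (- (s k)\<^sup>2 * (b k)\<^sup>2 / 2)))"
      by (intro prod.cong refl char_normal_density s_pos) auto
    also have "\<dots> = iexp (\<Sum>k<m. b k * (c * x w k)) * complex_of_real (exp (\<Sum>k<m. - (s k)\<^sup>2 * (b k)\<^sup>2 / 2))"
      by (simp add: prod.distrib exp_sum sum_distrib_left)
    also have "(\<Sum>k<m. - (s k)\<^sup>2 * (b k)\<^sup>2 / 2) = - (\<Sum>k<m. (s k)\<^sup>2 * (b k)\<^sup>2) / 2"
      by (simp add: sum_negf sum_divide_distrib)
    also have "iexp (\<Sum>i<m. x w i * a i) * (iexp (\<Sum>k<m. b k * (c * x w k)) * complex_of_real (exp (- (\<Sum>k<m. (s k)\<^sup>2 * (b k)\<^sup>2) / 2))) =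
       iexp (\<Sum>i<m. x w i * (a i + c * b i)) * complex_of_real (exp (- (\<Sum>k<m. (s k)\<^sup>2 * (b k)\<^sup>2) / 2))"
    proof -
      have "(\<Sum>i<m. x w i * (a i + c * b i)) = (\<Sum>i<m. x w i * a i) + (\<Sum>k<m. b k * (c * x w k))"
        by (simp add: distrib_left sum.distrib mult_ac)
      then show ?thesis by (simp only: of_real_add distrib_left exp_add mult.assoc)
    qed
    finally show ?thesis .
  qed
  have "(CLINT z|distr M (RnB \<Otimes>\<^sub>M RnB) (\<lambda>w. (x w, Y w)). iexp ((\<Sum>i<m. fst z i * a i) + (\<Sum>i<m. snd z i * b i)))
     = (CLINT w|M. iexp ((\<Sum>k<m. x w k * a k) + (\<Sum>k<m. Y w k * b k)))"
    by (subst integral_distr[OF m1 me]) simp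
  also have "\<dots> = (CLINT w|M. (\<integral>y. kern w y *\<^sub>R iexp ((\<Sum>i<m. x w i * a i) + (\<Sum>i<m. y i * b i)) \<partial>lebesgue_Rn m))"
    unfolding inner channel_char by simp
  also have "\<dots> = (CLINT p|joint. iexp ((\<Sum>i<m. x (fst p) i * a i) + (\<Sum>i<m. snd p i * b i)))"
  proof (subst joint_integral(1))
    have [measurable]: "(\<lambda>p. x (fst p) i) \<in> borel_measurable joint" "(\<lambda>p. snd p i) \<in> borel_measurable joint" if "i < m" for i
    proof -
      have "fst \<in> measurable joint M" "snd \<in> measurable joint (lebesgue_Rn m)" by measurable
      then show "(\<lambda>p. x (fst p) i) \<in> borel_measurable joint" "(\<lambda>p. snd p i) \<in> borel_measurable joint"
        using measurable_compose[OF _ x_comp[OF that]] measurable_compose[OF _ lebesgue_Rn_component[OF that]] by blast+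
    qed
    show "integrable joint (\<lambda>p. iexp ((\<Sum>i<m. x (fst p) i * a i) + (\<Sum>i<m. snd p i * b i)))"
      by (rule Jt.integrable_const_bound[where B=1]) auto
  qed simp
  also have "\<dots> = (CLINT z|distr joint (RnB \<Otimes>\<^sub>M RnB) (\<lambda>(w, y). (x w, y)). iexp ((\<Sum>i<m. fst z i * a i) + (\<Sum>i<m. snd z i * b i)))"
    by (subst integral_distr[OF m2 me]) (simp add: case_prod_beta')
  finally show "(CLINT z|distr M (RnB \<Otimes>\<^sub>M RnB) (\<lambda>w. (x w, Y w)). iexp (\<Sum>j\<in>J. (case j of Inl k \<Rightarrow> fst z k | Inr k \<Rightarrow> snd z k) \<bullet> k j)) =
     (CLINT z|distr joint (RnB \<Otimes>\<^sub>M RnB) (\<lambda>(w, y). (x w, y)). iexp (\<Sum>j\<in>J. (case j of Inl k \<Rightarrow> fst z k | Inr k \<Rightarrow> snd z k) \<bullet> k j))"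
    unfolding lin .
qed (auto)

end

lemma integrable_mult_bounded:
  fixes u g :: "'a \<Rightarrow> complex"
  assumes u: "integrable M u" and [measurable]: "g \<in> borel_measurable M" and g: "\<And>x. x \<in> space M \<Longrightarrow> cmod (g x) \<le> C"
  shows "integrable M (\<lambda>x. u x * g x)"
proof (rule Bochner_Integration.integrable_bound)
  show "integrable M (\<lambda>x. complex_of_real C * u x)" using u by simp
  show "AE x in M. norm (u x * g x) \<le> norm (complex_of_real C * u x)"
  proof (rule AE_I2)
    fix x assume "x \<in> space M"
    from g[OF this] have "cmod (g x) \<le> \<bar>C\<bar>" by linarith
    then show "norm (u x * g x) \<le> norm (complex_of_real C * u x)"
      by (simp add: norm_mult mult.commute[of "cmod (u x)"] mult_right_mono)
  qed
qed (use u in measurable)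

text \<open>Two densities of the same law agree almost everywhere. Every open box around
  \<open>y\<close> has positive measure and so contains a point of agreement; shrinking the boxes,
  continuity gives agreement at \<open>y\<close>.\<close>

lemma smooth_density_unique:
  assumes p: "is_smooth_density M n Z p" and q: "is_smooth_density M n Z q" and y: "y \<in> Rn n"
  shows "p y = q y"
proof -
  interpret L: sigma_finite_measure "lebesgue_Rn n" by (rule sigma_finite_lebesgue_Rn)
  interpret product_sigma_finite "\<lambda>_. lborel :: real measure" by standard
  have cont: "continuous_on (Rn n) p" "continuous_on (Rn n) q"
    using p q by (auto simp: is_smooth_density_def twice_cont_diff_def)
  have "AE y in lebesgue_Rn n. ennreal (p y) = ennreal (q y)"
    using p q by (intro L.density_unique) (auto simp: is_smooth_density_def distributed_def)
  then have ae: "AE y in lebesgue_Rn n. p y = q y"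
  proof (rule AE_mp, intro AE_I2 impI)
    fix y assume "y \<in> space (lebesgue_Rn n)" "ennreal (p y) = ennreal (q y)"
    moreover from this have "0 < p y" "0 < q y" using p q by (auto simp: is_smooth_density_def space_lebesgue_Rn)
    ultimately show "p y = q y" by (simp add: ennreal_inj)
  qed
  define B where "B i = Pi\<^sub>E {..<n} (\<lambda>k. {y k - 1 / real (Suc i)<..<y k + 1 / real (Suc i)})" for i
  have B_sets: "B i \<in> sets (lebesgue_Rn n)" for i unfolding B_def lebesgue_Rn_def by (intro sets_PiM_I_finite) auto
  have "emeasure (lebesgue_Rn n) (B i) = (\<Prod>k<n. ennreal (2 / real (Suc i)))" for i
    unfolding B_def lebesgue_Rn_def by (subst emeasure_PiM) auto
  then have "emeasure (lebesgue_Rn n) (B i) \<noteq> 0" for i by (simp add: prod_ennreal)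
  then have "\<exists>z\<in>B i. p z = q z" for i
  proof (rule contrapos_np)
    assume "\<not> (\<exists>z\<in>B i. p z = q z)"
    then have "AE z in lebesgue_Rn n. z \<notin> B i" using ae by (auto elim!: AE_mp)
    moreover have "{z \<in> space (lebesgue_Rn n). \<not> z \<notin> B i} = B i" using sets.sets_into_space[OF B_sets] by auto
    ultimately show "emeasure (lebesgue_Rn n) (B i) = 0"
      using AE_iff_measurable[OF B_sets, of "\<lambda>z. z \<notin> B i"] by blast
  qed
  then obtain z where z: "\<And>i. z i \<in> B i" "\<And>i. p (z i) = q (z i)" by metis
  have zR: "z i \<in> Rn n" for i using z(1)[of i] by (auto simp: B_def PiE_def)
  have comp: "(\<lambda>i. z i k) \<longlonglongrightarrow> y k" for k
  proof (cases "k < n")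
    case True
    have b: "\<bar>z i k - y k\<bar> \<le> 1 / real (Suc i)" for i
    proof -
      have "z i k \<in> {y k - 1 / real (Suc i)<..<y k + 1 / real (Suc i)}"
        using PiE_mem[OF z(1)[of i, unfolded B_def], of k] True by simp
      then show ?thesis unfolding abs_le_iff greaterThanLessThan_iff by linarith
    qed
    have l: "(\<lambda>i. 1 / real (Suc i)) \<longlonglongrightarrow> 0" using LIMSEQ_Suc[OF lim_const_over_n[of "1 :: real"]] by simp
    have "(\<lambda>i. z i k - y k) \<longlonglongrightarrow> 0"
      by (rule Lim_null_comparison[OF _ l]) (use b in \<open>simp only: real_norm_def eventually_True\<close>)
    then show ?thesis by (simp add: LIM_zero_iff)
  next
    case False
    then have "z i k = y k" for i using zR[of i] y by (auto simp: PiE_def extensional_def)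
    then show ?thesis by simp
  qed
  have "z \<longlonglongrightarrow> y"
  proof -
    have "limitin (product_topology (\<lambda>_. euclidean) UNIV) z y sequentially"
      unfolding limitin_componentwise using comp by auto
    then show ?thesis by (simp add: euclidean_product_topology)
  qed
  have ev: "\<forall>\<^sub>F i in sequentially. z i \<in> Rn n" by (rule always_eventually) (rule allI, rule zR)
  have "(\<lambda>i. p (z i)) \<longlonglongrightarrow> p y" "(\<lambda>i. q (z i)) \<longlonglongrightarrow> q y"
    by (rule continuous_on_tendsto_compose[OF cont(1) \<open>z \<longlonglongrightarrow> y\<close> y ev],
        rule continuous_on_tendsto_compose[OF cont(2) \<open>z \<longlonglongrightarrow> y\<close> y ev])
  then show ?thesis using z(2) LIMSEQ_unique by simp
qed

context gaussian_channel
begin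

lemma channel_nn_integral:
  assumes [measurable]: "f \<in> borel_measurable (RnB \<Otimes>\<^sub>M RnB)"
  shows "(\<integral>\<^sup>+w. f (x w, Y w) \<partial>M) = (\<integral>\<^sup>+y. \<integral>\<^sup>+w. ennreal (kern w y) * f (x w, y) \<partial>M \<partial>lebesgue_Rn m)"
proof -
  interpret L: sigma_finite_measure "lebesgue_Rn m" by (rule sigma_finite_lebesgue_Rn)
  interpret P: pair_sigma_finite M "lebesgue_Rn m" ..
  have "(\<integral>\<^sup>+w. f (x w, Y w) \<partial>M) = (\<integral>\<^sup>+p. f p \<partial>distr M (RnB \<Otimes>\<^sub>M RnB) (\<lambda>w. (x w, Y w)))"
    by (subst nn_integral_distr) auto
  also have "\<dots> = (\<integral>\<^sup>+p. f (x (fst p), snd p) \<partial>joint)"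
    unfolding joint_law by (subst nn_integral_distr) (auto simp: case_prod_beta')
  also have "\<dots> = (\<integral>\<^sup>+w. \<integral>\<^sup>+y. ennreal (kern w y) * f (x w, y) \<partial>lebesgue_Rn m \<partial>M)"
    by (subst joint_nn_integral) auto
  also have "\<dots> = (\<integral>\<^sup>+y. \<integral>\<^sup>+w. ennreal (kern w y) * f (x w, y) \<partial>M \<partial>lebesgue_Rn m)"
    by (rule P.Fubini'[symmetric]) measurable
  finally show ?thesis .
qed

lemma dens_meas [measurable]: "dens \<in> borel_measurable (lebesgue_Rn m)"
  unfolding dens_def by measurable

lemma kern_nn_dens: "(\<integral>\<^sup>+w. ennreal (kern w y) \<partial>M) = ennreal (dens y)"
  unfolding dens_def by (rule nn_integral_eq_integral[OF kern_integrable]) (auto intro!: less_imp_le kern_pos)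

lemma distributed_dens: "distributed M (lebesgue_Rn m) Y (\<lambda>y. ennreal (dens y))"
  unfolding distributed_def
proof (intro conjI)
  show Ym: "Y \<in> measurable M (lebesgue_Rn m)" by measurable
  show "distr M (lebesgue_Rn m) Y = density (lebesgue_Rn m) (\<lambda>y. ennreal (dens y))"
  proof (rule measure_eqI)
    fix A assume "A \<in> sets (distr M (lebesgue_Rn m) Y)"
    then have A[measurable]: "A \<in> sets (lebesgue_Rn m)" by simp
    then have [measurable]: "A \<in> sets RnB" by (simp add: sets_lebesgue_Rn)
    have "emeasure (distr M (lebesgue_Rn m) Y) A = (\<integral>\<^sup>+y. indicator A y \<partial>distr M (lebesgue_Rn m) Y)" by simp
    also have "\<dots> = (\<integral>\<^sup>+w. indicator A (snd (x w, Y w)) \<partial>M)"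
      by (subst nn_integral_distr[OF Ym]) auto
    also have "\<dots> = (\<integral>\<^sup>+y. \<integral>\<^sup>+w. ennreal (kern w y) * indicator A (snd (x w, y)) \<partial>M \<partial>lebesgue_Rn m)"
      by (rule channel_nn_integral) measurable
    also have "\<dots> = (\<integral>\<^sup>+y. ennreal (dens y) * indicator A y \<partial>lebesgue_Rn m)"
      by (intro nn_integral_cong) (simp add: nn_integral_multc kern_nn_dens)
    also have "\<dots> = emeasure (density (lebesgue_Rn m) (\<lambda>y. ennreal (dens y))) A"
      by (subst emeasure_density) auto
    finally show "emeasure (distr M (lebesgue_Rn m) Y) A = emeasure (density (lebesgue_Rn m) (\<lambda>y. ennreal (dens y))) A" .
  qed simp
qed measurable

lemma is_smooth_density_dens: "is_smooth_density M m Y dens"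
  unfolding is_smooth_density_def using distributed_dens dens_pos twice_cont_diff_dens by blast

lemma smooth_density_eq_dens:
  assumes "y \<in> Rn m"
  shows "smooth_density M m Y y = dens y"
proof -
  have "is_smooth_density M m Y (smooth_density M m Y)"
    unfolding smooth_density_def by (rule someI[of _ dens]) (rule is_smooth_density_dens)
  then show ?thesis using smooth_density_unique is_smooth_density_dens assms by blast
qed

definition wint :: "nat \<Rightarrow> (nat \<Rightarrow> real) \<Rightarrow> real" where
  "wint j y = (\<integral>w. x w j * kern w y \<partial>M)"

text \<open>Bayes' formula for the posterior mean of \<open>x j\<close> given \<open>Y = y\<close>.
  As \<open>dens\<close> is positive, it is meaningful for every \<open>y\<close> and not just
  almost every one; this version is the one that turns out to be continuous.\<close>

definition post :: "nat \<Rightarrow> (nat \<Rightarrow> real) \<Rightarrow> real" where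
  "post j y = wint j y / dens y"

lemma kern_mult_integrable:
  assumes "integrable M f"
  shows "integrable M (\<lambda>w. f w * kern w y)"
proof -
  let ?C = "\<Prod>k<m. 1 / s k + 1 / (s k)\<^sup>2 + 3 / s k ^ 3"
  have [measurable]: "(\<lambda>w. kern w y) \<in> borel_measurable M" using kern_integrable by auto
  have "integrable M (\<lambda>w. ?C * f w)" using assms by simp
  then show ?thesis
    by (rule Bochner_Integration.integrable_bound)
       (use assms kern_bounded[of _ y] in \<open>auto simp: abs_mult mult.commute intro!: AE_I2 mult_left_mono intro: order_trans[OF _ abs_ge_self]\<close>)
qed

text \<open>Tweedie's formula in coordinates: differentiating the normal kernel in
  \<open>y k\<close> multiplies it by \<open>- (y k - c * x w k) / (s k)^2\<close>, and averaging
  over the input replaces \<open>x w k\<close> by its posterior mean.\<close>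

lemma grad_log_smooth_density:
  assumes y: "y \<in> Rn m" and k: "k < m" and int: "integrable M (\<lambda>w. x w k)"
  shows "grad_log m (smooth_density M m Y) y k = - (y k - c * post k y) / (s k)\<^sup>2"
proof -
  have upd: "y(k := t) \<in> Rn m" for t using y k by (auto simp: PiE_def extensional_def)
  let ?r = "(\<lambda>_. 0)(k := Suc 0)"
  have d: "((\<lambda>t. dens (y(k := t))) has_real_derivative smooth_deriv ?r (y(k := y k))) (at (y k))"
    unfolding dens_eq_smooth_deriv by (rule smooth_deriv_has_derivative[OF k]) simp
  have "((\<lambda>t. ln (dens (y(k := t)))) has_real_derivative smooth_deriv ?r y / dens y) (at (y k))"
    using DERIV_ln_divide[THEN DERIV_chain2, OF _ d] dens_pos[of y] by simp
  then have "((\<lambda>t. ln (smooth_density M m Y (y(k := t)))) has_real_derivative smooth_deriv ?r y / dens y) (at (y k))"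
    using smooth_density_eq_dens[OF upd] by simp
  then have "grad_log m (smooth_density M m Y) y k = smooth_deriv ?r y / dens y"
    unfolding grad_log_def using k by (simp add: DERIV_imp_deriv)
  also have "smooth_deriv ?r y = (\<integral>w. - (y k / (s k)\<^sup>2) * kern w y + c / (s k)\<^sup>2 * (x w k * kern w y) \<partial>M)"
    unfolding smooth_deriv_def
  proof (rule Bochner_Integration.integral_cong[OF refl])
    fix w
    have split: "(\<Prod>k<m. f k) = f k * (\<Prod>k\<in>{..<m} - {k}. f k)" for f :: "nat \<Rightarrow> real"
      using k by (subst prod.remove[of _ k]) auto
    let ?P = "\<Prod>i\<in>{..<m} - {k}. normal_density 0 (s i) (y i - c * x w i)"
    have "(\<Prod>i\<in>{..<m} - {k}. normal_deriv (?r i) (s i) (y i - c * x w i)) = ?P"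
      by (rule prod.cong) auto
    then have "(\<Prod>i<m. normal_deriv (?r i) (s i) (y i - c * x w i)) = - ((y k - c * x w k) / (s k)\<^sup>2) * kern w y"
      unfolding kern_def split by simp
    then show "(\<Prod>i<m. normal_deriv (?r i) (s i) (y i - c * x w i)) = - (y k / (s k)\<^sup>2) * kern w y + c / (s k)\<^sup>2 * (x w k * kern w y)"
      by (simp add: algebra_simps diff_divide_distrib)
  qed
  also have "\<dots> = - (y k / (s k)\<^sup>2) * dens y + c / (s k)\<^sup>2 * wint k y"
    unfolding dens_def wint_def
    by (subst Bochner_Integration.integral_add) (auto intro!: integrable_mult_right kern_integrable kern_mult_integrable int)
  also have "\<dots> / dens y = - (y k - c * post k y) / (s k)\<^sup>2"
    using dens_pos[of y] s_pos[OF k] by (simp add: post_def field_simps)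
  finally show ?thesis .
qed

lemma wint_meas [measurable]: "j < m \<Longrightarrow> wint j \<in> borel_measurable (lebesgue_Rn m)"
  unfolding wint_def by measurable

lemma post_meas [measurable]: "j < m \<Longrightarrow> post j \<in> borel_measurable (lebesgue_Rn m)"
  unfolding post_def by measurable

lemma post_meas_RnB [measurable]: "j < m \<Longrightarrow> post j \<in> borel_measurable RnB"
  using post_meas[of j] measurable_cong_sets[OF sets_lebesgue_Rn refl] by blast

text \<open>The posterior variance is nonnegative.\<close>

lemma dens_post_sq_le:
  assumes int: "integrable M (\<lambda>w. x w j)" and int2: "integrable M (\<lambda>w. (x w j)\<^sup>2)"
  shows "dens y * (post j y)\<^sup>2 \<le> (\<integral>w. (x w j)\<^sup>2 * kern w y \<partial>M)"
proof -
  let ?p = "post j y"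
  have "0 \<le> (\<integral>w. (x w j - ?p)\<^sup>2 * kern w y \<partial>M)"
    by (intro integral_nonneg_AE AE_I2 mult_nonneg_nonneg) (auto intro!: less_imp_le kern_pos)
  also have "\<dots> = (\<integral>w. (x w j)\<^sup>2 * kern w y - 2 * ?p * (x w j * kern w y) + ?p\<^sup>2 * kern w y \<partial>M)"
    by (intro Bochner_Integration.integral_cong refl) (simp add: power2_diff algebra_simps)
  also have "\<dots> = (\<integral>w. (x w j)\<^sup>2 * kern w y \<partial>M) - 2 * ?p * wint j y + ?p\<^sup>2 * dens y"
    unfolding wint_def dens_def
    using kern_mult_integrable[OF int, of y] kern_mult_integrable[OF int2, of y] kern_integrable[of y] by simp
  also have "wint j y = ?p * dens y" using dens_pos[of y] by (simp add: post_def)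
  finally show ?thesis by (simp add: power2_eq_square algebra_simps)
qed

lemma post_sq_integrable:
  assumes j: "j < m" and int: "integrable M (\<lambda>w. x w j)" and int2: "integrable M (\<lambda>w. (x w j)\<^sup>2)"
  shows "integrable M (\<lambda>w. (post j (Y w))\<^sup>2)" "(\<integral>w. (post j (Y w))\<^sup>2 \<partial>M) \<le> (\<integral>w. (x w j)\<^sup>2 \<partial>M)"
proof -
  have [measurable]: "(\<lambda>p. fst p j) \<in> borel_measurable (RnB \<Otimes>\<^sub>M RnB)"
    using j by (auto intro: measurable_compose[OF measurable_fst])
  have [measurable]: "post j \<in> borel_measurable (lebesgue_Rn m)" "post j \<in> borel_measurable RnB" using j by measurable
  have "(\<integral>\<^sup>+w. ennreal ((post j (Y w))\<^sup>2) \<partial>M) = (\<integral>\<^sup>+y. ennreal (dens y) * ennreal ((post j y)\<^sup>2) \<partial>lebesgue_Rn m)"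
    by (rule distributed_nn_integral[OF distributed_dens, symmetric]) measurable
  also have "\<dots> \<le> (\<integral>\<^sup>+y. \<integral>\<^sup>+w. ennreal (kern w y) * ennreal ((fst (x w, y) j)\<^sup>2) \<partial>M \<partial>lebesgue_Rn m)"
  proof (rule nn_integral_mono)
    fix y
    have "ennreal (dens y) * ennreal ((post j y)\<^sup>2) = ennreal (dens y * (post j y)\<^sup>2)"
      using dens_pos[of y] by (simp add: ennreal_mult less_imp_le)
    also have "\<dots> \<le> ennreal (\<integral>w. (x w j)\<^sup>2 * kern w y \<partial>M)" using dens_post_sq_le[OF int int2] by (rule ennreal_leI)
    also have "\<dots> = (\<integral>\<^sup>+w. ennreal ((x w j)\<^sup>2 * kern w y) \<partial>M)"
      by (rule nn_integral_eq_integral[symmetric, OF kern_mult_integrable[OF int2]]) (intro AE_I2 mult_nonneg_nonneg zero_le_power2 less_imp_le[OF kern_pos])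
    also have "\<dots> = (\<integral>\<^sup>+w. ennreal (kern w y) * ennreal ((fst (x w, y) j)\<^sup>2) \<partial>M)"
      by (intro nn_integral_cong) (simp add: ennreal_mult' mult.commute less_imp_le[OF kern_pos])
    finally show "ennreal (dens y) * ennreal ((post j y)\<^sup>2) \<le> (\<integral>\<^sup>+w. ennreal (kern w y) * ennreal ((fst (x w, y) j)\<^sup>2) \<partial>M)" .
  qed
  also have "\<dots> = (\<integral>\<^sup>+w. ennreal ((fst (x w, Y w) j)\<^sup>2) \<partial>M)"
    by (rule channel_nn_integral[symmetric]) measurable
  also have "\<dots> = ennreal (\<integral>w. (x w j)\<^sup>2 \<partial>M)"
    using int2 by (simp add: nn_integral_eq_integral)
  finally have le: "(\<integral>\<^sup>+w. ennreal ((post j (Y w))\<^sup>2) \<partial>M) \<le> ennreal (\<integral>w. (x w j)\<^sup>2 \<partial>M)" .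
  have [measurable]: "(\<lambda>w. post j (Y w)) \<in> borel_measurable M" by measurable
  show i: "integrable M (\<lambda>w. (post j (Y w))\<^sup>2)"
    using le by (intro integrableI_nonneg) (auto intro: le_less_trans)
  show "(\<integral>w. (post j (Y w))\<^sup>2 \<partial>M) \<le> (\<integral>w. (x w j)\<^sup>2 \<partial>M)"
    using le by (subst (asm) nn_integral_eq_integral[OF i]) (auto simp: ennreal_le_iff)
qed

lemma post_integrable:
  assumes "j < m" "integrable M (\<lambda>w. x w j)" "integrable M (\<lambda>w. (x w j)\<^sup>2)"
  shows "integrable M (\<lambda>w. post j (Y w))"
proof -
  have [measurable]: "(\<lambda>w. post j (Y w)) \<in> borel_measurable M" using assms(1) by measurable
  show ?thesis by (rule square_integrable_imp_integrable[OF _ post_sq_integrable(1)[OF assms]]) measurable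
qed

text \<open>In the model \<open>joint\<close>, integrating first over \<open>w\<close> replaces
  \<open>x w j * kern w y\<close> by \<open>dens y * post j y\<close>. The result characterises
  \<open>post j (Y w)\<close> as the conditional expectation of \<open>x j\<close> given
  \<open>Y\<close>.\<close>

lemma post_orthogonal:
  fixes f :: "(nat \<Rightarrow> real) \<Rightarrow> complex"
  assumes j: "j < m" and int: "integrable M (\<lambda>w. x w j)" and int2: "integrable M (\<lambda>w. (x w j)\<^sup>2)"
    and f[measurable]: "f \<in> borel_measurable RnB" and fb: "\<And>y. cmod (f y) \<le> C"
  shows "(CLINT w|M. complex_of_real (x w j - post j (Y w)) * f (Y w)) = 0"
proof -
  have xj[measurable]: "(\<lambda>p. fst p j) \<in> borel_measurable (RnB \<Otimes>\<^sub>M RnB)" "(\<lambda>w. x w j) \<in> borel_measurable M"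
    using j by (auto intro: measurable_compose[OF measurable_fst])
  have pj[measurable]: "post j \<in> borel_measurable (lebesgue_Rn m)" "post j \<in> borel_measurable RnB" using j by measurable
  have fL[measurable]: "f \<in> borel_measurable (lebesgue_Rn m)"
    using f measurable_cong_sets[OF sets_lebesgue_Rn refl] by blast
  let ?F = "\<lambda>p. complex_of_real (fst p j) * f (snd p)"
  have i1: "integrable M (\<lambda>w. complex_of_real (x w j) * f (Y w))"
    by (rule integrable_mult_bounded[where C=C]) (use int fb in auto)
  have i2: "integrable M (\<lambda>w. complex_of_real (post j (Y w)) * f (Y w))"
    by (rule integrable_mult_bounded[where C=C]) (use post_integrable[OF j int int2] fb in auto)
  have ij: "integrable joint (\<lambda>p. ?F (x (fst p), snd p))"
  proof -
    have "integrable (distr M (RnB \<Otimes>\<^sub>M RnB) (\<lambda>w. (x w, Y w))) ?F"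
      using i1 by (subst integrable_distr_eq) auto
    then show ?thesis unfolding joint_law
      by (subst (asm) integrable_distr_eq) (auto simp: case_prod_beta')
  qed
  have "(CLINT w|M. complex_of_real (x w j) * f (Y w)) = (CLINT p|distr M (RnB \<Otimes>\<^sub>M RnB) (\<lambda>w. (x w, Y w)). ?F p)"
    by (subst integral_distr) auto
  also have "\<dots> = (CLINT p|joint. ?F (x (fst p), snd p))"
    unfolding joint_law by (subst integral_distr) (auto simp: case_prod_beta')
  also have "\<dots> = (\<integral>y. \<integral>w. kern w y *\<^sub>R (complex_of_real (x w j) * f y) \<partial>M \<partial>lebesgue_Rn m)"
    by (subst joint_integral(2)[OF ij]) simp
  also have "\<dots> = (\<integral>y. dens y *\<^sub>R (complex_of_real (post j y) * f y) \<partial>lebesgue_Rn m)"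
  proof (rule Bochner_Integration.integral_cong[OF refl])
    fix y
    have "(\<integral>w. kern w y *\<^sub>R (complex_of_real (x w j) * f y) \<partial>M) = (\<integral>w. complex_of_real (x w j * kern w y) * f y \<partial>M)"
      by (intro Bochner_Integration.integral_cong refl) (simp add: scaleR_conv_of_real mult_ac)
    also have "\<dots> = complex_of_real (wint j y) * f y"
      unfolding wint_def by (simp only: integral_mult_left_zero integral_complex_of_real)
    also have "wint j y = dens y * post j y" using dens_pos[of y] by (simp add: post_def)
    finally show "(\<integral>w. kern w y *\<^sub>R (complex_of_real (x w j) * f y) \<partial>M) = dens y *\<^sub>R (complex_of_real (post j y) * f y)"
      by (simp add: scaleR_conv_of_real mult_ac)
  qed
  also have "\<dots> = (\<integral>y. complex_of_real (post j y) * f y \<partial>density (lebesgue_Rn m) (\<lambda>y. ennreal (dens y)))"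
    using dens_pos by (subst integral_density) (auto intro: less_imp_le)
  also have "density (lebesgue_Rn m) (\<lambda>y. ennreal (dens y)) = distr M (lebesgue_Rn m) Y"
    using distributed_dens by (simp add: distributed_def)
  also have "(\<integral>y. complex_of_real (post j y) * f y \<partial>distr M (lebesgue_Rn m) Y) = (CLINT w|M. complex_of_real (post j (Y w)) * f (Y w))"
    by (subst integral_distr) auto
  finally show ?thesis using i1 i2 by (simp add: left_diff_distrib)
qed

end

text \<open>Joint continuity of the posterior mean in the channel parameters and the observation,
  for a fixed prior. Along a path of the process time changes all three at once, so this is what
  makes the reverse drift continuous in time. The bounds on the kernels converge together with
  \<open>sn n\<close> and are therefore bounded, which gives the dominating function.\<close>

lemma post_tendsto:
  assumes ch: "\<And>n. gaussian_channel M m x (Yn n) (cn n) (sn n)" and ch0: "gaussian_channel M m x Y c s"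
    and c: "cn \<longlonglongrightarrow> c" and s: "\<And>k. k < m \<Longrightarrow> (\<lambda>n. sn n k) \<longlonglongrightarrow> s k"
    and y: "\<And>k. k < m \<Longrightarrow> (\<lambda>n. yn n k) \<longlonglongrightarrow> y k"
    and j: "j < m" and int: "integrable M (\<lambda>w. x w j)"
  shows "(\<lambda>n. gaussian_channel.post M m x (cn n) (sn n) j (yn n)) \<longlonglongrightarrow> gaussian_channel.post M m x c s j y"
proof -
  interpret A: gaussian_channel M m x Y c s by fact
  interpret B: gaussian_channel M m x "Yn n" "cn n" "sn n" for n by (rule ch)
  define h where "h t = (\<Prod>k<m. 1 / t k + 1 / (t k)\<^sup>2 + 3 / t k ^ 3)" for t :: "nat \<Rightarrow> real"
  have "(\<lambda>n. h (sn n)) \<longlonglongrightarrow> h s" unfolding h_def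
    by (intro tendsto_intros s) (use A.s_pos in \<open>auto simp: less_imp_neq[symmetric]\<close>)
  then have "convergent (\<lambda>n. h (sn n))" by (rule convergentI)
  then have "Bseq (\<lambda>n. h (sn n))" by (rule convergent_imp_Bseq)
  then obtain K where K: "\<And>n. \<bar>h (sn n)\<bar> \<le> K" unfolding Bseq_def by auto
  have kb: "\<bar>B.kern n w (yn n)\<bar> \<le> K" for n w
    using B.kern_bounded[of n w "yn n"] K[of n] unfolding h_def by linarith
  have kl: "(\<lambda>n. B.kern n w (yn n)) \<longlonglongrightarrow> A.kern w y" for w
    unfolding A.kern_def B.kern_def normal_density_def
  proof (intro tendsto_intros s y c)
    fix k assume k: "k \<in> {..<m}"
    then have "0 < s k" using A.s_pos by auto
    then show "sqrt (2 * pi * (s k)\<^sup>2) \<noteq> 0" "2 * (s k)\<^sup>2 \<noteq> 0" by auto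
  qed auto
  have [measurable]: "(\<lambda>w. B.kern n w (yn n)) \<in> borel_measurable M" "(\<lambda>w. A.kern w y) \<in> borel_measurable M" for n
    using B.kern_integrable A.kern_integrable by auto
  have "(\<lambda>n. B.dens n (yn n)) \<longlonglongrightarrow> A.dens y"
    unfolding A.dens_def B.dens_def
    by (rule integral_dominated_convergence[where w="\<lambda>_. K"]) (use kl kb in auto)
  moreover have "(\<lambda>n. B.wint n j (yn n)) \<longlonglongrightarrow> A.wint j y"
    unfolding A.wint_def B.wint_def
  proof (rule integral_dominated_convergence[where w="\<lambda>w. \<bar>x w j\<bar> * K"])
    show "AE w in M. norm (x w j * B.kern n w (yn n)) \<le> \<bar>x w j\<bar> * K" for n
      using kb by (intro AE_I2) (simp add: abs_mult mult_left_mono)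
  qed (use kl int in \<open>auto intro!: tendsto_intros\<close>)
  ultimately show ?thesis
    unfolding A.post_def B.post_def using A.dens_pos[of y] by (intro tendsto_divide) auto
qed

lemma bounded_linear_Pn: "bounded_linear (Pn e n)"
  unfolding Pn_def[abs_def]
  by (intro bounded_linear_sum bounded_linear_compose[OF bounded_linear_scaleR_left bounded_linear_inner_left])

lemma Qn_inner: "x \<bullet> Qn e lam n y = (\<Sum>k<n. lam k * (x \<bullet> e k) * (y \<bullet> e k))"
  by (simp add: Qn_def inner_sum_right inner_commute mult_ac)

lemma linear_Qn: "linear (Qn e lam n)"
  by (rule linearI) (simp_all add: Qn_def inner_add_right distrib_left distrib_right scaleR_add_left sum.distrib
      scaleR_sum_right mult_ac)

lemma Qn_psd: "(\<And>k. 0 \<le> lam k) \<Longrightarrow> 0 \<le> x \<bullet> Qn e lam n x"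
  unfolding Qn_inner by (intro sum_nonneg) (simp add: mult.assoc)

section \<open>Time reversal\<close>

text \<open>\<open>B t\<close> stands for the projected noise integral of \<psi>.
  \<open>B_char\<close> says that \<open>B\<close> is centred Gaussian with covariance
  \<open>noise_var (min s t)\<close> times \<open>Qn e lam m\<close> and independent of
  \<open>x0\<close>. The reversal argument sees the law of the noise only through this formula;
  Wiener processes do not enter it.\<close>

locale ou_process = prob_space M + noise_schedule T \<alpha> \<alpha>'
  for M :: "'w measure" and T \<alpha> \<alpha>' +
  fixes e :: "nat \<Rightarrow> 'h::{real_inner,banach,second_countable_topology}" and lam :: "nat \<Rightarrow> real" and m :: nat
    and x0 :: "'w \<Rightarrow> 'h" and B :: "real \<Rightarrow> 'w \<Rightarrow> 'h"
  assumes orth: "\<And>i j. e i \<bullet> e j = (if i = j then 1 else 0)"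
    and lam_pos: "\<And>k. 0 < lam k"
    and x0_meas [measurable]: "x0 \<in> borel_measurable M" and x0_Hn: "\<And>w. Pn e m (x0 w) = x0 w"
    and x0_sq: "integrable M (\<lambda>w. (norm (x0 w))\<^sup>2)"
    and B_meas: "\<And>t. t \<in> {0..T} \<Longrightarrow> B t \<in> borel_measurable M"
    and B_cont: "\<And>w. w \<in> space M \<Longrightarrow> continuous_on {0..T} (\<lambda>t. B t w)"
    and B_Hn: "\<And>t w. Pn e m (B t w) = B t w"
    and B_char: "\<And>(g :: 'h \<Rightarrow> complex) C l u k. g \<in> borel_measurable borel \<Longrightarrow> (\<And>x. cmod (g x) \<le> C) \<Longrightarrow>
      (\<And>j. j < l \<Longrightarrow> u j \<in> {0..T}) \<Longrightarrow>
      (CLINT w|M. g (x0 w) * iexp (\<Sum>j<(l::nat). B (u j) w \<bullet> k j)) =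
      (CLINT w|M. g (x0 w)) * complex_of_real (exp (- (\<Sum>i<l. \<Sum>j<l. (k i \<bullet> Qn e lam m (k j)) * noise_var (min (u i) (u j))) / 2))"
begin

definition X :: "real \<Rightarrow> 'w \<Rightarrow> 'h" where
  "X t w = (1 / growth t) *\<^sub>R (x0 w + B t w)"

abbreviation q :: "'h \<Rightarrow> 'h \<Rightarrow> real" where
  "q h k \<equiv> h \<bullet> Qn e lam m k"

lemma lam_nonneg: "0 \<le> lam k" using lam_pos[of k] by simp

lemma q_nonneg: "0 \<le> q h h" by (rule Qn_psd[OF lam_nonneg])

lemma q_lin [simp]: "q (a *\<^sub>R h) k = a * q h k" "q h (a *\<^sub>R k) = a * q h k" "q (- h) k = - q h k" "q h (- k) = - q h k"
  "q (h + h') k = q h k + q h' k" "q h (k + k') = q h k + q h k'" "q (h - h') k = q h k - q h' k" "q h (k - k') = q h k - q h k'"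
  by (simp_all add: linear_scale[OF linear_Qn] linear_neg[OF linear_Qn] linear_add[OF linear_Qn] linear_diff[OF linear_Qn]
      inner_add_left inner_add_right inner_diff_left inner_diff_right)

lemma q_sum: "q (\<Sum>i\<in>I. f i) k = (\<Sum>i\<in>I. q (f i) k)" "q k (\<Sum>i\<in>I. f i) = (\<Sum>i\<in>I. q k (f i))"
  by (simp_all add: linear_sum[OF linear_Qn] inner_sum_left inner_sum_right)

lemma X_meas: "t \<in> {0..T} \<Longrightarrow> X t \<in> borel_measurable M"
  unfolding X_def[abs_def] using B_meas by measurable

lemma X_cont: "w \<in> space M \<Longrightarrow> continuous_on {0..T} (\<lambda>t. X t w)"
  unfolding X_def by (intro continuous_intros growth_cont B_cont) auto

lemma X_Hn: "Pn e m (X t w) = X t w"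
proof -
  interpret bounded_linear "Pn e m" by (rule bounded_linear_Pn)
  show ?thesis by (simp add: X_def scaleR add x0_Hn B_Hn)
qed

lemma x0_norm_int: "integrable M (\<lambda>w. norm (x0 w))"
  by (rule square_integrable_imp_integrable[OF _ x0_sq]) measurable

lemma coord_int: "integrable M (\<lambda>w. x0 w \<bullet> h)" "integrable M (\<lambda>w. (x0 w \<bullet> h)\<^sup>2)"
proof -
  have i: "integrable M (\<lambda>w. norm (x0 w) * norm h)" "integrable M (\<lambda>w. (norm (x0 w))\<^sup>2 * (norm h)\<^sup>2)"
    using x0_norm_int x0_sq by auto
  show "integrable M (\<lambda>w. x0 w \<bullet> h)"
    by (rule Bochner_Integration.integrable_bound[OF i(1)]) (auto simp: Cauchy_Schwarz_ineq2)
  have "(x0 w \<bullet> h)\<^sup>2 \<le> (norm (x0 w))\<^sup>2 * (norm h)\<^sup>2" for w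
    using Cauchy_Schwarz_ineq[of "x0 w" h] by (simp add: power2_norm_eq_inner)
  then show "integrable M (\<lambda>w. (x0 w \<bullet> h)\<^sup>2)"
    by (intro Bochner_Integration.integrable_bound[OF i(2)]) auto
qed

lemma coord_sum: "k < m \<Longrightarrow> (\<Sum>i<m. a i *\<^sub>R e i) \<bullet> e k = a k"
  by (simp add: inner_sum_left orth if_distrib cong: if_cong)

lemma iota_coord: "k < m \<Longrightarrow> iota e m x k = x \<bullet> e k"
  by (simp add: iota_def)

lemma iota_int: "k < m \<Longrightarrow> integrable M (\<lambda>w. iota e m (x0 w) k)" "k < m \<Longrightarrow> integrable M (\<lambda>w. (iota e m (x0 w) k)\<^sup>2)"
  using coord_int by (simp_all add: iota_coord)

abbreviation std :: "real \<Rightarrow> nat \<Rightarrow> real" where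
  "std t k \<equiv> sqrt (noise_var t * lam k) / growth t"

lemma iota_meas [measurable]: "iota e m \<in> measurable borel (Pi\<^sub>M {..<m} (\<lambda>_. borel))"
  unfolding iota_def[abs_def] by measurable

text \<open>\<open>X t\<close> is the sum of \<open>x0 / growth t\<close> and
  \<open>B t / growth t\<close>, and the coordinates of the latter along the eigenvectors are
  independent. \<open>B_char\<close> is needed at a single time only.\<close>

lemma channel:
  assumes t: "0 < t" "t \<le> T"
  shows "gaussian_channel M m (\<lambda>w. iota e m (x0 w)) (\<lambda>w. iota e m (X t w)) (1 / growth t) (std t)"
proof
  have [measurable]: "X t \<in> borel_measurable M" using t by (intro X_meas) auto
  show "(\<lambda>w. iota e m (x0 w)) \<in> measurable M (Pi\<^sub>M {..<m} (\<lambda>_. borel))" by measurable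
  show "(\<lambda>w. iota e m (X t w)) \<in> measurable M (Pi\<^sub>M {..<m} (\<lambda>_. borel))" by measurable
  show "0 < std t k" if "k < m" for k using noise_var_pos[OF t] lam_pos[of k] by simp
  fix a b :: "nat \<Rightarrow> real"
  define av where "av = (\<Sum>k<m. a k *\<^sub>R e k)"
  define bv where "bv = (\<Sum>k<m. b k *\<^sub>R e k)"
  have bve: "bv \<bullet> e k = b k" if "k < m" for k unfolding bv_def by (rule coord_sum[OF that])
  have qb: "q bv bv = (\<Sum>k<m. lam k * (b k)\<^sup>2)"
    unfolding Qn_inner by (intro sum.cong refl) (simp add: bve power2_eq_square)
  have lin: "(\<Sum>k<m. iota e m x k * c k) = x \<bullet> (\<Sum>k<m. c k *\<^sub>R e k)" for x c
    by (simp add: inner_sum_right iota_def mult.commute)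
  let ?g = "growth t"
  have 1: "(\<Sum>k<m. iota e m (x0 w) k * a k) + (\<Sum>k<m. iota e m (X t w) k * b k) =
      x0 w \<bullet> (av + (1 / ?g) *\<^sub>R bv) + (\<Sum>j<Suc 0. B t w \<bullet> ((1 / ?g) *\<^sub>R bv))" for w
    unfolding lin av_def[symmetric] bv_def[symmetric] X_def by (simp add: inner_add_left inner_add_right add_divide_distrib)
  have 2: "(\<Sum>k<m. iota e m (x0 w) k * (a k + 1 / ?g * b k)) = x0 w \<bullet> (av + (1 / ?g) *\<^sub>R bv)" for w
    unfolding lin av_def bv_def by (simp add: scaleR_add_left sum.distrib scaleR_sum_right)
  have "(CLINT w|M. iexp ((\<Sum>k<m. iota e m (x0 w) k * a k) + (\<Sum>k<m. iota e m (X t w) k * b k))) =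
    (CLINT w|M. (\<lambda>x. iexp (x \<bullet> (av + (1 / ?g) *\<^sub>R bv))) (x0 w) * iexp (\<Sum>j<Suc 0. B ((\<lambda>_. t) j) w \<bullet> ((\<lambda>_. (1 / ?g) *\<^sub>R bv) j)))"
    unfolding 1 of_real_add distrib_left exp_add ..
  also have "\<dots> = (CLINT w|M. iexp (x0 w \<bullet> (av + (1 / ?g) *\<^sub>R bv))) *
    complex_of_real (exp (- (\<Sum>i<Suc 0. \<Sum>j<Suc 0. (q ((1 / ?g) *\<^sub>R bv) ((1 / ?g) *\<^sub>R bv)) * noise_var (min t t)) / 2))"
    by (rule B_char[where C=1]) (use t in auto)
  also have "(\<Sum>i<Suc 0. \<Sum>j<Suc 0. (q ((1 / ?g) *\<^sub>R bv) ((1 / ?g) *\<^sub>R bv)) * noise_var (min t t)) = (\<Sum>k<m. (std t k)\<^sup>2 * (b k)\<^sup>2)"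
  proof -
    have "(std t k)\<^sup>2 = noise_var t * lam k / ?g\<^sup>2" for k
      using noise_var_pos[OF t] lam_pos[of k] by (simp add: power_divide)
    then show ?thesis by (simp add: qb sum_distrib_left sum_distrib_right power2_eq_square mult_ac)
  qed
  finally show "(CLINT w|M. iexp ((\<Sum>k<m. iota e m (x0 w) k * a k) + (\<Sum>k<m. iota e m (X t w) k * b k))) =
    (CLINT w|M. iexp (\<Sum>k<m. iota e m (x0 w) k * (a k + 1 / ?g * b k))) * complex_of_real (exp (- (\<Sum>k<m. (std t k)\<^sup>2 * (b k)\<^sup>2) / 2))"
    unfolding 2 .
qed

definition pmean :: "real \<Rightarrow> 'h \<Rightarrow> 'h" where
  "pmean t x = (\<Sum>k<m. gaussian_channel.post M m (\<lambda>w. iota e m (x0 w)) (1 / growth t) (std t) k (iota e m x) *\<^sub>R e k)"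

definition rdrift :: "real \<Rightarrow> 'h \<Rightarrow> 'h" where
  "rdrift t x = \<kappa>1 t *\<^sub>R x + \<kappa>2 t *\<^sub>R pmean t x"

lemma pmean_meas:
  assumes t: "0 < t" "t \<le> T"
  shows "pmean t \<in> borel_measurable borel"
proof -
  interpret C: gaussian_channel M m "\<lambda>w. iota e m (x0 w)" "\<lambda>w. iota e m (X t w)" "1 / growth t" "std t"
    by (rule channel[OF t])
  show ?thesis unfolding pmean_def[abs_def]
    by (intro borel_measurable_sum borel_measurable_scaleR borel_measurable_const measurable_compose[OF iota_meas C.post_meas_RnB]) auto
qed

lemma rdrift_meas: "0 < t \<Longrightarrow> t \<le> T \<Longrightarrow> rdrift t \<in> borel_measurable borel"
  unfolding rdrift_def[abs_def] using pmean_meas[of t] by measurable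

lemma Hn_coord: "Pn e m x = x \<Longrightarrow> x \<bullet> h = (\<Sum>k<m. (x \<bullet> e k) * (e k \<bullet> h))"
  by (metis (no_types, lifting) Pn_def inner_scaleR_left inner_sum_left sum.cong)

lemma norm_sq_expand: "norm (\<Sum>k<m. a k *\<^sub>R e k) ^ 2 = (\<Sum>k<m. (a k)\<^sup>2)"
  unfolding power2_norm_eq_inner inner_sum_right[of _ _ "{..<m}"] by (simp add: coord_sum power2_eq_square)

lemma pmean_sq:
  assumes t: "0 < t" "t \<le> T"
  shows "integrable M (\<lambda>w. (norm (pmean t (X t w)))\<^sup>2)" "(\<integral>w. (norm (pmean t (X t w)))\<^sup>2 \<partial>M) \<le> (\<integral>w. (norm (x0 w))\<^sup>2 \<partial>M)"
proof -
  interpret C: gaussian_channel M m "\<lambda>w. iota e m (x0 w)" "\<lambda>w. iota e m (X t w)" "1 / growth t" "std t"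
    by (rule channel[OF t])
  have n: "(norm (pmean t (X t w)))\<^sup>2 = (\<Sum>k<m. (C.post k (iota e m (X t w)))\<^sup>2)" for w
    unfolding pmean_def norm_sq_expand ..
  have n0: "(norm (x0 w))\<^sup>2 = (\<Sum>k<m. (iota e m (x0 w) k)\<^sup>2)" for w
    using norm_sq_expand[of "\<lambda>k. x0 w \<bullet> e k"] x0_Hn[of w] by (simp add: Pn_def iota_coord)
  show "integrable M (\<lambda>w. (norm (pmean t (X t w)))\<^sup>2)" unfolding n
    by (intro Bochner_Integration.integrable_sum C.post_sq_integrable(1) iota_int) auto
  show "(\<integral>w. (norm (pmean t (X t w)))\<^sup>2 \<partial>M) \<le> (\<integral>w. (norm (x0 w))\<^sup>2 \<partial>M)"
    unfolding n n0 using C.post_sq_integrable iota_int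
    by (subst (1 2) Bochner_Integration.integral_sum) (auto intro!: sum_mono)
qed

text \<open>The bound is uniform in \<open>t\<close>, so that the second-order terms of all steps of
  a grid add up to \<open>O(h)\<close>. The constant 4 combines the bound
  \<open>2 |a|^2 + 2 |b|^2\<close> for the square of a difference with the fact that taking the
  posterior mean does not increase the second moment.\<close>

lemma innovation_sq:
  assumes t: "0 < t" "t \<le> T"
  shows "integrable M (\<lambda>w. (norm (x0 w - pmean t (X t w)))\<^sup>2)"
    "(\<integral>w. (norm (x0 w - pmean t (X t w)))\<^sup>2 \<partial>M) \<le> 4 * (\<integral>w. (norm (x0 w))\<^sup>2 \<partial>M)"
proof -
  have [measurable]: "pmean t \<in> borel_measurable borel" "X t \<in> borel_measurable M"
    using pmean_meas[OF t] X_meas[of t] t by auto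
  have le: "(norm (a - b))\<^sup>2 \<le> 2 * (norm a)\<^sup>2 + 2 * (norm b)\<^sup>2" for a b :: 'h
    using norm_add_sq_le2[of a "- b"] by simp
  have i2: "integrable M (\<lambda>w. 2 * (norm (x0 w))\<^sup>2 + 2 * (norm (pmean t (X t w)))\<^sup>2)"
    using x0_sq pmean_sq(1)[OF t] by auto
  show i: "integrable M (\<lambda>w. (norm (x0 w - pmean t (X t w)))\<^sup>2)"
    by (rule Bochner_Integration.integrable_bound[OF i2]) (use le in \<open>auto intro!: AE_I2 order_trans[OF le] abs_ge_self\<close>)
  have "(\<integral>w. (norm (x0 w - pmean t (X t w)))\<^sup>2 \<partial>M) \<le> (\<integral>w. 2 * (norm (x0 w))\<^sup>2 + 2 * (norm (pmean t (X t w)))\<^sup>2 \<partial>M)"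
    by (rule integral_mono[OF i i2 le])
  also have "\<dots> \<le> 4 * (\<integral>w. (norm (x0 w))\<^sup>2 \<partial>M)"
    using x0_sq pmean_sq[OF t] by simp
  finally show "(\<integral>w. (norm (x0 w - pmean t (X t w)))\<^sup>2 \<partial>M) \<le> 4 * (\<integral>w. (norm (x0 w))\<^sup>2 \<partial>M)" .
qed

lemma innovation_int:
  assumes t: "0 < t" "t \<le> T"
  shows "integrable M (\<lambda>w. (x0 w - pmean t (X t w)) \<bullet> h)"
proof -
  have [measurable]: "pmean t \<in> borel_measurable borel" "X t \<in> borel_measurable M"
    using pmean_meas[OF t] X_meas[of t] t by auto
  have "integrable M (\<lambda>w. norm (x0 w - pmean t (X t w)))"
    by (rule square_integrable_imp_integrable[OF _ innovation_sq(1)[OF t]]) measurable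
  then have "integrable M (\<lambda>w. norm (x0 w - pmean t (X t w)) * norm h)" by simp
  then show ?thesis
    by (rule Bochner_Integration.integrable_bound) (auto simp: Cauchy_Schwarz_ineq2)
qed

lemma innovation_orthogonal_present:
  fixes f :: "'h \<Rightarrow> complex"
  assumes t: "0 < t" "t \<le> T" and [measurable]: "f \<in> borel_measurable borel" and fb: "\<And>x. cmod (f x) \<le> C"
  shows "(CLINT w|M. complex_of_real ((x0 w - pmean t (X t w)) \<bullet> h) * f (X t w)) = 0"
proof -
  interpret C: gaussian_channel M m "\<lambda>w. iota e m (x0 w)" "\<lambda>w. iota e m (X t w)" "1 / growth t" "std t"
    by (rule channel[OF t])
  have [measurable]: "X t \<in> borel_measurable M" using t by (intro X_meas) auto
  \<comment> \<open>The states lie in the span of the first \<open>m\<close> basis vectors, so a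
    function of \<open>X t\<close> is a function of its coordinates.\<close>
  have inv: "iota_inv e m (iota e m (X t w)) = X t w" for w
    using X_Hn[of t w] by (simp add: iota_inv_def iota_def Pn_def)
  have [measurable]: "iota_inv e m \<in> borel_measurable (Pi\<^sub>M {..<m} (\<lambda>_. borel))"
    unfolding iota_inv_def[abs_def] by measurable
  let ?w = "\<lambda>k w. complex_of_real (iota e m (x0 w) k - C.post k (iota e m (X t w))) * f (iota_inv e m (iota e m (X t w)))"
  have int: "integrable M (?w k)" if k: "k < m" for k
    by (rule integrable_mult_bounded[where C=C]) (use fb iota_int[OF k] C.post_integrable[OF k iota_int[OF k]] in auto)
  have "(CLINT w|M. complex_of_real ((x0 w - pmean t (X t w)) \<bullet> h) * f (X t w)) = (CLINT w|M. \<Sum>k<m. complex_of_real (e k \<bullet> h) * ?w k w)"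
  proof (rule Bochner_Integration.integral_cong[OF refl])
    fix w
    have "(x0 w - pmean t (X t w)) \<bullet> h = (\<Sum>k<m. (e k \<bullet> h) * (iota e m (x0 w) k - C.post k (iota e m (X t w))))"
    proof -
      have "(x0 w - pmean t (X t w)) \<bullet> h = (\<Sum>k<m. (x0 w \<bullet> e k) * (e k \<bullet> h)) - pmean t (X t w) \<bullet> h"
        by (simp only: inner_diff_left Hn_coord[OF x0_Hn, of w h])
      also have "\<dots> = (\<Sum>k<m. (e k \<bullet> h) * (iota e m (x0 w) k - C.post k (iota e m (X t w))))"
        unfolding pmean_def inner_sum_left sum_subtractf[symmetric]
        by (intro sum.cong refl) (simp add: iota_coord algebra_simps)
      finally show ?thesis .
    qed
    then show "complex_of_real ((x0 w - pmean t (X t w)) \<bullet> h) * f (X t w) = (\<Sum>k<m. complex_of_real (e k \<bullet> h) * ?w k w)"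
      unfolding inv by (simp add: sum_distrib_right mult.assoc)
  qed
  also have "\<dots> = (\<Sum>k<m. complex_of_real (e k \<bullet> h) * (CLINT w|M. ?w k w))"
    using int by (subst Bochner_Integration.integral_sum) auto
  also have "\<dots> = 0"
  proof (rule sum.neutral, rule ballI)
    fix k assume "k \<in> {..<m}"
    then have k: "k < m" by simp
    have "(CLINT w|M. ?w k w) = 0"
      by (rule C.post_orthogonal[OF k iota_int[OF k], where f="\<lambda>y. f (iota_inv e m y)" and C=C]) (use fb in auto)
    then show "complex_of_real (e k \<bullet> h) * (CLINT w|M. ?w k w) = 0" by simp
  qed
  finally show ?thesis .
qed

lemma pmean_cont:
  assumes w: "w \<in> space M" and r: "0 < r"
  shows "continuous_on {r..T} (\<lambda>t. pmean t (X t w))"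
proof (rule continuous_on_sequentiallyI)
  fix u a assume u: "\<forall>n. u n \<in> {r..T}" "a \<in> {r..T}" "u \<longlonglongrightarrow> a"
  have pos: "0 < u n" "u n \<le> T" "0 < a" "a \<le> T" for n using u r by (auto intro: less_le_trans)
  have lim: "(\<lambda>n. f (u n)) \<longlonglongrightarrow> f a" if "continuous_on {0..T} f" for f :: "real \<Rightarrow> 'b::topological_space"
    by (rule continuous_on_tendsto_compose[OF that u(3)]) (use pos in \<open>auto intro!: always_eventually less_imp_le\<close>)
  show "(\<lambda>n. pmean (u n) (X (u n) w)) \<longlonglongrightarrow> pmean a (X a w)"
    unfolding pmean_def
  proof (intro tendsto_sum tendsto_scaleR tendsto_const post_tendsto[OF channel[OF pos(1,2)] channel[OF pos(3,4)]])
    fix k assume "k \<in> {..<m}" then have k: "k < m" by simp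
    show "(\<lambda>n. 1 / growth (u n)) \<longlonglongrightarrow> 1 / growth a" by (intro tendsto_intros lim growth_cont) simp
    show "(\<lambda>n. std (u n) j) \<longlonglongrightarrow> std a j" for j by (intro tendsto_intros lim growth_cont noise_var_cont) simp
    show "(\<lambda>n. iota e m (X (u n) w) j) \<longlonglongrightarrow> iota e m (X a w) j" if "j < m" for j
      unfolding iota_coord[OF that] by (intro tendsto_intros lim X_cont[OF w])
    show "k < m" by fact
    show "integrable M (\<lambda>w. iota e m (x0 w) k)" by (rule iota_int(1)[OF k])
  qed
qed

lemma rdrift_cont:
  assumes w: "w \<in> space M" and r: "0 < r"
  shows "continuous_on {r..T} (\<lambda>t. rdrift t (X t w))"
  unfolding rdrift_def
  by (intro continuous_intros pmean_cont assms \<kappa>_cont[OF r] continuous_on_subset[OF X_cont[OF w]]) (use r in auto)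

text \<open>The bridge decomposition: \<open>B\<^sub>p\<close> minus its projection on \<open>B\<^sub>p\<^sub>'\<close> is independent of \<open>x0\<close> and of
  the path after time \<open>p'\<close>, because its covariance with every later \<open>B\<^sub>u\<close> vanishes.\<close>

lemma bridge_char:
  fixes g :: "'h \<Rightarrow> complex" and l :: nat
  assumes g: "g \<in> borel_measurable borel" "\<And>x. cmod (g x) \<le> C"
    and p: "0 \<le> p" "p \<le> p'" "0 < p'" "p' \<le> T" and u: "\<And>j. j < l \<Longrightarrow> p' \<le> u j \<and> u j \<le> T"
  shows "(CLINT w|M. g (x0 w) * iexp ((\<Sum>j<l. B (u j) w \<bullet> k j) + (B p w - bridge p p' *\<^sub>R B p' w) \<bullet> \<kappa>)) =
    (CLINT w|M. g (x0 w) * iexp (\<Sum>j<l. B (u j) w \<bullet> k j)) * complex_of_real (exp (- (noise_var p * (1 - bridge p p') * q \<kappa> \<kappa>) / 2))"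
proof -
  let ?r = "bridge p p'"
  \<comment> \<open>The times \<open>p\<close> and \<open>p'\<close> are appended at positions
    \<open>l\<close> and \<open>l + 1\<close>, with test vectors that produce the bridge.\<close>
  define u' where "u' = u(l := p, Suc l := p')"
  define k' where "k' = k(l := \<kappa>, Suc l := - (?r *\<^sub>R \<kappa>))"
  have lo: "u' i = u i" "k' i = k i" if "i < l" for i using that by (simp_all add: u'_def k'_def)
  have hi: "u' l = p" "k' l = \<kappa>" "u' (Suc l) = p'" "k' (Suc l) = - (?r *\<^sub>R \<kappa>)" by (auto simp: u'_def k'_def)
  have rv: "?r * noise_var p' = noise_var p" using noise_var_pos[OF p(3,4)] by (simp add: bridge_def)
  have e1: "(\<Sum>j<l. B (u j) w \<bullet> k j) + (B p w - ?r *\<^sub>R B p' w) \<bullet> \<kappa> = (\<Sum>j<Suc (Suc l). B (u' j) w \<bullet> k' j)" for w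
    by (simp add: hi inner_diff_left lo)
  have mins: "min (u i) p = p" "min p (u i) = p" "min (u i) p' = p'" "min p' (u i) = p'" if "i < l" for i
    using u[OF that] p by (auto simp: min_def)
  \<comment> \<open>At a later time \<open>u i\<close>, the covariance with \<open>B p\<close> and
    the one with the projection of \<open>B p\<close> on \<open>B p'\<close> both carry the factor
    \<open>noise_var p\<close>, so the cross terms cancel.\<close>
  have z1: "(\<Sum>i<l. q (k i) \<kappa> * noise_var (min (u i) p)) - (\<Sum>i<l. ?r * (q (k i) \<kappa> * noise_var (min (u i) p'))) = 0"
    unfolding sum_subtractf[symmetric] by (rule sum.neutral) (auto simp: mins rv[symmetric])
  have z2: "(\<Sum>i<l. q \<kappa> (k i) * noise_var (min p (u i))) - (\<Sum>i<l. ?r * (q \<kappa> (k i) * noise_var (min p' (u i)))) = 0"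
    unfolding sum_subtractf[symmetric] by (rule sum.neutral) (auto simp: mins rv[symmetric])
  have e2: "(\<Sum>i<Suc (Suc l). \<Sum>j<Suc (Suc l). q (k' i) (k' j) * noise_var (min (u' i) (u' j))) =
     (\<Sum>i<l. \<Sum>j<l. q (k i) (k j) * noise_var (min (u i) (u j))) + noise_var p * (1 - ?r) * q \<kappa> \<kappa>"
  proof -
    have "(\<Sum>i<Suc (Suc l). \<Sum>j<Suc (Suc l). q (k' i) (k' j) * noise_var (min (u' i) (u' j))) =
      (\<Sum>i<l. \<Sum>j<l. q (k i) (k j) * noise_var (min (u i) (u j)))
      + ((\<Sum>i<l. q (k i) \<kappa> * noise_var (min (u i) p)) - (\<Sum>i<l. ?r * (q (k i) \<kappa> * noise_var (min (u i) p'))))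
      + ((\<Sum>i<l. q \<kappa> (k i) * noise_var (min p (u i))) - (\<Sum>i<l. ?r * (q \<kappa> (k i) * noise_var (min p' (u i)))))
      + (q \<kappa> \<kappa> * noise_var p - 2 * ?r * q \<kappa> \<kappa> * noise_var p + ?r * q \<kappa> \<kappa> * (?r * noise_var p'))"
      using p by (simp add: hi lo sum.distrib sum_negf sum_subtractf algebra_simps)
    then show ?thesis unfolding z1 z2 rv by (simp add: algebra_simps)
  qed
  have 1: "(CLINT w|M. g (x0 w) * iexp (\<Sum>j<Suc (Suc l). B (u' j) w \<bullet> k' j)) =
    (CLINT w|M. g (x0 w)) * complex_of_real (exp (- (\<Sum>i<Suc (Suc l). \<Sum>j<Suc (Suc l). q (k' i) (k' j) * noise_var (min (u' i) (u' j))) / 2))"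
  proof (rule B_char[OF g])
    fix j assume "j < Suc (Suc l)"
    then show "u' j \<in> {0..T}" using u[of j] p by (auto simp: u'_def)
  qed
  have 2: "(CLINT w|M. g (x0 w) * iexp (\<Sum>j<l. B (u j) w \<bullet> k j)) =
    (CLINT w|M. g (x0 w)) * complex_of_real (exp (- (\<Sum>i<l. \<Sum>j<l. q (k i) (k j) * noise_var (min (u i) (u j))) / 2))"
    by (rule B_char[OF g]) (use u p in fastforce)+
  show ?thesis unfolding e1 1 2 e2
    by (simp add: exp_add[symmetric] add_divide_distrib flip: of_real_mult)
qed

text \<open>Increments of \<open>B\<close> after \<open>p\<close> have zero covariance with
  \<open>B p\<close>, hence are independent of the pair of \<open>x0\<close> and \<open>B p\<close>.
  This is the Markov property in the form needed for the innovation.\<close>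

lemma later_char:
  fixes g :: "'h \<Rightarrow> complex" and l :: nat
  assumes g: "g \<in> borel_measurable borel" "\<And>x. cmod (g x) \<le> C"
    and p: "0 < p" "p \<le> T" and u: "\<And>j. j < l \<Longrightarrow> p \<le> u j \<and> u j \<le> T"
  shows "(CLINT w|M. g (x0 w) * iexp ((\<Sum>j<l. (B (u j) w - B p w) \<bullet> k j) + B p w \<bullet> \<kappa>)) =
    (CLINT w|M. g (x0 w) * iexp (B p w \<bullet> \<kappa>)) * (CLINT w|M. iexp (\<Sum>j<l. (B (u j) w - B p w) \<bullet> k j))"
proof -
  define S where "S = (\<Sum>j<l. k j)"
  \<comment> \<open>The variance of the tested sum of increments: subtracting \<open>B p\<close>
    from each term removes \<open>noise_var p * q S S\<close>.\<close>
  define Qf where "Qf = (\<Sum>i<l. \<Sum>j<l. q (k i) (k j) * noise_var (min (u i) (u j))) - noise_var p * q S S"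
  have main: "(CLINT w|M. f (x0 w) * iexp ((\<Sum>j<l. (B (u j) w - B p w) \<bullet> k j) + B p w \<bullet> h)) =
     (CLINT w|M. f (x0 w)) * complex_of_real (exp (- (Qf + noise_var p * q h h) / 2))"
    if f: "f \<in> borel_measurable borel" "\<And>x. cmod (f x) \<le> D" for f :: "'h \<Rightarrow> complex" and D h
  proof -
    define u' where "u' = u(l := p)"
    define k' where "k' = k(l := h - S)"
    have lo: "u' i = u i" "k' i = k i" if "i < l" for i using that by (simp_all add: u'_def k'_def)
    have hi: "u' l = p" "k' l = h - S" by (auto simp: u'_def k'_def)
    have mins: "min (u i) p = p" "min p (u i) = p" if "i < l" for i
      using u[OF that] by (auto simp: min_def)
    have e1: "(\<Sum>j<l. (B (u j) w - B p w) \<bullet> k j) + B p w \<bullet> h = (\<Sum>j<Suc l. B (u' j) w \<bullet> k' j)" for w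
      by (simp add: hi lo inner_diff_left inner_diff_right sum_subtractf S_def inner_sum_right)
    have s1: "(\<Sum>i<l. q (k i) (h - S) * noise_var (min (u i) p)) = noise_var p * q S (h - S)"
      unfolding S_def q_sum(1) sum_distrib_left by (rule sum.cong[OF refl]) (simp add: mins)
    have s2: "(\<Sum>i<l. q (h - S) (k i) * noise_var (min p (u i))) = noise_var p * q (h - S) S"
    proof -
      have "q (h - S) S = (\<Sum>i<l. q (h - S) (k i))" by (subst (2) S_def) (rule q_sum(2))
      then show ?thesis unfolding sum_distrib_left by (simp add: sum_distrib_left mins del: q_lin) (simp add: mins mult.commute)
    qed
    have e2: "(\<Sum>i<Suc l. \<Sum>j<Suc l. q (k' i) (k' j) * noise_var (min (u' i) (u' j))) = Qf + noise_var p * q h h"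
    proof -
      have "(\<Sum>i<Suc l. \<Sum>j<Suc l. q (k' i) (k' j) * noise_var (min (u' i) (u' j))) =
         (\<Sum>i<l. \<Sum>j<l. q (k i) (k j) * noise_var (min (u i) (u j)))
         + (\<Sum>i<l. q (k i) (h - S) * noise_var (min (u i) p))
         + (\<Sum>i<l. q (h - S) (k i) * noise_var (min p (u i))) + q (h - S) (h - S) * noise_var p"
        by (simp add: hi lo sum.distrib del: q_lin)
      then show ?thesis unfolding s1 s2 Qf_def by (simp add: algebra_simps)
    qed
    have "(CLINT w|M. f (x0 w) * iexp (\<Sum>j<Suc l. B (u' j) w \<bullet> k' j)) =
      (CLINT w|M. f (x0 w)) * complex_of_real (exp (- (\<Sum>i<Suc l. \<Sum>j<Suc l. q (k' i) (k' j) * noise_var (min (u' i) (u' j))) / 2))"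
    proof (rule B_char[OF f])
      fix j assume "j < Suc l"
      then show "u' j \<in> {0..T}" using u[of j] p by (auto simp: u'_def)
    qed
    then show ?thesis unfolding e1 e2 .
  qed
  have m0: "(CLINT w|M. g (x0 w) * iexp (B p w \<bullet> \<kappa>)) = (CLINT w|M. g (x0 w)) * complex_of_real (exp (- (noise_var p * q \<kappa> \<kappa>) / 2))"
    using B_char[OF g, of "Suc 0" "\<lambda>_. p" "\<lambda>_. \<kappa>"] p by (simp add: mult.commute)
  have m1: "(CLINT w|M. iexp (\<Sum>j<l. (B (u j) w - B p w) \<bullet> k j)) = complex_of_real (exp (- Qf / 2))"
    using main[of "\<lambda>_. 1" 1 0] by (simp add: prob_space)
  show ?thesis unfolding main[OF g] m0 m1
    by (simp add: add_divide_distrib exp_add[symmetric] add.commute flip: of_real_mult)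
qed

end

section \<open>Second moments and elementary bounds for exponentials\<close>

lemma real_gaussian_second_moment:
  assumes "0 \<le> v"
  shows "(\<integral>\<^sup>+x. ennreal (x\<^sup>2) \<partial>real_gaussian v) = ennreal v"
proof (cases "v = 0")
  case True
  then show ?thesis by (simp add: real_gaussian_def nn_integral_return)
next
  case False
  then have v: "0 < v" using assms by simp
  have b: "has_bochner_integral lborel (\<lambda>x. normal_density 0 (sqrt v) x * x\<^sup>2) v"
  proof -
    have eq: "fact (2 * 1) / ((2 / (sqrt v)\<^sup>2) ^ 1 * fact 1) = v" using v by (simp add: fact_2)
    have "(\<lambda>x. normal_density 0 (sqrt v) x * x\<^sup>2) = (\<lambda>x. normal_density 0 (sqrt v) x * (x - 0) ^ (2 * 1))" by simp
    then show ?thesis using normal_moment_even[where \<mu>=0 and \<sigma>="sqrt v" and k=1] v unfolding eq by (simp only: real_sqrt_gt_0_iff)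
  qed
  have "(\<integral>\<^sup>+x. ennreal (x\<^sup>2) \<partial>real_gaussian v) = (\<integral>\<^sup>+x. ennreal (normal_density 0 (sqrt v) x * x\<^sup>2) \<partial>lborel)"
    using v by (simp add: real_gaussian_def nn_integral_density ennreal_mult)
  also have "\<dots> = ennreal v"
    using b by (subst nn_integral_eq_integral) (auto simp: has_bochner_integral_iff)
  finally show ?thesis .
qed

lemma sets_real_gaussian [simp]: "sets (real_gaussian v) = sets borel"
  by (simp add: real_gaussian_def)

lemma finite_measure_real_gaussian:
  assumes "0 \<le> v"
  shows "finite_measure (real_gaussian v)"
proof (cases "v = 0")
  case True
  then show ?thesis using prob_space.finite_measure[OF prob_space_return[of "0 :: real" borel]] by (simp add: real_gaussian_def)
next
  case False
  then show ?thesis using finite_measure_density[of lborel "normal_density 0 (sqrt v)"] assms by (simp add: real_gaussian_def)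
qed

lemma exp_minus_Lipschitz:
  assumes "0 \<le> a" "0 \<le> b"
  shows "\<bar>exp (- a) - exp (- b)\<bar> \<le> \<bar>a - b :: real\<bar>"
proof -
  have *: "\<bar>exp (- a) - exp (- b)\<bar> \<le> b - a" if "0 \<le> a" "a \<le> b" for a b :: real
  proof -
    have "exp (- b) = exp (- a) * exp (- (b - a))" by (simp add: exp_add[symmetric])
    then have "exp (- a) - exp (- b) = exp (- a) * (1 - exp (- (b - a)))" by (simp add: algebra_simps)
    also have "\<dots> \<le> 1 * (b - a)"
    proof (rule mult_mono)
      show "1 - exp (- (b - a)) \<le> b - a" using exp_ge_add_one_self[of "- (b - a)"] by linarith
    qed (use that in auto)
    finally show ?thesis using that by simp
  qed
  show ?thesis using *[of a b] *[of b a] assms by (cases "a \<le> b") (auto simp: abs_minus_commute)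
qed

lemma norm_integral_le:
  fixes f :: "'a \<Rightarrow> 'b::{banach,second_countable_topology}"
  assumes "integrable M f" "integrable M g" "\<And>x. x \<in> space M \<Longrightarrow> norm (f x) \<le> g x"
  shows "norm (\<integral>x. f x \<partial>M) \<le> (\<integral>x. g x \<partial>M)"
  by (rule order_trans[OF Bochner_Integration.integral_norm_bound]) (use assms in \<open>auto intro!: integral_mono\<close>)

lemma cmod_iexp_bounds:
  shows "cmod (iexp t - 1) \<le> \<bar>t\<bar>" "cmod (iexp t - 1 - \<i> * complex_of_real t) \<le> t\<^sup>2 / 2"
proof -
  show "cmod (iexp t - 1) \<le> \<bar>t\<bar>" using iexp_approx1[of t 0] by simp
  have "(\<Sum>k\<le>Suc 0. (\<i> * complex_of_real t) ^ k / fact k) = 1 + \<i> * complex_of_real t" by simp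
  then show "cmod (iexp t - 1 - \<i> * complex_of_real t) \<le> t\<^sup>2 / 2"
    using iexp_approx1[of t "Suc 0"] by (simp add: diff_diff_eq power2_eq_square numeral_2_eq_2)
qed

context ou_process
begin

lemma B_second_moment:
  assumes t: "t \<in> {0..T}"
  shows "integrable M (\<lambda>w. (norm (B t w))\<^sup>2)" "(\<integral>w. (norm (B t w))\<^sup>2 \<partial>M) \<le> noise_var T * (\<Sum>k<m. lam k)"
proof -
  have [measurable]: "B t \<in> borel_measurable M" by (rule B_meas[OF t])
  have v: "0 \<le> noise_var t" "noise_var t \<le> noise_var T" using t noise_var_nonneg noise_var_mono by auto
  have one: "(\<integral>\<^sup>+w. ennreal ((B t w \<bullet> e k)\<^sup>2) \<partial>M) = ennreal (noise_var t * lam k)" if k: "k < m" for k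
  proof -
    have qe: "q (e k) (e k) = lam k" using k by (simp add: Qn_inner orth if_distrib cong: if_cong)
    have vnn: "0 \<le> noise_var t * lam k" using v lam_nonneg by simp
    have d: "distr M borel (\<lambda>w. B t w \<bullet> e k) = real_gaussian (noise_var t * lam k)"
    proof (rule finite_measure_char_unique)
      fix s
      have "(CLINT x|distr M borel (\<lambda>w. B t w \<bullet> e k). iexp (s * x)) = (CLINT w|M. iexp (s * (B t w \<bullet> e k)))"
        by (subst integral_distr) auto
      also have "\<dots> = complex_of_real (exp (- (noise_var t * lam k) * s\<^sup>2 / 2))"
        using B_char[of "\<lambda>_. 1" 1 "Suc 0" "\<lambda>_. t" "\<lambda>_. s *\<^sub>R e k"] t
        by (simp add: qe prob_space power2_eq_square mult_ac)
      finally show "(CLINT x|distr M borel (\<lambda>w. B t w \<bullet> e k). iexp (s * x)) = (CLINT x|real_gaussian (noise_var t * lam k). iexp (s * x))"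
        using char_real_gaussian[OF vnn] by simp
    qed (auto simp: finite_measure_real_gaussian[OF vnn] intro!: finite_measure_distr)
    have "(\<integral>\<^sup>+w. ennreal ((B t w \<bullet> e k)\<^sup>2) \<partial>M) = (\<integral>\<^sup>+x. ennreal (x\<^sup>2) \<partial>distr M borel (\<lambda>w. B t w \<bullet> e k))"
      by (subst nn_integral_distr) auto
    then show ?thesis unfolding d using real_gaussian_second_moment[OF vnn] by simp
  qed
  have n: "(norm (B t w))\<^sup>2 = (\<Sum>k<m. (B t w \<bullet> e k)\<^sup>2)" for w
    using norm_sq_expand[of "\<lambda>k. B t w \<bullet> e k"] B_Hn[of t w] by (simp add: Pn_def)
  have "(\<integral>\<^sup>+w. ennreal ((norm (B t w))\<^sup>2) \<partial>M) = (\<Sum>k<m. \<integral>\<^sup>+w. ennreal ((B t w \<bullet> e k)\<^sup>2) \<partial>M)"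
    unfolding n by (subst nn_integral_sum[symmetric]) (auto simp: sum_ennreal)
  also have "\<dots> = (\<Sum>k<m. ennreal (noise_var t * lam k))" by (rule sum.cong) (auto simp: one)
  also have "\<dots> = ennreal (noise_var t * (\<Sum>k<m. lam k))"
    using v lam_nonneg by (simp add: sum_ennreal sum_distrib_left)
  finally have nn: "(\<integral>\<^sup>+w. ennreal ((norm (B t w))\<^sup>2) \<partial>M) = ennreal (noise_var t * (\<Sum>k<m. lam k))" .
  show i: "integrable M (\<lambda>w. (norm (B t w))\<^sup>2)"
    using nn by (intro integrableI_nonneg) auto
  have "(\<integral>w. (norm (B t w))\<^sup>2 \<partial>M) = noise_var t * (\<Sum>k<m. lam k)"
  proof -
    have "ennreal (\<integral>w. (norm (B t w))\<^sup>2 \<partial>M) = ennreal (noise_var t * (\<Sum>k<m. lam k))"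
      using nn i by (subst (asm) nn_integral_eq_integral) auto
    moreover have "0 \<le> (\<integral>w. (norm (B t w))\<^sup>2 \<partial>M)" "0 \<le> noise_var t * (\<Sum>k<m. lam k)"
      using v lam_nonneg by (auto intro!: mult_nonneg_nonneg sum_nonneg)
    ultimately show ?thesis by (simp only: ennreal_inj)
  qed
  also have "\<dots> \<le> noise_var T * (\<Sum>k<m. lam k)" using v lam_nonneg by (intro mult_right_mono sum_nonneg) auto
  finally show "(\<integral>w. (norm (B t w))\<^sup>2 \<partial>M) \<le> noise_var T * (\<Sum>k<m. lam k)" .
qed

text \<open>Bounds the first moment of \<open>X t\<close> uniformly in time, by
  \<open>growth t \<ge> 1\<close> and the estimate of the norm of \<open>B t\<close> by one plus its
  square.\<close>

definition X_bound :: real where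
  "X_bound = (\<integral>w. norm (x0 w) \<partial>M) + (1 + noise_var T * (\<Sum>k<m. lam k))"

lemma X_norm:
  assumes t: "t \<in> {0..T}"
  shows "integrable M (\<lambda>w. norm (X t w))" "(\<integral>w. norm (X t w) \<partial>M) \<le> X_bound"
proof -
  have [measurable]: "B t \<in> borel_measurable M" "X t \<in> borel_measurable M" using B_meas[OF t] X_meas[OF t] by auto
  have i: "integrable M (\<lambda>w. norm (x0 w) + (1 + (norm (B t w))\<^sup>2))"
    using x0_norm_int B_second_moment(1)[OF t] by simp
  have le: "norm (X t w) \<le> norm (x0 w) + (1 + (norm (B t w))\<^sup>2)" for w
  proof -
    have "norm (X t w) = norm (x0 w + B t w) / growth t" by (simp add: X_def less_imp_le)
    also have "\<dots> \<le> norm (x0 w + B t w) / 1" using growth_ge_1[of t] t by (intro divide_left_mono) auto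
    also have "\<dots> \<le> norm (x0 w) + norm (B t w)" by (simp add: norm_triangle_ineq)
    also have "norm (B t w) \<le> 1 + (norm (B t w))\<^sup>2"
    proof -
      have "2 * norm (B t w) \<le> 1 + (norm (B t w))\<^sup>2" using sum_squares_bound[of 1 "norm (B t w)"] by simp
      then show ?thesis using norm_ge_zero[of "B t w"] by linarith
    qed
    finally show ?thesis by simp
  qed
  show iX: "integrable M (\<lambda>w. norm (X t w))"
    by (rule Bochner_Integration.integrable_bound[OF i]) (auto intro!: AE_I2 order_trans[OF le] abs_ge_self)
  have "(\<integral>w. norm (X t w) \<partial>M) \<le> (\<integral>w. norm (x0 w) + (1 + (norm (B t w))\<^sup>2) \<partial>M)"
    by (rule integral_mono[OF iX i le])
  also have "\<dots> \<le> X_bound"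
    using x0_norm_int B_second_moment[OF t] by (simp add: X_bound_def prob_space)
  finally show "(\<integral>w. norm (X t w) \<partial>M) \<le> X_bound" .
qed

text \<open>The innovation is orthogonal not just to \<open>X p\<close> but to all later states:
  these are functions of \<open>X p\<close> and of increments of \<open>B\<close> after
  \<open>p\<close>, which are independent of \<open>x0\<close> and \<open>X p\<close>. In reversed
  time the later states are the past of the process.\<close>

lemma innovation_orthogonal:
  fixes \<Psi> :: "(nat \<Rightarrow> 'h) \<Rightarrow> complex" and l :: nat
  assumes p: "0 < p" "p \<le> T" and u: "\<And>j. j < l \<Longrightarrow> p \<le> u j \<and> u j \<le> T"
    and \<Psi>[measurable]: "\<Psi> \<in> borel_measurable (Pi\<^sub>M {..<l} (\<lambda>_. borel))" and \<Psi>b: "\<And>z. cmod (\<Psi> z) \<le> C"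
  shows "(CLINT w|M. complex_of_real ((x0 w - pmean p (X p w)) \<bullet> h) * \<Psi> (\<lambda>j\<in>{..<l}. X (u j) w)) = 0"
proof (rule weighted_char_zero[where Z="\<lambda>j. X (u j)"])
  have [measurable]: "pmean p \<in> borel_measurable borel" "X p \<in> borel_measurable M" "B p \<in> borel_measurable M"
    using pmean_meas[OF p] X_meas[of p] B_meas[of p] p by auto
  have uT: "u j \<in> {0..T}" if "j < l" for j using u[OF that] p by auto
  have [measurable]: "X (u j) \<in> borel_measurable M" "B (u j) \<in> borel_measurable M" if "j < l" for j
    using X_meas B_meas uT[OF that] by auto
  show "finite {..<l}" by simp
  show "X (u j) \<in> borel_measurable M" if "j \<in> {..<l}" for j using that by simp
  have wi: "integrable M (\<lambda>w. complex_of_real ((x0 w - pmean p (X p w)) \<bullet> h))"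
    using innovation_int[OF p] by (rule integrable_of_real)
  then show "integrable M (\<lambda>w. complex_of_real ((x0 w - pmean p (X p w)) \<bullet> h))" .
  show "\<Psi> \<in> borel_measurable (Pi\<^sub>M {..<l} (\<lambda>_. borel))" by measurable
  show "integrable M (\<lambda>w. complex_of_real ((x0 w - pmean p (X p w)) \<bullet> h) * \<Psi> (\<lambda>j\<in>{..<l}. X (u j) w))"
    by (rule integrable_mult_bounded[OF wi, where C=C]) (use \<Psi>b in auto)
  fix k :: "nat \<Rightarrow> 'h"
  define k' where "k' j = (1 / growth (u j)) *\<^sub>R k j" for j
  \<comment> \<open>Since \<open>x0 + B p\<close> is \<open>growth p\<close> times
    \<open>X p\<close>, the part of the exponent not coming from later increments is
    \<open>X p\<close> tested with this vector.\<close>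
  define s where "s = growth p *\<^sub>R (\<Sum>j<l. k' j)"
  define D where "D w = iexp (\<Sum>j<l. (B (u j) w - B p w) \<bullet> k' j)" for w
  have [measurable]: "D \<in> borel_measurable M" unfolding D_def[abs_def] by measurable
  have lin: "(\<Sum>j<l. X (u j) w \<bullet> k j) = (\<Sum>j<l. (B (u j) w - B p w) \<bullet> k' j) + X p w \<bullet> s" for w
  proof -
    have "X (u j) w \<bullet> k j = (B (u j) w - B p w) \<bullet> k' j + (x0 w + B p w) \<bullet> k' j" for j
      by (simp add: X_def k'_def inner_add_left inner_diff_left add_divide_distrib diff_divide_distrib)
    then have "(\<Sum>j<l. X (u j) w \<bullet> k j) = (\<Sum>j<l. (B (u j) w - B p w) \<bullet> k' j) + (x0 w + B p w) \<bullet> (\<Sum>j<l. k' j)"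
      by (simp add: sum.distrib inner_sum_right)
    then show ?thesis by (simp add: s_def X_def)
  qed
  \<comment> \<open>Coordinates 0 and 1 of \<open>z\<close> stand for \<open>x0\<close> and
    \<open>B p\<close>.\<close>
  let ?\<Phi> = "\<lambda>z :: nat \<Rightarrow> 'h. complex_of_real ((z 0 - pmean p ((1 / growth p) *\<^sub>R (z 0 + z 1))) \<bullet> h) * iexp (((1 / growth p) *\<^sub>R (z 0 + z 1)) \<bullet> s)"
  let ?Z = "\<lambda>j :: nat. if j = 0 then x0 else B p"
  have z01: "(\<lambda>j\<in>{..<2}. ?Z j w) 0 = x0 w" "(\<lambda>j\<in>{..<2}. ?Z j w) 1 = B p w" for w by auto
  have \<Phi>: "?\<Phi> (\<lambda>j\<in>{..<2}. ?Z j w) = complex_of_real ((x0 w - pmean p (X p w)) \<bullet> h) * iexp (X p w \<bullet> s)" for w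
    unfolding z01 X_def ..
  have "(CLINT w|M. complex_of_real ((x0 w - pmean p (X p w)) \<bullet> h) * iexp (\<Sum>j<l. X (u j) w \<bullet> k j)) =
    (CLINT w|M. D w * ?\<Phi> (\<lambda>j\<in>{..<2}. ?Z j w))"
    unfolding \<Phi> lin D_def of_real_add distrib_left exp_add by (simp only: mult_ac)
  also have "\<dots> = (CLINT w|M. D w) * (CLINT w|M. ?\<Phi> (\<lambda>j\<in>{..<2}. ?Z j w))"
  proof (rule char_factor)
    note [measurable] = PiM_lessThan_component
    show "?\<Phi> \<in> borel_measurable (Pi\<^sub>M {..<2} (\<lambda>_. borel))" by measurable
    show "integrable M (\<lambda>w. ?\<Phi> (\<lambda>j\<in>{..<2}. ?Z j w))" unfolding \<Phi> by (rule integrable_iexp_weight[OF wi]) measurable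
    fix kk :: "nat \<Rightarrow> 'h"
    have e: "iexp (\<Sum>j<2. ?Z j w \<bullet> kk j) = iexp (x0 w \<bullet> kk 0) * iexp (B p w \<bullet> kk 1)" for w
      by (simp add: numeral_2_eq_2 distrib_left exp_add)
    have "(CLINT w|M. D w * iexp (\<Sum>j<2. ?Z j w \<bullet> kk j)) =
        (CLINT w|M. iexp (x0 w \<bullet> kk 0) * iexp ((\<Sum>j<l. (B (u j) w - B p w) \<bullet> k' j) + B p w \<bullet> kk 1))"
      unfolding e D_def of_real_add distrib_left exp_add by (simp only: mult_ac)
    also have "\<dots> = (CLINT w|M. iexp (x0 w \<bullet> kk 0) * iexp (B p w \<bullet> kk 1)) * (CLINT w|M. D w)"
      unfolding D_def by (rule later_char[where g="\<lambda>x. iexp (x \<bullet> kk 0)" and C=1]) (use p u in auto)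
    finally show "(CLINT w|M. D w * iexp (\<Sum>j<2. ?Z j w \<bullet> kk j)) = (CLINT w|M. D w) * (CLINT w|M. iexp (\<Sum>j<2. ?Z j w \<bullet> kk j))"
      unfolding e by (simp only: mult.commute)
  qed (auto simp: D_def)
  also have "(CLINT w|M. ?\<Phi> (\<lambda>j\<in>{..<2}. ?Z j w)) = 0" unfolding \<Phi>
    by (rule innovation_orthogonal_present[OF p, where f="\<lambda>x. iexp (x \<bullet> s)" and C=1]) auto
  finally show "(CLINT w|M. complex_of_real ((x0 w - pmean p (X p w)) \<bullet> h) * iexp (\<Sum>j<l. X (u j) w \<bullet> k j)) = 0" by simp
qed

text \<open>One step of the reversed process, tested against a function of the states already
  visited. Its residual has three parts: \<theta>1 collects the errors of the coefficients and is of
  order \<epsilon> times the step \<open>h\<close>; \<theta>2 is \<open>h * \<kappa>2\<close> times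
  the innovation, hence of order \<open>h\<close>, but by orthogonality without first-order effect;
  \<zeta> is the bridge noise, independent of \<open>x0\<close> and of the visited states and, after
  rescaling, of variance close to \<open>h * \<alpha>\<close>.\<close>

lemma one_step:
  fixes \<Psi> :: "(nat \<Rightarrow> 'h) \<Rightarrow> complex" and l :: nat
  assumes p: "0 < p" "p \<le> p'" "p' \<le> T" and u: "\<And>j. j < Suc l \<Longrightarrow> p' \<le> u j \<and> u j \<le> T" and ul: "u l = p'"
    and \<Psi>[measurable]: "\<Psi> \<in> borel_measurable (Pi\<^sub>M {..<Suc l} (\<lambda>_. borel))" and \<Psi>b: "\<And>z. cmod (\<Psi> z) \<le> C"
    and \<epsilon>: "\<bar>growth p' / growth p * bridge p p' - 1 - (p' - p) * \<kappa>1 p'\<bar> \<le> \<epsilon> * (p' - p)"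
      "\<bar>(1 - bridge p p') / growth p - (p' - p) * \<kappa>2 p'\<bar> \<le> \<epsilon> * (p' - p)"
      "\<bar>noise_var p * (1 - bridge p p') / (growth p)\<^sup>2 - (p' - p) * \<alpha> p'\<bar> \<le> \<epsilon> * (p' - p)"
  shows "cmod ((CLINT w|M. \<Psi> (\<lambda>j\<in>{..<Suc l}. X (u j) w) * iexp ((X p w - X p' w - (p' - p) *\<^sub>R rdrift p' (X p' w)) \<bullet> \<kappa>))
      - (CLINT w|M. \<Psi> (\<lambda>j\<in>{..<Suc l}. X (u j) w)) * complex_of_real (exp (- ((p' - p) * \<alpha> p' * q \<kappa> \<kappa>) / 2)))
    \<le> C * (\<epsilon> * (p' - p) * norm \<kappa> * (X_bound + (\<integral>w. norm (x0 w) \<partial>M))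
        + 2 * (p' - p)\<^sup>2 * (\<kappa>2 p')\<^sup>2 * (norm \<kappa>)\<^sup>2 * (\<integral>w. (norm (x0 w))\<^sup>2 \<partial>M) + \<epsilon> * (p' - p) * q \<kappa> \<kappa> / 2)"
proof -
  let ?r = "bridge p p'" and ?h = "p' - p"
  have p'0: "0 < p'" and pT: "p \<in> {0..T}" "p' \<in> {0..T}" using p by auto
  have C0: "0 \<le> C" using \<Psi>b[of undefined] norm_ge_zero order_trans by blast
  have h0: "0 \<le> ?h" using p by simp
  have \<epsilon>0: "0 \<le> \<epsilon> * ?h" using \<epsilon>(1) by linarith
  have [measurable]: "pmean p' \<in> borel_measurable borel" "X p' \<in> borel_measurable M" "X p \<in> borel_measurable M"
      "B p' \<in> borel_measurable M" "B p \<in> borel_measurable M" "rdrift p' \<in> borel_measurable borel"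
    using pmean_meas[of p'] rdrift_meas[of p'] X_meas B_meas pT p'0 p by auto
  have [measurable]: "X (u j) \<in> borel_measurable M" "B (u j) \<in> borel_measurable M" if "j < Suc l" for j
    using X_meas B_meas u[OF that] p'0 by auto
  define Xs where "Xs w = (\<lambda>j\<in>{..<Suc l}. X (u j) w)" for w
  have Xs_m[measurable]: "Xs \<in> measurable M (Pi\<^sub>M {..<Suc l} (\<lambda>_. borel))" unfolding Xs_def[abs_def] by measurable
  define \<rho>1 where "\<rho>1 = growth p' / growth p * ?r - 1 - ?h * \<kappa>1 p'"
  define \<rho>2 where "\<rho>2 = (1 - ?r) / growth p - ?h * \<kappa>2 p'"
  define \<zeta> where "\<zeta> w = B p w - ?r *\<^sub>R B p' w" for w
  define \<nu> where "\<nu> w = x0 w - pmean p' (X p' w)" for w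
  define \<theta>1 where "\<theta>1 w = (\<rho>1 *\<^sub>R X p' w + \<rho>2 *\<^sub>R x0 w) \<bullet> \<kappa>" for w
  define \<theta>2 where "\<theta>2 w = (?h * \<kappa>2 p') * (\<nu> w \<bullet> \<kappa>)" for w
  have [measurable]: "\<zeta> \<in> borel_measurable M" "\<nu> \<in> borel_measurable M" "\<theta>1 \<in> borel_measurable M" "\<theta>2 \<in> borel_measurable M"
    unfolding \<zeta>_def[abs_def] \<nu>_def[abs_def] \<theta>1_def[abs_def] \<theta>2_def[abs_def] by measurable
  define \<kappa>' where "\<kappa>' = (1 / growth p) *\<^sub>R \<kappa>"
  define c0 where "c0 = exp (- (noise_var p * (1 - ?r) * q \<kappa>' \<kappa>') / 2)"
  \<comment> \<open>Substituting the bridge decomposition of \<open>B p\<close> and then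
    \<open>B p' = growth p' * X p' - x0\<close> leaves only \<open>X p'\<close>, \<open>x0\<close>
    and \<zeta>.\<close>
  have split: "(X p w - X p' w - ?h *\<^sub>R rdrift p' (X p' w)) \<bullet> \<kappa> = (\<theta>1 w + \<theta>2 w) + \<zeta> w \<bullet> \<kappa>'" for w
  proof -
    have B': "B p' w = growth p' *\<^sub>R X p' w - x0 w" by (simp add: X_def)
    have Xp: "X p w = (1 / growth p) *\<^sub>R (x0 w + \<zeta> w + ?r *\<^sub>R B p' w)" by (simp add: X_def \<zeta>_def)
    show ?thesis unfolding Xp B' \<theta>1_def \<theta>2_def \<kappa>'_def \<rho>1_def \<rho>2_def \<nu>_def rdrift_def
      by (simp add: inner_add_left inner_diff_left algebra_simps add_divide_distrib diff_divide_distrib)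
  qed
  \<comment> \<open>The exponential of \<zeta> is pulled out by \<open>char_factor\<close>; for this
    the remaining integrand is written as a function of \<open>x0\<close> and the later values of
    \<open>B\<close>.\<close>
  have A: "(CLINT w|M. \<Psi> (Xs w) * iexp ((\<theta>1 w + \<theta>2 w) + \<zeta> w \<bullet> \<kappa>')) = (CLINT w|M. \<Psi> (Xs w) * iexp (\<theta>1 w + \<theta>2 w)) * complex_of_real c0"
  proof -
    let ?Z = "\<lambda>j. case j of 0 \<Rightarrow> x0 | Suc i \<Rightarrow> B (u i)"
    let ?P = "Pi\<^sub>M {..<Suc (Suc l)} (\<lambda>_. borel :: 'h measure)"
    let ?xs = "\<lambda>z j. (1 / growth (u j)) *\<^sub>R (z 0 + z (Suc j))"
    let ?\<Phi> = "\<lambda>z :: nat \<Rightarrow> 'h. \<Psi> (\<lambda>j\<in>{..<Suc l}. ?xs z j) *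
        iexp ((\<rho>1 *\<^sub>R ?xs z l + \<rho>2 *\<^sub>R z 0) \<bullet> \<kappa> + (?h * \<kappa>2 p') * ((z 0 - pmean p' (?xs z l)) \<bullet> \<kappa>))"
    have ev: "?\<Phi> (\<lambda>j\<in>{..<Suc (Suc l)}. ?Z j w) = \<Psi> (Xs w) * iexp (\<theta>1 w + \<theta>2 w)" for w
    proof -
      have "?xs (\<lambda>j\<in>{..<Suc (Suc l)}. ?Z j w) j = X (u j) w" if "j < Suc l" for j
        using that by (simp add: X_def)
      then have "(\<lambda>j\<in>{..<Suc l}. ?xs (\<lambda>j\<in>{..<Suc (Suc l)}. ?Z j w) j) = Xs w" "?xs (\<lambda>j\<in>{..<Suc (Suc l)}. ?Z j w) l = X p' w"
        using ul by (auto simp: Xs_def restrict_def)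
      moreover have "(\<lambda>j\<in>{..<Suc (Suc l)}. ?Z j w) 0 = x0 w" by simp
      ultimately show ?thesis by (simp only: \<theta>1_def \<theta>2_def \<nu>_def)
    qed
    have "(CLINT w|M. \<Psi> (Xs w) * iexp ((\<theta>1 w + \<theta>2 w) + \<zeta> w \<bullet> \<kappa>')) = (CLINT w|M. iexp (\<zeta> w \<bullet> \<kappa>') * ?\<Phi> (\<lambda>j\<in>{..<Suc (Suc l)}. ?Z j w))"
      unfolding ev of_real_add[of "\<theta>1 _ + \<theta>2 _"] distrib_left[of \<i> "complex_of_real (\<theta>1 _ + \<theta>2 _)"] exp_add[of "\<i> * complex_of_real (\<theta>1 _ + \<theta>2 _)"]
      by (simp only: mult_ac)
    also have "\<dots> = complex_of_real c0 * (CLINT w|M. ?\<Phi> (\<lambda>j\<in>{..<Suc (Suc l)}. ?Z j w))"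
    proof (rule char_factor)
      note [measurable] = PiM_lessThan_component
      show "?Z j \<in> borel_measurable M" if "j \<in> {..<Suc (Suc l)}" for j using that by (cases j) auto
      have [measurable]: "(\<lambda>z. ?xs z j) \<in> borel_measurable ?P" if "j < Suc l" for j
        by (intro borel_measurable_scaleR borel_measurable_const borel_measurable_add PiM_lessThan_component) (use that in auto)
      have "(\<lambda>z. \<lambda>j\<in>{..<Suc l}. ?xs z j) \<in> measurable ?P (Pi\<^sub>M {..<Suc l} (\<lambda>_. borel))"
        by (rule measurable_restrict) simp
      then have [measurable]: "(\<lambda>z. \<Psi> (\<lambda>j\<in>{..<Suc l}. ?xs z j)) \<in> borel_measurable ?P"
        by (rule measurable_compose[OF _ \<Psi>])
      show "?\<Phi> \<in> borel_measurable ?P" by measurable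
      show "integrable M (\<lambda>w. ?\<Phi> (\<lambda>j\<in>{..<Suc (Suc l)}. ?Z j w))"
        unfolding ev by (rule integrable_const_bound[where B=C]) (use \<Psi>b in \<open>auto simp: norm_mult\<close>)
      fix k :: "nat \<Rightarrow> 'h"
      have e: "iexp (\<Sum>j<Suc (Suc l). ?Z j w \<bullet> k j) = iexp (x0 w \<bullet> k 0) * iexp (\<Sum>j<Suc l. B (u j) w \<bullet> k (Suc j))" for w
        by (subst sum.lessThan_Suc_shift) (simp add: distrib_left exp_add del: sum.lessThan_Suc)
      have "(CLINT w|M. iexp (\<zeta> w \<bullet> \<kappa>') * iexp (\<Sum>j<Suc (Suc l). ?Z j w \<bullet> k j)) =
          (CLINT w|M. iexp (x0 w \<bullet> k 0) * iexp ((\<Sum>j<Suc l. B (u j) w \<bullet> k (Suc j)) + \<zeta> w \<bullet> \<kappa>'))"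
        unfolding e of_real_add[of "\<Sum>j<Suc l. B (u j) _ \<bullet> k (Suc j)"] distrib_left[of \<i> "complex_of_real (\<Sum>j<Suc l. B (u j) _ \<bullet> k (Suc j))"]
          exp_add[of "\<i> * complex_of_real (\<Sum>j<Suc l. B (u j) _ \<bullet> k (Suc j))"]
        by (simp only: mult_ac)
      also have "\<dots> = (CLINT w|M. iexp (x0 w \<bullet> k 0) * iexp (\<Sum>j<Suc l. B (u j) w \<bullet> k (Suc j))) * complex_of_real c0"
        unfolding \<zeta>_def c0_def
        by (rule bridge_char[where g="\<lambda>x. iexp (x \<bullet> k 0)" and C=1]) (use p p'0 u in auto)
      finally show "(CLINT w|M. iexp (\<zeta> w \<bullet> \<kappa>') * iexp (\<Sum>j<Suc (Suc l). ?Z j w \<bullet> k j)) =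
          complex_of_real c0 * (CLINT w|M. iexp (\<Sum>j<Suc (Suc l). ?Z j w \<bullet> k j))"
        unfolding e by (simp only: mult.commute)
    qed auto
    finally show ?thesis unfolding ev by (simp only: mult.commute)
  qed
  have iX: "integrable M (\<lambda>w. norm (X p' w))" "(\<integral>w. norm (X p' w) \<partial>M) \<le> X_bound" using X_norm[OF pT(2)] by auto
  have i\<nu>: "integrable M (\<lambda>w. (norm (\<nu> w))\<^sup>2)" "(\<integral>w. (norm (\<nu> w))\<^sup>2 \<partial>M) \<le> 4 * (\<integral>w. (norm (x0 w))\<^sup>2 \<partial>M)"
    using innovation_sq[OF p'0 p(3)] unfolding \<nu>_def by auto
  define b where "b w = \<epsilon> * ?h * norm \<kappa> * (norm (X p' w) + norm (x0 w)) + (?h * \<kappa>2 p' * norm \<kappa>)\<^sup>2 * (norm (\<nu> w))\<^sup>2 / 2" for w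
  have ib: "integrable M b" unfolding b_def[abs_def] using iX i\<nu> x0_norm_int by auto
  \<comment> \<open>The term linear in \<theta>2 has expectation zero, so it may be subtracted
    before absolute values are taken.\<close>
  have o: "(CLINT w|M. \<Psi> (Xs w) * (\<i> * complex_of_real (\<theta>2 w))) = 0"
  proof -
    have "(CLINT w|M. \<Psi> (Xs w) * (\<i> * complex_of_real (\<theta>2 w))) =
       (CLINT w|M. (\<i> * complex_of_real (?h * \<kappa>2 p')) * (complex_of_real ((x0 w - pmean p' (X p' w)) \<bullet> \<kappa>) * \<Psi> (\<lambda>j\<in>{..<Suc l}. X (u j) w)))"
      unfolding Xs_def \<theta>2_def \<nu>_def of_real_mult by (simp only: mult_ac)
    also have "\<dots> = (\<i> * complex_of_real (?h * \<kappa>2 p')) * 0"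
      unfolding integral_mult_right_zero using innovation_orthogonal[OF p'0 p(3) u \<Psi> \<Psi>b] by (simp only:)
    finally show ?thesis by simp
  qed
  have i\<theta>: "integrable M (\<lambda>w. \<Psi> (Xs w) * (\<i> * complex_of_real (\<theta>2 w)))"
  proof -
    have "integrable M (\<lambda>w. \<i> * complex_of_real (\<theta>2 w))"
      unfolding \<theta>2_def \<nu>_def using innovation_int[OF p'0 p(3), of \<kappa>] by (intro integrable_mult_right integrable_of_real)
    from integrable_mult_bounded[OF this, of "\<lambda>w. \<Psi> (Xs w)" C] \<Psi>b show ?thesis by (simp add: mult.commute)
  qed
  \<comment> \<open>\<theta>1 is treated by the first-order bound of the exponential and \<theta>2,
    after subtraction of its linear term, by the second-order one.\<close>
  have pw: "cmod (\<Psi> (Xs w) * (iexp (\<theta>1 w + \<theta>2 w) - 1 - \<i> * complex_of_real (\<theta>2 w))) \<le> C * b w" for w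
  proof -
    have "iexp (\<theta>1 w + \<theta>2 w) - 1 - \<i> * complex_of_real (\<theta>2 w) =
        iexp (\<theta>2 w) * (iexp (\<theta>1 w) - 1) + (iexp (\<theta>2 w) - 1 - \<i> * complex_of_real (\<theta>2 w))"
      by (simp add: distrib_left exp_add algebra_simps)
    also have "cmod \<dots> \<le> cmod (iexp (\<theta>2 w) * (iexp (\<theta>1 w) - 1)) + cmod (iexp (\<theta>2 w) - 1 - \<i> * complex_of_real (\<theta>2 w))"
      by (rule norm_triangle_ineq)
    also have "\<dots> \<le> \<bar>\<theta>1 w\<bar> + (\<theta>2 w)\<^sup>2 / 2"
      using cmod_iexp_bounds[of "\<theta>1 w"] cmod_iexp_bounds[of "\<theta>2 w"] by (intro add_mono) (auto simp: norm_mult)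
    also have "\<bar>\<theta>1 w\<bar> \<le> \<epsilon> * ?h * norm \<kappa> * (norm (X p' w) + norm (x0 w))"
    proof -
      have "\<bar>\<theta>1 w\<bar> \<le> norm (\<rho>1 *\<^sub>R X p' w + \<rho>2 *\<^sub>R x0 w) * norm \<kappa>" unfolding \<theta>1_def by (rule Cauchy_Schwarz_ineq2)
      also have "\<dots> \<le> (\<bar>\<rho>1\<bar> * norm (X p' w) + \<bar>\<rho>2\<bar> * norm (x0 w)) * norm \<kappa>"
        by (intro mult_right_mono order_trans[OF norm_triangle_ineq]) auto
      also have "\<dots> \<le> (\<epsilon> * ?h * norm (X p' w) + \<epsilon> * ?h * norm (x0 w)) * norm \<kappa>"
        using \<epsilon>(1,2) unfolding \<rho>1_def \<rho>2_def by (intro mult_right_mono add_mono) auto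
      finally show ?thesis by (simp add: algebra_simps)
    qed
    also have "(\<theta>2 w)\<^sup>2 \<le> (?h * \<kappa>2 p' * norm \<kappa>)\<^sup>2 * (norm (\<nu> w))\<^sup>2"
    proof -
      have "(\<nu> w \<bullet> \<kappa>)\<^sup>2 \<le> (norm (\<nu> w))\<^sup>2 * (norm \<kappa>)\<^sup>2"
        using Cauchy_Schwarz_ineq[of "\<nu> w" \<kappa>] by (simp add: power2_norm_eq_inner)
      then have "(?h * \<kappa>2 p')\<^sup>2 * (\<nu> w \<bullet> \<kappa>)\<^sup>2 \<le> (?h * \<kappa>2 p')\<^sup>2 * ((norm (\<nu> w))\<^sup>2 * (norm \<kappa>)\<^sup>2)" by (rule mult_left_mono) simp
      then show ?thesis unfolding \<theta>2_def power_mult_distrib by (simp add: mult_ac)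
    qed
    finally have "cmod (iexp (\<theta>1 w + \<theta>2 w) - 1 - \<i> * complex_of_real (\<theta>2 w)) \<le> b w" by (simp add: b_def)
    then show ?thesis unfolding norm_mult using \<Psi>b C0 by (intro mult_mono) auto
  qed
  have E1: "cmod ((CLINT w|M. \<Psi> (Xs w) * iexp (\<theta>1 w + \<theta>2 w)) - (CLINT w|M. \<Psi> (Xs w)))
     \<le> C * (\<epsilon> * ?h * norm \<kappa> * (X_bound + (\<integral>w. norm (x0 w) \<partial>M)) + 2 * ?h\<^sup>2 * (\<kappa>2 p')\<^sup>2 * (norm \<kappa>)\<^sup>2 * (\<integral>w. (norm (x0 w))\<^sup>2 \<partial>M))"
  proof -
    have i1: "integrable M (\<lambda>w. \<Psi> (Xs w) * iexp (\<theta>1 w + \<theta>2 w))" "integrable M (\<lambda>w. \<Psi> (Xs w))"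
      by (rule integrable_const_bound[where B=C]; use \<Psi>b in \<open>auto simp: norm_mult\<close>)+
    have "(CLINT w|M. \<Psi> (Xs w) * iexp (\<theta>1 w + \<theta>2 w)) - (CLINT w|M. \<Psi> (Xs w)) =
       (CLINT w|M. \<Psi> (Xs w) * iexp (\<theta>1 w + \<theta>2 w) - \<Psi> (Xs w) - \<Psi> (Xs w) * (\<i> * complex_of_real (\<theta>2 w)))"
      using i1 i\<theta> o by simp
    also have "\<dots> = (CLINT w|M. \<Psi> (Xs w) * (iexp (\<theta>1 w + \<theta>2 w) - 1 - \<i> * complex_of_real (\<theta>2 w)))"
      by (simp only: right_diff_distrib mult_1_right)
    also have "cmod \<dots> \<le> (\<integral>w. C * b w \<partial>M)"
      by (rule norm_integral_le) (use ib pw i1 i\<theta> in \<open>auto simp: right_diff_distrib\<close>)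
    also have "\<dots> = C * (\<epsilon> * ?h * norm \<kappa> * ((\<integral>w. norm (X p' w) \<partial>M) + (\<integral>w. norm (x0 w) \<partial>M)) + (?h * \<kappa>2 p' * norm \<kappa>)\<^sup>2 * (\<integral>w. (norm (\<nu> w))\<^sup>2 \<partial>M) / 2)"
      unfolding b_def using iX i\<nu> x0_norm_int by simp
    also have "\<dots> \<le> C * (\<epsilon> * ?h * norm \<kappa> * (X_bound + (\<integral>w. norm (x0 w) \<partial>M)) + (?h * \<kappa>2 p' * norm \<kappa>)\<^sup>2 * (4 * (\<integral>w. (norm (x0 w))\<^sup>2 \<partial>M)) / 2)"
      using C0 iX(2) i\<nu>(2) mult_nonneg_nonneg[OF \<epsilon>0 norm_ge_zero[of \<kappa>]]
      by (intro mult_left_mono[OF _ C0] add_mono divide_right_mono mult_left_mono[where c="\<epsilon> * ?h * norm \<kappa>"]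
          mult_left_mono[where c="(?h * \<kappa>2 p' * norm \<kappa>)\<^sup>2"]) auto
    also have "\<dots> = C * (\<epsilon> * ?h * norm \<kappa> * (X_bound + (\<integral>w. norm (x0 w) \<partial>M)) + 2 * ?h\<^sup>2 * (\<kappa>2 p')\<^sup>2 * (norm \<kappa>)\<^sup>2 * (\<integral>w. (norm (x0 w))\<^sup>2 \<partial>M))"
      by (simp add: power_mult_distrib)
    finally show ?thesis .
  qed
  have r1: "?r \<le> 1" "0 \<le> noise_var p"
    using noise_var_mono[of p p'] noise_var_pos[of p'] noise_var_nonneg[of p] p p'0 by (auto simp: bridge_def divide_le_eq)
  have qk: "noise_var p * (1 - ?r) * q \<kappa>' \<kappa>' = noise_var p * (1 - ?r) / (growth p)\<^sup>2 * q \<kappa> \<kappa>"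
    by (simp add: \<kappa>'_def power2_eq_square)
  \<comment> \<open>The exact bridge variance is replaced by \<open>h * \<alpha>\<close>; the
    exponential is 1-Lipschitz on nonpositive arguments.\<close>
  have c0: "0 \<le> c0" "c0 \<le> 1" "\<bar>c0 - exp (- (?h * \<alpha> p' * q \<kappa> \<kappa>) / 2)\<bar> \<le> \<epsilon> * ?h * q \<kappa> \<kappa> / 2"
  proof -
    have n1: "0 \<le> noise_var p * (1 - ?r) * q \<kappa>' \<kappa>' / 2" using r1 q_nonneg by simp
    show "0 \<le> c0" by (simp add: c0_def)
    show "c0 \<le> 1" using n1 by (simp add: c0_def)
    have n2: "0 \<le> ?h * \<alpha> p' * q \<kappa> \<kappa> / 2" using h0 \<alpha>_pos[OF pT(2)] q_nonneg by simp
    have "\<bar>c0 - exp (- (?h * \<alpha> p' * q \<kappa> \<kappa>) / 2)\<bar> \<le> \<bar>noise_var p * (1 - ?r) * q \<kappa>' \<kappa>' / 2 - ?h * \<alpha> p' * q \<kappa> \<kappa> / 2\<bar>"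
      unfolding c0_def using exp_minus_Lipschitz[OF n1 n2] by simp
    also have "\<dots> = \<bar>noise_var p * (1 - ?r) / (growth p)\<^sup>2 - ?h * \<alpha> p'\<bar> * (q \<kappa> \<kappa> / 2)"
    proof -
      have "noise_var p * (1 - ?r) * q \<kappa>' \<kappa>' / 2 - ?h * \<alpha> p' * q \<kappa> \<kappa> / 2 = (noise_var p * (1 - ?r) / (growth p)\<^sup>2 - ?h * \<alpha> p') * (q \<kappa> \<kappa> / 2)"
      proof -
        have "a * x / 2 - b * x / 2 = (a - b) * (x / 2)" for a b x :: real by (simp add: field_simps)
        then show ?thesis unfolding qk by blast
      qed
      then show ?thesis using q_nonneg[of \<kappa>] by (simp only: abs_mult)
    qed
    also have "\<dots> \<le> (\<epsilon> * ?h) * (q \<kappa> \<kappa> / 2)" using \<epsilon>(3) q_nonneg[of \<kappa>] by (intro mult_right_mono) auto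
    finally show "\<bar>c0 - exp (- (?h * \<alpha> p' * q \<kappa> \<kappa>) / 2)\<bar> \<le> \<epsilon> * ?h * q \<kappa> \<kappa> / 2" by simp
  qed
  let ?E1 = "CLINT w|M. \<Psi> (Xs w) * iexp (\<theta>1 w + \<theta>2 w)" and ?E0 = "CLINT w|M. \<Psi> (Xs w)"
  let ?c1 = "exp (- (?h * \<alpha> p' * q \<kappa> \<kappa>) / 2)"
  have E0: "cmod ?E0 \<le> C"
  proof -
    have "cmod ?E0 \<le> (\<integral>w. C \<partial>M)"
      by (rule norm_integral_le) (use \<Psi>b in \<open>auto intro!: integrable_const_bound[where B=C]\<close>)
    then show ?thesis by (simp add: prob_space)
  qed
  have "?E1 * complex_of_real c0 - ?E0 * complex_of_real ?c1 = (?E1 - ?E0) * complex_of_real c0 + ?E0 * complex_of_real (c0 - ?c1)"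
    by (simp add: algebra_simps)
  also have "cmod \<dots> \<le> cmod (?E1 - ?E0) * 1 + C * (\<epsilon> * ?h * q \<kappa> \<kappa> / 2)"
  proof (rule order_trans[OF norm_triangle_ineq], rule add_mono)
    show "cmod ((?E1 - ?E0) * complex_of_real c0) \<le> cmod (?E1 - ?E0) * 1"
      unfolding norm_mult using c0 by (intro mult_left_mono) auto
    have "cmod (complex_of_real (c0 - ?c1)) = \<bar>c0 - ?c1\<bar>" by (simp only: norm_of_real)
    then show "cmod (?E0 * complex_of_real (c0 - ?c1)) \<le> C * (\<epsilon> * ?h * q \<kappa> \<kappa> / 2)"
      unfolding norm_mult using E0 c0(3) C0 by (intro mult_mono) auto
  qed
  finally have fin: "cmod (?E1 * complex_of_real c0 - ?E0 * complex_of_real ?c1) \<le> cmod (?E1 - ?E0) + C * (\<epsilon> * ?h * q \<kappa> \<kappa> / 2)" by simp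
  show ?thesis
    unfolding split Xs_def[symmetric] A using fin E1 by (simp add: algebra_simps)
qed

end

section \<open>The noise of the reversed process\<close>

lemma integral_measurable:
  fixes f :: "real \<Rightarrow> 'w \<Rightarrow> 'h::{banach,second_countable_topology}"
  assumes fm: "\<And>s. s \<in> {0..t} \<Longrightarrow> f s \<in> borel_measurable M"
    and fc: "\<And>w. w \<in> space M \<Longrightarrow> continuous_on {0..t} (\<lambda>s. f s w)" and t: "0 \<le> t"
  shows "(\<lambda>w. integral {0..t} (\<lambda>s. f s w)) \<in> borel_measurable M"
proof (rule borel_measurable_LIMSEQ_metric)
  show "(\<lambda>w. \<Sum>i<gidx t N. gstep N *\<^sub>R f (real i * gstep N) w) \<in> borel_measurable M" for N
    by (intro borel_measurable_sum borel_measurable_scaleR borel_measurable_const fm gidx_grid[OF t]) auto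
  show "(\<lambda>N. \<Sum>i<gidx t N. gstep N *\<^sub>R f (real i * gstep N) w) \<longlonglongrightarrow> integral {0..t} (\<lambda>s. f s w)" if "w \<in> space M" for w
    by (rule riemann_sum_tendsto[OF fc[OF that] _ gstep_nonneg gstep_tendsto gidx_le[OF t] gidx_tendsto[OF t]]) (use t in auto)
qed

text \<open>The error of a step is multiplied only by later factors of modulus at most 1, so the
  errors just add up.\<close>

lemma weighted_telescope:
  fixes A :: "nat \<Rightarrow> complex" and c :: "nat \<Rightarrow> complex"
  assumes "\<And>i. i < n \<Longrightarrow> cmod (A (Suc i) - A i * c i) \<le> d" "\<And>i. i < n \<Longrightarrow> cmod (c i) \<le> 1"
  shows "cmod (A n - A 0 * (\<Prod>i<n. c i)) \<le> real n * d"
  using assms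
proof (induction n)
  case (Suc n)
  have "A (Suc n) - A 0 * (\<Prod>i<Suc n. c i) = (A (Suc n) - A n * c n) + (A n - A 0 * (\<Prod>i<n. c i)) * c n"
    by (simp add: algebra_simps)
  also have "cmod \<dots> \<le> d + real n * d * 1"
  proof (rule order_trans[OF norm_triangle_ineq], rule add_mono)
    show "cmod (A (Suc n) - A n * c n) \<le> d" using Suc.prems(1)[of n] by simp
    have IH: "cmod (A n - A 0 * (\<Prod>i<n. c i)) \<le> real n * d" using Suc by simp
    have "0 \<le> real n * d" using IH norm_ge_zero order_trans by blast
    then show "cmod ((A n - A 0 * (\<Prod>i<n. c i)) * c n) \<le> real n * d * 1"
      unfolding norm_mult using IH Suc.prems(2)[of n] by (intro mult_mono) auto
  qed
  finally show ?case by (simp add: algebra_simps)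
qed simp

context ou_process
begin

text \<open>With this choice the reversed path satisfies its integral equation identically; all
  content lies in the law of the process.\<close>

definition rnoise :: "real \<Rightarrow> 'w \<Rightarrow> 'h" where
  "rnoise t w = X (T - t) w - X T w - integral {0..t} (\<lambda>s. rdrift (T - s) (X (T - s) w))"

lemma rdrift_path_cont:
  assumes "w \<in> space M" "t0 < T"
  shows "continuous_on {0..t0} (\<lambda>s. rdrift (T - s) (X (T - s) w))"
  by (rule continuous_on_compose2[OF rdrift_cont[OF assms(1), of "T - t0"], where f="\<lambda>s. T - s"])
     (use assms in \<open>auto intro!: continuous_intros\<close>)

lemma X_path_cont:
  assumes "w \<in> space M" "t0 < T"
  shows "continuous_on {0..t0} (\<lambda>s. X (T - s) w)"
  by (rule continuous_on_compose2[OF X_cont[OF assms(1)], where f="\<lambda>s. T - s"])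
     (use assms in \<open>auto intro!: continuous_intros\<close>)

lemma rnoise_cont:
  assumes "w \<in> space M" "t0 < T"
  shows "continuous_on {0..t0} (\<lambda>t. rnoise t w)"
  unfolding rnoise_def
  by (intro continuous_intros continuous_on_integral rdrift_path_cont[OF assms] X_path_cont[OF assms])

lemma rnoise_meas:
  assumes "0 \<le> t" "t < T"
  shows "rnoise t \<in> borel_measurable M"
proof -
  have [measurable]: "X (T - s) \<in> borel_measurable M" if "s \<in> {0..t}" for s using X_meas[of "T - s"] that assms by auto
  have "(\<lambda>w. integral {0..t} (\<lambda>s. rdrift (T - s) (X (T - s) w))) \<in> borel_measurable M"
  proof (rule integral_measurable)
    fix s assume s: "s \<in> {0..t}"
    show "(\<lambda>w. rdrift (T - s) (X (T - s) w)) \<in> borel_measurable M"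
      by (rule measurable_compose[OF _ rdrift_meas]) (use s assms in auto)
  qed (use assms rdrift_path_cont in auto)
  moreover have "X T \<in> borel_measurable M" "X (T - t) \<in> borel_measurable M" using X_meas assms by auto
  ultimately show ?thesis unfolding rnoise_def[abs_def] by measurable
qed

text \<open>Time reversal: \<open>rnoise\<close> is the noise driving the reversed process.  Like the innovation
  process in filtering, it is Gaussian and independent of \<open>X T\<close>, since along a fine grid each step
  changes the characteristic function by the Gaussian factor up to an error \<open>o(h)\<close>.\<close>

lemma rnoise_char:
  fixes g :: "'h \<Rightarrow> complex" and J :: "real set"
  assumes g[measurable]: "g \<in> borel_measurable borel" and gb: "\<And>x. cmod (g x) \<le> C"
    and t0: "0 \<le> t0" "t0 < T" and J: "finite J" "J \<subseteq> {0..t0}"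
  shows "(CLINT w|M. g (X T w) * iexp (\<Sum>t\<in>J. rnoise t w \<bullet> k t)) =
    (CLINT w|M. g (X T w)) * complex_of_real (exp (- (\<Sum>s\<in>J. \<Sum>t\<in>J. q (k s) (k t) * integral {0..min s t} (\<lambda>r. \<alpha> (T - r))) / 2))"
    (is "?L = ?E0 * complex_of_real ?R")
proof -
  have C0: "0 \<le> C" using gb[of undefined] norm_ge_zero order_trans by blast
  have XT[measurable]: "X T \<in> borel_measurable M" using X_meas T_pos by auto
  have J': "0 \<le> t" "t \<le> t0" if "t \<in> J" for t using J that by auto
  \<comment> \<open>The grid runs backwards from \<open>T\<close>; stopping at \<open>t0\<close>
    keeps its points at or above \<open>T - t0\<close>, away from the singular time 0.\<close>
  define u where "u N i = T - real i * gstep N" for N i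
  have u: "T - t0 \<le> u N i" "u N i \<le> T" "0 < u N i" if "i \<le> gidx t0 N" for N i
    using gidx_grid[OF t0(1) that] t0 by (auto simp: u_def)
  have uS: "u N i - u N (Suc i) = gstep N" for N i by (simp add: u_def algebra_simps)
  have u0: "u N 0 = T" for N by (simp add: u_def)
  define d where "d N i w = X (u N (Suc i)) w - X (u N i) w - gstep N *\<^sub>R rdrift (u N i) (X (u N i) w)" for N i w
  define \<kappa> where "\<kappa> N i = (\<Sum>t\<in>J. of_bool (i < gidx t N) *\<^sub>R k t)" for N i
  define S where "S N t w = (\<Sum>i<gidx t N. d N i w)" for N t w
  have X_m: "X (u N i) \<in> borel_measurable M" if "i \<le> gidx t0 N" for N i using u[OF that] X_meas[of "u N i"] by auto
  have r_m: "(\<lambda>w. rdrift (u N i) (X (u N i) w)) \<in> borel_measurable M" if "i \<le> gidx t0 N" for N i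
    by (rule measurable_compose[OF X_m[OF that] rdrift_meas]) (use u[OF that] in auto)
  have d_m: "d N i \<in> borel_measurable M" if "i < gidx t0 N" for N i
    unfolding d_def[abs_def]
    by (intro borel_measurable_diff borel_measurable_scaleR borel_measurable_const X_m r_m) (use that in auto)
  have S_eq: "(\<Sum>t\<in>J. S N t w \<bullet> k t) = (\<Sum>i<gidx t0 N. d N i w \<bullet> \<kappa> N i)" for N w
  proof -
    have "S N t w \<bullet> k t = (\<Sum>i<gidx t0 N. d N i w \<bullet> (of_bool (i < gidx t N) *\<^sub>R k t))" if "t \<in> J" for t
    proof -
      have "(\<Sum>i<gidx t0 N. d N i w \<bullet> (of_bool (i < gidx t N) *\<^sub>R k t)) = (\<Sum>i<gidx t N. d N i w \<bullet> k t)"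
        using gidx_mono[OF J'(2)[OF that], of N] by (intro sum.mono_neutral_cong_right) auto
      then show ?thesis by (simp add: S_def inner_sum_left)
    qed
    then have "(\<Sum>t\<in>J. S N t w \<bullet> k t) = (\<Sum>t\<in>J. \<Sum>i<gidx t0 N. d N i w \<bullet> (of_bool (i < gidx t N) *\<^sub>R k t))"
      by (rule sum.cong[OF refl])
    also have "\<dots> = (\<Sum>i<gidx t0 N. d N i w \<bullet> \<kappa> N i)"
      by (subst sum.swap) (simp add: \<kappa>_def inner_sum_right)
    finally show ?thesis .
  qed
  have S_lim: "(\<lambda>N. S N t w) \<longlonglongrightarrow> rnoise t w" if w: "w \<in> space M" and t: "t \<in> J" for t w
  proof -
    let ?b = "\<lambda>s. rdrift (T - s) (X (T - s) w)"
    have tele: "(\<Sum>i<n. d N i w) = X (u N n) w - X T w - (\<Sum>i<n. gstep N *\<^sub>R ?b (real i * gstep N))" for n N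
    proof -
      have "(\<Sum>i<n. X (u N (Suc i)) w - X (u N i) w) = X (u N n) w - X (u N 0) w"
        by (rule sum_lessThan_telescope)
      then show ?thesis unfolding d_def by (simp add: sum_subtractf u0) (simp add: u_def)
    qed
    have "(\<lambda>N. X (u N (gidx t N)) w) \<longlonglongrightarrow> X (T - t) w"
    proof (rule continuous_on_tendsto_compose[OF X_cont[OF w]])
      show "(\<lambda>N. u N (gidx t N)) \<longlonglongrightarrow> T - t" unfolding u_def using J'[OF t] by (intro tendsto_intros gidx_tendsto)
      show "\<forall>\<^sub>F N in sequentially. u N (gidx t N) \<in> {0..T}"
        using u(2,3) gidx_mono[OF J'(2)[OF t]] by (intro always_eventually) (auto intro: less_imp_le)
    qed (use J'[OF t] t0 in auto)
    moreover have "(\<lambda>N. \<Sum>i<gidx t N. gstep N *\<^sub>R ?b (real i * gstep N)) \<longlonglongrightarrow> integral {0..t} ?b"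
      by (rule riemann_sum_tendsto[OF rdrift_path_cont[OF w t0(2)] _ gstep_nonneg gstep_tendsto _ gidx_tendsto[OF J'(1)[OF t]]])
         (use J'[OF t] order_trans[OF gidx_le[OF J'(1)[OF t]]] in auto)
    ultimately show ?thesis unfolding S_def tele rnoise_def by (intro tendsto_diff tendsto_const)
  qed
  have rn_m: "rnoise t \<in> borel_measurable M" if "t \<in> J" for t using rnoise_meas J'[OF that] t0 by auto
  \<comment> \<open>The expectation after \<open>l\<close> steps; \<open>c N l\<close> below is the
    Gaussian factor that the next step contributes up to a small error.\<close>
  define A where "A N l = (CLINT w|M. g (X T w) * iexp (\<Sum>i<l. d N i w \<bullet> \<kappa> N i))" for N l
  define c where "c N i = complex_of_real (exp (- (gstep N * \<alpha> (u N i) * q (\<kappa> N i) (\<kappa> N i)) / 2))" for N i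
  have A_lim: "(\<lambda>N. A N (gidx t0 N)) \<longlonglongrightarrow> ?L"
    unfolding A_def S_eq[symmetric]
  proof (rule integral_dominated_convergence[where w="\<lambda>_. C"])
    show "AE w in M. (\<lambda>N. g (X T w) * iexp (\<Sum>t\<in>J. S N t w \<bullet> k t)) \<longlonglongrightarrow> g (X T w) * iexp (\<Sum>t\<in>J. rnoise t w \<bullet> k t)"
      by (intro AE_I2 tendsto_intros S_lim)
    show "(\<lambda>w. g (X T w) * iexp (\<Sum>t\<in>J. S N t w \<bullet> k t)) \<in> borel_measurable M" for N
      unfolding S_eq using d_m[of _ N] by measurable
    show "(\<lambda>w. g (X T w) * iexp (\<Sum>t\<in>J. rnoise t w \<bullet> k t)) \<in> borel_measurable M"
      using rn_m by measurable
  qed (use gb in \<open>auto simp: norm_mult\<close>)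
  define Kn where "Kn = (\<Sum>t\<in>J. norm (k t))"
  define Kq where "Kq = (\<Sum>s\<in>J. \<Sum>t\<in>J. \<bar>q (k s) (k t)\<bar>)"
  have Kn0: "0 \<le> Kn" "0 \<le> Kq" by (auto simp: Kn_def Kq_def intro!: sum_nonneg)
  have \<kappa>n: "norm (\<kappa> N i) \<le> Kn" for N i
    unfolding \<kappa>_def Kn_def by (rule order_trans[OF norm_sum], rule sum_mono) auto
  have q\<kappa>: "q (\<kappa> N i) (\<kappa> N i) = (\<Sum>s\<in>J. \<Sum>t\<in>J. of_bool (i < gidx (min s t) N) * q (k s) (k t))" for N i
    unfolding \<kappa>_def q_sum gidx_min
    by (subst sum.swap) (simp add: mult_ac of_bool_conj)
  have \<kappa>q: "q (\<kappa> N i) (\<kappa> N i) \<le> Kq" for N i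
    unfolding q\<kappa> Kq_def by (intro sum_mono) auto
  have "bounded (\<kappa>2 ` {T - t0..T})" using \<kappa>_cont(2)[of "T - t0"] t0
    by (intro compact_imp_bounded compact_continuous_image) auto
  then obtain K2 where K2: "\<And>t. t \<in> {T - t0..T} \<Longrightarrow> \<bar>\<kappa>2 t\<bar> \<le> K2"
    unfolding bounded_iff by (metis image_eqI real_norm_def)
  define E1 where "E1 = X_bound + (\<integral>w. norm (x0 w) \<partial>M)"
  define E2 where "E2 = (\<integral>w. (norm (x0 w))\<^sup>2 \<partial>M)"
  have E10: "0 \<le> E1" "0 \<le> E2"
  proof -
    have "0 \<le> (\<integral>w. norm (X T w) \<partial>M)" by simp
    also have "\<dots> \<le> X_bound" using T_pos by (intro X_norm) simp
    finally have "0 \<le> X_bound" .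
    then show "0 \<le> E1" by (simp add: E1_def)
    show "0 \<le> E2" by (simp add: E2_def)
  qed
  have err: "(\<lambda>N. A N (gidx t0 N) - A N 0 * (\<Prod>i<gidx t0 N. c N i)) \<longlonglongrightarrow> 0"
  proof (rule LIMSEQ_I)
    fix r :: real assume r: "0 < r"
    \<comment> \<open>The error of a single step is at most \<epsilon> times the mesh times
      \<open>K\<close>, with \<open>K\<close> independent of the grid.\<close>
    define K where "K = C * (Kn * E1 + 2 * K2\<^sup>2 * Kn\<^sup>2 * E2 + Kq / 2)"
    have K0: "0 \<le> K" unfolding K_def using C0 Kn0 E10 by auto
    define \<epsilon> where "\<epsilon> = r / (2 * (t0 * K + 1))"
    have pos: "0 < t0 * K + 1" using t0 K0 by (simp add: add_nonneg_pos)
    have \<epsilon>: "0 < \<epsilon>" using r pos by (simp add: \<epsilon>_def)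
    obtain \<delta> where \<delta>: "0 < \<delta>" and step: "\<And>s t. T - t0 \<le> s \<Longrightarrow> s \<le> t \<Longrightarrow> t \<le> T \<Longrightarrow> t - s < \<delta> \<Longrightarrow>
        \<bar>growth t / growth s * bridge s t - 1 - (t - s) * \<kappa>1 t\<bar> \<le> \<epsilon> * (t - s) \<and>
        \<bar>(1 - bridge s t) / growth s - (t - s) * \<kappa>2 t\<bar> \<le> \<epsilon> * (t - s) \<and>
        \<bar>noise_var s * (1 - bridge s t) / (growth s)\<^sup>2 - (t - s) * \<alpha> t\<bar> \<le> \<epsilon> * (t - s)"
      using one_step_coefficients[of "T - t0" \<epsilon>] t0 \<epsilon> by auto
    \<comment> \<open>Besides \<open>h < \<delta>\<close>, also \<open>h < \<epsilon>\<close> is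
      required of the mesh, so that terms of order \<open>h^2\<close> are at most \<epsilon> times
      \<open>h\<close>.\<close>
    have "0 < min \<delta> \<epsilon>" using \<delta> \<epsilon> by simp
    then obtain N0 where N0: "\<And>N. N \<ge> N0 \<Longrightarrow> gstep N < min \<delta> \<epsilon>"
      using LIMSEQ_D[OF gstep_tendsto, of "min \<delta> \<epsilon>"] gstep_pos by (metis abs_of_pos diff_zero real_norm_def)
    have "cmod (A N (gidx t0 N) - A N 0 * (\<Prod>i<gidx t0 N. c N i)) < r" if N: "N \<ge> N0" for N
    proof -
      let ?h = "gstep N"
      have h: "0 < ?h" "?h < \<delta>" "?h < \<epsilon>" using gstep_pos[of N] N0[OF N] by auto
      have "cmod (A N (gidx t0 N) - A N 0 * (\<Prod>i<gidx t0 N. c N i)) \<le> real (gidx t0 N) * (\<epsilon> * ?h * K)"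
      proof (rule weighted_telescope)
        fix l assume l: "l < gidx t0 N"
        have ul: "T - t0 \<le> u N l" "u N l \<le> T" "T - t0 \<le> u N (Suc l)" "0 < u N (Suc l)" "u N (Suc l) \<le> u N l"
          using u[of l N] u[of "Suc l" N] l uS[of N l] h by auto
        have \<alpha>l: "0 < \<alpha> (u N l)" using \<alpha>_pos[of "u N l"] ul t0 by auto
        then show "cmod (c N l) \<le> 1" unfolding c_def using h q_nonneg[of "\<kappa> N l"] by simp
        let ?P = "Pi\<^sub>M {..<Suc l} (\<lambda>_. borel :: 'h measure)"
        \<comment> \<open>The initial factor and the exponential of the steps already taken, as a
          function of the visited states alone; \<open>rdrift\<close> is a deterministic function of
          the state.\<close>
        define \<Psi> where "\<Psi> z = g (z 0) * iexp (\<Sum>i<l. (z (Suc i) - z i - ?h *\<^sub>R rdrift (u N i) (z i)) \<bullet> \<kappa> N i)" for z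
        have \<Psi>m: "\<Psi> \<in> borel_measurable ?P"
        proof -
          note [measurable] = PiM_lessThan_component
          have [measurable]: "(\<lambda>z. rdrift (u N i) (z i)) \<in> borel_measurable ?P" if "i < l" for i
            by (rule measurable_compose[OF PiM_lessThan_component rdrift_meas]) (use that l u[of i N] in auto)
          show ?thesis unfolding \<Psi>_def[abs_def] by measurable
        qed
        have \<Psi>b: "cmod (\<Psi> z) \<le> C" for z unfolding \<Psi>_def norm_mult using gb by simp
        have \<Psi>X: "\<Psi> (\<lambda>j\<in>{..<Suc l}. X (u N j) w) = g (X T w) * iexp (\<Sum>i<l. d N i w \<bullet> \<kappa> N i)" for w
          unfolding \<Psi>_def d_def by (simp add: u0)
        have e: "u N l - u N (Suc l) = ?h" by (rule uS)
        note st = step[OF ul(3) ul(5) ul(2), unfolded e, OF h(2)]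
        have "cmod ((CLINT w|M. \<Psi> (\<lambda>j\<in>{..<Suc l}. X (u N j) w) * iexp ((X (u N (Suc l)) w - X (u N l) w - (u N l - u N (Suc l)) *\<^sub>R rdrift (u N l) (X (u N l) w)) \<bullet> \<kappa> N l))
          - (CLINT w|M. \<Psi> (\<lambda>j\<in>{..<Suc l}. X (u N j) w)) * complex_of_real (exp (- ((u N l - u N (Suc l)) * \<alpha> (u N l) * q (\<kappa> N l) (\<kappa> N l)) / 2)))
          \<le> C * (\<epsilon> * (u N l - u N (Suc l)) * norm (\<kappa> N l) * (X_bound + (\<integral>w. norm (x0 w) \<partial>M))
            + 2 * (u N l - u N (Suc l))\<^sup>2 * (\<kappa>2 (u N l))\<^sup>2 * (norm (\<kappa> N l))\<^sup>2 * (\<integral>w. (norm (x0 w))\<^sup>2 \<partial>M) + \<epsilon> * (u N l - u N (Suc l)) * q (\<kappa> N l) (\<kappa> N l) / 2)"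
        proof (rule one_step[where u="u N", OF ul(4,5,2) _ refl \<Psi>m \<Psi>b])
          show "u N l \<le> u N j \<and> u N j \<le> T" if "j < Suc l" for j
            using that gstep_nonneg[of N] by (auto simp: u_def intro!: mult_right_mono)
        qed (use st e in auto)
        then have "cmod (A N (Suc l) - A N l * c N l)
          \<le> C * (\<epsilon> * ?h * norm (\<kappa> N l) * E1 + 2 * ?h\<^sup>2 * (\<kappa>2 (u N l))\<^sup>2 * (norm (\<kappa> N l))\<^sup>2 * E2 + \<epsilon> * ?h * q (\<kappa> N l) (\<kappa> N l) / 2)"
          unfolding e \<Psi>X A_def c_def E1_def E2_def d_def[symmetric]
          by (simp add: distrib_left exp_add mult.assoc)
        also have "\<dots> \<le> C * (\<epsilon> * ?h * Kn * E1 + 2 * (\<epsilon> * ?h) * K2\<^sup>2 * Kn\<^sup>2 * E2 + \<epsilon> * ?h * Kq / 2)"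
        proof (intro mult_left_mono[OF _ C0] add_mono divide_right_mono)
          have eh: "0 \<le> \<epsilon> * ?h" using \<epsilon> h by simp
          show "\<epsilon> * ?h * norm (\<kappa> N l) * E1 \<le> \<epsilon> * ?h * Kn * E1"
            using eh E10 \<kappa>n by (intro mult_right_mono mult_left_mono) auto
          show "\<epsilon> * ?h * q (\<kappa> N l) (\<kappa> N l) \<le> \<epsilon> * ?h * Kq" using eh \<kappa>q by (intro mult_left_mono) auto
          have "?h\<^sup>2 \<le> \<epsilon> * ?h" using h by (simp add: power2_eq_square)
          moreover have "(\<kappa>2 (u N l))\<^sup>2 \<le> K2\<^sup>2" using K2[of "u N l"] ul by (intro power2_le_iff_abs_le[THEN iffD2]) auto
          moreover have "(norm (\<kappa> N l))\<^sup>2 \<le> Kn\<^sup>2" using \<kappa>n by (intro power_mono) auto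
          ultimately show "2 * ?h\<^sup>2 * (\<kappa>2 (u N l))\<^sup>2 * (norm (\<kappa> N l))\<^sup>2 * E2 \<le> 2 * (\<epsilon> * ?h) * K2\<^sup>2 * Kn\<^sup>2 * E2"
            using eh E10 by (intro mult_right_mono mult_mono) auto
        qed simp
        also have "\<dots> = \<epsilon> * ?h * K" by (simp add: K_def algebra_simps)
        finally show "cmod (A N (Suc l) - A N l * c N l) \<le> \<epsilon> * ?h * K" .
      qed
      also have "\<dots> = (real (gidx t0 N) * ?h) * (\<epsilon> * K)" by simp
      also have "\<dots> \<le> t0 * (\<epsilon> * K)" using gidx_le[OF t0(1), of N] \<epsilon> K0 by (intro mult_right_mono) auto
      also have "\<dots> \<le> \<epsilon> * (t0 * K + 1)" using \<epsilon> by (simp add: algebra_simps)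
      also have "\<dots> = r / 2"
      proof -
        have "r / (2 * x) * x = r / 2" if "0 < x" for x :: real using that by simp
        then show ?thesis unfolding \<epsilon>_def using pos by blast
      qed
      finally show ?thesis using r by simp
    qed
    then show "\<exists>no. \<forall>N\<ge>no. norm (A N (gidx t0 N) - A N 0 * (\<Prod>i<gidx t0 N. c N i) - 0) < r" by auto
  qed
  have A0: "A N 0 = ?E0" for N by (simp add: A_def)
  have c_prod: "(\<Prod>i<gidx t0 N. c N i) = complex_of_real (exp (- (\<Sum>s\<in>J. \<Sum>t\<in>J. q (k s) (k t) * (\<Sum>i<gidx (min s t) N. gstep N *\<^sub>R \<alpha> (T - real i * gstep N))) / 2))" for N
  proof -
    have "(\<Prod>i<gidx t0 N. c N i) = complex_of_real (exp (\<Sum>i<gidx t0 N. - (gstep N * \<alpha> (u N i) * q (\<kappa> N i) (\<kappa> N i)) / 2))"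
      by (simp add: c_def exp_sum)
    also have "(\<Sum>i<gidx t0 N. - (gstep N * \<alpha> (u N i) * q (\<kappa> N i) (\<kappa> N i)) / 2) = - (\<Sum>i<gidx t0 N. gstep N * \<alpha> (u N i) * q (\<kappa> N i) (\<kappa> N i)) / 2"
      by (simp add: sum_negf sum_divide_distrib)
    also have "(\<Sum>i<gidx t0 N. gstep N * \<alpha> (u N i) * q (\<kappa> N i) (\<kappa> N i)) =
      (\<Sum>i<gidx t0 N. \<Sum>s\<in>J. \<Sum>t\<in>J. q (k s) (k t) * (of_bool (i < gidx (min s t) N) * (gstep N * \<alpha> (u N i))))"
      unfolding q\<kappa> sum_distrib_left by (simp only: mult_ac)
    also have "\<dots> = (\<Sum>s\<in>J. \<Sum>t\<in>J. \<Sum>i<gidx t0 N. q (k s) (k t) * (of_bool (i < gidx (min s t) N) * (gstep N * \<alpha> (u N i))))"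
      by (subst sum.swap, rule sum.cong[OF refl], rule sum.swap)
    also have "\<dots> = (\<Sum>s\<in>J. \<Sum>t\<in>J. q (k s) (k t) * (\<Sum>i<gidx (min s t) N. gstep N *\<^sub>R \<alpha> (T - real i * gstep N)))"
    proof (intro sum.cong refl)
      fix s t assume "s \<in> J" "t \<in> J"
      then have le: "gidx (min s t) N \<le> gidx t0 N" using J' by (intro gidx_mono) (auto simp: min_def)
      have "(\<Sum>i<gidx t0 N. of_bool (i < gidx (min s t) N) * (gstep N * \<alpha> (u N i))) = (\<Sum>i<gidx (min s t) N. gstep N *\<^sub>R \<alpha> (T - real i * gstep N))"
        using le by (intro sum.mono_neutral_cong_right) (auto simp: u_def)
      then show "(\<Sum>i<gidx t0 N. q (k s) (k t) * (of_bool (i < gidx (min s t) N) * (gstep N * \<alpha> (u N i)))) =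
          q (k s) (k t) * (\<Sum>i<gidx (min s t) N. gstep N *\<^sub>R \<alpha> (T - real i * gstep N))"
        by (simp only: sum_distrib_left[symmetric])
    qed
    finally show ?thesis .
  qed
  have "(\<lambda>N. A N 0 * (\<Prod>i<gidx t0 N. c N i)) \<longlonglongrightarrow> ?E0 * complex_of_real ?R"
    unfolding A0 c_prod
  proof (intro tendsto_mult tendsto_const tendsto_of_real tendsto_exp tendsto_divide tendsto_minus tendsto_sum)
    fix s t assume st: "s \<in> J" "t \<in> J"
    have mt: "0 \<le> min s t" "min s t \<le> t0" using J' st by (auto simp: min_def)
    have c: "continuous_on {0..t0} (\<lambda>r. \<alpha> (T - r))"
      by (rule continuous_on_compose2[OF \<alpha>_cont, where f="\<lambda>r. T - r"]) (use t0 in \<open>auto intro!: continuous_intros\<close>)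
    show "(\<lambda>N. \<Sum>i<gidx (min s t) N. gstep N *\<^sub>R \<alpha> (T - real i * gstep N)) \<longlonglongrightarrow> integral {0..min s t} (\<lambda>r. \<alpha> (T - r))"
      by (rule riemann_sum_tendsto[OF c _ gstep_nonneg gstep_tendsto _ gidx_tendsto[OF mt(1)]])
         (use mt order_trans[OF gidx_le[OF mt(1)] mt(2)] in auto)
  qed simp
  with err have "(\<lambda>N. A N (gidx t0 N)) \<longlonglongrightarrow> 0 + ?E0 * complex_of_real ?R"
    using tendsto_add[OF err] by fastforce
  with A_lim show ?thesis using LIMSEQ_unique by auto
qed

text \<open>Tweedie's formula: the drift of the reversed process is \<open>\<alpha>/2 X\<close> plus the score.\<close>

lemma rdrift_eq_score:
  assumes t: "0 \<le> t" "t < T" and Z: "AE w in M. Z (T - t) w = X (T - t) w" "Z (T - t) \<in> borel_measurable M"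
    and x: "Pn e m x = x"
  shows "rdrift (T - t) x = (\<alpha> (T - t) / 2) *\<^sub>R x + score M e lam \<alpha> T m Z t x"
proof -
  define u where "u = T - t"
  have u: "0 < u" "u \<le> T" using t by (auto simp: u_def)
  interpret C: gaussian_channel M m "\<lambda>w. iota e m (x0 w)" "\<lambda>w. iota e m (X u w)" "1 / growth u" "std u"
    by (rule channel[OF u])
  let ?Y = "\<lambda>w. iota e m (X u w)" and ?Z = "\<lambda>w. iota e m (Z u w)"
  have [measurable]: "X u \<in> borel_measurable M" "Z u \<in> borel_measurable M" using X_meas[of u] u Z by (auto simp: u_def)
  have il[measurable]: "iota e m \<in> measurable borel (lebesgue_Rn m)"
    using iota_meas measurable_cong_sets[OF refl sets_lebesgue_Rn] by blast
  \<comment> \<open>\<open>score\<close> depends on \<open>Z\<close> only through the law of its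
    coordinates, and \<open>Z\<close> is a version of the explicit process, so the two have the same
    density.\<close>
  have ae: "AE w in M. ?Z w = ?Y w" using Z(1) unfolding u_def[symmetric] by (rule AE_mp) auto
  have "distr M (lebesgue_Rn m) ?Z = distr M (lebesgue_Rn m) ?Y"
    by (rule distr_cong_AE[OF refl refl ae]) measurable
  then have "is_smooth_density M m ?Z = is_smooth_density M m ?Y"
    unfolding is_smooth_density_def distributed_def by (auto simp: fun_eq_iff)
  then have sd: "smooth_density M m ?Z = smooth_density M m ?Y" unfolding smooth_density_def by simp
  let ?y = "iota e m x"
  have y: "?y \<in> Rn m" by (simp add: iota_def)
  let ?g = "growth u"
  have nv: "0 < noise_var u" by (rule noise_var_pos[OF u])
  have gl: "grad_log m (smooth_density M m ?Z) ?y k = - (?g\<^sup>2 / (noise_var u * lam k)) * (x \<bullet> e k - 1 / ?g * C.post k ?y)" if k: "k < m" for k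
    unfolding sd C.grad_log_smooth_density[OF y k iota_int(1)[OF k]] iota_coord[OF k]
    using nv lam_pos[of k] by (simp add: power_divide field_simps)
  have x_exp: "x = (\<Sum>k<m. (x \<bullet> e k) *\<^sub>R e k)" using x by (simp add: Pn_def)
  have "score M e lam \<alpha> T m Z t x = \<alpha> u *\<^sub>R (\<Sum>k<m. (lam k * (- (?g\<^sup>2 / (noise_var u * lam k)) * (x \<bullet> e k - 1 / ?g * C.post k ?y))) *\<^sub>R e k)"
    unfolding score_def u_def[symmetric] Qn_def iota_inv_def
  proof (intro arg_cong[where f="\<lambda>z. \<alpha> u *\<^sub>R z"] sum.cong refl arg_cong2[where f=scaleR] arg_cong2[where f="(*)"])
    fix k assume "k \<in> {..<m}"
    then have k: "k < m" by simp
    show "e k \<bullet> (\<Sum>k<m. grad_log m (smooth_density M m ?Z) ?y k *\<^sub>R e k) = - (?g\<^sup>2 / (noise_var u * lam k)) * (x \<bullet> e k - 1 / ?g * C.post k ?y)"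
      unfolding inner_commute[of "e k"] coord_sum[OF k] by (rule gl[OF k])
  qed
  also have "\<dots> = \<alpha> u *\<^sub>R (\<Sum>k<m. (- (?g\<^sup>2 / noise_var u) * (x \<bullet> e k) + ?g / noise_var u * C.post k ?y) *\<^sub>R e k)"
  proof (intro arg_cong[where f="\<lambda>z. \<alpha> u *\<^sub>R z"] sum.cong refl arg_cong2[where f=scaleR])
    fix k
    show "lam k * (- (?g\<^sup>2 / (noise_var u * lam k)) * (x \<bullet> e k - 1 / ?g * C.post k ?y)) = - (?g\<^sup>2 / noise_var u) * (x \<bullet> e k) + ?g / noise_var u * C.post k ?y"
      using nv lam_pos[of k] by (simp add: field_simps power2_eq_square)
  qed
  also have "\<dots> = \<alpha> u *\<^sub>R ((- (?g\<^sup>2 / noise_var u)) *\<^sub>R x + (?g / noise_var u) *\<^sub>R pmean u x)"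
  proof -
    have "(\<Sum>k<m. (- (?g\<^sup>2 / noise_var u) * (x \<bullet> e k) + ?g / noise_var u * C.post k ?y) *\<^sub>R e k) =
       (- (?g\<^sup>2 / noise_var u)) *\<^sub>R (\<Sum>k<m. (x \<bullet> e k) *\<^sub>R e k) + (?g / noise_var u) *\<^sub>R pmean u x"
      unfolding pmean_def scaleR_sum_right sum.distrib[symmetric]
      by (intro sum.cong refl) (simp only: scaleR_add_left scaleR_scaleR)
    then show ?thesis using x_exp by simp
  qed
  finally have sc: "score M e lam \<alpha> T m Z t x = \<alpha> u *\<^sub>R ((- (?g\<^sup>2 / noise_var u)) *\<^sub>R x + (?g / noise_var u) *\<^sub>R pmean u x)" .
  have nvg: "noise_var u = ?g * (?g - 1 / ?g)" by (simp add: noise_var_def power2_eq_square algebra_simps)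
  have gd: "0 < ?g - 1 / ?g" by (rule growth_diff_pos[OF u])
  \<comment> \<open>After Tweedie's formula there remain two identities, for the coefficients of
    \<open>x\<close> and of the posterior mean; both come from
    \<open>noise_var = growth * (growth - 1 / growth)\<close>.\<close>
  have k1: "\<kappa>1 u = \<alpha> u / 2 - \<alpha> u * (?g\<^sup>2 / noise_var u)"
  proof -
    have "?g\<^sup>2 / noise_var u = ?g / (?g - 1 / ?g)" unfolding nvg by (simp add: power2_eq_square)
    moreover have "\<alpha> u / 2 - \<alpha> u * (a / (a - b)) = - (\<alpha> u / 2 * (a + b)) / (a - b)" if "0 < a - b" for a b
      using that by (simp add: field_simps)
    ultimately show ?thesis unfolding \<kappa>1_def using gd by simp
  qed
  have k2: "\<kappa>2 u = \<alpha> u * (?g / noise_var u)" unfolding nvg \<kappa>2_def by simp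
  show ?thesis unfolding rdrift_def sc u_def[symmetric] k1 k2
    by (simp add: scaleR_diff_left scaleR_add_right scaleR_diff_right)
qed

end

section \<open>The Euler scheme\<close>

lemma euler_measurable:
  fixes b :: "real \<Rightarrow> 'h \<Rightarrow> 'h::{real_normed_vector,second_countable_topology}"
  assumes "\<And>i. i < n \<Longrightarrow> b (real i * h) \<in> borel_measurable borel"
    and "\<And>i. i \<le> n \<Longrightarrow> B i \<in> borel_measurable M" and "y \<in> borel_measurable M"
  shows "(\<lambda>w. euler b (\<lambda>i. B i w) (y w) h n) \<in> borel_measurable M"
  using assms
proof (induction n)
  case (Suc n)
  have IH[measurable]: "(\<lambda>w. euler b (\<lambda>i. B i w) (y w) h n) \<in> borel_measurable M" using Suc by simp
  have [measurable]: "b (real n * h) \<in> borel_measurable borel" "B n \<in> borel_measurable M" "B (Suc n) \<in> borel_measurable M"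
    using Suc.prems by auto
  show ?case by simp
qed simp

lemma euler_cong: "(\<And>i. i \<le> n \<Longrightarrow> B i = B' i) \<Longrightarrow> euler b B y0 h n = euler b B' y0 h n"
  by (induction n) auto

context
  fixes b :: "real \<Rightarrow> 'h::{real_inner,banach,second_countable_topology} \<Rightarrow> 'h" and t0 L :: real
  assumes t0: "0 \<le> t0" and b: "continuous_on ({0..t0} \<times> UNIV) (\<lambda>(t, x). b t x)"
    and L: "\<And>t. t \<in> {0..t0} \<Longrightarrow> L-lipschitz_on UNIV (b t)"
begin

lemma drift_measurable: "t \<in> {0..t0} \<Longrightarrow> b t \<in> borel_measurable borel"
  using lipschitz_on_continuous_on[OF L] by (rule borel_measurable_continuous_onI)

lemma euler_grid_measurable:
  assumes t: "t \<in> {0..t0}" and y: "y \<in> borel_measurable M" and B: "\<And>t. t \<in> {0..t0} \<Longrightarrow> B t \<in> borel_measurable M"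
  shows "(\<lambda>w. euler b (\<lambda>i. B (real i * gstep N) w) (y w) (gstep N) (gidx t N)) \<in> borel_measurable M"
proof (rule euler_measurable[where B="\<lambda>i. B (real i * gstep N)", OF _ _ y])
  have grid: "real i * gstep N \<in> {0..t0}" if "i \<le> gidx t N" for i using gidx_grid[OF _ that] t by auto
  show "b (real i * gstep N) \<in> borel_measurable borel" if "i < gidx t N" for i using that by (intro drift_measurable grid) simp
  show "B (real i * gstep N) \<in> borel_measurable M" if "i \<le> gidx t N" for i by (rule B[OF grid[OF that]])
qed

lemma euler_grid_tendsto:
  assumes t: "t \<in> {0..t0}" and "B 0 = 0" "continuous_on {0..t0} y"
    and "\<And>t. t \<in> {0..t0} \<Longrightarrow> y t = y0 + integral {0..t} (\<lambda>s. b s (y s)) + B t"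
  shows "(\<lambda>N. euler b (\<lambda>i. B (real i * gstep N)) y0 (gstep N) (gidx t N)) \<longlonglongrightarrow> y t"
proof -
  have t': "0 \<le> t" "t \<le> t0" using t by auto
  show ?thesis
    by (rule euler_tendsto[OF b L assms(2-4) t gstep_nonneg gstep_tendsto _ gidx_tendsto[OF t'(1)]])
       (use t' order_trans[OF gidx_le[OF t'(1)]] in auto)
qed

text \<open>The fixed-point construction treats each path separately and says nothing about
  measurability in the sample point; that comes from the Euler scheme.\<close>

lemma ode_solution_measurable:
  assumes y0: "y0 \<in> borel_measurable M"
    and B: "\<And>t. t \<in> {0..t0} \<Longrightarrow> B t \<in> borel_measurable M" "\<And>w. w \<in> space M \<Longrightarrow> B 0 w = 0"
    and Z: "\<And>w. w \<in> space M \<Longrightarrow> continuous_on {0..t0} (\<lambda>t. Z t w)"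
      "\<And>w t. w \<in> space M \<Longrightarrow> t \<in> {0..t0} \<Longrightarrow> Z t w = y0 w + integral {0..t} (\<lambda>s. b s (Z s w)) + B t w"
    and t: "t \<in> {0..t0}"
  shows "Z t \<in> borel_measurable M"
proof (rule borel_measurable_LIMSEQ_metric)
  show "(\<lambda>w. euler b (\<lambda>i. B (real i * gstep N) w) (y0 w) (gstep N) (gidx t N)) \<in> borel_measurable M" for N
    by (rule euler_grid_measurable[OF t y0 B(1)])
  show "(\<lambda>N. euler b (\<lambda>i. B (real i * gstep N) w) (y0 w) (gstep N) (gidx t N)) \<longlonglongrightarrow> Z t w" if "w \<in> space M" for w
    using euler_grid_tendsto[OF t, of "\<lambda>t. B t w" "\<lambda>t. Z t w" "y0 w"] B(2) Z that by blast
qed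

text \<open>The law of the solution is determined by that of the initial value and the driving noise, because the solution is
  the limit of the Euler scheme.\<close>

lemma solution_path_law_eq:
  fixes M :: "'w measure" and M' :: "'v measure"
  assumes ps: "prob_space M" "prob_space M'"
    and y0: "y0 \<in> borel_measurable M" and y0': "y0' \<in> borel_measurable M'"
    and B: "\<And>t. t \<in> {0..t0} \<Longrightarrow> B t \<in> borel_measurable M" "\<And>w. w \<in> space M \<Longrightarrow> B 0 w = 0"
    and B': "\<And>t. t \<in> {0..t0} \<Longrightarrow> B' t \<in> borel_measurable M'" "\<And>w. w \<in> space M' \<Longrightarrow> B' 0 w = 0"
    and Z: "\<And>t. t \<in> {0..t0} \<Longrightarrow> Z t \<in> borel_measurable M" "\<And>w. w \<in> space M \<Longrightarrow> continuous_on {0..t0} (\<lambda>t. Z t w)"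
      "AE w in M. \<forall>t\<in>{0..t0}. Z t w = y0 w + integral {0..t} (\<lambda>s. b s (Z s w)) + B t w"
    and Z': "\<And>t. t \<in> {0..t0} \<Longrightarrow> Z' t \<in> borel_measurable M'" "\<And>w. w \<in> space M' \<Longrightarrow> continuous_on {0..t0} (\<lambda>t. Z' t w)"
      "AE w in M'. \<forall>t\<in>{0..t0}. Z' t w = y0' w + integral {0..t} (\<lambda>s. b s (Z' s w)) + B' t w"
    and char: "\<And>J a k. finite J \<Longrightarrow> J \<subseteq> {0..t0} \<Longrightarrow>
      (CLINT w|M. iexp (y0 w \<bullet> a) * iexp (\<Sum>t\<in>J. B t w \<bullet> k t)) = (CLINT w|M'. iexp (y0' w \<bullet> a) * iexp (\<Sum>t\<in>J. B' t w \<bullet> k t))"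
  shows "path_law M t0 Z = path_law M' t0 Z'"
proof (rule path_law_eqI_char[OF t0 ps Z(1,2) Z'(1,2)])
  interpret M: prob_space M by fact
  interpret M': prob_space M' by fact
  fix J :: "real set" and k :: "real \<Rightarrow> 'h" assume J: "finite J" "J \<subseteq> {0..t0}"
  have le: "gidx t N \<le> gidx t0 N" if "t \<in> J" for t N using J that by (intro gidx_mono) auto
  note grid = gidx_grid[OF t0]
  define n where "n N = Suc (Suc (gidx t0 N))" for N
  \<comment> \<open>Position 0 holds the initial value and position \<open>i + 1\<close> the noise
    at the \<open>i\<close>-th grid point for \<open>i\<close> from 0 to \<open>gidx t0 N\<close>,
    which makes \<open>gidx t0 N + 2\<close> entries.\<close>
  define enc where "enc N y W = (\<lambda>j\<in>{..<n N}. case j of 0 \<Rightarrow> y | Suc i \<Rightarrow> W (real i * gstep N))" for N and y :: 'h and W :: "real \<Rightarrow> 'h"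
  define \<Phi> where "\<Phi> N z = iexp (\<Sum>t\<in>J. euler b (\<lambda>i. z (Suc i)) (z 0) (gstep N) (gidx t N) \<bullet> k t)" for N and z :: "nat \<Rightarrow> 'h"
  let ?P = "\<lambda>N. Pi\<^sub>M {..<n N} (\<lambda>_. borel :: 'h measure)"
  have encm: "(\<lambda>w. enc N (y w) (\<lambda>t. W t w)) \<in> measurable D (?P N)"
    if "y \<in> borel_measurable D" "\<And>t. t \<in> {0..t0} \<Longrightarrow> W t \<in> borel_measurable D" for D :: "'u measure" and y W N
    unfolding enc_def
  proof (rule measurable_restrict)
    fix j assume "j \<in> {..<n N}"
    then show "(\<lambda>w. case j of 0 \<Rightarrow> y w | Suc i \<Rightarrow> W (real i * gstep N) w) \<in> borel_measurable D"
      using that grid by (cases j) (auto simp: n_def simp del: atLeastAtMost_iff)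
  qed
  have fm: "(\<lambda>w. enc N (y0 w) (\<lambda>t. B t w)) \<in> measurable M (?P N)" for N by (rule encm[OF y0 B(1)])
  have fm': "(\<lambda>w. enc N (y0' w) (\<lambda>t. B' t w)) \<in> measurable M' (?P N)" for N by (rule encm[OF y0' B'(1)])
  have \<Phi>m: "\<Phi> N \<in> borel_measurable (?P N)" for N
  proof -
    have [measurable]: "(\<lambda>z. euler b (\<lambda>i. z (Suc i)) (z 0) (gstep N) (gidx t N)) \<in> borel_measurable (?P N)" if "t \<in> J" for t
      by (rule euler_measurable[where B="\<lambda>i z. z (Suc i)" and y="\<lambda>z. z 0"])
         (use le[OF that, of N] grid in \<open>auto simp: n_def simp del: atLeastAtMost_iff intro!: drift_measurable PiM_lessThan_component\<close>)
    show ?thesis unfolding \<Phi>_def[abs_def] by measurable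
  qed
  have law: "distr M (?P N) (\<lambda>w. enc N (y0 w) (\<lambda>t. B t w)) = distr M' (?P N) (\<lambda>w. enc N (y0' w) (\<lambda>t. B' t w))" for N
  proof (rule finite_measure_PiM_eqI_char[of _ _ "{..<n N}"])
    show "finite_measure (distr M (?P N) (\<lambda>w. enc N (y0 w) (\<lambda>t. B t w)))" by (rule M.finite_measure_distr[OF fm])
    show "finite_measure (distr M' (?P N) (\<lambda>w. enc N (y0' w) (\<lambda>t. B' t w)))" by (rule M'.finite_measure_distr[OF fm'])
    fix a :: "nat \<Rightarrow> 'h"
    note [measurable] = PiM_lessThan_component
    have me: "(\<lambda>z. iexp (\<Sum>j<n N. z j \<bullet> a j)) \<in> borel_measurable (?P N)" by measurable
    \<comment> \<open>\<open>char\<close> is indexed by sets of times, the encoded vector by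
      positions; the floor recovers the position from the grid time.\<close>
    let ?J = "(\<lambda>i. real i * gstep N) ` {..<Suc (gidx t0 N)}" and ?k = "\<lambda>t. a (Suc (nat \<lfloor>t / gstep N\<rfloor>))"
    have inj: "inj_on (\<lambda>i. real i * gstep N) {..<Suc (gidx t0 N)}" using gstep_pos[of N] by (auto intro!: inj_onI)
    have e: "(\<Sum>j<n N. enc N x z j \<bullet> a j) = x \<bullet> a 0 + (\<Sum>t\<in>?J. z t \<bullet> ?k t)" for x z
    proof -
      have "(\<Sum>j<n N. enc N x z j \<bullet> a j) = x \<bullet> a 0 + (\<Sum>i<Suc (gidx t0 N). z (real i * gstep N) \<bullet> a (Suc i))"
        unfolding n_def by (subst sum.lessThan_Suc_shift) (simp add: enc_def n_def)
      also have "(\<Sum>i<Suc (gidx t0 N). z (real i * gstep N) \<bullet> a (Suc i)) = (\<Sum>t\<in>?J. z t \<bullet> ?k t)"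
        using gstep_pos[of N] by (subst sum.reindex[OF inj]) (simp add: less_imp_neq[symmetric])
      finally show ?thesis .
    qed
    have "(CLINT w|M. iexp (y0 w \<bullet> a 0) * iexp (\<Sum>t\<in>?J. B t w \<bullet> ?k t)) = (CLINT w|M'. iexp (y0' w \<bullet> a 0) * iexp (\<Sum>t\<in>?J. B' t w \<bullet> ?k t))"
      by (rule char) (use grid[of _ N] in \<open>auto simp: less_Suc_eq_le simp del: atLeastAtMost_iff\<close>)
    then show "(CLINT z|distr M (?P N) (\<lambda>w. enc N (y0 w) (\<lambda>t. B t w)). iexp (\<Sum>j<n N. z j \<bullet> a j)) =
        (CLINT z|distr M' (?P N) (\<lambda>w. enc N (y0' w) (\<lambda>t. B' t w)). iexp (\<Sum>j<n N. z j \<bullet> a j))"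
      unfolding integral_distr[OF fm me] integral_distr[OF fm' me] e of_real_add distrib_left exp_add .
  qed auto
  have conv: "(\<lambda>N. CLINT w|D. \<Phi> N (enc N (y w) (\<lambda>t. W t w))) \<longlonglongrightarrow> (CLINT w|D. iexp (\<Sum>t\<in>J. X t w \<bullet> k t))"
    if D: "prob_space D" and y: "y \<in> borel_measurable D"
      and W: "\<And>t. t \<in> {0..t0} \<Longrightarrow> W t \<in> borel_measurable D" "\<And>w. w \<in> space D \<Longrightarrow> W 0 w = 0"
      and X: "\<And>t. t \<in> {0..t0} \<Longrightarrow> X t \<in> borel_measurable D" "\<And>w. w \<in> space D \<Longrightarrow> continuous_on {0..t0} (\<lambda>t. X t w)"
      "AE w in D. \<forall>t\<in>{0..t0}. X t w = y w + integral {0..t} (\<lambda>s. b s (X s w)) + W t w"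
    for D :: "'u measure" and y W X
  proof -
    interpret D: prob_space D by fact
    let ?e = "\<lambda>N t w. euler b (\<lambda>i. W (real i * gstep N) w) (y w) (gstep N) (gidx t N)"
    have ev: "\<Phi> N (enc N (y w) (\<lambda>t. W t w)) = iexp (\<Sum>t\<in>J. ?e N t w \<bullet> k t)" for N w
    proof -
      have "euler b (\<lambda>i. enc N (y w) (\<lambda>t. W t w) (Suc i)) (y w) (gstep N) (gidx t N) = ?e N t w" if "t \<in> J" for t
        by (rule euler_cong) (use le[OF that, of N] in \<open>auto simp: n_def enc_def\<close>)
      moreover have "enc N (y w) (\<lambda>t. W t w) 0 = y w" by (simp add: enc_def n_def)
      ultimately show ?thesis unfolding \<Phi>_def by simp
    qed
    have [measurable]: "?e N t \<in> borel_measurable D" "X t \<in> borel_measurable D" if "t \<in> J" for t N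
      using euler_grid_measurable[OF _ y W(1)] X(1) J that by auto
    show ?thesis unfolding ev
    proof (rule integral_dominated_convergence[where w="\<lambda>_. 1"])
      show "AE w in D. (\<lambda>N. iexp (\<Sum>t\<in>J. ?e N t w \<bullet> k t)) \<longlonglongrightarrow> iexp (\<Sum>t\<in>J. X t w \<bullet> k t)"
        using X(3)
      proof (rule AE_mp, intro AE_I2 impI tendsto_intros)
        fix w t assume w: "w \<in> space D" and "\<forall>t\<in>{0..t0}. X t w = y w + integral {0..t} (\<lambda>s. b s (X s w)) + W t w" "t \<in> J"
        then show "(\<lambda>N. ?e N t w) \<longlonglongrightarrow> X t w"
          using euler_grid_tendsto[of t "\<lambda>t. W t w" "\<lambda>t. X t w" "y w"] W(2) X(2) J by blast
      qed
      show "(\<lambda>w. iexp (\<Sum>t\<in>J. ?e N t w \<bullet> k t)) \<in> borel_measurable D" for N by measurable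
      show "(\<lambda>w. iexp (\<Sum>t\<in>J. X t w \<bullet> k t)) \<in> borel_measurable D" by measurable
    qed auto
  qed
  have eqN: "(CLINT w|M. \<Phi> N (enc N (y0 w) (\<lambda>t. B t w))) = (CLINT w|M'. \<Phi> N (enc N (y0' w) (\<lambda>t. B' t w)))" for N
    using integral_distr[OF fm \<Phi>m[of N]] integral_distr[OF fm' \<Phi>m[of N]] law[of N] by simp
  show "(CLINT w|M. iexp (\<Sum>t\<in>J. Z t w \<bullet> k t)) = (CLINT w|M'. iexp (\<Sum>t\<in>J. Z' t w \<bullet> k t))"
    by (rule LIMSEQ_unique[OF conv[OF ps(1) y0 B Z, unfolded eqN] conv[OF ps(2) y0' B' Z']])
qed

end

section \<open>Coupling\<close>

text \<open>Taking the first point of an enumerated dense set within distance \<eta> makes the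
  choice of the cell measurable.\<close>

lemma cell_index_exists:
  assumes "0 < \<eta>"
  obtains d :: "nat \<Rightarrow> 'h::{real_normed_vector,second_countable_topology}" and idx :: "'h \<Rightarrow> nat"
  where "idx \<in> measurable borel (count_space UNIV)" "\<And>x. norm (x - d (idx x)) < \<eta>"
proof -
  obtain D :: "'h set" where D: "countable D" "\<And>X. open X \<Longrightarrow> X \<noteq> {} \<Longrightarrow> \<exists>d\<in>D. d \<in> X"
    using countable_dense_exists by blast
  define d where "d = from_nat_into D"
  define idx where "idx x = (LEAST i. norm (x - d i) < \<eta>)" for x
  have "\<exists>i. norm (x - d i) < \<eta>" for x
  proof -
    obtain y where y: "y \<in> D" "y \<in> ball x \<eta>" using D(2)[of "ball x \<eta>"] assms by auto
    obtain i where "d i = y" using from_nat_into_surj[OF D(1) y(1)] unfolding d_def by auto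
    then show ?thesis using y(2) by (auto simp: dist_norm)
  qed
  then have "norm (x - d (idx x)) < \<eta>" for x unfolding idx_def by (rule LeastI_ex)
  moreover have "idx \<in> measurable borel (count_space UNIV)" unfolding idx_def[abs_def] by measurable
  ultimately show thesis using that by blast
qed

text \<open>Young's inequality with weights 6 and 6/5. It is used twice in a row, from a point to
  the centre of its cell and back, and the square of 6/5 is still below 2.\<close>

lemma norm_add_sq_le: "(norm (a + b))\<^sup>2 \<le> 6 * (norm a)\<^sup>2 + 6 / 5 * (norm (b :: 'a::real_normed_vector))\<^sup>2"
proof -
  have "(norm (a + b))\<^sup>2 \<le> (norm a + norm b)\<^sup>2" by (intro power_mono norm_triangle_ineq) auto
  moreover have "0 \<le> (5 * norm a - norm b)\<^sup>2" by simp
  ultimately show ?thesis by (simp add: power2_eq_square algebra_simps)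
qed

text \<open>An approximate gluing that needs no disintegration: given the first coordinate, the second one is resampled
  from \<open>\<gamma>\<close> conditioned only on the cell of the first one.\<close>

lemma coupling_kernel:
  fixes \<gamma> :: "('h::{real_inner,second_countable_topology} \<times> 'h) measure" and \<xi> :: "'w \<Rightarrow> 'h"
  assumes ps: "prob_space M" and \<xi>[measurable]: "\<xi> \<in> borel_measurable M"
    and sets[measurable_cong]: "sets \<gamma> = sets (borel \<Otimes>\<^sub>M borel)" and fst_law: "distr \<gamma> borel fst = distr M borel \<xi>"
    and \<eta>: "0 < \<eta>"
  obtains P :: "(nat \<Rightarrow> 'h) measure" and idx :: "'h \<Rightarrow> nat"
  where "prob_space P"
    and "(\<lambda>(w, z). z (idx (\<xi> w))) \<in> borel_measurable (M \<Otimes>\<^sub>M P)"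
    and "distr (M \<Otimes>\<^sub>M P) borel (\<lambda>(w, z). z (idx (\<xi> w))) = distr \<gamma> borel snd"
    and "(\<integral>\<^sup>+(w, z). ennreal ((norm (\<xi> w - z (idx (\<xi> w))))\<^sup>2) \<partial>(M \<Otimes>\<^sub>M P)) \<le>
      ennreal \<eta> + 2 * (\<integral>\<^sup>+(x, y). ennreal ((norm (x - y))\<^sup>2) \<partial>\<gamma>)"
    and "\<And>a. \<exists>g :: 'h \<Rightarrow> complex. g \<in> borel_measurable borel \<and> (\<forall>x. cmod (g x) \<le> 1) \<and>
      (\<forall>G. integrable M G \<longrightarrow> (CLINT (w, z)|M \<Otimes>\<^sub>M P. iexp (z (idx (\<xi> w)) \<bullet> a) * G w) = (CLINT w|M. g (\<xi> w) * G w))"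
proof -
  interpret M: prob_space M by fact
  \<comment> \<open>The two applications of Young's inequality cost \<open>6 * \<delta>^2\<close>
    and 6/5 of that again, together at most \<open>18 * \<delta>^2 = \<eta>\<close>.\<close>
  define \<delta> where "\<delta> = sqrt (\<eta> / 18)"
  have \<delta>: "0 < \<delta>" "\<delta>\<^sup>2 = \<eta> / 18" using \<eta> by (auto simp: \<delta>_def)
  obtain d :: "nat \<Rightarrow> 'h" and idx :: "'h \<Rightarrow> nat" where idx[measurable]: "idx \<in> measurable borel (count_space UNIV)"
    and near: "\<And>x. norm (x - d (idx x)) < \<delta>" using cell_index_exists[OF \<delta>(1)] by blast
  have sp: "space \<gamma> = UNIV" using sets_eq_imp_space_eq[OF sets] by (simp add: space_pair_measure)
  have fst_m[measurable]: "fst \<in> borel_measurable \<gamma>" and snd_m[measurable]: "snd \<in> borel_measurable \<gamma>" by measurable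
  have "prob_space (distr \<gamma> borel fst)" unfolding fst_law by (rule M.prob_space_distr) simp
  then interpret \<gamma>: prob_space \<gamma> by (rule prob_space_distrD[OF fst_m])
  define C :: "nat \<Rightarrow> ('h \<times> 'h) set" where "C i = {p. idx (fst p) = i}" for i
  have C[measurable]: "C i \<in> sets \<gamma>" for i
  proof -
    have "{p \<in> space \<gamma>. idx (fst p) = i} \<in> sets \<gamma>" by measurable
    then show ?thesis by (simp add: C_def sp)
  qed
  \<comment> \<open>The law of the second coordinate given that the first lies in cell
    \<open>i\<close>; the value on a null cell is an arbitrary probability measure.\<close>
  define K where "K i = (if emeasure \<gamma> (C i) = 0 then return borel 0 else distr (uniform_measure \<gamma> (C i)) borel snd)" for i
  have K_sets[measurable_cong]: "sets (K i) = sets borel" for i by (simp add: K_def)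
  have K_ps: "prob_space (K i)" for i
  proof (cases "emeasure \<gamma> (C i) = 0")
    case True
    then show ?thesis by (simp add: K_def prob_space_return)
  next
    case False
    then have "prob_space (uniform_measure \<gamma> (C i))" by (intro prob_space_uniform_measure) auto
    then have "prob_space (distr (uniform_measure \<gamma> (C i)) borel snd)"
      by (rule prob_space.prob_space_distr) simp
    then show ?thesis using False by (simp add: K_def)
  qed
  have K_nn: "(\<integral>\<^sup>+y. h y \<partial>K i) * emeasure \<gamma> (C i) = (\<integral>\<^sup>+p. h (snd p) * indicator (C i) p \<partial>\<gamma>)"
    if [measurable]: "h \<in> borel_measurable borel" for h :: "'h \<Rightarrow> ennreal" and i
  proof (cases "emeasure \<gamma> (C i) = 0")
    case True
    have "(\<integral>\<^sup>+p. h (snd p) * indicator (C i) p \<partial>\<gamma>) = 0"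
    proof (subst nn_integral_0_iff_AE)
      have "AE p in \<gamma>. p \<notin> C i" using True by (intro AE_not_in) auto
      then show "AE p in \<gamma>. h (snd p) * indicator (C i) p = 0" by (rule AE_mp) auto
    qed measurable
    then show ?thesis using True by simp
  next
    case False
    have "(\<integral>\<^sup>+y. h y \<partial>K i) = (\<integral>\<^sup>+p. h (snd p) \<partial>uniform_measure \<gamma> (C i))"
      using False unfolding K_def by (simp add: nn_integral_distr)
    also have "\<dots> = (\<integral>\<^sup>+p. h (snd p) * indicator (C i) p \<partial>\<gamma>) / emeasure \<gamma> (C i)"
      by (rule nn_integral_uniform_measure) auto
    finally show ?thesis using False by (simp add: ennreal_divide_times ennreal_divide_self less_top[symmetric])
  qed
  have split: "(\<integral>\<^sup>+p. f (idx (fst p)) p \<partial>\<gamma>) = (\<Sum>i. \<integral>\<^sup>+p. f i p * indicator (C i) p \<partial>\<gamma>)"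
    if [measurable]: "\<And>i. f i \<in> borel_measurable \<gamma>" for f :: "nat \<Rightarrow> 'h \<times> 'h \<Rightarrow> ennreal"
  proof -
    have "f (idx (fst p)) p = (\<Sum>i. f i p * indicator (C i) p)" for p
    proof -
      have "(\<Sum>i. f i p * indicator (C i) p) = (\<Sum>i\<in>{idx (fst p)}. f i p * indicator (C i) p)"
        by (rule suminf_finite) (auto simp: C_def indicator_def)
      then show ?thesis by (simp add: C_def)
    qed
    then show ?thesis by (simp add: nn_integral_suminf)
  qed
  \<comment> \<open>Disintegration in the only form needed, for functions that see the first
    coordinate through its cell; there are countably many cells, so it is a sum.\<close>
  have dis: "(\<integral>\<^sup>+w. (\<integral>\<^sup>+y. h (idx (\<xi> w)) y \<partial>K (idx (\<xi> w))) \<partial>M) = (\<integral>\<^sup>+(x, y). h (idx x) y \<partial>\<gamma>)"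
    if [measurable]: "\<And>i. h i \<in> borel_measurable borel" for h :: "nat \<Rightarrow> 'h \<Rightarrow> ennreal"
  proof -
    let ?H = "\<lambda>i. \<integral>\<^sup>+y. h i y \<partial>K i"
    have "(\<integral>\<^sup>+w. ?H (idx (\<xi> w)) \<partial>M) = (\<integral>\<^sup>+x. ?H (idx x) \<partial>distr M borel \<xi>)"
      by (rule nn_integral_distr[symmetric]) measurable
    also have "\<dots> = (\<integral>\<^sup>+p. ?H (idx (fst p)) \<partial>\<gamma>)"
      unfolding fst_law[symmetric] by (rule nn_integral_distr) measurable
    also have "\<dots> = (\<Sum>i. \<integral>\<^sup>+p. ?H i * indicator (C i) p \<partial>\<gamma>)" by (rule split) simp
    also have "\<dots> = (\<Sum>i. ?H i * emeasure \<gamma> (C i))" by (simp add: nn_integral_cmult_indicator)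
    also have "\<dots> = (\<Sum>i. \<integral>\<^sup>+p. h i (snd p) * indicator (C i) p \<partial>\<gamma>)" by (simp add: K_nn)
    also have "\<dots> = (\<integral>\<^sup>+p. h (idx (fst p)) (snd p) \<partial>\<gamma>)" by (rule split[symmetric]) measurable
    finally show ?thesis by (simp add: case_prod_beta')
  qed
  \<comment> \<open>One independent sample is drawn for every cell in advance, and the one belonging
    to the cell of \<open>\<xi> w\<close> is read off. All the extra randomness thus sits in a
    product factor.\<close>
  define P where "P = Pi\<^sub>M UNIV K"
  interpret PK: product_prob_space K UNIV
    using K_ps by (simp add: product_prob_space_def product_prob_space_axioms_def product_sigma_finite_def prob_space_imp_sigma_finite)
  have P_ps: "prob_space P" unfolding P_def by (rule PK.prob_space_axioms)
  interpret P: prob_space P by (rule P_ps)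
  interpret MP: pair_prob_space M P ..
  have comp[measurable]: "(\<lambda>z. z i) \<in> borel_measurable P" for i
    using measurable_component_singleton[of i UNIV K] measurable_cong_sets[OF refl K_sets, of P i] unfolding P_def by simp
  have Y[measurable]: "(\<lambda>p. snd p (idx (\<xi> (fst p)))) \<in> borel_measurable (M \<Otimes>\<^sub>M P)"
    by (rule measurable_compose_countable[where f="\<lambda>i p. snd p i" and g="\<lambda>p. idx (\<xi> (fst p))"]) measurable
  have comp_distr: "distr P borel (\<lambda>z. z i) = K i" for i
  proof -
    have "distr (Pi\<^sub>M UNIV K) (K i) (\<lambda>z. z i) = K i" by (rule PK.PiM_component) simp
    moreover have "distr P borel (\<lambda>z. z i) = distr P (K i) (\<lambda>z. z i)" by (rule distr_cong) (auto simp: K_sets)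
    ultimately show ?thesis by (simp add: P_def)
  qed
  have nnP: "(\<integral>\<^sup>+z. h (z i) \<partial>P) = (\<integral>\<^sup>+y. h y \<partial>K i)" if "h \<in> borel_measurable borel" for h :: "'h \<Rightarrow> ennreal" and i
    using nn_integral_distr[OF comp, of h i] that by (simp add: comp_distr measurable_cong_sets[OF K_sets refl])
  have snd_law: "distr (M \<Otimes>\<^sub>M P) borel (\<lambda>p. snd p (idx (\<xi> (fst p)))) = distr \<gamma> borel snd"
  proof (rule measure_eqI)
    fix A assume "A \<in> sets (distr (M \<Otimes>\<^sub>M P) borel (\<lambda>p. snd p (idx (\<xi> (fst p)))))"
    then have A[measurable]: "A \<in> sets borel" by simp
    have "emeasure (distr (M \<Otimes>\<^sub>M P) borel (\<lambda>p. snd p (idx (\<xi> (fst p))))) A = (\<integral>\<^sup>+y. indicator A y \<partial>distr (M \<Otimes>\<^sub>M P) borel (\<lambda>p. snd p (idx (\<xi> (fst p)))))"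
      by simp
    also have "\<dots> = (\<integral>\<^sup>+p. indicator A (snd p (idx (\<xi> (fst p)))) \<partial>(M \<Otimes>\<^sub>M P))" by (rule nn_integral_distr[OF Y]) simp
    also have "\<dots> = (\<integral>\<^sup>+w. (\<integral>\<^sup>+z. indicator A (z (idx (\<xi> w))) \<partial>P) \<partial>M)"
      by (subst P.nn_integral_fst[symmetric]) auto
    also have "\<dots> = (\<integral>\<^sup>+w. (\<integral>\<^sup>+y. indicator A y \<partial>K (idx (\<xi> w))) \<partial>M)"
      by (subst nnP) auto
    also have "\<dots> = (\<integral>\<^sup>+(x, y). indicator A y \<partial>\<gamma>)" by (rule dis) simp
    also have "\<dots> = (\<integral>\<^sup>+y. indicator A y \<partial>distr \<gamma> borel snd)"
      by (subst nn_integral_distr) (auto simp: case_prod_beta')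
    also have "\<dots> = emeasure (distr \<gamma> borel snd) A" by simp
    finally show "emeasure (distr (M \<Otimes>\<^sub>M P) borel (\<lambda>p. snd p (idx (\<xi> (fst p))))) A = emeasure (distr \<gamma> borel snd) A" .
  qed simp
  have cost: "(\<integral>\<^sup>+p. ennreal ((norm (\<xi> (fst p) - snd p (idx (\<xi> (fst p)))))\<^sup>2) \<partial>(M \<Otimes>\<^sub>M P)) \<le>
      ennreal \<eta> + 2 * (\<integral>\<^sup>+(x, y). ennreal ((norm (x - y))\<^sup>2) \<partial>\<gamma>)"
  proof -
    define h where "h i y = ennreal (6 * \<delta>\<^sup>2 + 6 / 5 * (norm (d i - y))\<^sup>2)" for i y
    have [measurable]: "h i \<in> borel_measurable borel" for i unfolding h_def[abs_def] by measurable
    have "(\<integral>\<^sup>+p. ennreal ((norm (\<xi> (fst p) - snd p (idx (\<xi> (fst p)))))\<^sup>2) \<partial>(M \<Otimes>\<^sub>M P)) =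
        (\<integral>\<^sup>+w. (\<integral>\<^sup>+z. ennreal ((norm (\<xi> w - z (idx (\<xi> w))))\<^sup>2) \<partial>P) \<partial>M)"
      by (subst P.nn_integral_fst[symmetric]) auto
    also have "\<dots> \<le> (\<integral>\<^sup>+w. (\<integral>\<^sup>+z. h (idx (\<xi> w)) (z (idx (\<xi> w))) \<partial>P) \<partial>M)"
    proof (intro nn_integral_mono)
      fix w and z :: "nat \<Rightarrow> 'h"
      have "(norm (\<xi> w - d (idx (\<xi> w))))\<^sup>2 \<le> \<delta>\<^sup>2" using near[of "\<xi> w"] by (intro power_mono) auto
      then show "ennreal ((norm (\<xi> w - z (idx (\<xi> w))))\<^sup>2) \<le> h (idx (\<xi> w)) (z (idx (\<xi> w)))"
        using norm_add_sq_le[of "\<xi> w - d (idx (\<xi> w))" "d (idx (\<xi> w)) - z (idx (\<xi> w))"]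
        unfolding h_def by (intro ennreal_leI) (simp add: algebra_simps)
    qed
    also have "\<dots> = (\<integral>\<^sup>+w. (\<integral>\<^sup>+y. h (idx (\<xi> w)) y \<partial>K (idx (\<xi> w))) \<partial>M)" by (subst nnP) auto
    also have "\<dots> = (\<integral>\<^sup>+(x, y). h (idx x) y \<partial>\<gamma>)" by (rule dis) simp
    also have "\<dots> \<le> (\<integral>\<^sup>+p. ennreal \<eta> + 2 * ennreal ((norm (fst p - snd p))\<^sup>2) \<partial>\<gamma>)"
    proof (rule nn_integral_mono, clarsimp)
      fix x y
      have "(norm (d (idx x) - x))\<^sup>2 \<le> \<delta>\<^sup>2" using near[of x] by (intro power_mono) (auto simp: norm_minus_commute)
      then have "6 * \<delta>\<^sup>2 + 6 / 5 * (norm (d (idx x) - y))\<^sup>2 \<le> \<eta> + 2 * (norm (x - y))\<^sup>2"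
        using norm_add_sq_le[of "d (idx x) - x" "x - y"] \<delta> \<eta> zero_le_power2[of "norm (x - y)"] by (simp only: diff_add_cancel add_diff_eq)
      then have "h (idx x) y \<le> ennreal (\<eta> + 2 * (norm (x - y))\<^sup>2)" unfolding h_def by (rule ennreal_leI)
      then show "h (idx x) y \<le> ennreal \<eta> + 2 * ennreal ((norm (x - y))\<^sup>2)"
        using \<eta> by (simp add: ennreal_plus ennreal_mult'')
    qed
    also have "\<dots> = ennreal \<eta> + 2 * (\<integral>\<^sup>+p. ennreal ((norm (fst p - snd p))\<^sup>2) \<partial>\<gamma>)"
      by (subst nn_integral_add) (auto simp: nn_integral_cmult \<gamma>.emeasure_space_1)
    finally show ?thesis by (simp add: case_prod_beta')
  qed
  have char: "\<exists>g :: 'h \<Rightarrow> complex. g \<in> borel_measurable borel \<and> (\<forall>x. cmod (g x) \<le> 1) \<and>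
      (\<forall>G. integrable M G \<longrightarrow> (CLINT p|M \<Otimes>\<^sub>M P. iexp (snd p (idx (\<xi> (fst p))) \<bullet> a) * G (fst p)) = (CLINT w|M. g (\<xi> w) * G w))" for a
  proof (intro exI conjI allI impI)
    \<comment> \<open>Given \<open>w\<close>, the characteristic function of the resampled point
      depends on \<open>\<xi> w\<close> alone: conditionally on \<xi>, the resampled point is
      independent of everything on \<open>M\<close>.\<close>
    let ?g = "\<lambda>x. CLINT y|K (idx x). iexp (y \<bullet> a)"
    show "?g \<in> borel_measurable borel"
      by (rule measurable_compose[OF idx, where g="\<lambda>i. CLINT y|K i. iexp (y \<bullet> a)"]) simp
    show "cmod (?g x) \<le> 1" for x
    proof -
      have "cmod (?g x) \<le> (LINT y|K (idx x). cmod (iexp (y \<bullet> a)))" by (rule integral_norm_bound)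
      also have "\<dots> = 1" by (simp add: prob_space.prob_space[OF K_ps])
      finally show ?thesis .
    qed
    fix G :: "'w \<Rightarrow> complex" assume G: "integrable M G"
    have [measurable]: "G \<in> borel_measurable M" using G by simp
    have i1: "integrable (M \<Otimes>\<^sub>M P) (\<lambda>p. G (fst p))"
      by (rule integrable_distr[where T=fst and M'=M]) (use G in \<open>auto simp: P.distr_pair_fst\<close>)
    have i2: "integrable (M \<Otimes>\<^sub>M P) (\<lambda>p. iexp (snd p (idx (\<xi> (fst p))) \<bullet> a) * G (fst p))"
      by (rule Bochner_Integration.integrable_bound[OF i1]) (measurable, simp add: norm_mult)
    have "(CLINT p|M \<Otimes>\<^sub>M P. iexp (snd p (idx (\<xi> (fst p))) \<bullet> a) * G (fst p)) =
        (CLINT w|M. CLINT z|P. iexp (z (idx (\<xi> w)) \<bullet> a) * G w)"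
      using MP.integral_fst'[OF i2] by simp
    also have "\<dots> = (CLINT w|M. ?g (\<xi> w) * G w)"
    proof (rule Bochner_Integration.integral_cong[OF refl])
      fix w
      have "(CLINT z|P. iexp (z i \<bullet> a)) = (CLINT y|K i. iexp (y \<bullet> a))" for i
        using integral_distr[OF comp, of "\<lambda>y. iexp (y \<bullet> a)" i] by (simp add: comp_distr measurable_cong_sets[OF K_sets refl])
      then show "(CLINT z|P. iexp (z (idx (\<xi> w)) \<bullet> a) * G w) = ?g (\<xi> w) * G w" by simp
    qed
    finally show "(CLINT p|M \<Otimes>\<^sub>M P. iexp (snd p (idx (\<xi> (fst p))) \<bullet> a) * G (fst p)) = (CLINT w|M. ?g (\<xi> w) * G w)" .
  qed
  show thesis
    by (rule that[of P idx]) (use P_ps Y snd_law cost char in \<open>simp_all add: case_prod_beta'\<close>)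
qed

text \<open>Simple functions below \<open>f\<close> pull back to measurable functions below the
  composition of \<open>f\<close> with \<open>T\<close>, so the inequality holds for arbitrary
  \<open>f\<close>. It is applied to the uniform distance on pairs of paths, avoiding the question
  of its measurability for the product sigma-algebra.\<close>

lemma nn_integral_distr_le:
  assumes T: "T \<in> measurable M N"
  shows "(\<integral>\<^sup>+y. f y \<partial>distr M N T) \<le> (\<integral>\<^sup>+x. f (T x) \<partial>M)"
  unfolding nn_integral_def[of "distr M N T"]
proof (rule SUP_least, clarify)
  fix g assume g: "simple_function (distr M N T) g" and le: "g \<le> f"
  have gm: "g \<in> borel_measurable N" using borel_measurable_simple_function[OF g] by simp
  have "integral\<^sup>S (distr M N T) g = (\<integral>\<^sup>+y. g y \<partial>distr M N T)" by (rule nn_integral_eq_simple_integral[OF g, symmetric])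
  also have "\<dots> = (\<integral>\<^sup>+x. g (T x) \<partial>M)" using gm by (intro nn_integral_distr[OF T]) simp
  also have "\<dots> \<le> (\<integral>\<^sup>+x. f (T x) \<partial>M)" using le by (intro nn_integral_mono) (auto simp: le_fun_def)
  finally show "integral\<^sup>S (distr M N T) g \<le> (\<integral>\<^sup>+x. f (T x) \<partial>M)" .
qed

section \<open>Stability of the integral equation and the synchronous coupling\<close>

lemma continuous_on_along_path:
  assumes b: "continuous_on (A \<times> UNIV) (\<lambda>(t, x). b t x)" and z: "continuous_on A z"
  shows "continuous_on A (\<lambda>s. b s (z s))"
proof -
  have "continuous_on A (\<lambda>s. (\<lambda>(t, x). b t x) (s, z s))"
    by (rule continuous_on_compose2[OF b]) (auto intro!: continuous_intros z)
  then show ?thesis by simp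
qed

text \<open>Cauchy-Schwarz, from the nonnegativity of the integral of the squared deviation of
  \<open>g\<close> from its mean \<open>c\<close>.\<close>

lemma integral_square_le:
  fixes g :: "real \<Rightarrow> real"
  assumes t0: "0 \<le> t0" and g: "continuous_on {0..t0} g"
  shows "(integral {0..t0} g)\<^sup>2 \<le> t0 * integral {0..t0} (\<lambda>s. (g s)\<^sup>2)"
proof (cases "t0 = 0")
  case False
  define c where "c = integral {0..t0} g / t0"
  have i[simp]: "g integrable_on {0..t0}" "(\<lambda>s. (g s)\<^sup>2) integrable_on {0..t0}"
    using g by (auto intro!: integrable_continuous_real continuous_intros)
  have "0 \<le> integral {0..t0} (\<lambda>s. (g s - c)\<^sup>2)" by (rule Henstock_Kurzweil_Integration.integral_nonneg) (auto intro!: integrable_continuous_real continuous_intros g)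
  also have "integral {0..t0} (\<lambda>s. (g s - c)\<^sup>2) = integral {0..t0} (\<lambda>s. (g s)\<^sup>2) - 2 * c * integral {0..t0} g + t0 * c\<^sup>2"
  proof (rule integral_unique)
    have "((\<lambda>s. (g s)\<^sup>2 - 2 * c * g s + c\<^sup>2) has_integral (integral {0..t0} (\<lambda>s. (g s)\<^sup>2) - 2 * c * integral {0..t0} g + t0 * c\<^sup>2)) {0..t0}"
      using has_integral_add[OF has_integral_diff[OF integrable_integral[OF i(2)] has_integral_mult_right[OF integrable_integral[OF i(1)], of "2 * c"]]
        has_integral_const_real[of "c\<^sup>2" 0 t0]] t0 by simp
    then show "((\<lambda>s. (g s - c)\<^sup>2) has_integral (integral {0..t0} (\<lambda>s. (g s)\<^sup>2) - 2 * c * integral {0..t0} g + t0 * c\<^sup>2)) {0..t0}"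
      by (simp add: power2_diff algebra_simps)
  qed
  finally have "0 \<le> t0 * (integral {0..t0} (\<lambda>s. (g s)\<^sup>2) - 2 * c * integral {0..t0} g + t0 * c\<^sup>2)" using t0 by simp
  moreover have c: "t0 * c = integral {0..t0} g" using False by (simp add: c_def)
  have "t0 * (2 * c * integral {0..t0} g) = 2 * (integral {0..t0} g)\<^sup>2" "t0 * (t0 * c\<^sup>2) = (integral {0..t0} g)\<^sup>2"
    unfolding c[symmetric] by (simp_all add: power2_eq_square)
  ultimately show ?thesis by (simp add: right_diff_distrib distrib_left)
qed simp

text \<open>Both paths contain the same \<open>B\<close>, which cancels in the difference, so
  Gronwall's lemma applies to the distance itself. The factor 2 comes from squaring a sum,
  \<open>t0\<close> from Cauchy-Schwarz and \<open>exp (2 * K * t0)\<close> from squaring Gronwall's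
  factor.\<close>

lemma gronwall_perturbed_drift:
  fixes x y r B :: "real \<Rightarrow> 'h::banach"
  assumes t0: "0 \<le> t0" and b: "continuous_on ({0..t0} \<times> UNIV) (\<lambda>(t, x). b t x)"
    and L: "\<And>t. t \<in> {0..t0} \<Longrightarrow> K-lipschitz_on UNIV (b t)"
    and c: "continuous_on {0..t0} x" "continuous_on {0..t0} y" "continuous_on {0..t0} r"
    and x: "\<And>t. t \<in> {0..t0} \<Longrightarrow> x t = x0 + integral {0..t} r + B t"
    and y: "\<And>t. t \<in> {0..t0} \<Longrightarrow> y t = y0 + integral {0..t} (\<lambda>s. b s (y s)) + B t"
    and t: "t \<in> {0..t0}"
  shows "(dist (x t) (y t))\<^sup>2 \<le> 2 * exp (2 * K * t0) * ((norm (x0 - y0))\<^sup>2 + t0 * integral {0..t0} (\<lambda>s. (norm (r s - b s (x s)))\<^sup>2))"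
proof -
  have K: "0 \<le> K" using L[of 0] t0 by (auto dest: lipschitz_on_nonneg)
  have bc: "continuous_on {0..t0} (\<lambda>s. b s (z s))" if "continuous_on {0..t0} z" for z
    by (rule continuous_on_along_path[OF b that])
  define g where "g s = norm (r s - b s (x s))" for s
  have gc: "continuous_on {0..t0} g" unfolding g_def by (intro continuous_intros c bc)
  define G where "G = integral {0..t0} g"
  have uc: "continuous_on {0..t0} (\<lambda>t. norm (x t - y t))" by (intro continuous_intros c)
  have sub: "continuous_on {0..s} f" if "continuous_on {0..t0} f" "s \<in> {0..t0}" for f :: "real \<Rightarrow> 'z::topological_space" and s
    using that by (auto intro: continuous_on_subset)
  have "norm (x t - y t) \<le> (norm (x0 - y0) + G) * exp (K * t)"
  proof (rule gronwall[OF uc K _ t])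
    fix s assume s: "s \<in> {0..t0}"
    have i1: "r integrable_on {0..s}" "(\<lambda>s. b s (y s)) integrable_on {0..s}" "g integrable_on {0..s}" "(\<lambda>t. norm (x t - y t)) integrable_on {0..s}"
      using sub[OF c(3) s] sub[OF bc[OF c(2)] s] sub[OF gc s] sub[OF uc s] by (auto intro: integrable_continuous_real)
    have i2: "(\<lambda>u. K * norm (x u - y u)) integrable_on {0..s}" using integrable_cmul[OF i1(4), of K] by simp
    have "x s - y s = (x0 - y0) + integral {0..s} (\<lambda>u. r u - b u (y u))"
      using x[OF s] y[OF s] i1 by (simp add: Henstock_Kurzweil_Integration.integral_diff)
    then have "norm (x s - y s) \<le> norm (x0 - y0) + norm (integral {0..s} (\<lambda>u. r u - b u (y u)))" by (simp add: norm_triangle_ineq)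
    also have "norm (integral {0..s} (\<lambda>u. r u - b u (y u))) \<le> integral {0..s} (\<lambda>u. g u + K * norm (x u - y u))"
    proof (rule integral_norm_bound_integral)
      fix u assume "u \<in> {0..s}"
      then have "norm (b u (x u) - b u (y u)) \<le> K * norm (x u - y u)"
        using lipschitz_onD[OF L[of u], of "x u" "y u"] s by (auto simp: dist_norm)
      moreover have "r u - b u (y u) = (r u - b u (x u)) + (b u (x u) - b u (y u))" by simp
      ultimately show "norm (r u - b u (y u)) \<le> g u + K * norm (x u - y u)"
        unfolding g_def by (metis add_left_mono norm_triangle_ineq order_trans)
    qed (intro integrable_diff integrable_add i1 i2)+
    also have "\<dots> = integral {0..s} g + K * integral {0..s} (\<lambda>u. norm (x u - y u))"
      by (simp add: Henstock_Kurzweil_Integration.integral_add[OF i1(3) i2])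
    also have "integral {0..s} g \<le> G" unfolding G_def
      using s i1 gc by (intro integral_subset_le) (auto intro: integrable_continuous_real simp: g_def)
    finally show "norm (x s - y s) \<le> norm (x0 - y0) + G + K * integral {0..s} (\<lambda>u. norm (x u - y u))" by simp
  qed
  also have "\<dots> \<le> (norm (x0 - y0) + G) * exp (K * t0)"
    using t K gc unfolding G_def by (intro mult_left_mono add_nonneg_nonneg Henstock_Kurzweil_Integration.integral_nonneg)
      (auto intro!: mult_left_mono integrable_continuous_real simp: g_def)
  finally have "(dist (x t) (y t))\<^sup>2 \<le> ((norm (x0 - y0) + G) * exp (K * t0))\<^sup>2" by (intro power_mono) (auto simp: dist_norm)
  also have "\<dots> = exp (2 * K * t0) * (norm (x0 - y0) + G)\<^sup>2" by (simp add: power_mult_distrib exp_double mult.assoc)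
  also have "\<dots> \<le> exp (2 * K * t0) * (2 * ((norm (x0 - y0))\<^sup>2 + t0 * integral {0..t0} (\<lambda>s. (g s)\<^sup>2)))"
  proof (rule mult_left_mono)
    have "(norm (x0 - y0) + G)\<^sup>2 \<le> 2 * ((norm (x0 - y0))\<^sup>2 + G\<^sup>2)"
      using sum_squares_bound[of "norm (x0 - y0)" G] by (simp add: power2_eq_square algebra_simps)
    then show "(norm (x0 - y0) + G)\<^sup>2 \<le> 2 * ((norm (x0 - y0))\<^sup>2 + t0 * integral {0..t0} (\<lambda>s. (g s)\<^sup>2))"
      by (rule order_trans) (use integral_square_le[OF t0 gc] in \<open>simp add: G_def\<close>)
  qed simp
  finally show ?thesis unfolding g_def by (simp add: algebra_simps)
qed

context ou_process
begin

lemma reverse_sqrt_\<alpha>_deriv: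
  assumes "0 \<le> t0" "t0 < T" "t \<in> {0..t0}"
  shows "((\<lambda>t. sqrt (\<alpha> (T - t))) has_real_derivative - \<phi>' (T - t)) (at t within {0..t0})"
proof -
  have "((\<lambda>t. sqrt (\<alpha> t)) has_real_derivative \<phi>' (T - t)) (at (T - t) within (\<lambda>t. T - t) ` {0..t0})"
    by (rule has_field_derivative_subset[OF sqrt_\<alpha>_deriv]) (use assms in auto)
  moreover have "((\<lambda>t. T - t) has_real_derivative - 1) (at t within {0..t0})" by (auto intro!: derivative_eq_intros)
  ultimately show ?thesis using DERIV_image_chain by (fastforce simp: comp_def)
qed

lemma reverse_\<phi>'_cont:
  assumes "t0 < T"
  shows "continuous_on {0..t0} (\<lambda>t. - \<phi>' (T - t))"
  by (intro continuous_intros continuous_on_compose2[OF \<phi>'_cont]) (use assms in auto)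

text \<open>The approximate equation is solved once more on the product of \<open>M\<close> with the
  resampling space, driven by \<open>rnoise\<close> and started at a point coupled to
  \<open>X T\<close>. This solution has the law of \<open>Y\<close>, so pairing its path with the
  reversed path of \<open>X\<close> gives an admissible coupling in which both paths share one
  noise.\<close>

lemma reverse_coupling_bound:
  fixes b :: "real \<Rightarrow> 'h \<Rightarrow> 'h" and N :: "'v measure"
  assumes t0: "0 \<le> t0" "t0 < T" and b: "continuous_on ({0..t0} \<times> UNIV) (\<lambda>(t, x). b t x)"
    and L: "\<And>t. t \<in> {0..t0} \<Longrightarrow> K-lipschitz_on UNIV (b t)"
    and N: "prob_space N" and V: "wiener_process N (Qn e lam m) t0 V" and ind: "independent_of_process N t0 (Y 0) V"
    and Y: "sde_solution N t0 b (\<lambda>t. sqrt (\<alpha> (T - t))) V Y"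
    and \<gamma>: "sets \<gamma> = sets (borel \<Otimes>\<^sub>M borel)" "distr \<gamma> borel fst = distr M borel (X T)" "distr \<gamma> borel snd = distr N borel (Y 0)"
    and \<eta>: "0 < \<eta>"
  shows "(INF \<rho>\<in>couplings (path_space t0) (path_law M t0 (\<lambda>t. X (T - t))) (path_law N t0 Y).
        \<integral>\<^sup>+(x, y). ennreal ((mdist (path_space t0) x y)\<^sup>2) \<partial>\<rho>)
    \<le> ennreal (2 * exp (2 * K * t0)) * (ennreal \<eta> + 2 * (\<integral>\<^sup>+(x, y). ennreal ((norm (x - y))\<^sup>2) \<partial>\<gamma>) +
        ennreal t0 * (\<integral>\<^sup>+w. ennreal (integral {0..t0} (\<lambda>s. (norm (rdrift (T - s) (X (T - s) w) - b s (X (T - s) w)))\<^sup>2)) \<partial>M))"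
proof -
  interpret N: prob_space N by fact
  have XT[measurable]: "X T \<in> borel_measurable M" using X_meas T_pos by simp
  obtain P :: "(nat \<Rightarrow> 'h) measure" and idx :: "'h \<Rightarrow> nat" where P: "prob_space P"
    and Ym: "(\<lambda>(w, z). z (idx (X T w))) \<in> borel_measurable (M \<Otimes>\<^sub>M P)"
    and law: "distr (M \<Otimes>\<^sub>M P) borel (\<lambda>(w, z). z (idx (X T w))) = distr \<gamma> borel snd"
    and cost: "(\<integral>\<^sup>+(w, z). ennreal ((norm (X T w - z (idx (X T w))))\<^sup>2) \<partial>(M \<Otimes>\<^sub>M P)) \<le>
      ennreal \<eta> + 2 * (\<integral>\<^sup>+(x, y). ennreal ((norm (x - y))\<^sup>2) \<partial>\<gamma>)"
    and mix: "\<And>a. \<exists>g :: 'h \<Rightarrow> complex. g \<in> borel_measurable borel \<and> (\<forall>x. cmod (g x) \<le> 1) \<and>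
      (\<forall>G. integrable M G \<longrightarrow> (CLINT (w, z)|M \<Otimes>\<^sub>M P. iexp (z (idx (X T w)) \<bullet> a) * G w) = (CLINT w|M. g (X T w) * G w))"
    using coupling_kernel[OF prob_space_axioms XT \<gamma>(1,2) \<eta>] by blast
  define \<Omega> where "\<Omega> = M \<Otimes>\<^sub>M P"
  define y0 where "y0 p = snd p (idx (X T (fst p)))" for p :: "'w \<times> (nat \<Rightarrow> 'h)"
  define B' where "B' t p = rnoise t (fst p)" for t and p :: "'w \<times> (nat \<Rightarrow> 'h)"
  interpret P: prob_space P by fact
  interpret MP: pair_prob_space M P ..
  have \<Omega>_ps: "prob_space \<Omega>" unfolding \<Omega>_def by (rule MP.prob_space_axioms)
  interpret O: prob_space \<Omega> by (rule \<Omega>_ps)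
  have fst_sp: "fst p \<in> space M" if "p \<in> space \<Omega>" for p using that by (auto simp: \<Omega>_def space_pair_measure)
  have fstm[measurable]: "fst \<in> measurable \<Omega> M" unfolding \<Omega>_def by simp
  have fstd: "distr \<Omega> M fst = M" unfolding \<Omega>_def by (rule P.distr_pair_fst)
  have y0m[measurable]: "y0 \<in> borel_measurable \<Omega>" using Ym by (simp add: \<Omega>_def y0_def[abs_def] case_prod_beta')
  have y0law: "distr \<Omega> borel y0 = distr N borel (Y 0)" using law \<gamma>(3) by (simp add: \<Omega>_def y0_def[abs_def] case_prod_beta')
  have B'm: "B' t \<in> borel_measurable \<Omega>" if "t \<in> {0..t0}" for t
    unfolding B'_def[abs_def] by (rule measurable_compose[OF fstm rnoise_meas]) (use that t0 in auto)
  have B'0: "B' 0 p = 0" for p by (simp add: B'_def rnoise_def)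
  have "\<exists>y. continuous_on {0..t0} y \<and> (\<forall>t\<in>{0..t0}. y t = y0 p + integral {0..t} (\<lambda>s. b s (y s)) + B' t p)" if "p \<in> space \<Omega>" for p
    unfolding B'_def by (rule ode_exists[OF t0(1) b L rnoise_cont[OF fst_sp[OF that] t0(2)]])
  then obtain y where yc: "\<And>p. p \<in> space \<Omega> \<Longrightarrow> continuous_on {0..t0} (y p)"
    and yeq: "\<And>p t. p \<in> space \<Omega> \<Longrightarrow> t \<in> {0..t0} \<Longrightarrow> y p t = y0 p + integral {0..t} (\<lambda>s. b s (y p s)) + B' t p" by metis
  define Y' where "Y' t p = y p t" for t p
  have Y'c: "\<And>p. p \<in> space \<Omega> \<Longrightarrow> continuous_on {0..t0} (\<lambda>t. Y' t p)"
    and Y'eq: "\<And>p t. p \<in> space \<Omega> \<Longrightarrow> t \<in> {0..t0} \<Longrightarrow> Y' t p = y0 p + integral {0..t} (\<lambda>s. b s (Y' s p)) + B' t p"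
    unfolding Y'_def using yc yeq by auto
  have Y'm: "Y' t \<in> borel_measurable \<Omega>" if "t \<in> {0..t0}" for t
    by (rule ode_solution_measurable[OF t0(1) b L y0m B'm B'0 Y'c Y'eq that])
  have Vc: "\<And>w. w \<in> space N \<Longrightarrow> continuous_on {0..t0} (\<lambda>t. V t w)" and Vm: "\<And>t. t \<in> {0..t0} \<Longrightarrow> V t \<in> borel_measurable N"
    using V unfolding wiener_process_def by auto
  have Yc: "\<And>w. w \<in> space N \<Longrightarrow> continuous_on {0..t0} (\<lambda>t. Y t w)" and YYm: "\<And>t. t \<in> {0..t0} \<Longrightarrow> Y t \<in> borel_measurable N"
    using Y unfolding sde_solution_def by auto
  have bc: "continuous_on {0..t0} (\<lambda>s. b s (z s))" if "continuous_on {0..t0} z" for z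
    by (rule continuous_on_along_path[OF b that])
  note \<phi> = reverse_\<phi>'_cont[OF t0(2)] reverse_sqrt_\<alpha>_deriv[OF t0]
  define J where "J t w = pathwise_integral (\<lambda>t. sqrt (\<alpha> (T - t))) (\<lambda>t. - \<phi>' (T - t)) (\<lambda>t. V t w) t" for t w
  have Jm: "J t \<in> borel_measurable N" if "t \<in> {0..t0}" for t
    unfolding J_def[abs_def] by (rule pathwise_integral_measurable[OF Vc Vm \<phi> that])
  have J0: "J 0 w = 0" for w by (simp add: J_def pathwise_integral_def)
  have Yeq: "AE w in N. \<forall>t\<in>{0..t0}. Y t w = Y 0 w + integral {0..t} (\<lambda>s. b s (Y s w)) + J t w"
    unfolding J_def by (rule N.sde_solution_pathwise[OF Y Vc Vm \<phi> bc[OF Yc]])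
  have var: "integral {0..u} (\<lambda>s. (sqrt (\<alpha> (T - s)))\<^sup>2) = integral {0..u} (\<lambda>r. \<alpha> (T - r))" if "u \<in> {0..t0}" for u
    by (rule Henstock_Kurzweil_Integration.integral_cong) (use that t0 \<alpha>_pos in \<open>auto intro!: real_sqrt_pow2 less_imp_le\<close>)
  \<comment> \<open>Both driving noises have the same Gaussian characteristic function and are
    independent of their initial values, whose laws agree.\<close>
  have YY': "path_law N t0 Y = path_law \<Omega> t0 Y'"
  proof (rule solution_path_law_eq[of t0 b K N \<Omega> "Y 0" y0 J B' Y Y', OF t0(1) b L N \<Omega>_ps _ y0m Jm J0 B'm B'0 YYm Yc Yeq Y'm Y'c])
    show "Y 0 \<in> borel_measurable N" using YYm t0 by simp
    show "AE w in \<Omega>. \<forall>t\<in>{0..t0}. Y' t w = y0 w + integral {0..t} (\<lambda>s. b s (Y' s w)) + B' t w"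
      using Y'eq by auto
    fix S :: "real set" and a and k :: "real \<Rightarrow> 'h" assume S: "finite S" "S \<subseteq> {0..t0}"
    let ?E = "complex_of_real (exp (- (\<Sum>s\<in>S. \<Sum>t\<in>S. (k s \<bullet> Qn e lam m (k t)) * integral {0..min s t} (\<lambda>r. \<alpha> (T - r))) / 2))"
    have "(CLINT w|N. iexp (Y 0 w \<bullet> a) * iexp (\<Sum>t\<in>S. J t w \<bullet> k t)) = (CLINT w|N. iexp (Y 0 w \<bullet> a)) *
       exp (- (\<Sum>s\<in>S. \<Sum>t\<in>S. (k s \<bullet> Qn e lam m (k t)) * integral {0..min s t} (\<lambda>s. (sqrt (\<alpha> (T - s)))\<^sup>2)) / 2)"
      unfolding J_def
      by (rule N.wiener_integral_char[OF V t0(1) linear_Qn Qn_psd[OF lam_nonneg] \<phi> ind, where C=1 and g="\<lambda>x. iexp (x \<bullet> a)"])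
        (use S in auto)
    also have "(\<Sum>s\<in>S. \<Sum>t\<in>S. (k s \<bullet> Qn e lam m (k t)) * integral {0..min s t} (\<lambda>s. (sqrt (\<alpha> (T - s)))\<^sup>2)) =
        (\<Sum>s\<in>S. \<Sum>t\<in>S. (k s \<bullet> Qn e lam m (k t)) * integral {0..min s t} (\<lambda>r. \<alpha> (T - r)))"
      using S by (intro sum.cong refl) (subst var, auto simp: min_def)
    finally have 1: "(CLINT w|N. iexp (Y 0 w \<bullet> a) * iexp (\<Sum>t\<in>S. J t w \<bullet> k t)) = (CLINT w|N. iexp (Y 0 w \<bullet> a)) * ?E" .
    \<comment> \<open>Integrating out the resampling leaves a function of \<open>X T\<close>, to
      which the independence of \<open>rnoise\<close> and \<open>X T\<close> applies.\<close>
    obtain g :: "'h \<Rightarrow> complex" where g[measurable]: "g \<in> borel_measurable borel" and gb: "\<And>x. cmod (g x) \<le> 1"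
      and gm: "\<And>G. integrable M G \<Longrightarrow> (CLINT p|\<Omega>. iexp (y0 p \<bullet> a) * G (fst p)) = (CLINT w|M. g (X T w) * G w)"
      using mix[of a] by (auto simp: \<Omega>_def y0_def case_prod_beta')
    have rm: "rnoise t \<in> borel_measurable M" if "t \<in> S" for t using S that t0 by (intro rnoise_meas) auto
    have im: "(\<lambda>w. iexp (\<Sum>t\<in>S. rnoise t w \<bullet> k t)) \<in> borel_measurable M" using rm by measurable
    have "(CLINT p|\<Omega>. iexp (y0 p \<bullet> a) * iexp (\<Sum>t\<in>S. B' t p \<bullet> k t)) = (CLINT w|M. g (X T w) * iexp (\<Sum>t\<in>S. rnoise t w \<bullet> k t))"
      unfolding B'_def by (rule gm) (rule integrable_const_bound[where B=1], simp, rule im)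
    also have "\<dots> = (CLINT w|M. g (X T w)) * ?E" by (rule rnoise_char[OF g gb t0 S])
    also have "(CLINT w|M. g (X T w)) = (CLINT p|\<Omega>. iexp (y0 p \<bullet> a))" using gm[of "\<lambda>_. 1"] by simp
    also have "\<dots> = (CLINT x|distr \<Omega> borel y0. iexp (x \<bullet> a))" by (rule integral_distr[symmetric]) measurable
    also have "\<dots> = (CLINT w|N. iexp (Y 0 w \<bullet> a))"
      unfolding y0law by (rule integral_distr) (use YYm[of 0] t0 in auto)
    finally show "(CLINT w|N. iexp (Y 0 w \<bullet> a) * iexp (\<Sum>t\<in>S. J t w \<bullet> k t)) = (CLINT p|\<Omega>. iexp (y0 p \<bullet> a) * iexp (\<Sum>t\<in>S. B' t p \<bullet> k t))"
      using 1 by simp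
  qed
  let ?PS = "borel_of_metric (path_space t0 :: (real \<Rightarrow> 'h) metric)"
  have Xm: "X (T - t) \<in> borel_measurable M" if "t \<in> {0..t0}" for t using that t0 by (intro X_meas) auto
  define f1 where "f1 p = (\<lambda>t\<in>{0..t0}. X (T - t) (fst p))" for p :: "'w \<times> (nat \<Rightarrow> 'h)"
  define f2 where "f2 p = (\<lambda>t\<in>{0..t0}. Y' t p)" for p
  have f0m: "(\<lambda>w. \<lambda>t\<in>{0..t0}. X (T - t) w) \<in> measurable M ?PS"
    by (rule path_map_measurable[OF t0(1) Xm X_path_cont[OF _ t0(2)]])
  have f1m[measurable]: "f1 \<in> measurable \<Omega> ?PS" unfolding f1_def[abs_def] by (rule measurable_compose[OF fstm f0m])
  have f2m[measurable]: "f2 \<in> measurable \<Omega> ?PS" unfolding f2_def[abs_def] by (rule path_map_measurable[OF t0(1) Y'm Y'c])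
  have fm[measurable]: "(\<lambda>p. (f1 p, f2 p)) \<in> measurable \<Omega> (?PS \<Otimes>\<^sub>M ?PS)" by measurable
  define \<rho> where "\<rho> = distr \<Omega> (?PS \<Otimes>\<^sub>M ?PS) (\<lambda>p. (f1 p, f2 p))"
  have "distr \<rho> ?PS fst = distr \<Omega> ?PS f1" unfolding \<rho>_def by (subst distr_distr) (auto simp: comp_def)
  also have "\<dots> = distr (distr \<Omega> M fst) ?PS (\<lambda>w. \<lambda>t\<in>{0..t0}. X (T - t) w)"
    by (subst distr_distr[OF f0m fstm]) (simp add: f1_def[abs_def] comp_def)
  finally have r1: "distr \<rho> ?PS fst = path_law M t0 (\<lambda>t. X (T - t))" unfolding fstd path_law_def .
  have "distr \<rho> ?PS snd = distr \<Omega> ?PS f2" unfolding \<rho>_def by (subst distr_distr) (auto simp: comp_def)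
  then have r2: "distr \<rho> ?PS snd = path_law N t0 Y" unfolding YY' by (simp add: path_law_def f2_def[abs_def])
  have "\<rho> \<in> couplings (path_space t0) (path_law M t0 (\<lambda>t. X (T - t))) (path_law N t0 Y)"
    unfolding couplings_def using r1 r2 by (simp add: \<rho>_def)
  then have "(INF \<rho>\<in>couplings (path_space t0) (path_law M t0 (\<lambda>t. X (T - t))) (path_law N t0 Y).
        \<integral>\<^sup>+(x, y). ennreal ((mdist (path_space t0) x y)\<^sup>2) \<partial>\<rho>) \<le> (\<integral>\<^sup>+(x, y). ennreal ((mdist (path_space t0) x y)\<^sup>2) \<partial>\<rho>)"
    by (rule INF_lower)
  also have "\<dots> \<le> (\<integral>\<^sup>+p. ennreal ((mdist (path_space t0) (f1 p) (f2 p))\<^sup>2) \<partial>\<Omega>)"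
    unfolding \<rho>_def using nn_integral_distr_le[OF fm, of "\<lambda>(x, y). ennreal ((mdist (path_space t0) x y)\<^sup>2)"] by simp
  finally have coupled: "(INF \<rho>\<in>couplings (path_space t0) (path_law M t0 (\<lambda>t. X (T - t))) (path_law N t0 Y).
        \<integral>\<^sup>+(x, y). ennreal ((mdist (path_space t0) x y)\<^sup>2) \<partial>\<rho>) \<le> (\<integral>\<^sup>+p. ennreal ((mdist (path_space t0) (f1 p) (f2 p))\<^sup>2) \<partial>\<Omega>)" .
  have pathwise: "(\<integral>\<^sup>+p. ennreal ((mdist (path_space t0) (f1 p) (f2 p))\<^sup>2) \<partial>\<Omega>)
      \<le> (\<integral>\<^sup>+p. ennreal (2 * exp (2 * K * t0)) * (ennreal ((norm (X T (fst p) - y0 p))\<^sup>2) + ennreal t0 * ennreal (D (fst p))) \<partial>\<Omega>)"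
    if D_def: "D = (\<lambda>w. integral {0..t0} (\<lambda>s. (norm (rdrift (T - s) (X (T - s) w) - b s (X (T - s) w)))\<^sup>2))" for D
  proof (rule nn_integral_mono)
    fix p assume p: "p \<in> space \<Omega>"
    note w = fst_sp[OF p]
    have Dnn: "0 \<le> D (fst p)" unfolding D_def
      by (intro Henstock_Kurzweil_Integration.integral_nonneg integrable_continuous_real continuous_intros rdrift_path_cont[OF w t0(2)] bc X_path_cont[OF w t0(2)]) auto
    let ?b = "2 * exp (2 * K * t0) * ((norm (X T (fst p) - y0 p))\<^sup>2 + t0 * D (fst p))"
    have b0: "0 \<le> ?b" using Dnn t0 by simp
    have "(dist (X (T - t) (fst p)) (Y' t p))\<^sup>2 \<le> ?b" if t: "t \<in> {0..t0}" for t
      unfolding D_def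
      by (rule gronwall_perturbed_drift[OF t0(1) b L X_path_cont[OF w t0(2)] Y'c[OF p] rdrift_path_cont[OF w t0(2)] _ Y'eq[OF p] t])
         (auto simp: B'_def rnoise_def)
    then have "dist (f1 p t) (f2 p t) \<le> sqrt ?b" if "t \<in> {0..t0}" for t
      using that by (intro real_le_rsqrt) (simp add: f1_def f2_def)
    then have "mdist (path_space t0) (f1 p) (f2 p) \<le> sqrt ?b" using b0 by (intro mdist_path_space_le) auto
    then have "(mdist (path_space t0) (f1 p) (f2 p))\<^sup>2 \<le> (sqrt ?b)\<^sup>2" by (intro power_mono) auto
    then have "(mdist (path_space t0) (f1 p) (f2 p))\<^sup>2 \<le> ?b" using b0 by simp
    then have "ennreal ((mdist (path_space t0) (f1 p) (f2 p))\<^sup>2) \<le> ennreal ?b" by (rule ennreal_leI)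
    also have "\<dots> = ennreal (2 * exp (2 * K * t0)) * (ennreal ((norm (X T (fst p) - y0 p))\<^sup>2) + ennreal t0 * ennreal (D (fst p)))"
      using Dnn t0 by (simp add: ennreal_mult' ennreal_plus)
    finally show "ennreal ((mdist (path_space t0) (f1 p) (f2 p))\<^sup>2) \<le>
      ennreal (2 * exp (2 * K * t0)) * (ennreal ((norm (X T (fst p) - y0 p))\<^sup>2) + ennreal t0 * ennreal (D (fst p)))" .
  qed
  note bound = order_trans[OF coupled pathwise[OF refl]]
  let ?D = "\<lambda>w. integral {0..t0} (\<lambda>s. (norm (rdrift (T - s) (X (T - s) w) - b s (X (T - s) w)))\<^sup>2)"
  have Dm[measurable]: "?D \<in> borel_measurable M"
  proof (rule integral_measurable[OF _ _ t0(1)])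
    fix s assume s: "s \<in> {0..t0}"
    have "b s \<in> borel_measurable borel" using lipschitz_on_continuous_on[OF L[OF s]] by (rule borel_measurable_continuous_onI)
    note [measurable] = this Xm[OF s] rdrift_meas[of "T - s"]
    have "rdrift (T - s) \<in> borel_measurable borel" using s t0 by (intro rdrift_meas) auto
    note [measurable] = this
    show "(\<lambda>w. (norm (rdrift (T - s) (X (T - s) w) - b s (X (T - s) w)))\<^sup>2) \<in> borel_measurable M" by measurable
  next
    fix w assume w: "w \<in> space M"
    show "continuous_on {0..t0} (\<lambda>s. (norm (rdrift (T - s) (X (T - s) w) - b s (X (T - s) w)))\<^sup>2)"
      by (intro continuous_intros rdrift_path_cont[OF w t0(2)] bc X_path_cont[OF w t0(2)])
  qed
  have [measurable]: "(\<lambda>p. ?D (fst p)) \<in> borel_measurable \<Omega>" by (rule measurable_compose[OF fstm Dm])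
  have [measurable]: "(\<lambda>p. X T (fst p)) \<in> borel_measurable \<Omega>" by (rule measurable_compose[OF fstm XT])
  have Dint: "(\<integral>\<^sup>+p. ennreal (?D (fst p)) \<partial>\<Omega>) = (\<integral>\<^sup>+w. ennreal (?D w) \<partial>M)"
    by (subst (2) fstd[symmetric], subst nn_integral_distr[OF fstm]) (use Dm in \<open>auto simp: fstd\<close>)
  have "(\<integral>\<^sup>+p. ennreal (2 * exp (2 * K * t0)) * (ennreal ((norm (X T (fst p) - y0 p))\<^sup>2) + ennreal t0 * ennreal (?D (fst p))) \<partial>\<Omega>) =
     ennreal (2 * exp (2 * K * t0)) * ((\<integral>\<^sup>+p. ennreal ((norm (X T (fst p) - y0 p))\<^sup>2) \<partial>\<Omega>) + ennreal t0 * (\<integral>\<^sup>+p. ennreal (?D (fst p)) \<partial>\<Omega>))"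
    by (simp add: nn_integral_cmult nn_integral_add)
  also have "\<dots> \<le> ennreal (2 * exp (2 * K * t0)) * (ennreal \<eta> + 2 * (\<integral>\<^sup>+(x, y). ennreal ((norm (x - y))\<^sup>2) \<partial>\<gamma>) + ennreal t0 * (\<integral>\<^sup>+w. ennreal (?D w) \<partial>M))"
    unfolding Dint using cost by (intro mult_left_mono add_right_mono) (simp_all add: \<Omega>_def y0_def case_prod_beta')
  finally show ?thesis using bound by (rule order_trans[rotated])
qed

end

section \<open>The Wasserstein estimate\<close>

lemma ennreal_sqrt_square: "(ennreal_sqrt x)\<^sup>2 = x"
proof (cases "x = \<top>")
  case False
  then have "(ennreal_sqrt x)\<^sup>2 = ennreal ((sqrt (enn2real x))\<^sup>2)" by (simp add: ennreal_sqrt_def ennreal_power)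
  then show ?thesis using False by (simp add: less_top)
qed (simp add: ennreal_sqrt_def power2_eq_square)

lemma W2_square: "(W2 m \<mu> \<nu>)\<^sup>2 = (INF \<gamma>\<in>couplings m \<mu> \<nu>. \<integral>\<^sup>+(x, y). ennreal ((mdist m x y)\<^sup>2) \<partial>\<gamma>)"
  unfolding W2_def by (rule ennreal_sqrt_square)

lemma sigma_finite_interval: "sigma_finite_measure (restrict_space lborel {0..t0 :: real})"
  by (rule sigma_finite_measure_restrict_space) (auto intro: sigma_finite_lborel)

text \<open>The process is the limit of its values at the last grid point up to the current time,
  and each of these is a countable case distinction on that grid point.\<close>

lemma continuous_process_jointly_measurable:
  fixes G :: "real \<Rightarrow> 'w \<Rightarrow> 'h::{real_normed_vector,second_countable_topology}"
  assumes G: "\<And>t. t \<in> {0..t0} \<Longrightarrow> G t \<in> borel_measurable M" and c: "\<And>w. w \<in> space M \<Longrightarrow> continuous_on {0..t0} (\<lambda>t. G t w)"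
  shows "(\<lambda>p. G (snd p) (fst p)) \<in> borel_measurable (time_prod M t0)"
proof (rule borel_measurable_LIMSEQ_metric)
  \<comment> \<open>The guard makes the term measurable for every index, including grid points
    beyond \<open>t0\<close>, which never are the last one up to a time in
    \<open>[0, t0]\<close>.\<close>
  let ?A = "\<lambda>i N p. if real i * gstep N \<le> t0 then G (real i * gstep N) (fst p) else 0"
  show "(\<lambda>p. ?A (gidx (snd p) N) N p) \<in> borel_measurable (time_prod M t0)" for N
  proof (rule measurable_compose_countable[where f="\<lambda>i p. ?A i N p"])
    show "(\<lambda>p. ?A i N p) \<in> borel_measurable (time_prod M t0)" for i
    proof (cases "real i * gstep N \<le> t0")
      case True
      then have "real i * gstep N \<in> {0..t0}" using gstep_nonneg[of N] by simp
      from measurable_compose[OF measurable_fst G[OF this]] True show ?thesis by (simp add: time_prod_def)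
    qed simp
    have "(\<lambda>t. t) \<in> borel_measurable (restrict_space lborel {0..t0})" by (intro measurable_restrict_space1) simp
    from measurable_compose[OF measurable_snd this, of M] have "snd \<in> borel_measurable (time_prod M t0)"
      unfolding time_prod_def by simp
    then show "(\<lambda>p. gidx (snd p) N) \<in> measurable (time_prod M t0) (count_space UNIV)"
      unfolding gidx_def by measurable
  qed
  show "(\<lambda>N. ?A (gidx (snd p) N) N p) \<longlonglongrightarrow> G (snd p) (fst p)" if "p \<in> space (time_prod M t0)" for p
  proof -
    have p: "fst p \<in> space M" "snd p \<in> {0..t0}" using that by (auto simp: time_prod_def space_pair_measure space_restrict_space)
    have le: "real (gidx (snd p) N) * gstep N \<le> t0" for N using gidx_le[of "snd p" N] p by simp
    have "(\<lambda>N. G (real (gidx (snd p) N) * gstep N) (fst p)) \<longlonglongrightarrow> G (snd p) (fst p)"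
      by (rule continuous_on_tendsto_compose[OF c[OF p(1)] gidx_tendsto p(2)]) (use p le gstep_nonneg in auto)
    then show ?thesis using le by simp
  qed
qed

lemma L2sq_triangle:
  fixes G H U :: "real \<Rightarrow> 'w \<Rightarrow> 'h::{real_normed_vector,second_countable_topology}"
  assumes "(\<lambda>(w, t). G t w - U t w) \<in> borel_measurable (time_prod M t0)" "(\<lambda>(w, t). U t w - H t w) \<in> borel_measurable (time_prod M t0)"
  shows "L2sq M t0 (\<lambda>t w. G t w - H t w) \<le> 2 * L2sq M t0 (\<lambda>t w. G t w - U t w) + 2 * L2sq M t0 (\<lambda>t w. U t w - H t w)"
proof -
  let ?a = "\<lambda>p. ennreal ((norm (G (snd p) (fst p) - U (snd p) (fst p)))\<^sup>2)" and ?b = "\<lambda>p. ennreal ((norm (U (snd p) (fst p) - H (snd p) (fst p)))\<^sup>2)"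
  have [measurable]: "(\<lambda>p. G (snd p) (fst p) - U (snd p) (fst p)) \<in> borel_measurable (time_prod M t0)"
    "(\<lambda>p. U (snd p) (fst p) - H (snd p) (fst p)) \<in> borel_measurable (time_prod M t0)"
    using assms by (simp_all add: case_prod_beta')
  have "L2sq M t0 (\<lambda>t w. G t w - H t w) \<le> (\<integral>\<^sup>+p. 2 * ?a p + 2 * ?b p \<partial>time_prod M t0)"
    unfolding L2sq_def case_prod_beta'
  proof (rule nn_integral_mono)
    fix p
    let ?x = "G (snd p) (fst p) - U (snd p) (fst p)" and ?y = "U (snd p) (fst p) - H (snd p) (fst p)"
    have "ennreal ((norm (G (snd p) (fst p) - H (snd p) (fst p)))\<^sup>2) \<le> ennreal (2 * (norm ?x)\<^sup>2 + 2 * (norm ?y)\<^sup>2)"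
      using norm_add_sq_le2[of ?x ?y] by (intro ennreal_leI) simp
    then show "ennreal ((norm (G (snd p) (fst p) - H (snd p) (fst p)))\<^sup>2) \<le> 2 * ?a p + 2 * ?b p"
      by (simp add: ennreal_plus ennreal_mult'')
  qed
  also have "\<dots> = 2 * L2sq M t0 (\<lambda>t w. G t w - U t w) + 2 * L2sq M t0 (\<lambda>t w. U t w - H t w)"
    unfolding L2sq_def case_prod_beta' by (simp add: nn_integral_add nn_integral_cmult)
  finally show ?thesis .
qed

text \<open>\<open>L2sq\<close> integrates over the product space, Gronwall's bound along each
  continuous path. The score error along the given version of the process plays the role of
  \<open>G\<close>; only its norm, and only almost surely, is identified with that of a continuous
  \<open>H\<close>.\<close>

lemma L2sq_eq_iterated:
  fixes G :: "real \<Rightarrow> 'w \<Rightarrow> 'h::{real_normed_vector,second_countable_topology}"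
  assumes "(\<lambda>(w, t). G t w) \<in> borel_measurable (time_prod M t0)"
    and H: "AE w in M. continuous_on {0..t0} (\<lambda>t. H t w) \<and> (\<forall>t\<in>{0..t0}. norm (G t w) = norm (H t w :: 'h))"
  shows "(\<integral>\<^sup>+w. ennreal (integral {0..t0} (\<lambda>t. (norm (H t w))\<^sup>2)) \<partial>M) = L2sq M t0 G"
proof -
  interpret I: sigma_finite_measure "restrict_space lborel {0..t0}" by (rule sigma_finite_interval)
  have [measurable]: "(\<lambda>p. G (snd p) (fst p)) \<in> borel_measurable (M \<Otimes>\<^sub>M restrict_space lborel {0..t0})"
    using assms by (simp add: case_prod_beta' time_prod_def)
  have "L2sq M t0 G = (\<integral>\<^sup>+w. \<integral>\<^sup>+t. ennreal ((norm (G t w))\<^sup>2) \<partial>restrict_space lborel {0..t0} \<partial>M)"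
    unfolding L2sq_def case_prod_beta' time_prod_def by (subst I.nn_integral_fst[symmetric]) auto
  also have "\<dots> = (\<integral>\<^sup>+w. ennreal (integral {0..t0} (\<lambda>t. (norm (H t w))\<^sup>2)) \<partial>M)"
  proof (rule nn_integral_cong_AE, rule AE_mp[OF H], intro AE_I2 impI, elim conjE)
    fix w assume c: "continuous_on {0..t0} (\<lambda>t. H t w)" and GH: "\<forall>t\<in>{0..t0}. norm (G t w) = norm (H t w)"
    have "((\<lambda>t. (norm (H t w))\<^sup>2) has_integral integral {0..t0} (\<lambda>t. (norm (H t w))\<^sup>2)) {0..t0}"
      by (intro integrable_integral integrable_continuous_real continuous_intros c)
    then have "(\<integral>\<^sup>+t. ennreal (indicator {0..t0} t * (norm (H t w))\<^sup>2) \<partial>lborel) = ennreal (integral {0..t0} (\<lambda>t. (norm (H t w))\<^sup>2))"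
      by (rule nn_integral_has_integral_lebesgue[rotated]) auto
    moreover have "(\<integral>\<^sup>+t. ennreal ((norm (G t w))\<^sup>2) \<partial>restrict_space lborel {0..t0}) = (\<integral>\<^sup>+t. ennreal (indicator {0..t0} t * (norm (H t w))\<^sup>2) \<partial>lborel)"
      by (subst nn_integral_restrict_space) (auto intro!: nn_integral_cong simp: GH split: split_indicator)
    ultimately show "(\<integral>\<^sup>+t. ennreal ((norm (G t w))\<^sup>2) \<partial>restrict_space lborel {0..t0}) = ennreal (integral {0..t0} (\<lambda>t. (norm (H t w))\<^sup>2))" by simp
  qed
  finally show ?thesis by simp
qed

text \<open>The tail suprema decrease to the limit superior.\<close>

lemma tail_SUP_tendsto_zero:
  fixes u :: "nat \<Rightarrow> ennreal"
  assumes "u \<longlonglongrightarrow> 0"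
  shows "(\<lambda>n. SUP m\<in>{n..}. u m) \<longlonglongrightarrow> 0"
proof -
  have "decseq (\<lambda>n. SUP m\<in>{n..}. u m)" by (intro decseq_SucI SUP_subset_mono) auto
  from LIMSEQ_INF[OF this] have "(\<lambda>n. SUP m\<in>{n..}. u m) \<longlonglongrightarrow> limsup u" by (simp add: limsup_INF_SUP)
  then show ?thesis using lim_imp_Limsup[OF _ assms] by simp
qed

text \<open>Couplings \<gamma> of the initial laws with cost close to the infimum are inserted in
  the coupling bound, and the resampling error is sent to zero together with their excess cost. The
  integral of the difference of the drifts is the score error, since the linear parts of the two
  drifts are equal.\<close>

lemma (in ou_process) reverse_W2_bound:
  fixes b f :: "real \<Rightarrow> 'h \<Rightarrow> 'h" and N :: "'v measure"
  assumes t0: "0 \<le> t0" "t0 < T"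
    and Z: "\<And>t. t \<in> {0..T} \<Longrightarrow> Z t \<in> borel_measurable M" "\<And>w. w \<in> space M \<Longrightarrow> continuous_on {0..T} (\<lambda>t. Z t w)"
      "AE w in M. \<forall>t\<in>{0..T}. Z t w = X t w"
    and b_eq: "\<And>t x. b t x = (\<alpha> (T - t) / 2) *\<^sub>R x + f t x"
    and b: "continuous_on ({0..t0} \<times> UNIV) (\<lambda>(t, x). b t x)"
    and L: "\<And>t. t \<in> {0..t0} \<Longrightarrow> K-lipschitz_on UNIV (b t)"
    and sm: "(\<lambda>(w, t). score M e lam \<alpha> T m Z t (Z (T - t) w) - f t (Z (T - t) w)) \<in> borel_measurable (time_prod M t0)"
    and N: "prob_space N" and V: "wiener_process N (Qn e lam m) t0 V" and ind: "independent_of_process N t0 (Y 0) V"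
    and Y0: "is_gaussian (Qn e lam m) (distr N borel (Y 0))"
    and Y: "sde_solution N t0 b (\<lambda>t. sqrt (\<alpha> (T - t))) V Y"
  shows "(W2 (path_space t0) (path_law M t0 (\<lambda>t. Z (T - t))) (path_law N t0 Y))\<^sup>2 \<le>
    ennreal (2 * exp (2 * K * t0)) * (2 * (W2 euclidean_metric (distr M borel (Z T)) (gaussian (Qn e lam m)))\<^sup>2 +
      ennreal t0 * L2sq M t0 (\<lambda>t w. score M e lam \<alpha> T m Z t (Z (T - t) w) - f t (Z (T - t) w)))"
    (is "?W \<le> ennreal ?c * (2 * ?I + ennreal t0 * ?D)")
proof -
  have TT: "T \<in> {0..T}" using T_pos by simp
  have law_path: "path_law M t0 (\<lambda>t. Z (T - t)) = path_law M t0 (\<lambda>t. X (T - t))" unfolding path_law_def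
  proof (rule distr_cong_AE[OF refl refl])
    show "AE w in M. (\<lambda>t\<in>{0..t0}. Z (T - t) w) = (\<lambda>t\<in>{0..t0}. X (T - t) w)"
      using Z(3) by (rule AE_mp) (use t0 in \<open>auto intro!: AE_I2 restrict_ext\<close>)
    show "(\<lambda>w. \<lambda>t\<in>{0..t0}. Z (T - t) w) \<in> measurable M (borel_of_metric (path_space t0))"
      by (rule path_map_measurable[OF t0(1) Z(1) continuous_on_compose2[OF Z(2)]]) (use t0 in \<open>auto intro!: continuous_intros\<close>)
    show "(\<lambda>w. \<lambda>t\<in>{0..t0}. X (T - t) w) \<in> measurable M (borel_of_metric (path_space t0))"
      by (rule path_map_measurable[OF t0(1) X_meas X_path_cont[OF _ t0(2)]]) (use t0 in auto)
  qed
  have law_T: "distr M borel (Z T) = distr M borel (X T)"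
    by (rule distr_cong_AE[OF refl refl _ Z(1)[OF TT] X_meas[OF TT]]) (use Z(3) TT in \<open>auto elim!: AE_mp\<close>)
  have D: "(\<integral>\<^sup>+w. ennreal (integral {0..t0} (\<lambda>s. (norm (rdrift (T - s) (X (T - s) w) - b s (X (T - s) w)))\<^sup>2)) \<partial>M) = ?D"
  proof (rule L2sq_eq_iterated[OF sm])
    show "AE w in M. continuous_on {0..t0} (\<lambda>s. rdrift (T - s) (X (T - s) w) - b s (X (T - s) w)) \<and>
      (\<forall>t\<in>{0..t0}. norm (score M e lam \<alpha> T m Z t (Z (T - t) w) - f t (Z (T - t) w)) = norm (rdrift (T - t) (X (T - t) w) - b t (X (T - t) w)))"
    proof (rule AE_mp[OF Z(3)], intro AE_I2 impI conjI ballI)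
      fix w assume w: "w \<in> space M" and eq: "\<forall>t\<in>{0..T}. Z t w = X t w"
      show "continuous_on {0..t0} (\<lambda>s. rdrift (T - s) (X (T - s) w) - b s (X (T - s) w))"
        by (intro continuous_intros rdrift_path_cont[OF w t0(2)] continuous_on_along_path[OF b] X_path_cont[OF w t0(2)])
      fix t assume t: "t \<in> {0..t0}"
      have Tt: "T - t \<in> {0..T}" using t t0 by auto
      have "rdrift (T - t) (X (T - t) w) = (\<alpha> (T - t) / 2) *\<^sub>R X (T - t) w + score M e lam \<alpha> T m Z t (X (T - t) w)"
      proof (rule rdrift_eq_score)
        show "AE w in M. Z (T - t) w = X (T - t) w" using Z(3) by (rule AE_mp) (use Tt in auto)
      qed (use t t0 Z(1)[OF Tt] X_Hn in auto)
      then show "norm (score M e lam \<alpha> T m Z t (Z (T - t) w) - f t (Z (T - t) w)) = norm (rdrift (T - t) (X (T - t) w) - b t (X (T - t) w))"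
        using eq Tt by (simp add: b_eq)
    qed
  qed
  have I: "?I = (INF \<gamma>\<in>couplings euclidean_metric (distr M borel (X T)) (distr N borel (Y 0)). \<integral>\<^sup>+(x, y). ennreal ((norm (x - y))\<^sup>2) \<partial>\<gamma>)"
    unfolding W2_square law_T gaussian_eqI[OF Y0] by (simp add: dist_norm)
  have c: "0 < ?c" by simp
  have bound: "?W \<le> ennreal ?c * (ennreal \<eta> + 2 * (\<integral>\<^sup>+(x, y). ennreal ((norm (x - y))\<^sup>2) \<partial>\<gamma>) + ennreal t0 * ?D)"
    if \<eta>: "0 < \<eta>" and \<gamma>: "\<gamma> \<in> couplings euclidean_metric (distr M borel (X T)) (distr N borel (Y 0))" for \<eta> \<gamma>
  proof -
    have g: "sets \<gamma> = sets (borel \<Otimes>\<^sub>M borel)" "distr \<gamma> borel fst = distr M borel (X T)" "distr \<gamma> borel snd = distr N borel (Y 0)"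
      using \<gamma> unfolding couplings_def borel_of_metric_euclidean by auto
    show ?thesis unfolding W2_square law_path D[symmetric]
      by (rule reverse_coupling_bound[OF t0 b L N V ind Y g \<eta>])
  qed
  show ?thesis
  proof (rule ennreal_le_epsilon)
    fix \<epsilon> :: real assume fin: "ennreal ?c * (2 * ?I + ennreal t0 * ?D) < \<top>" and \<epsilon>: "0 < \<epsilon>"
    \<comment> \<open>The resampling contributes \<eta> and the choice of \<gamma> contributes twice
      \<eta>, all multiplied by \<open>?c\<close>.\<close>
    define \<eta> where "\<eta> = \<epsilon> / (3 * ?c)"
    have \<eta>: "0 < \<eta>" using \<epsilon> c by (simp add: \<eta>_def)
    \<comment> \<open>An infinite infimum would make the bound trivial; finiteness makes
      \<open>?I + \<eta>\<close> strictly larger than \<open>?I\<close>.\<close>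
    have "?I \<noteq> \<top>" using fin c by (auto simp: ennreal_mult_eq_top_iff ennreal_mult_top less_top[symmetric] top_unique)
    then have "?I < ?I + ennreal \<eta>" using \<eta> by (simp add: ennreal_less_iff less_top ennreal_add_less_top)
    then obtain \<gamma> where \<gamma>: "\<gamma> \<in> couplings euclidean_metric (distr M borel (X T)) (distr N borel (Y 0))"
      and less: "(\<integral>\<^sup>+(x, y). ennreal ((norm (x - y))\<^sup>2) \<partial>\<gamma>) < ?I + ennreal \<eta>"
      unfolding I by (auto simp: INF_less_iff)
    note bound[OF \<eta> \<gamma>]
    also have "ennreal ?c * (ennreal \<eta> + 2 * (\<integral>\<^sup>+(x, y). ennreal ((norm (x - y))\<^sup>2) \<partial>\<gamma>) + ennreal t0 * ?D)
       \<le> ennreal ?c * (ennreal \<eta> + 2 * (?I + ennreal \<eta>) + ennreal t0 * ?D)"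
      using less by (intro mult_left_mono add_mono order_refl) auto
    also have "\<dots> = ennreal ?c * (2 * ?I + ennreal t0 * ?D) + ennreal ?c * (ennreal \<eta> + 2 * ennreal \<eta>)"
      by (simp add: algebra_simps)
    also have "ennreal ?c * (ennreal \<eta> + 2 * ennreal \<eta>) = ennreal (?c * (3 * \<eta>))"
    proof -
      have "ennreal \<eta> + 2 * ennreal \<eta> = ennreal (2 * \<eta> + \<eta>)" using \<eta> by (subst ennreal_plus) (auto simp: ennreal_mult'' add.commute)
      also have "2 * \<eta> + \<eta> = 3 * \<eta>" by simp
      finally show ?thesis by (simp only:) (rule ennreal_mult[symmetric], use \<eta> in auto)
    qed
    also have "?c * (3 * \<eta>) = \<epsilon>" using c unfolding \<eta>_def by (simp add: field_simps)
    finally show "?W \<le> ennreal ?c * (2 * ?I + ennreal t0 * ?D) + ennreal \<epsilon>" .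
  qed
qed

section \<open>Projections onto spans of eigenvectors and the forward equation\<close>

lemma Pn_self_adjoint: "Pn e n x \<bullet> y = x \<bullet> Pn e n y"
  by (simp add: Pn_def inner_sum_left inner_sum_right inner_commute mult.commute)

lemma Pn_measurable: "Pn e n \<in> borel_measurable (borel :: 'h::{real_inner,second_countable_topology} measure)"
  by (intro borel_measurable_continuous_onI linear_continuous_on bounded_linear_Pn)

lemma Pn_in_Hn: "Pn e n x \<in> Hn e n"
  unfolding Pn_def Hn_def by (intro span_sum span_scale span_base) auto

context
  fixes e :: "nat \<Rightarrow> 'h::real_inner"
  assumes orth: "\<And>i j. e i \<bullet> e j = (if i = j then 1 else 0)"
begin

lemma Pn_coord: "k < n \<Longrightarrow> Pn e n x \<bullet> e k = x \<bullet> e k"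
  by (simp add: Pn_def inner_sum_left orth if_distrib cong: if_cong)

lemma Pn_Pn: "n \<le> m \<Longrightarrow> Pn e n (Pn e m x) = Pn e n x"
  unfolding Pn_def[of e n] by (intro sum.cong refl) (simp add: Pn_coord)

lemma norm_Pn_le: "norm (Pn e n x) \<le> norm x"
proof -
  have "(norm (Pn e n x))\<^sup>2 = Pn e n x \<bullet> x"
    using Pn_self_adjoint[of e n "Pn e n x" x] by (simp add: Pn_Pn power2_norm_eq_inner)
  also have "\<dots> \<le> norm (Pn e n x) * norm x" by (rule norm_cauchy_schwarz)
  finally show ?thesis by (cases "norm (Pn e n x) = 0") (auto simp: power2_eq_square)
qed

text \<open>\<open>Qn\<close> is the compression of \<open>Q\<close> to a span of eigenvectors, so
  it is the covariance of the projected noise.\<close>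

lemma Qn_compression:
  assumes Q: "linear Q" "\<And>k. Q (e k) = lam k *\<^sub>R e k"
  shows "Pn e n x \<bullet> Q (Pn e n y) = x \<bullet> Qn e lam n y"
proof -
  have "Q (Pn e n y) = (\<Sum>k<n. (y \<bullet> e k * lam k) *\<^sub>R e k)"
    unfolding Pn_def by (simp add: linear_sum[OF Q(1)] linear_scale[OF Q(1)] Q(2))
  then show ?thesis unfolding Qn_inner by (simp add: inner_sum_right Pn_coord mult_ac)
qed

end

lemma eigenvalue_pos:
  assumes "trace_class_operator Q" "inj Q" "e k \<bullet> e k = 1" "Q (e k) = lam k *\<^sub>R e k"
  shows "0 < lam k"
proof -
  interpret Q: bounded_linear Q using assms(1) by (simp add: trace_class_operator_def)
  have "0 \<le> lam k" using assms(1,3,4) unfolding trace_class_operator_def by (metis inner_scaleR_right mult.right_neutral)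
  moreover have "lam k \<noteq> 0" using assms(2-4) Q.zero by (metis injD inner_zero_left scaleR_zero_left zero_neq_one)
  ultimately show ?thesis by simp
qed

lemma WQn_eq: "(\<And>k. 0 < lam k) \<Longrightarrow> WQn e lam W n t w = Pn e n (W t w)"
  by (simp add: WQn_def KL_beta_def Pn_def less_imp_neq[symmetric])

context noise_schedule
begin

text \<open>Self-adjointness moves the projection from the noise integral to the test vectors, so
  the covariance formula of the full noise, tested with projected vectors, yields
  \<open>Qn\<close>.\<close>

lemma forward_ou_process:
  fixes W :: "real \<Rightarrow> 'w \<Rightarrow> 'h::{real_inner,banach,second_countable_topology}"
  assumes M: "prob_space M" and Q: "trace_class_operator Q" "inj Q"
    and e: "orthonormal_basis e" "\<And>k. Q (e k) = lam k *\<^sub>R e k"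
    and W: "wiener_process M Q T W" and X0[measurable]: "X0 \<in> borel_measurable M" and X0_sq: "integrable M (\<lambda>w. (norm (X0 w))\<^sup>2)"
    and ind: "independent_of_process M T X0 W"
  shows "ou_process M T \<alpha> \<alpha>' e lam m (\<lambda>w. Pn e m (X0 w)) (\<lambda>t w. Pn e m (pathwise_integral \<psi> \<psi>' (\<lambda>t. W t w) t))"
proof -
  interpret prob_space M by fact
  have orth: "\<And>i j. e i \<bullet> e j = (if i = j then 1 else 0)" using e(1) by (simp add: orthonormal_basis_def)
  have Wc: "\<And>w. w \<in> space M \<Longrightarrow> continuous_on {0..T} (\<lambda>t. W t w)" and Wm: "\<And>t. t \<in> {0..T} \<Longrightarrow> W t \<in> borel_measurable M"
    using W unfolding wiener_process_def by auto
  have Pm[measurable]: "Pn e m \<in> borel_measurable borel" by (rule Pn_measurable)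
  have linQ: "linear Q" and psd: "\<And>x. 0 \<le> x \<bullet> Q x" using Q(1) by (auto simp: trace_class_operator_def bounded_linear.linear)
  have Im: "(\<lambda>w. pathwise_integral \<psi> \<psi>' (\<lambda>t. W t w) t) \<in> borel_measurable M" if "t \<in> {0..T}" for t
    by (rule pathwise_integral_measurable[OF Wc Wm \<psi>'_cont \<psi>_deriv that])
  show ?thesis
  proof unfold_locales
    show "e i \<bullet> e j = (if i = j then 1 else 0)" for i j by (rule orth)
    show "0 < lam k" for k by (rule eigenvalue_pos[where e=e, OF Q _ e(2)]) (simp add: orth)
    show "(\<lambda>w. Pn e m (X0 w)) \<in> borel_measurable M" by measurable
    show "Pn e m (Pn e m (X0 w)) = Pn e m (X0 w)" for w by (simp add: Pn_Pn[OF orth])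
    show "integrable M (\<lambda>w. (norm (Pn e m (X0 w)))\<^sup>2)"
      by (rule Bochner_Integration.integrable_bound[OF X0_sq]) (measurable, auto intro!: power_mono norm_Pn_le[OF orth])
    show "(\<lambda>w. Pn e m (pathwise_integral \<psi> \<psi>' (\<lambda>t. W t w) t)) \<in> borel_measurable M" if "t \<in> {0..T}" for t
      by (rule measurable_compose[OF Im[OF that] Pm])
    show "continuous_on {0..T} (\<lambda>t. Pn e m (pathwise_integral \<psi> \<psi>' (\<lambda>t. W t w) t))" if "w \<in> space M" for w
      by (rule bounded_linear.continuous_on[OF bounded_linear_Pn pathwise_integral_continuous[OF Wc[OF that] \<psi>'_cont \<psi>_deriv]])
    show "Pn e m (Pn e m (pathwise_integral \<psi> \<psi>' (\<lambda>t. W t w) t)) = Pn e m (pathwise_integral \<psi> \<psi>' (\<lambda>t. W t w) t)" for t w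
      by (simp add: Pn_Pn[OF orth])
    fix g :: "'h \<Rightarrow> complex" and C and l :: nat and u and k :: "nat \<Rightarrow> 'h"
    assume g: "g \<in> borel_measurable borel" "\<And>x. cmod (g x) \<le> C" and u: "\<And>j. j < l \<Longrightarrow> u j \<in> {0..T}"
    have gP: "(\<lambda>x. g (Pn e m x)) \<in> borel_measurable borel" by (rule measurable_compose[OF Pm g(1)])
    have "(CLINT w|M. g (Pn e m (X0 w)) * iexp (\<Sum>j<l. pathwise_integral \<psi> \<psi>' (\<lambda>t. W t w) (u j) \<bullet> Pn e m (k j))) =
      (CLINT w|M. g (Pn e m (X0 w))) * complex_of_real (exp (- (\<Sum>i<l. \<Sum>j<l. (Pn e m (k i) \<bullet> Q (Pn e m (k j))) * integral {0..min (u i) (u j)} (\<lambda>s. (\<psi> s)\<^sup>2)) / 2))"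
      by (rule wiener_integral_char[OF W _ linQ psd \<psi>'_cont \<psi>_deriv ind gP g(2)]) (use T_pos u in auto)
    also have "(\<Sum>i<l. \<Sum>j<l. (Pn e m (k i) \<bullet> Q (Pn e m (k j))) * integral {0..min (u i) (u j)} (\<lambda>s. (\<psi> s)\<^sup>2)) =
        (\<Sum>i<l. \<Sum>j<l. (k i \<bullet> Qn e lam m (k j)) * noise_var (min (u i) (u j)))"
    proof (intro sum.cong refl)
      fix i j assume "i \<in> {..<l}" "j \<in> {..<l}"
      then have "min (u i) (u j) \<in> {0..T}" using u[of i] u[of j] by (auto simp: min_def)
      then show "(Pn e m (k i) \<bullet> Q (Pn e m (k j))) * integral {0..min (u i) (u j)} (\<lambda>s. (\<psi> s)\<^sup>2) = (k i \<bullet> Qn e lam m (k j)) * noise_var (min (u i) (u j))"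
        by (simp only: Qn_compression[OF orth linQ e(2)] integral_\<psi>_sq)
    qed
    finally show "(CLINT w|M. g (Pn e m (X0 w)) * iexp (\<Sum>j<l. Pn e m (pathwise_integral \<psi> \<psi>' (\<lambda>t. W t w) (u j)) \<bullet> k j)) =
      (CLINT w|M. g (Pn e m (X0 w))) * complex_of_real (exp (- (\<Sum>i<l. \<Sum>j<l. (k i \<bullet> Qn e lam m (k j)) * noise_var (min (u i) (u j))) / 2))"
      unfolding Pn_self_adjoint .
  qed
qed

text \<open>Projecting commutes with pathwise integration, so the same integral of the full path
  \<open>W\<close> appears at every level \<open>n\<close>: up to null sets all levels are
  projections of a single process.\<close>

lemma forward_solution_explicit:
  fixes W :: "real \<Rightarrow> 'w \<Rightarrow> 'h::{real_inner,banach,second_countable_topology}"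
  assumes M: "prob_space M" and lam: "\<And>k. 0 < lam k" and W: "wiener_process M Q T W"
    and sol: "sde_solution M T (\<lambda>t x. - (\<alpha> t / 2) *\<^sub>R x) (\<lambda>t. sqrt (\<alpha> t)) (WQn e lam W n) Z"
    and Z0: "AE w in M. Z 0 w = Pn e n (X0 w)"
  shows "AE w in M. \<forall>t\<in>{0..T}. Z t w = (1 / growth t) *\<^sub>R (Pn e n (X0 w) + Pn e n (pathwise_integral \<psi> \<psi>' (\<lambda>t. W t w) t))"
proof -
  interpret prob_space M by fact
  have Wc: "\<And>w. w \<in> space M \<Longrightarrow> continuous_on {0..T} (\<lambda>t. W t w)" and Wm: "\<And>t. t \<in> {0..T} \<Longrightarrow> W t \<in> borel_measurable M"
    and W0: "\<And>w. w \<in> space M \<Longrightarrow> W 0 w = 0"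
    using W unfolding wiener_process_def by auto
  have Zc: "continuous_on {0..T} (\<lambda>t. Z t w)" if "w \<in> space M" for w using sol that unfolding sde_solution_def by auto
  have PW: "WQn e lam W n t = (\<lambda>w. Pn e n (W t w))" for t by (rule ext) (rule WQn_eq[OF lam])
  have PWc: "continuous_on {0..T} (\<lambda>t. Pn e n (W t w))" if "w \<in> space M" for w
    by (rule bounded_linear.continuous_on[OF bounded_linear_Pn Wc[OF that]])
  have "AE w in M. \<forall>t\<in>{0..T}. Z t w = Z 0 w + integral {0..t} (\<lambda>s. - (\<alpha> s / 2) *\<^sub>R Z s w) + pathwise_integral (\<lambda>t. sqrt (\<alpha> t)) \<phi>' (\<lambda>t. WQn e lam W n t w) t"
  proof (rule sde_solution_pathwise[OF sol _ _ \<phi>'_cont sqrt_\<alpha>_deriv])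
    show "WQn e lam W n t \<in> borel_measurable M" if "t \<in> {0..T}" for t
      unfolding PW by (rule measurable_compose[OF Wm[OF that] Pn_measurable])
    show "continuous_on {0..T} (\<lambda>t. WQn e lam W n t w)" if "w \<in> space M" for w unfolding PW by (rule PWc[OF that])
    show "continuous_on {0..T} (\<lambda>s. - (\<alpha> s / 2) *\<^sub>R Z s w)" if "w \<in> space M" for w
      by (rule continuous_on_scaleR[OF _ Zc[OF that]]) (rule continuous_on_minus, rule continuous_on_divide[OF \<alpha>_cont], auto)
  qed
  from this Z0 show ?thesis
  proof (rule AE_mp[OF AE_conjI], intro AE_I2 impI ballI, elim conjE)
    fix w t assume w: "w \<in> space M" and t: "t \<in> {0..T}"
      and eq: "\<forall>t\<in>{0..T}. Z t w = Z 0 w + integral {0..t} (\<lambda>s. - (\<alpha> s / 2) *\<^sub>R Z s w) + pathwise_integral (\<lambda>t. sqrt (\<alpha> t)) \<phi>' (\<lambda>t. WQn e lam W n t w) t"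
      and Z0: "Z 0 w = Pn e n (X0 w)"
    have "Pn e n (W 0 w) = 0" by (simp add: W0[OF w] Pn_def)
    then have "Z t w = (1 / growth t) *\<^sub>R (Z 0 w + pathwise_integral \<psi> \<psi>' (\<lambda>t. Pn e n (W t w)) t)"
      by (rule ou_explicit[OF Zc[OF w] PWc[OF w] _ eq[unfolded PW, rule_format] t])
    then show "Z t w = (1 / growth t) *\<^sub>R (Pn e n (X0 w) + Pn e n (pathwise_integral \<psi> \<psi>' (\<lambda>t. W t w) t))"
      unfolding Z0 pathwise_integral_bounded_linear[OF bounded_linear_Pn Wc[OF w] \<psi>'_cont t] .
  qed
qed

end

section \<open>Almost sure identities and the regularity of the score\<close>

lemma AE_time_prod_fst:
  assumes "AE w in M. R w"
  shows "AE p in time_prod M t0. R (fst p)"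
proof -
  interpret I: sigma_finite_measure "restrict_space lborel {0..t0}" by (rule sigma_finite_interval)
  obtain A where A: "{w \<in> space M. \<not> R w} \<subseteq> A" "emeasure M A = 0" "A \<in> sets M" using assms by (rule AE_E)
  let ?B = "A \<times> space (restrict_space lborel {0..t0})"
  show ?thesis
  proof (rule AE_I[of _ _ ?B])
    show "emeasure (time_prod M t0) ?B = 0" unfolding time_prod_def
      by (subst I.emeasure_pair_measure_Times[OF A(3) sets.top]) (simp add: A)
    show "?B \<in> sets (time_prod M t0)" unfolding time_prod_def using A(3) sets.top by (rule pair_measureI)
  qed (use A(1) in \<open>auto simp: time_prod_def space_pair_measure\<close>)
qed

lemma L2sq_cong_AE:
  assumes "AE w in M. \<forall>t\<in>{0..t0}. G t w = H t w"
  shows "L2sq M t0 G = L2sq M t0 H"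
  unfolding L2sq_def case_prod_beta'
proof (rule nn_integral_cong_AE, rule AE_mp[OF AE_time_prod_fst[OF assms]], intro AE_I2 impI)
  fix p assume "p \<in> space (time_prod M t0)" "\<forall>t\<in>{0..t0}. G t (fst p) = H t (fst p)"
  then show "ennreal ((norm (G (snd p) (fst p)))\<^sup>2) = ennreal ((norm (H (snd p) (fst p)))\<^sup>2)"
    by (simp add: time_prod_def space_pair_measure space_restrict_space mem_Times_iff)
qed

text \<open>The infimum is attained: each difference quotient is a lower bound of the set of
  constants, which is nonempty for an admissible score.\<close>

lemma lipschitz_constant_lipschitz:
  assumes g: "admissible_score e t0 n g" and s: "s \<in> {0..t0}" and t: "t \<in> {0..s}"
  shows "(lipschitz_constant e n g s)-lipschitz_on (Hn e n) (g t)"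
proof -
  let ?S = "{C. \<forall>t\<in>{0..s}. C-lipschitz_on (Hn e n) (g t)}"
  have ne: "?S \<noteq> {}" using g s unfolding admissible_score_def by blast
  show ?thesis
  proof (rule lipschitz_onI)
    show "0 \<le> lipschitz_constant e n g s" unfolding lipschitz_constant_def
      using t by (intro cInf_greatest[OF ne]) (auto dest: lipschitz_on_nonneg)
    fix x y assume xy: "x \<in> Hn e n" "y \<in> Hn e n"
    show "dist (g t x) (g t y) \<le> lipschitz_constant e n g s * dist x y"
    proof (cases "dist x y = 0")
      case False
      then have pos: "0 < dist x y" by simp
      have "dist (g t x) (g t y) / dist x y \<le> Inf ?S"
      proof (rule cInf_greatest[OF ne])
        fix C assume "C \<in> ?S"
        then have "C-lipschitz_on (Hn e n) (g t)" using t by blast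
        from lipschitz_onD[OF this xy] show "dist (g t x) (g t y) / dist x y \<le> C" using pos by (simp add: divide_le_eq)
      qed
      then show ?thesis using pos by (simp add: lipschitz_constant_def divide_le_eq)
    qed simp
  qed
qed

lemma lipschitz_constant_mono:
  assumes g: "admissible_score e t0 n g" and s: "s \<in> {0..t0}"
  shows "lipschitz_constant e n g s \<le> lipschitz_constant e n g t0"
  unfolding lipschitz_constant_def
proof (rule cInf_superset_mono)
  show "{C. \<forall>t\<in>{0..t0}. C-lipschitz_on (Hn e n) (g t)} \<noteq> {}"
  proof -
    have "t0 \<in> {0..t0}" using s by simp
    then show ?thesis using g unfolding admissible_score_def by blast
  qed
  show "bdd_below {C. \<forall>t\<in>{0..s}. C-lipschitz_on (Hn e n) (g t)}"
    using s by (intro bdd_belowI[of _ 0]) (auto dest!: bspec[of _ _ s] dest: lipschitz_on_nonneg)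
qed (use s in auto)

text \<open>With \<open>y = t \<surd>(2 \<xi>)\<close> the inequality of the exponents is \<open>2 y \<le> 1 + 3 y\<^sup>2 / 2\<close>.\<close>

lemma exp_rate_bound:
  assumes "0 \<le> \<xi>"
  shows "exp (2 * sqrt (2 * \<xi>) * t) \<le> 3 * exp (3 * \<xi> * t\<^sup>2)"
proof -
  let ?y = "sqrt (2 * \<xi>) * t"
  have sq: "?y\<^sup>2 = 2 * \<xi> * t\<^sup>2" using assms by (simp add: power_mult_distrib)
  have "0 \<le> (3 * ?y - 2)\<^sup>2" by simp
  then have "2 * ?y \<le> 1 + 3 / 2 * ?y\<^sup>2" by (simp add: power2_diff power_mult_distrib algebra_simps)
  then have "2 * sqrt (2 * \<xi>) * t \<le> 1 + 3 * \<xi> * t\<^sup>2" unfolding sq by (simp add: mult.assoc)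
  then have "exp (2 * sqrt (2 * \<xi>) * t) \<le> exp 1 * exp (3 * \<xi> * t\<^sup>2)" by (simp flip: exp_add)
  also have "\<dots> \<le> 3 * exp (3 * \<xi> * t\<^sup>2)" using exp_le by (intro mult_right_mono) auto
  finally show ?thesis .
qed

text \<open>An admissible score factors through the projection \<open>Pn\<close>, so its continuity
  on \<open>Hn\<close> extends to the whole space.\<close>

lemma admissible_score_continuous:
  assumes g: "admissible_score e t0 n g" and t0: "0 \<le> t0"
  shows "continuous_on ({0..t0} \<times> UNIV) (\<lambda>(t, x). g t x)"
proof -
  have c: "continuous_on ({0..t0} \<times> Hn e n) (\<lambda>(t, x). g t x)" using g t0 unfolding admissible_score_def by simp
  have "continuous_on ({0..t0} \<times> UNIV) (\<lambda>p. Pn e n (snd p))"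
    using linear_continuous_on[OF bounded_linear_Pn] by (rule continuous_on_compose2) (auto intro: continuous_on_snd continuous_on_id)
  then have "continuous_on ({0..t0} \<times> UNIV) (\<lambda>p. (fst p, Pn e n (snd p)))"
    by (rule continuous_on_Pair[rotated]) (rule continuous_on_fst[OF continuous_on_id])
  then have "continuous_on ({0..t0} \<times> UNIV) (\<lambda>p. (\<lambda>(t, x). g t x) (fst p, Pn e n (snd p)))"
    by (rule continuous_on_compose2[OF c]) (auto simp: Pn_in_Hn)
  moreover have "(\<lambda>(t, x). g t x) (fst p, Pn e n (snd p)) = (\<lambda>(t, x). g t x) p" if "p \<in> {0..t0} \<times> UNIV" for p
  proof -
    have "fst p \<in> {0..t0}" using that by auto
    then have "g (fst p) (snd p) = g (fst p) (Pn e n (snd p))" using g unfolding admissible_score_def by blast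
    then show ?thesis by (simp add: case_prod_beta)
  qed
  ultimately show ?thesis by (rule continuous_on_eq)
qed

lemma admissible_score_lipschitz:
  assumes orth: "\<And>i j. e i \<bullet> e j = (if i = j then 1 else 0)" and g: "admissible_score e t0 n g" and t: "t \<in> {0..t0}"
  shows "(lipschitz_constant e n g t)-lipschitz_on UNIV (g t)"
proof (rule lipschitz_onI)
  have L: "(lipschitz_constant e n g t)-lipschitz_on (Hn e n) (g t)"
    by (rule lipschitz_constant_lipschitz[OF g t]) (use t in auto)
  then show nn: "0 \<le> lipschitz_constant e n g t" by (rule lipschitz_on_nonneg)
  fix x y
  have "g t x = g t (Pn e n x)" "g t y = g t (Pn e n y)" using g t unfolding admissible_score_def by blast+
  then have "dist (g t x) (g t y) \<le> lipschitz_constant e n g t * dist (Pn e n x) (Pn e n y)"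
    using lipschitz_onD[OF L Pn_in_Hn Pn_in_Hn, of x y] by simp
  also have "dist (Pn e n x) (Pn e n y) \<le> dist x y"
    using norm_Pn_le[OF orth, of n "x - y"] linear_diff[OF bounded_linear.linear[OF bounded_linear_Pn[of e n]], of x y] by (simp add: dist_norm)
  finally show "dist (g t x) (g t y) \<le> lipschitz_constant e n g t * dist x y" using nn by (simp add: mult_left_mono)
qed

context noise_schedule
begin

text \<open>A real supremum is an upper bound only of a set that is bounded above. Here \<alpha> is
  bounded on a compact interval, and the Lipschitz constants on shorter intervals are dominated by
  the one on \<open>[0, t0]\<close>.\<close>

lemma reverse_rate_bounded:
  assumes t0: "0 \<le> t0" "t0 < T" and g: "admissible_score e t0 n g"
  obtains A where "0 \<le> A" "\<And>s. s \<in> {0..t0} \<Longrightarrow> \<alpha> (T - s) \<le> A"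
    "bdd_above ((\<lambda>s. (\<alpha> (T - s))\<^sup>2 / 4 + (lipschitz_constant e n g s)\<^sup>2) ` {0..t0})"
proof -
  have "bounded (\<alpha> ` {0..T})" by (rule compact_imp_bounded[OF compact_continuous_image[OF \<alpha>_cont]]) simp
  then obtain A where A: "\<forall>s\<in>{0..T}. \<bar>\<alpha> s\<bar> \<le> A" unfolding bounded_iff by auto
  have A0: "0 \<le> A" using bspec[OF A, of T] T_pos by force
  have le: "0 < \<alpha> (T - s)" "\<alpha> (T - s) \<le> A" if "s \<in> {0..t0}" for s using that t0 bspec[OF A, of "T - s"] \<alpha>_pos[of "T - s"] by auto
  have "bdd_above ((\<lambda>s. (\<alpha> (T - s))\<^sup>2 / 4 + (lipschitz_constant e n g s)\<^sup>2) ` {0..t0})"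
  proof (rule bdd_aboveI2)
    fix s assume s: "s \<in> {0..t0}"
    have "0 \<le> lipschitz_constant e n g s" using lipschitz_on_nonneg[OF lipschitz_constant_lipschitz[OF g s, of s]] s by simp
    then have "(lipschitz_constant e n g s)\<^sup>2 \<le> (lipschitz_constant e n g t0)\<^sup>2" by (intro power_mono lipschitz_constant_mono[OF g s])
    moreover have "(\<alpha> (T - s))\<^sup>2 \<le> A\<^sup>2" using le[OF s] by (intro power_mono) auto
    ultimately show "(\<alpha> (T - s))\<^sup>2 / 4 + (lipschitz_constant e n g s)\<^sup>2 \<le> A\<^sup>2 / 4 + (lipschitz_constant e n g t0)\<^sup>2" by simp
  qed
  then show thesis using that A0 le by blast
qed

lemma reverse_rate_le:
  assumes t0: "0 \<le> t0" "t0 < T" and g: "admissible_score e t0 n g" and s: "s \<in> {0..t0}"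
  shows "(\<alpha> (T - s))\<^sup>2 / 4 + (lipschitz_constant e n g s)\<^sup>2 \<le> (SUP s\<in>{0..t0}. (\<alpha> (T - s))\<^sup>2 / 4 + (lipschitz_constant e n g s)\<^sup>2)"
  by (rule reverse_rate_bounded[OF t0 g]) (rule cSUP_upper[OF s])

lemma reverse_drift_continuous:
  assumes t0: "0 \<le> t0" "t0 < T" and g: "admissible_score e t0 n g" and orth: "\<And>i j. e i \<bullet> e j = (if i = j then 1 else 0)"
  shows "continuous_on ({0..t0} \<times> UNIV) (\<lambda>(t, x). (\<alpha> (T - t) / 2) *\<^sub>R x + g t x)"
proof -
  have "continuous_on ({0..t0} \<times> UNIV) (\<lambda>p. \<alpha> (T - fst p))"
    by (rule continuous_on_compose2[OF \<alpha>_cont]) (use t0 in \<open>auto intro!: continuous_intros\<close>)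
  then have "continuous_on ({0..t0} \<times> UNIV) (\<lambda>p. (\<alpha> (T - fst p) / 2) *\<^sub>R snd p + (\<lambda>(t, x). g t x) p)"
    by (intro continuous_on_add continuous_on_scaleR continuous_on_divide continuous_on_const continuous_on_snd continuous_on_id admissible_score_continuous[OF g t0(1)]) auto
  then show ?thesis by (simp add: case_prod_beta')
qed

text \<open>By the inequality of \<open>(a + b)^2\<close> and \<open>2 * (a^2 + b^2)\<close> with
  \<open>a = \<alpha> / 2\<close> and \<open>b\<close> the Lipschitz constant of the score; this is
  the origin of \<open>sqrt (2 * \<xi>)\<close> in Gronwall's exponent.\<close>

lemma reverse_drift_lipschitz:
  fixes e :: "nat \<Rightarrow> 'h::real_inner"
  assumes t0: "0 \<le> t0" "t0 < T" and g: "admissible_score e t0 n g" and orth: "\<And>i j. e i \<bullet> e j = (if i = j then 1 else 0)"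
    and t: "t \<in> {0..t0}" and \<xi>: "(\<alpha> (T - t))\<^sup>2 / 4 + (lipschitz_constant e n g t)\<^sup>2 \<le> \<xi>"
  shows "(sqrt (2 * \<xi>))-lipschitz_on UNIV (\<lambda>x. (\<alpha> (T - t) / 2) *\<^sub>R x + g t x)"
proof (rule lipschitz_on_le)
  have \<alpha>: "0 < \<alpha> (T - t)" using t t0 \<alpha>_pos[of "T - t"] by auto
  have g': "(lipschitz_constant e n g t)-lipschitz_on UNIV (g t)" by (rule admissible_score_lipschitz[OF orth g t])
  have "(\<alpha> (T - t) / 2)-lipschitz_on UNIV (\<lambda>x :: 'h. (\<alpha> (T - t) / 2) *\<^sub>R x)"
  proof (rule lipschitz_onI)
    fix x y :: 'h
    have "dist ((\<alpha> (T - t) / 2) *\<^sub>R x) ((\<alpha> (T - t) / 2) *\<^sub>R y) = \<bar>\<alpha> (T - t) / 2\<bar> * dist x y"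
      by (simp only: dist_norm scaleR_diff_right[symmetric] norm_scaleR)
    then show "dist ((\<alpha> (T - t) / 2) *\<^sub>R x) ((\<alpha> (T - t) / 2) *\<^sub>R y) \<le> \<alpha> (T - t) / 2 * dist x y" using \<alpha> by simp
  qed (use \<alpha> in simp)
  then show "(\<alpha> (T - t) / 2 + lipschitz_constant e n g t)-lipschitz_on UNIV (\<lambda>x. (\<alpha> (T - t) / 2) *\<^sub>R x + g t x)"
    using g' by (rule lipschitz_on_add)
  have "(\<alpha> (T - t) / 2 + lipschitz_constant e n g t)\<^sup>2 \<le> 2 * ((\<alpha> (T - t))\<^sup>2 / 4 + (lipschitz_constant e n g t)\<^sup>2)"
    using sum_squares_bound[of "\<alpha> (T - t) / 2" "lipschitz_constant e n g t"] by (simp add: power2_eq_square algebra_simps)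
  also have "\<dots> \<le> 2 * \<xi>" using \<xi> by simp
  finally show "\<alpha> (T - t) / 2 + lipschitz_constant e n g t \<le> sqrt (2 * \<xi>)" by (rule real_le_rsqrt)
qed

end

text \<open>\<open>2 * E\<close> is the squared Gronwall factor including its 2, at most
  \<open>6 * c3\<close>. Resampling doubles the initial term, and \<open>8 * ep + 2 * et\<close> is
  at most twice \<open>4 * ep + 2 * et\<close>; so both terms get the factor 12, the score term with
  the larger exponential \<open>c4\<close>.\<close>

lemma combine_error_terms:
  fixes I D ep et :: ennreal and E c3 c4 t0 :: real
  assumes "0 \<le> E" "E \<le> 3 * c3" "c3 \<le> c4" "0 \<le> t0" and D: "D \<le> 8 * ep + 2 * et"
  shows "ennreal (2 * E) * (2 * I + ennreal t0 * D) \<le> 12 * (4 * ep + 2 * et) * ennreal t0 * ennreal c4 + 12 * ennreal c3 * I"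
proof -
  have c: "0 \<le> c3" "0 \<le> c4" using assms by auto
  have six: "ennreal (6 * c) = 6 * ennreal c" if "0 \<le> c" for c using that by (simp add: ennreal_mult)
  have "8 * ep + 2 * et \<le> 8 * ep + 4 * et" by (intro add_left_mono mult_right_mono) auto
  also have "\<dots> = 2 * (4 * ep + 2 * et)" by (simp add: distrib_left mult.assoc[symmetric])
  finally have D': "D \<le> 2 * (4 * ep + 2 * et)" using D by (rule order_trans[rotated])
  have "ennreal (2 * E) * (2 * I + ennreal t0 * D) = ennreal (2 * E) * (2 * I) + ennreal (2 * E) * (ennreal t0 * D)"
    by (rule distrib_left)
  also have "\<dots> \<le> ennreal (6 * c3) * (2 * I) + ennreal (6 * c4) * (ennreal t0 * (2 * (4 * ep + 2 * et)))"
  proof (rule add_mono)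
    have E: "2 * E \<le> 6 * c3" "2 * E \<le> 6 * c4" using assms by auto
    show "ennreal (2 * E) * (2 * I) \<le> ennreal (6 * c3) * (2 * I)" by (rule mult_right_mono[OF ennreal_leI[OF E(1)]]) simp
    show "ennreal (2 * E) * (ennreal t0 * D) \<le> ennreal (6 * c4) * (ennreal t0 * (2 * (4 * ep + 2 * et)))"
      by (rule mult_mono[OF ennreal_leI[OF E(2)] mult_left_mono[OF D']]) auto
  qed
  also have "ennreal (6 * c3) * (2 * I) = 12 * ennreal c3 * I" unfolding six[OF c(1)]
    by (simp add: mult_ac)
  also have "ennreal (6 * c4) * (ennreal t0 * (2 * (4 * ep + 2 * et))) = 12 * (4 * ep + 2 * et) * ennreal t0 * ennreal c4"
  proof -
    have "ennreal (6 * c4) * (ennreal t0 * (2 * (4 * ep + 2 * et))) = (6 * 2) * ((4 * ep + 2 * et) * ennreal t0 * ennreal c4)"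
      unfolding six[OF c(2)] by (simp only: mult_ac)
    moreover have "(6 :: ennreal) * 2 = 12" by simp
    ultimately show ?thesis by (simp only: mult.assoc)
  qed
  finally show ?thesis by (simp only: add.commute)
qed

text \<open>All levels share one noise and the level-n score sees only the first \<open>n\<close>
  coordinates; therefore its error along the process of level \<open>m\<close> reduces to the
  training loss at level \<open>n\<close> and the distance of the two score processes. With bounded
  Lipschitz constants \<open>err\<close> and the exponential factor of \<open>init_err\<close> are
  under control. The distance of the law of \<open>X m T\<close> from the Gaussian is governed by
  the horizon \<open>T\<close>, not by the training, so its vanishing is a separate premise of the
  last limit.\<close>

theorem theorem3p8:
  fixes M :: "'w measure"
    and Q :: "'h::{real_inner,banach,second_countable_topology} \<Rightarrow> 'h"
    and e :: "nat \<Rightarrow> 'h" and lam :: "nat \<Rightarrow> real"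
    and \<alpha> :: "real \<Rightarrow> real" and T t0 :: real
    and X0 :: "'w \<Rightarrow> 'h" and W :: "real \<Rightarrow> 'w \<Rightarrow> 'h"
    and X :: "nat \<Rightarrow> real \<Rightarrow> 'w \<Rightarrow> 'h"
    and Fn :: "nat \<Rightarrow> real \<Rightarrow> 'w \<Rightarrow> 'h" and F :: "real \<Rightarrow> 'w \<Rightarrow> 'h"
    and ft :: "nat \<Rightarrow> real \<Rightarrow> 'h \<Rightarrow> 'h"
    and L :: "nat \<Rightarrow> real \<Rightarrow> real" and \<xi> :: "nat \<Rightarrow> real"
    and eps_path eps_train :: "nat \<Rightarrow> ennreal"
    and err :: "nat \<Rightarrow> ennreal" and init_err :: "nat \<Rightarrow> nat \<Rightarrow> ennreal"
  assumes "0 < T" and "C1_positive_on T \<alpha>"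
    and "prob_space M"
    and "trace_class_operator Q" and "inj Q"
    and "orthonormal_basis e" and "\<And>k. Q (e k) = lam k *\<^sub>R e k"
    and "wiener_process M Q T W"
    and "X0 \<in> borel_measurable M" and "integrable M (\<lambda>\<omega>. (norm (X0 \<omega>))\<^sup>2)"
    and "independent_of_process M T X0 W"
    and "\<And>n. 1 \<le> n \<Longrightarrow>
           sde_solution M T (\<lambda>t x. - (\<alpha> t / 2) *\<^sub>R x) (\<lambda>t. sqrt (\<alpha> t)) (WQn e lam W n) (X n)"
    and "\<And>n. 1 \<le> n \<Longrightarrow> AE \<omega> in M. X n 0 \<omega> = (\<Sum>k<n. (X0 \<omega> \<bullet> e k) *\<^sub>R e k)"
    and "\<And>n. 1 \<le> n \<Longrightarrow> \<exists>p. distributed M (lebesgue_Rn n) (\<lambda>\<omega>. iota e n (X n 0 \<omega>)) p"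
    and "0 \<le> t0" and "t0 < T"
    and Fn_eq: "\<And>n t \<omega>. Fn n t \<omega> = score M e lam \<alpha> T n (X n) t (X n (T - t) \<omega>)"
    and "\<And>n. 1 \<le> n \<Longrightarrow> L2_process M t0 (Fn n)" and "L2_process M t0 F"
    and "(\<lambda>n. L2sq M t0 (\<lambda>t \<omega>. Fn n t \<omega> - F t \<omega>)) \<longlonglongrightarrow> 0"
    and eps_path_eq: "\<And>n. eps_path n = (SUP m\<in>{n..}. L2sq M t0 (\<lambda>t \<omega>. Fn m t \<omega> - F t \<omega>))"
    and eps_train_eq:
      "\<And>n. eps_train n = L2sq M t0 (\<lambda>t \<omega>. Fn n t \<omega> - ft n t (X n (T - t) \<omega>))"
    and L_eq: "\<And>n s. L n s = lipschitz_constant e n (ft n) s"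
    and xi_eq: "\<And>n. \<xi> n = (SUP s\<in>{0..t0}. (\<alpha> (T - s))\<^sup>2 / 4 + (L n s)\<^sup>2)"
    and err_eq: "\<And>n. err n =
      12 * (4 * eps_path n + 2 * eps_train n) * ennreal t0 * ennreal (exp (4 * \<xi> n * t0\<^sup>2))"
    and init_err_eq: "\<And>n m. init_err n m = 12 * ennreal (exp (3 * \<xi> n * t0\<^sup>2)) *
      (W2 euclidean_metric (distr M borel (X m T)) (gaussian (Qn e lam m)))\<^sup>2"
  shows
    "(\<forall>n\<ge>1. admissible_score e t0 n (ft n) \<longrightarrow>
        (\<forall>m\<ge>n. \<forall>(N :: 'v measure) (V :: real \<Rightarrow> 'v \<Rightarrow> 'h) (Y :: real \<Rightarrow> 'v \<Rightarrow> 'h).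
           prob_space N \<and>
           wiener_process N (Qn e lam m) t0 V \<and>
           independent_of_process N t0 (Y 0) V \<and>
           is_gaussian (Qn e lam m) (distr N borel (Y 0)) \<and>
           sde_solution N t0 (\<lambda>t y. (\<alpha> (T - t) / 2) *\<^sub>R y + ft n t y) (\<lambda>t. sqrt (\<alpha> (T - t))) V Y \<longrightarrow>
           (W2 (path_space t0) (path_law M t0 (\<lambda>t. X m (T - t))) (path_law N t0 Y))\<^sup>2
             \<le> err n + init_err n m))
     \<and>
     ((\<forall>n\<ge>1. admissible_score e t0 n (ft n)) \<and>
      (\<exists>C. \<forall>n\<ge>1. L n t0 \<le> C) \<and> eps_train \<longlonglongrightarrow> 0 \<longrightarrow>
        err \<longlonglongrightarrow> 0 \<and>
        ((\<lambda>m. (W2 euclidean_metric (distr M borel (X m T)) (gaussian (Qn e lam m)))\<^sup>2) \<longlonglongrightarrow> 0 \<longrightarrow>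
           (\<lambda>n. SUP m\<in>{n..}. err n + init_err n m) \<longlonglongrightarrow> 0))"
proof -
  note t0 = \<open>0 \<le> t0\<close> \<open>t0 < T\<close>
  obtain \<alpha>' where sched: "noise_schedule T \<alpha> \<alpha>'" using C1_positive_on_schedule[OF assms(1,2)] by blast
  interpret S: noise_schedule T \<alpha> \<alpha>' by (rule sched)
  interpret prob_space M by (rule assms(3))
  have orth: "\<And>i j. e i \<bullet> e j = (if i = j then 1 else 0)" using assms(6) by (simp add: orthonormal_basis_def)
  have lam: "0 < lam k" for k by (rule eigenvalue_pos[where e=e, OF assms(4,5) _ assms(7)]) (simp add: orth)
  let ?I = "\<lambda>t \<omega>. pathwise_integral S.\<psi> S.\<psi>' (\<lambda>t. W t \<omega>) t"
  have X_explicit: "AE \<omega> in M. \<forall>t\<in>{0..T}. X n t \<omega> = (1 / S.growth t) *\<^sub>R (Pn e n (X0 \<omega>) + Pn e n (?I t \<omega>))" if "1 \<le> n" for n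
    by (rule S.forward_solution_explicit[OF assms(3) lam assms(8) assms(12)[OF that]])
       (use assms(13)[OF that] in \<open>simp add: Pn_def\<close>)
  have Xm: "X n t \<in> borel_measurable M" if "1 \<le> n" "t \<in> {0..T}" for n t
    using assms(12)[OF that(1)] that(2) unfolding sde_solution_def by blast
  have Xc: "continuous_on {0..T} (\<lambda>t. X n t \<omega>)" if "1 \<le> n" "\<omega> \<in> space M" for n \<omega>
    using assms(12)[OF that(1)] that(2) unfolding sde_solution_def by blast
  \<comment> \<open>Projecting the explicit formula at level \<open>m\<close> gives the one at level
    \<open>n\<close>.\<close>
  have consistent: "AE \<omega> in M. \<forall>t\<in>{0..T}. Pn e n (X m t \<omega>) = X n t \<omega>" if nm: "1 \<le> n" "n \<le> m" for n m
  proof -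
    interpret P: bounded_linear "Pn e n" by (rule bounded_linear_Pn)
    have "AE \<omega> in M. (\<forall>t\<in>{0..T}. X n t \<omega> = (1 / S.growth t) *\<^sub>R (Pn e n (X0 \<omega>) + Pn e n (?I t \<omega>))) \<and>
        (\<forall>t\<in>{0..T}. X m t \<omega> = (1 / S.growth t) *\<^sub>R (Pn e m (X0 \<omega>) + Pn e m (?I t \<omega>)))"
      using X_explicit[of n] X_explicit[of m] nm by (intro AE_conjI) auto
    then show ?thesis
      by (rule AE_mp) (intro AE_I2 impI ballI, simp add: P.scaleR P.add Pn_Pn[OF orth nm(2)])
  qed
  have adm: "ft n t (Pn e n x) = ft n t x" if "admissible_score e t0 n (ft n)" "t \<in> {0..t0}" for n t x
    using that unfolding admissible_score_def by metis
  have \<xi>_ge: "(\<alpha> (T - s))\<^sup>2 / 4 + (lipschitz_constant e n (ft n) s)\<^sup>2 \<le> \<xi> n" if "admissible_score e t0 n (ft n)" "s \<in> {0..t0}" for n s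
    using S.reverse_rate_le[OF t0 that] by (simp add: xi_eq L_eq)
  have \<xi>_nonneg: "0 \<le> \<xi> n" if "admissible_score e t0 n (ft n)" for n
  proof -
    have "0 \<le> (\<alpha> (T - 0))\<^sup>2 / 4 + (lipschitz_constant e n (ft n) 0)\<^sup>2" by simp
    also have "\<dots> \<le> \<xi> n" by (rule \<xi>_ge[OF that]) (use t0 in simp)
    finally show ?thesis .
  qed
  have bound: "(W2 (path_space t0) (path_law M t0 (\<lambda>t. X m (T - t))) (path_law N t0 Y))\<^sup>2 \<le> err n + init_err n m"
    if n: "1 \<le> n" "n \<le> m" and g: "admissible_score e t0 n (ft n)" and N: "prob_space N" and V: "wiener_process N (Qn e lam m) t0 V"
      and ind: "independent_of_process N t0 (Y 0) V" and Y0: "is_gaussian (Qn e lam m) (distr N borel (Y 0))"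
      and Y: "sde_solution N t0 (\<lambda>t y. (\<alpha> (T - t) / 2) *\<^sub>R y + ft n t y) (\<lambda>t. sqrt (\<alpha> (T - t))) V Y"
    for n m and N :: "'v measure" and V Y
  proof -
    have m: "1 \<le> m" using n by simp
    interpret O: ou_process M T \<alpha> \<alpha>' e lam m "\<lambda>\<omega>. Pn e m (X0 \<omega>)" "\<lambda>t \<omega>. Pn e m (?I t \<omega>)"
      by (rule S.forward_ou_process[OF assms(3-11)])
    have Xm_eq: "AE \<omega> in M. \<forall>t\<in>{0..T}. X m t \<omega> = O.X t \<omega>" using X_explicit[OF m] unfolding O.X_def .
    define G where "G t \<omega> = ft n t (X m (T - t) \<omega>)" for t \<omega>
    have Xrc: "continuous_on {0..t0} (\<lambda>t. X m (T - t) \<omega>)" if "\<omega> \<in> space M" for \<omega>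
      by (rule continuous_on_compose2[OF Xc[OF m that]]) (use t0 in \<open>auto intro!: continuous_intros\<close>)
    have Gm: "(\<lambda>p. G (snd p) (fst p)) \<in> borel_measurable (time_prod M t0)"
    proof (rule continuous_process_jointly_measurable)
      fix t assume t: "t \<in> {0..t0}"
      have "ft n t \<in> borel_measurable borel"
        using lipschitz_on_continuous_on[OF admissible_score_lipschitz[OF orth g t]] by (rule borel_measurable_continuous_onI)
      from measurable_compose[OF Xm[OF m, of "T - t"] this] show "G t \<in> borel_measurable M" unfolding G_def[abs_def] using t t0 by simp
    next
      show "continuous_on {0..t0} (\<lambda>t. G t \<omega>)" if "\<omega> \<in> space M" for \<omega>
        unfolding G_def by (rule continuous_on_along_path[OF admissible_score_continuous[OF g t0(1)] Xrc[OF that]])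
    qed
    have Fm: "(\<lambda>p. Fn k (snd p) (fst p)) \<in> borel_measurable (time_prod M t0)" if "1 \<le> k" for k
      using assms(18)[OF that] by (simp add: L2_process_def case_prod_beta')
    have F: "(\<lambda>p. F (snd p) (fst p)) \<in> borel_measurable (time_prod M t0)"
      using assms(19) by (simp add: L2_process_def case_prod_beta')
    let ?D = "L2sq M t0 (\<lambda>t \<omega>. Fn m t \<omega> - G t \<omega>)"
    have main: "(W2 (path_space t0) (path_law M t0 (\<lambda>t. X m (T - t))) (path_law N t0 Y))\<^sup>2 \<le>
      ennreal (2 * exp (2 * sqrt (2 * \<xi> n) * t0)) * (2 * (W2 euclidean_metric (distr M borel (X m T)) (gaussian (Qn e lam m)))\<^sup>2 + ennreal t0 * ?D)"
      unfolding Fn_eq G_def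
    proof (rule O.reverse_W2_bound[OF t0 Xm[OF m] Xc[OF m] Xm_eq refl _ _ _ N V ind Y0 Y])
      show "continuous_on ({0..t0} \<times> UNIV) (\<lambda>(t, x). (\<alpha> (T - t) / 2) *\<^sub>R x + ft n t x)"
        by (rule S.reverse_drift_continuous[OF t0 g orth])
      show "(sqrt (2 * \<xi> n))-lipschitz_on UNIV (\<lambda>x. (\<alpha> (T - t) / 2) *\<^sub>R x + ft n t x)" if "t \<in> {0..t0}" for t
        by (rule S.reverse_drift_lipschitz[OF t0 g orth that \<xi>_ge[OF g that]])
      show "(\<lambda>(\<omega>, t). score M e lam \<alpha> T m (X m) t (X m (T - t) \<omega>) - ft n t (X m (T - t) \<omega>)) \<in> borel_measurable (time_prod M t0)"
        using borel_measurable_diff[OF Fm[OF m] Gm] by (simp add: Fn_eq G_def case_prod_beta')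
    qed
    \<comment> \<open>\<open>ft n\<close> depends on the projection to level \<open>n\<close> only,
      so along \<open>X m\<close> it takes the same values as along \<open>X n\<close>.\<close>
    have FG: "L2sq M t0 (\<lambda>t \<omega>. Fn n t \<omega> - G t \<omega>) = eps_train n" unfolding eps_train_eq
    proof (rule L2sq_cong_AE, rule AE_mp[OF consistent[OF n]], intro AE_I2 impI ballI)
      fix \<omega> t assume P: "\<forall>t\<in>{0..T}. Pn e n (X m t \<omega>) = X n t \<omega>" and t: "t \<in> {0..t0}"
      have "Pn e n (X m (T - t) \<omega>) = X n (T - t) \<omega>" using P t t0 by auto
      then show "Fn n t \<omega> - G t \<omega> = Fn n t \<omega> - ft n t (X n (T - t) \<omega>)" using adm[OF g t, of "X m (T - t) \<omega>"] by (simp add: G_def)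
    qed
    have FF: "L2sq M t0 (\<lambda>t \<omega>. Fn k t \<omega> - F t \<omega>) \<le> eps_path n" if "n \<le> k" for k
      unfolding eps_path_eq by (rule SUP_upper) (use that in simp)
    have swap: "L2sq M t0 (\<lambda>t \<omega>. F t \<omega> - Fn n t \<omega>) = L2sq M t0 (\<lambda>t \<omega>. Fn n t \<omega> - F t \<omega>)"
      unfolding L2sq_def by (simp add: norm_minus_commute)
    note meas = borel_measurable_diff[OF Fm[OF m] F] borel_measurable_diff[OF F Fm[OF n(1)]]
      borel_measurable_diff[OF Fm[OF m] Fm[OF n(1)]] borel_measurable_diff[OF Fm[OF n(1)] Gm]
    \<comment> \<open>Both score processes lie within \<open>eps_path n\<close> of \<open>F\<close>,
      in the sense of squared distances, since both levels are at least \<open>n\<close>; the two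
      factors 2 add up to 4.\<close>
    have "L2sq M t0 (\<lambda>t \<omega>. Fn m t \<omega> - Fn n t \<omega>) \<le> 2 * L2sq M t0 (\<lambda>t \<omega>. Fn m t \<omega> - F t \<omega>) + 2 * L2sq M t0 (\<lambda>t \<omega>. F t \<omega> - Fn n t \<omega>)"
      by (rule L2sq_triangle) (use meas in \<open>simp_all add: case_prod_beta'\<close>)
    also have "\<dots> \<le> 2 * eps_path n + 2 * eps_path n"
      unfolding swap by (intro add_mono mult_left_mono FF n order_refl) auto
    finally have 1: "L2sq M t0 (\<lambda>t \<omega>. Fn m t \<omega> - Fn n t \<omega>) \<le> 4 * eps_path n" by (simp flip: distrib_right)
    have "?D \<le> 2 * L2sq M t0 (\<lambda>t \<omega>. Fn m t \<omega> - Fn n t \<omega>) + 2 * L2sq M t0 (\<lambda>t \<omega>. Fn n t \<omega> - G t \<omega>)"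
      by (rule L2sq_triangle) (use meas in \<open>simp_all add: case_prod_beta'\<close>)
    also have "\<dots> \<le> 2 * (4 * eps_path n) + 2 * eps_train n" unfolding FG by (intro add_mono mult_left_mono 1 order_refl) auto
    also have "2 * (4 * eps_path n) = 8 * eps_path n" by (simp flip: mult.assoc)
    finally have D: "?D \<le> 8 * eps_path n + 2 * eps_train n" .
    note main
    also have "ennreal (2 * exp (2 * sqrt (2 * \<xi> n) * t0)) * (2 * (W2 euclidean_metric (distr M borel (X m T)) (gaussian (Qn e lam m)))\<^sup>2 + ennreal t0 * ?D)
      \<le> err n + init_err n m"
      unfolding err_eq init_err_eq
      by (rule combine_error_terms[OF _ exp_rate_bound[OF \<xi>_nonneg[OF g]] _ t0(1) D]) (use \<xi>_nonneg[OF g] in \<open>auto intro!: mult_right_mono\<close>)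
    finally show ?thesis .
  qed
  have limits: "err \<longlonglongrightarrow> 0 \<and> ((\<lambda>m. (W2 euclidean_metric (distr M borel (X m T)) (gaussian (Qn e lam m)))\<^sup>2) \<longlonglongrightarrow> 0 \<longrightarrow>
           (\<lambda>n. SUP m\<in>{n..}. err n + init_err n m) \<longlonglongrightarrow> 0)"
    if g: "\<And>n. 1 \<le> n \<Longrightarrow> admissible_score e t0 n (ft n)" and C: "\<And>n. 1 \<le> n \<Longrightarrow> L n t0 \<le> C" and train: "eps_train \<longlonglongrightarrow> 0" for C
  proof -
    obtain A where A: "0 \<le> A" "\<And>s. s \<in> {0..t0} \<Longrightarrow> \<alpha> (T - s) \<le> A" using S.reverse_rate_bounded[OF t0 g[OF order_refl]] by metis
    \<comment> \<open>A bound for \<open>\<xi> n\<close> that does not depend on \<open>n\<close>;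
      the constants on shorter intervals are dominated by \<open>L n t0\<close>, hence by
      \<open>C\<close>.\<close>
    define \<Xi> where "\<Xi> = A\<^sup>2 / 4 + C\<^sup>2"
    have \<Xi>: "\<xi> n \<le> \<Xi>" if n: "1 \<le> n" for n
      unfolding xi_eq L_eq
    proof (rule cSUP_least)
      fix s assume s: "s \<in> {0..t0}"
      have "0 \<le> lipschitz_constant e n (ft n) s" using lipschitz_on_nonneg[OF admissible_score_lipschitz[OF orth g[OF n] s]] .
      moreover have "lipschitz_constant e n (ft n) s \<le> C" using lipschitz_constant_mono[OF g[OF n] s] C[OF n] by (simp add: L_eq)
      ultimately have "(lipschitz_constant e n (ft n) s)\<^sup>2 \<le> C\<^sup>2" by (intro power_mono)
      moreover have "(\<alpha> (T - s))\<^sup>2 \<le> A\<^sup>2" using A(2)[OF s] S.\<alpha>_pos[of "T - s"] s t0 by (intro power_mono) auto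
      ultimately show "(\<alpha> (T - s))\<^sup>2 / 4 + (lipschitz_constant e n (ft n) s)\<^sup>2 \<le> \<Xi>" unfolding \<Xi>_def by simp
    qed (use t0 in auto)
    let ?w = "\<lambda>m. (W2 euclidean_metric (distr M borel (X m T)) (gaussian (Qn e lam m)))\<^sup>2"
    let ?K = "ennreal t0 * ennreal (exp (4 * \<Xi> * t0\<^sup>2))" and ?K' = "ennreal (exp (3 * \<Xi> * t0\<^sup>2))"
    have path: "eps_path \<longlonglongrightarrow> 0" using tail_SUP_tendsto_zero[OF assms(20)] by (simp add: eps_path_eq[abs_def])
    have "(\<lambda>n. 12 * (4 * eps_path n + 2 * eps_train n)) \<longlonglongrightarrow> 12 * (4 * 0 + 2 * 0)"
      by (intro ennreal_tendsto_cmult tendsto_add path train) auto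
    then have "(\<lambda>n. ?K * (12 * (4 * eps_path n + 2 * eps_train n))) \<longlonglongrightarrow> ?K * (12 * (4 * 0 + 2 * 0))"
      by (rule ennreal_tendsto_cmult[rotated]) (simp add: ennreal_mult_less_top)
    then have K: "(\<lambda>n. ?K * (12 * (4 * eps_path n + 2 * eps_train n))) \<longlonglongrightarrow> 0" by simp
    have err_le: "err n \<le> ?K * (12 * (4 * eps_path n + 2 * eps_train n))" if "1 \<le> n" for n
    proof -
      have "err n \<le> 12 * (4 * eps_path n + 2 * eps_train n) * ennreal t0 * ennreal (exp (4 * \<Xi> * t0\<^sup>2))"
        unfolding err_eq using \<Xi>[OF that] by (intro mult_left_mono ennreal_leI) (auto intro!: mult_right_mono)
      then show ?thesis by (simp only: mult_ac)
    qed
    \<comment> \<open>The estimates are available from level 1 on, so the limits are squeezed by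
      inequalities that hold eventually.\<close>
    have ev: "eventually (\<lambda>n::nat. 1 \<le> n) sequentially" by (rule eventually_ge_at_top)
    have err0: "err \<longlonglongrightarrow> 0"
      by (rule tendsto_sandwich[OF _ eventually_mono[OF ev err_le] tendsto_const K]) simp
    moreover have "(\<lambda>n. SUP m\<in>{n..}. err n + init_err n m) \<longlonglongrightarrow> 0" if w: "?w \<longlonglongrightarrow> 0"
    proof -
      have "(\<lambda>n. 12 * ?K' * (SUP m\<in>{n..}. ?w m)) \<longlonglongrightarrow> 12 * ?K' * 0"
        by (rule ennreal_tendsto_cmult[OF _ tail_SUP_tendsto_zero[OF w]]) (simp add: ennreal_mult_less_top)
      from tendsto_add[OF err0 this] have lim: "(\<lambda>n. err n + 12 * ?K' * (SUP m\<in>{n..}. ?w m)) \<longlonglongrightarrow> 0" by simp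
      have le: "(SUP m\<in>{n..}. err n + init_err n m) \<le> err n + 12 * ?K' * (SUP m\<in>{n..}. ?w m)" if n: "1 \<le> n" for n
      proof (rule SUP_least)
        fix m assume m: "m \<in> {n..}"
        have "init_err n m \<le> 12 * ?K' * (SUP m\<in>{n..}. ?w m)"
          unfolding init_err_eq using \<Xi>[OF n] by (intro mult_mono SUP_upper m ennreal_leI) (auto intro!: mult_right_mono)
        then show "err n + init_err n m \<le> err n + 12 * ?K' * (SUP m\<in>{n..}. ?w m)" by (rule add_left_mono)
      qed
      show ?thesis
        by (rule tendsto_sandwich[OF _ eventually_mono[OF ev le] tendsto_const lim]) simp
    qed
    ultimately show ?thesis by blast
  qed
  show ?thesis
  proof (intro conjI allI impI; (elim conjE exE)?)
    fix n m and N :: "'v measure" and V Y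
    assume "1 \<le> n" "admissible_score e t0 n (ft n)" "n \<le> m" "prob_space N" "wiener_process N (Qn e lam m) t0 V"
      "independent_of_process N t0 (Y 0) V" "is_gaussian (Qn e lam m) (distr N borel (Y 0))"
      "sde_solution N t0 (\<lambda>t y. (\<alpha> (T - t) / 2) *\<^sub>R y + ft n t y) (\<lambda>t. sqrt (\<alpha> (T - t))) V Y"
    then show "(W2 (path_space t0) (path_law M t0 (\<lambda>t. X m (T - t))) (path_law N t0 Y))\<^sup>2 \<le> err n + init_err n m"
      using bound by blast
  next
    fix C assume "\<forall>n\<ge>1. admissible_score e t0 n (ft n)" "\<forall>n\<ge>1. L n t0 \<le> C" "eps_train \<longlonglongrightarrow> 0"
    then show "err \<longlonglongrightarrow> 0" using limits by blast
  next
    fix C assume "\<forall>n\<ge>1. admissible_score e t0 n (ft n)" "\<forall>n\<ge>1. L n t0 \<le> C" "eps_train \<longlonglongrightarrow> 0"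
      "(\<lambda>m. (W2 euclidean_metric (distr M borel (X m T)) (gaussian (Qn e lam m)))\<^sup>2) \<longlonglongrightarrow> 0"
    then show "(\<lambda>n. SUP m\<in>{n..}. err n + init_err n m) \<longlonglongrightarrow> 0" using limits by blast
  qed
qed

end
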